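(* Assume that $\tau_0=\tau_L>0$, that for some $a>0$ we have $\mathbb{P}(C>Z^t\beta(\tau_0+a))=1$, and that conditions (C1)-(C4) and (D1)-(D3) stated in the context hold. Let $\hat\beta$ be the unpenalized censored quantile regression estimator defined in the context. Then the representation $$\hat\beta(s)-\beta(s)=(\mu'(\beta(s)))^{-1}\Big(w_n(s)+\int_{[\tau_0,s)}\Big(\boldsymbol{\pi}_{(u,s]}\big(I_d+M_v^t\,dH(v)\big)\Big)^tM_u\,w_n(u)\,dH(u)\Big)+R_n(s)$$ holds uniformly in $s\in[\tau_L,\tau_U]$, where $M_u:=\tilde\mu'(\beta(u))(\mu'(\beta(u)))^{-1}$, and for any $c_n\to\infty$ the remainder satisfies $$\sup_{\tau\in[\tau_L,\tau_U]}\sqrt n\,\|R_n(\tau)\|=O_P\big(n^{1/2}b_n+n^{-\gamma/2}+\omega_{c_nn^{-1/2}}(\sqrt n\,\nu_n)+\omega_{c_nn^{-1/2}}(\sqrt n\,\tilde\nu_n)\big).$$ In particular, $$\sqrt n(\hat\beta(\cdot)-\beta(\cdot))\xrightarrow{\ \mathcal D\ }(\mu'(\beta(\cdot)))^{-1}\mathbb{V}_{\tau_0}(\cdot)$$ in the space $D([\tau_L,\tau_U])^d$ equipped with the supremum norm and the ball sigma-algebra, where $\mathbb{V}_{\tau_0}$ is the centered Gaussian process $$\mathbb{V}_{\tau_0}(\tau)=\mathbb{W}(\tau)+\int_{[\tau_0,\tau)}\Big(\boldsymbol{\pi}_{(u,\tau]}\big(I_d+M_v^t\,dH(v)\big)\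Big)^tM_u\,\mathbb{W}(u)\,dH(u).$$
   Context: Setting. $(T_i,C_i,Z_i)$, $i=1,\dots,n$, are identically distributed (not necessarily independent) copies of $(T,C,Z)$, where $T$ is a real response, $C$ a real censoring time and $Z$ a $d$-dimensional covariate with support $\mathcal Z$; conditionally on $Z$, the variables $T$ and $C$ are independent. One observes $X_i=T_i\wedge C_i$, $\delta_i=I\{X_i=T_i\}$ and $Z_i$; $(X,\delta)$ denotes the generic copy. The conditional quantiles are linear: $Q_\tau(T|Z):=\inf\{t:\mathbb{P}(T\le t|Z)\ge\tau\}=Z^t\beta(\tau)$ for $\tau\in[\tau_L,\tau_U]\subset[0,1)$. $\|\cdot\|$ is the maximum norm and $H(u):=-\log(1-u)$. Estimator. Let $\tau_0=\tau_L<\tau_1<\dots<\tau_{N_\tau(n)}=\tau_U$ be a uniformly spaced grid of width $a_n=o(n^{-1/2})$, and $b_n:=a_n/(1-\tau_U)$. $\hat\beta(\tau_0)$ is the classical (Koenker-Bassett) regression quantile, i.e. a minimizer over $b\in\mathbb{R}^d$ of $\frac1n\sum_i\rho_{\tau_0}(X_i-Z_i^tb)$ with $\rho_\tau(u)=u(\tau-I\{u<0\})$. For $j=1,\dots,N_\tau(n)$, sequentially, $\hat\beta(\tau_j)$ is any minimizer over $b\in\mathbb{R}^d$ of the convex function $$\tilde H_j(b)=\frac1n\sum_{i=1}^n\Big(\delta_i|X_i-Z_i^tb|+Z_i^tb\Big(\delta_i-2\int_{[\tau_0,\tau_j)}I\{X_i\ge Z_i^t\hat\beta(u)\}\,dH(u)-2\tau_0\Big)\Big),$$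 where $\hat\beta(\tau):=\hat\beta(\tau_j)$ for $\tau\in[\tau_j,\tau_{j+1})$. Notation. $\tilde F(t|z)=\mathbb{P}(X\le t|Z=z)$, $F(t|z)=\mathbb{P}(X\le t,\delta=1|Z=z)$, with conditional densities $\tilde f(t|z),f(t|z)$ (derivatives in $t$). $\mu(b)=\mathbb{E}[Z\,I\{X\le Z^tb,\delta=1\}]$, $\tilde\mu(b)=\mathbb{E}[Z\,I\{X\ge Z^tb\}]$, with Jacobians $\mu',\tilde\mu'$ (so $\mu'(b)=\mathbb{E}[ZZ^tf(Z^tb|Z)]$, $\tilde\mu'(b)=-\mathbb{E}[ZZ^t\tilde f(Z^tb|Z)]$). $\nu_n(b)=\frac1n\sum_iZ_i\delta_iI\{X_i\le Z_i^tb\}-\mu(b)$, $\tilde\nu_n(b)=\frac1n\sum_iZ_iI\{X_i\ge Z_i^tb\}-\tilde\mu(b)$. $$w_n(s):=\frac{\tau_0}{n}\sum_{i=1}^n(Z_i-\mathbb{E}Z_i)-\nu_n(\beta(s))+\int_{[\tau_0,s)}\tilde\nu_n(\beta(u))\,dH(u).$$ For some $\varepsilon>0$ let $\mathcal B:=\{b\in\mathbb{R}^d:\inf_{\tau\in[\tau_L,\tau_U]}\|b-\beta(\tau)\|\le\varepsilon\}$, $\mathcal B_\varepsilon:=\{b:\inf_{\tau\in[\tau_L,\tau_U]}\|b-\beta(\tau)\|<\varepsilon\}$, and $\omega_a(g):=\sup\{\|g(b_1)-g(b_2)\|:b_1,b_2\in\mathcal B,\ \|b_1-b_2\|\le a\}$.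 The product-integral $\boldsymbol{\pi}_{(u,s]}(I_d+A_v\,dH(v))$ is the limit, over partitions $u=t_0<\dots<t_m=s$ with mesh tending to $0$, of $\prod_{l=1}^m(I_d+\int_{(t_{l-1},t_l]}A_v\,dH(v))$, factors ordered with increasing $l$ from left to right. Conditions. (C1) $Z_{i,1}=1$ a.s. for all $i$, and there is $C_Z<\infty$ with $\|Z\|\le C_Z$ a.s. (C2) There is $C_4<\infty$ with $\|\beta(\tau)-\beta(\tau')\|\le C_4|\tau-\tau'|$ for all $\tau,\tau'\in[\tau_L,\tau_U]$. (C3) $\sup_{b\in\mathcal B_\varepsilon}\sup_zf(z^tb|z)<\infty$ and $\sup_{b\in\mathcal B_\varepsilon}\sup_z\tilde f(z^tb|z)<\infty$; $f,\tilde f$ are uniformly continuous on $\{b^tz:b\in\mathcal B_\varepsilon,z\in\mathcal Z\}\times\mathcal Z$ in both arguments; and for some $\gamma>0$ and $H_f,\tilde H_f<\infty$, for all $b_1,b_2\in\mathcal B_\varepsilon$, $\sup_z|f(z^tb_1|z)-f(z^tb_2|z)|\le H_f\|b_1-b_2\|^\gamma$ and $\sup_z|\tilde f(z^tb_1|z)-\tilde f(z^tb_2|z)|\le\tilde H_f\|b_1-b_2\|^\gamma$. (C4) $\inf_{b\in\mathcal B_\varepsilon}\lambda_{\min}(\mathbb{E}[ZZ^tf(Z^tb|Z)])=:\lambda_0>0$, with $\lambda_{\min}$ the smallest eigenvalue. (D1) $\sup_{b\in\mathbb{R}^d}\|\nu_n(b)\|+\sup_{b\in\mathbb{R}^d}\|\tilde\nu_n(b)\|=o_P(1)$.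 (D2) For every sequence $r_n=o(1)$: $\omega_{r_n}(\sqrt n\,\nu_n)=o_P(1)$ and $\omega_{r_n}(\sqrt n\,\tilde\nu_n)=o_P(1)$. (D3) The process $(\sqrt n\,w_n(s))_{s\in[\tau_L,\tau_U]}$ converges weakly to a centered Gaussian process $\mathbb{W}$. *)

theory Defs
  imports "HOL-Probability.Probability" "HOL-Library.Landau_Symbols"
begin

section \<open>Data\<close>

text \<open>A datum is a triple (response, censoring time, covariate). The dimension of the covariate is
  the cardinality of the index type, and the maximum norm is \<^const>\<open>infnorm\<close>.\<close>

type_synonym 'd datum = "real \<times> real \<times> (real ^ 'd)"

definition resp :: "'d::finite datum \<Rightarrow> real" where
  "resp y = fst y"

definition cens :: "'d::finite datum \<Rightarrow> real" where
  "cens y = fst (snd y)"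

definition covar :: "'d::finite datum \<Rightarrow> real ^ 'd" where
  "covar y = snd (snd y)"

definition obs :: "'d::finite datum \<Rightarrow> real" where
  "obs y = min (resp y) (cens y)"

definition uncensored :: "'d::finite datum \<Rightarrow> bool" where
  "uncensored y \<longleftrightarrow> obs y = resp y"

definition support :: "'a measure \<Rightarrow> ('a \<Rightarrow> 'b::topological_space) \<Rightarrow> 'b set" where
  "support M Z = {z. \<forall>U. open U \<and> z \<in> U \<longrightarrow> measure M {\<omega> \<in> space M. Z \<omega> \<in> U} > 0}"


section \<open>Conditional distributions given the covariate\<close>

text \<open>\<open>K z\<close> is the conditional law of (response, censoring time) given that the covariate equals
  \<open>z\<close>. All conditional probabilities given the covariate are computed from one such kernel, which
  makes quantities such as conditional quantiles and conditional densities well defined.\<close>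

definition regular_cond_dist ::
    "'a measure \<Rightarrow> ('a \<Rightarrow> 'b::topological_space) \<Rightarrow> ('a \<Rightarrow> 'c::topological_space)
     \<Rightarrow> ('c \<Rightarrow> 'b measure) \<Rightarrow> bool" where
  "regular_cond_dist M V Z K \<longleftrightarrow>
     K \<in> borel \<rightarrow>\<^sub>M prob_algebra borel \<and>
     (\<forall>A \<in> sets borel. \<forall>B \<in> sets borel.
        measure M {\<omega> \<in> space M. Z \<omega> \<in> A \<and> V \<omega> \<in> B}
        = (LINT \<omega>:{\<omega> \<in> space M. Z \<omega> \<in> A}|M. measure (K (Z \<omega>)) B))"

definition cond_quantile :: "('c \<Rightarrow> (real \<times> real) measure) \<Rightarrow> real \<Rightarrow> 'c \<Rightarrow> real" where
  "cond_quantile K \<tau> z = Inf {t. measure (K z) {(x, c). x \<le> t} \<ge> \<tau>}"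

definition Ft_cond :: "('c \<Rightarrow> (real \<times> real) measure) \<Rightarrow> real \<Rightarrow> 'c \<Rightarrow> real" where
  "Ft_cond K t z = measure (K z) {(x, c). min x c \<le> t}"

definition F_cond :: "('c \<Rightarrow> (real \<times> real) measure) \<Rightarrow> real \<Rightarrow> 'c \<Rightarrow> real" where
  "F_cond K t z = measure (K z) {(x, c). min x c \<le> t \<and> min x c = x}"

definition ft_cond :: "('c \<Rightarrow> (real \<times> real) measure) \<Rightarrow> real \<Rightarrow> 'c \<Rightarrow> real" where
  "ft_cond K t z = deriv (\<lambda>s. Ft_cond K s z) t"

definition f_cond :: "('c \<Rightarrow> (real \<times> real) measure) \<Rightarrow> real \<Rightarrow> 'c \<Rightarrow> real" where
  "f_cond K t z = deriv (\<lambda>s. F_cond K s z) t"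


section \<open>The cumulative hazard \<open>H\<close> and product integrals\<close>

definition H :: "real \<Rightarrow> real" where
  "H u = - ln (1 - u)"

text \<open>The Lebesgue-Stieltjes measure of \<^const>\<open>H\<close> on the half line below 1, given by the
  derivative of \<^const>\<open>H\<close>; the next lemma identifies it.\<close>

definition dH :: "real measure" where
  "dH = density lborel (\<lambda>u. ennreal (indicator {..<1} u * (1 / (1 - u))))"

lemma emeasure_dH:
  assumes "a \<le> b" "b < 1"
  shows "emeasure dH {a<..b} = ennreal (H b - H a)"
proof -
  have der: "(H has_real_derivative (1 / (1 - x))) (at x)" if "x \<le> b" for x
    using that assms unfolding H_def by (auto intro!: derivative_eq_intros)
  have "emeasure dH {a<..b}
      = (\<integral>\<^sup>+ u. ennreal (indicator {..<1} u * (1 / (1 - u))) * indicator {a<..b} u \<partial>lborel)"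
    unfolding dH_def by (subst emeasure_density) auto
  also have "\<dots> = (\<integral>\<^sup>+ u. ennreal (1 / (1 - u)) * indicator {a..b} u \<partial>lborel)"
  proof (rule nn_integral_cong_AE, use AE_lborel_singleton[of a] in eventually_elim)
    case (elim u)
    then show ?case using assms by (auto simp: indicator_def)
  qed
  also have "\<dots> = ennreal (H b - H a)"
  proof (rule nn_integral_FTC_Icc)
    show "\<And>x. x \<in> {a..b} \<Longrightarrow> DERIV H x :> 1 / (1 - x)"
      using der by auto
  qed (use assms in auto)
  finally show ?thesis .
qed

primrec partition_prod ::
    "(real \<Rightarrow> real ^ 'd ^ 'd) \<Rightarrow> (nat \<Rightarrow> real) \<Rightarrow> nat \<Rightarrow> real ^ 'd ^ 'd::finite" where
  "partition_prod A t 0 = mat 1"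
| "partition_prod A t (Suc m) =
     partition_prod A t m ** (mat 1 + (LINT v:{t m<..t (Suc m)}|dH. A v))"

definition prod_integral :: "(real \<Rightarrow> real ^ 'd ^ 'd) \<Rightarrow> real \<Rightarrow> real \<Rightarrow> real ^ 'd ^ 'd::finite" where
  "prod_integral A u s = (THE P. \<forall>e>0. \<exists>r>0. \<forall>m t.
      t 0 = u \<and> t m = s \<and> (\<forall>l<m. t l < t (Suc l) \<and> t (Suc l) - t l < r)
      \<longrightarrow> dist (partition_prod A t m) P < e)"

text \<open>The map sending a path \<open>x\<close> to
  \<open>s \<mapsto> x(s) + \<integral>\<^bsub>[\<tau>0,s)\<^esub> (\<pi>\<^bsub>(u,s]\<^esub> (I + M\<^sub>v\<^sup>t dH(v)))\<^sup>t M\<^sub>u x(u) dH(u)\<close>.\<close>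

definition duhamel ::
    "real \<Rightarrow> (real \<Rightarrow> real ^ 'd ^ 'd) \<Rightarrow> (real \<Rightarrow> real ^ 'd) \<Rightarrow> real \<Rightarrow> real ^ 'd::finite" where
  "duhamel \<tau>0 Mv x s = x s +
     (LINT u:{\<tau>0..<s}|dH.
        (transpose (prod_integral (\<lambda>v. transpose (Mv v)) u s) ** Mv u) *v x u)"


section \<open>The estimator\<close>

definition grid :: "real \<Rightarrow> real \<Rightarrow> nat \<Rightarrow> nat \<Rightarrow> real" where
  "grid \<tau>L \<tau>U m j = \<tau>L + real j * (\<tau>U - \<tau>L) / real m"

definition check_loss :: "real \<Rightarrow> real \<Rightarrow> real" where
  "check_loss \<tau> u = u * (\<tau> - of_bool (u < 0))"

definition init_obj ::
    "(nat \<Rightarrow> 'd::finite datum) \<Rightarrow> nat \<Rightarrow> real \<Rightarrow> real ^ 'd \<Rightarrow> real" where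
  "init_obj ys n \<tau>0 b =
     (1 / real n) * (\<Sum>i<n. check_loss \<tau>0 (obs (ys i) - covar (ys i) \<bullet> b))"

definition step_obj ::
    "(nat \<Rightarrow> 'd::finite datum) \<Rightarrow> nat \<Rightarrow> real \<Rightarrow> (real \<Rightarrow> real ^ 'd) \<Rightarrow> real \<Rightarrow> real ^ 'd \<Rightarrow> real" where
  "step_obj ys n \<tau>0 bh t b =
     (1 / real n) * (\<Sum>i<n.
        of_bool (uncensored (ys i)) * \<bar>obs (ys i) - covar (ys i) \<bullet> b\<bar>
        + (covar (ys i) \<bullet> b) *
          (of_bool (uncensored (ys i))
           - 2 * (LINT u:{\<tau>0..<t}|dH. (of_bool (obs (ys i) \<ge> covar (ys i) \<bullet> bh u) :: real))
           - 2 * \<tau>0))"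

text \<open>For some samples (for instance a fully censored one) the convex objective is unbounded below
  and has no minimizer; the estimator is unconstrained at such a grid point and is an arbitrary
  minimizer whenever there is one.\<close>

definition minimizer_if_any :: "('b \<Rightarrow> real) \<Rightarrow> 'b \<Rightarrow> bool" where
  "minimizer_if_any g x \<longleftrightarrow>
     ((\<exists>b. is_arg_min g (\<lambda>_. True) b) \<longrightarrow> is_arg_min g (\<lambda>_. True) x)"

text \<open>\<open>m\<close> is the number of grid intervals and \<open>bh\<close> the estimated coefficient process computed
  from the first \<open>n\<close> data.\<close>

definition cqr_estimator ::
    "real \<Rightarrow> real \<Rightarrow> nat \<Rightarrow> (nat \<Rightarrow> 'd::finite datum) \<Rightarrow> nat \<Rightarrow> (real \<Rightarrow> real ^ 'd) \<Rightarrow> bool" where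
  "cqr_estimator \<tau>L \<tau>U m ys n bh \<longleftrightarrow>
     minimizer_if_any (init_obj ys n \<tau>L) (bh \<tau>L) \<and>
     (\<forall>j \<in> {1..m}. minimizer_if_any
        (step_obj ys n \<tau>L bh (grid \<tau>L \<tau>U m j)) (bh (grid \<tau>L \<tau>U m j))) \<and>
     (\<forall>j<m. \<forall>\<tau> \<in> {grid \<tau>L \<tau>U m j..<grid \<tau>L \<tau>U m (Suc j)}. bh \<tau> = bh (grid \<tau>L \<tau>U m j))"


section \<open>Population and empirical quantities\<close>

definition mu :: "'a measure \<Rightarrow> ('a \<Rightarrow> 'd::finite datum) \<Rightarrow> real ^ 'd \<Rightarrow> real ^ 'd" where
  "mu M Y b = (LINT \<omega>|M.
     of_bool (obs (Y \<omega>) \<le> covar (Y \<omega>) \<bullet> b \<and> uncensored (Y \<omega>)) *\<^sub>R covar (Y \<omega>))"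

definition mut :: "'a measure \<Rightarrow> ('a \<Rightarrow> 'd::finite datum) \<Rightarrow> real ^ 'd \<Rightarrow> real ^ 'd" where
  "mut M Y b = (LINT \<omega>|M. of_bool (obs (Y \<omega>) \<ge> covar (Y \<omega>) \<bullet> b) *\<^sub>R covar (Y \<omega>))"

definition mu' :: "'a measure \<Rightarrow> ('a \<Rightarrow> 'd::finite datum) \<Rightarrow> real ^ 'd \<Rightarrow> real ^ 'd ^ 'd" where
  "mu' M Y b = jacobian (mu M Y) (at b)"

definition mut' :: "'a measure \<Rightarrow> ('a \<Rightarrow> 'd::finite datum) \<Rightarrow> real ^ 'd \<Rightarrow> real ^ 'd ^ 'd" where
  "mut' M Y b = jacobian (mut M Y) (at b)"

definition nu ::
    "'a measure \<Rightarrow> ('a \<Rightarrow> 'd::finite datum) \<Rightarrow> (nat \<Rightarrow> 'a \<Rightarrow> 'd datum)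
     \<Rightarrow> nat \<Rightarrow> 'a \<Rightarrow> real ^ 'd \<Rightarrow> real ^ 'd" where
  "nu M Y Ys n \<omega> b = (1 / real n) *\<^sub>R (\<Sum>i<n.
       of_bool (uncensored (Ys i \<omega>) \<and> obs (Ys i \<omega>) \<le> covar (Ys i \<omega>) \<bullet> b) *\<^sub>R covar (Ys i \<omega>))
     - mu M Y b"

definition nut ::
    "'a measure \<Rightarrow> ('a \<Rightarrow> 'd::finite datum) \<Rightarrow> (nat \<Rightarrow> 'a \<Rightarrow> 'd datum)
     \<Rightarrow> nat \<Rightarrow> 'a \<Rightarrow> real ^ 'd \<Rightarrow> real ^ 'd" where
  "nut M Y Ys n \<omega> b = (1 / real n) *\<^sub>R (\<Sum>i<n.
       of_bool (obs (Ys i \<omega>) \<ge> covar (Ys i \<omega>) \<bullet> b) *\<^sub>R covar (Ys i \<omega>))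
     - mut M Y b"

definition wn ::
    "'a measure \<Rightarrow> ('a \<Rightarrow> 'd::finite datum) \<Rightarrow> (nat \<Rightarrow> 'a \<Rightarrow> 'd datum) \<Rightarrow> real
     \<Rightarrow> (real \<Rightarrow> real ^ 'd) \<Rightarrow> nat \<Rightarrow> 'a \<Rightarrow> real \<Rightarrow> real ^ 'd" where
  "wn M Y Ys \<tau>0 \<beta> n \<omega> s =
     (\<tau>0 / real n) *\<^sub>R (\<Sum>i<n. covar (Ys i \<omega>) - (LINT \<omega>'|M. covar (Ys i \<omega>')))
     - nu M Y Ys n \<omega> (\<beta> s)
     + (LINT u:{\<tau>0..<s}|dH. nut M Y Ys n \<omega> (\<beta> u))"

definition nbhd_closed :: "(real \<Rightarrow> real ^ 'd::finite) \<Rightarrow> real \<Rightarrow> real \<Rightarrow> real \<Rightarrow> (real ^ 'd) set" where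
  "nbhd_closed \<beta> \<tau>L \<tau>U \<epsilon> = {b. (INF \<tau>\<in>{\<tau>L..\<tau>U}. infnorm (b - \<beta> \<tau>)) \<le> \<epsilon>}"

definition nbhd_open :: "(real \<Rightarrow> real ^ 'd::finite) \<Rightarrow> real \<Rightarrow> real \<Rightarrow> real \<Rightarrow> (real ^ 'd) set" where
  "nbhd_open \<beta> \<tau>L \<tau>U \<epsilon> = {b. (INF \<tau>\<in>{\<tau>L..\<tau>U}. infnorm (b - \<beta> \<tau>)) < \<epsilon>}"

definition modulus :: "(real ^ 'd::finite) set \<Rightarrow> real \<Rightarrow> (real ^ 'd \<Rightarrow> real ^ 'd) \<Rightarrow> real" where
  "modulus B a g = Sup {infnorm (g b1 - g b2) |b1 b2. b1 \<in> B \<and> b2 \<in> B \<and> infnorm (b1 - b2) \<le> a}"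

definition outer_prod :: "real ^ 'd \<Rightarrow> real ^ 'd ^ 'd::finite" where
  "outer_prod z = (\<chi> i j. z $ i * z $ j)"

definition lambda_min :: "real ^ 'd ^ 'd::finite \<Rightarrow> real" where
  "lambda_min A = Min {l. \<exists>v. v \<noteq> 0 \<and> A *v v = l *\<^sub>R v}"


section \<open>Stochastic order symbols\<close>

text \<open>Suprema over uncountable sets and arbitrary selections of minimizers need not be measurable,
  so probabilities of events are outer probabilities; for events they are the usual ones.\<close>

definition small_oP1 :: "'a measure \<Rightarrow> (nat \<Rightarrow> 'a \<Rightarrow> real) \<Rightarrow> bool" where
  "small_oP1 M X \<longleftrightarrow>
     (\<forall>e>0. (\<lambda>n. outer_measure_of M {\<omega> \<in> space M. \<bar>X n \<omega>\<bar> > e}) \<longlonglongrightarrow> 0)"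

definition big_OP :: "'a measure \<Rightarrow> (nat \<Rightarrow> 'a \<Rightarrow> real) \<Rightarrow> (nat \<Rightarrow> 'a \<Rightarrow> real) \<Rightarrow> bool" where
  "big_OP M X R \<longleftrightarrow>
     (\<forall>\<eta>>0. \<exists>C>0. \<forall>\<^sub>F n in sequentially.
        outer_measure_of M {\<omega> \<in> space M. \<bar>X n \<omega>\<bar> > C * \<bar>R n \<omega>\<bar>} \<le> ennreal \<eta>)"


section \<open>Weak convergence in the Skorokhod space with supremum norm and ball sigma-algebra\<close>

text \<open>Elements of the space are functions on the real line; only their restriction to the
  interval matters for membership, for the supremum distance and hence for balls and continuity.\<close>

definition cadlag :: "real \<Rightarrow> real \<Rightarrow> (real \<Rightarrow> real ^ 'd::finite) set" where
  "cadlag a b = {x. (\<forall>t\<in>{a..<b}. (x \<longlongrightarrow> x t) (at_right t)) \<and>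
                    (\<forall>t\<in>{a<..b}. \<exists>l. (x \<longlongrightarrow> l) (at_left t))}"

definition sup_dist :: "real \<Rightarrow> real \<Rightarrow> (real \<Rightarrow> real ^ 'd::finite) \<Rightarrow> (real \<Rightarrow> real ^ 'd) \<Rightarrow> real" where
  "sup_dist a b x y = (SUP s\<in>{a..b}. infnorm (x s - y s))"

definition ball_algebra :: "real \<Rightarrow> real \<Rightarrow> (real \<Rightarrow> real ^ 'd::finite) measure" where
  "ball_algebra a b = sigma (cadlag a b)
     {{y \<in> cadlag a b. sup_dist a b x y < r} |x r. x \<in> cadlag a b \<and> 0 < r}"

definition sup_continuous :: "real \<Rightarrow> real \<Rightarrow> ((real \<Rightarrow> real ^ 'd::finite) \<Rightarrow> real) \<Rightarrow> bool" where
  "sup_continuous a b h \<longleftrightarrow>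
     (\<forall>x\<in>cadlag a b. \<forall>e>0. \<exists>r>0. \<forall>y\<in>cadlag a b. sup_dist a b x y < r \<longrightarrow> \<bar>h y - h x\<bar> < e)"

definition outer_expectation :: "'a measure \<Rightarrow> ('a \<Rightarrow> real) \<Rightarrow> real" where
  "outer_expectation M g = Inf {(LINT \<omega>|M. h \<omega>) |h. integrable M h \<and> (AE \<omega> in M. g \<omega> \<le> h \<omega>)}"

text \<open>The outer expectation is the expectation whenever \<open>X n\<close> is measurable for the ball
  sigma-algebra. Since the test functions are closed under negation, the inner expectations
  converge as well.\<close>

definition weakly_converges ::
    "real \<Rightarrow> real \<Rightarrow> 'a measure \<Rightarrow> (nat \<Rightarrow> 'a \<Rightarrow> real \<Rightarrow> real ^ 'd::finite)
     \<Rightarrow> 'w measure \<Rightarrow> ('w \<Rightarrow> real \<Rightarrow> real ^ 'd) \<Rightarrow> bool" where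
  "weakly_converges a b M X N W \<longleftrightarrow>
     (\<forall>n. AE \<omega> in M. X n \<omega> \<in> cadlag a b) \<and>
     W \<in> N \<rightarrow>\<^sub>M ball_algebra a b \<and>
     (\<forall>h. h \<in> borel_measurable (ball_algebra a b) \<and> bounded (h ` cadlag a b) \<and> sup_continuous a b h
        \<longrightarrow> (\<lambda>n. outer_expectation M (\<lambda>\<omega>. h (X n \<omega>))) \<longlonglongrightarrow> (LINT w|N. h (W w)))"

text \<open>All finite linear combinations are centered normal, possibly degenerate at 0.\<close>

definition centered_gaussian_process ::
    "'w measure \<Rightarrow> real set \<Rightarrow> ('w \<Rightarrow> real \<Rightarrow> real ^ 'd::finite) \<Rightarrow> bool" where
  "centered_gaussian_process N I W \<longleftrightarrow>
     (\<forall>s\<in>I. (\<lambda>w. W w s) \<in> borel_measurable N) \<and>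
     (\<forall>S c. finite S \<and> S \<subseteq> I \<longrightarrow>
        (AE w in N. (\<Sum>s\<in>S. c s \<bullet> W w s) = 0) \<or>
        (\<exists>\<sigma>>0. distributed N lborel (\<lambda>w. \<Sum>s\<in>S. c s \<bullet> W w s)
                 (\<lambda>x. ennreal (normal_density 0 \<sigma> x))))"

end

theory Submission
  imports Defs
begin

text \<open>Write \<open>S\<close> and \<open>St\<close> for the empirical versions of \<open>mu\<close> and \<open>mut\<close>. The estimator solves, approximately and
 grid point by grid point, \<open>S(\<beta>hat(s)) = \<tau>L Zbar + \<integral>\<^bsub>[\<tau>L,s)\<^esub> St(\<beta>hat) dH\<close>, while the true coefficients solve the population
 equation \<open>mu(\<beta>(s)) = \<tau>L EZ + \<integral>\<^bsub>[\<tau>L,s)\<^esub> mut(\<beta>) dH\<close> (\<open>population_identity\<close>), which follows from the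
 independence of response and censoring by a quantile transformation (\<open>quantile_identity\<close>).

 The two equations are first compared crudely. The objective functions are convex, and their means have
 Hessians bounded below by the smallest eigenvalue condition; so if the empirical processes oscillate
 little, each minimizer exists and lies near \<open>\<beta>\<close> (\<open>hinge_minimizer_distance\<close>), and a Gronwall argument
 along the grid gives \<open>sup \<bar>\<beta>hat - \<beta>\<bar> = O(n\<^sup>-\<^sup>1\<^sup>/\<^sup>2)\<close> with high probability (\<open>path_error\<close>). At this
 scale both equations can be linearized: with \<open>D(s) = mu'(\<beta>(s)) (\<beta>hat(s) - \<beta>(s))\<close> their difference is
 the Volterra equation \<open>D = w + \<integral> M D dH + error\<close>. The error collects the Hoelder remainders, the mesh and
 the moduli of the empirical processes (\<open>forcing_near_w\<close>). Variation of constants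
 (\<open>volterra_solution\<close>) solves the equation by \<^const>\<open>duhamel\<close>; as \<^const>\<open>duhamel\<close> is linear and bounded, the
 representation and the rate of the remainder follow.

 For the weak limit, \<open>x \<mapsto> mu'(\<beta>)\<inverse> duhamel x\<close> is a Lipschitz map on paths, so it preserves weak
 convergence (\<open>weakly_converges_map\<close>); it is a limit of finite linear combinations of coordinates, so it
 preserves normality (\<open>duhamel_gaussian\<close>). The remainder is removed by Slutsky's lemma. Since weak
 convergence is tested by functions that are merely continuous, Slutsky's lemma needs a limit law on a
 separable set: \<open>w\<close> is asymptotically equicontinuous (\<open>w_equicontinuous\<close>), so the limit has continuous
 paths almost surely (\<open>weak_limit_continuous\<close>).\<close>

section \<open>Linear matrix equations and product integrals\<close>

lemma norm_matrix_vector_le: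
 fixes A :: "real^'n::finite^'m::finite" and x :: "real^'n"
 shows "norm (A *v x) <= norm A * norm x"
proof -
 have "norm (A *v x) = L2_set (\<lambda>i. norm ((A *v x) $ i)) UNIV"
  by (simp add: norm_vec_def)
 also have "... <= L2_set (\<lambda>i. norm (A $ i) * norm x) UNIV"
  by (intro L2_set_mono) (auto simp: matrix_vector_mul_component Cauchy_Schwarz_ineq2)
 also have "... = norm A * norm x"
  by (simp add: L2_set_left_distrib norm_vec_def)
 finally show ?thesis .
qed

lemma norm_transpose: "norm (transpose (A :: real^'n::finite^'m::finite)) = norm A"
 by (simp add: norm_vec_def L2_set_def transpose_def sum_nonneg) (rule sum.swap)

lemma norm_matrix_mult_le:
 fixes A :: "real^'n::finite^'m::finite" and B :: "real^'k::finite^'n"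
 shows "norm (A ** B) <= norm A * norm B"
proof -
 have row: "(A ** B) $ i = transpose B *v (A $ i)" for i
  by (simp add: vec_eq_iff matrix_matrix_mult_def matrix_vector_mult_def transpose_def mult.commute)
 have "norm (A ** B) = L2_set (\<lambda>i. norm ((A ** B) $ i)) UNIV"
  by (simp add: norm_vec_def)
 also have "... <= L2_set (\<lambda>i. norm (A $ i) * norm B) UNIV"
 proof (intro L2_set_mono)
  fix i show "norm ((A ** B) $ i) <= norm (A $ i) * norm B"
   using norm_matrix_vector_le[of "transpose B" "A $ i"]
   by (simp add: row norm_transpose mult.commute)
 qed auto
 also have "... = norm A * norm B"
  by (simp add: L2_set_left_distrib norm_vec_def)
 finally show ?thesis .
qed

lemma bounded_bilinear_matrix_mult:
 "bounded_bilinear ((**) :: real^'n::finite^'m::finite => real^'k::finite^'n => _)"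
proof (rule bounded_bilinear.intro)
 show "\<exists>K. \<forall>a b. norm ((a :: real^'n^'m) ** (b :: real^'k^'n)) <= norm a * norm b * K"
  using norm_matrix_mult_le by (intro exI[of _ 1]) auto
qed (auto simp: vec_eq_iff matrix_matrix_mult_def algebra_simps sum.distrib sum_distrib_left)

lemma bounded_bilinear_matrix_vector:
 "bounded_bilinear ((*v) :: real^'n::finite^'m::finite => real^'n => _)"
proof (rule bounded_bilinear.intro)
 show "\<exists>K. \<forall>a b. norm ((a :: real^'n^'m) *v (b :: real^'n)) <= norm a * norm b * K"
  using norm_matrix_vector_le by (intro exI[of _ 1]) auto
qed (auto simp: matrix_vector_mult_add_rdistrib matrix_vector_right_distrib scaleR_matrix_vector_assoc
   matrix_vector_mult_scaleR)

lemma bounded_linear_transpose: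
 "bounded_linear (transpose :: real^'n::finite^'m::finite => _)"
 proof (rule bounded_linear_intro[of _ 1])
 show "norm (transpose x) <= norm x * 1" for x :: "real^'n^'m" by (simp add: norm_transpose)
qed (auto simp: transpose_def vec_eq_iff)

lemmas continuous_on_matrix_mult [continuous_intros] =
 bounded_bilinear.continuous_on[OF bounded_bilinear_matrix_mult]

lemmas continuous_on_matrix_vector [continuous_intros] =
 bounded_bilinear.continuous_on[OF bounded_bilinear_matrix_vector]

lemmas continuous_on_transpose [continuous_intros] =
 bounded_linear.continuous_on[OF bounded_linear_transpose]

lemma continuous_on_norm_bound:
 fixes f :: "real => 'b::real_normed_vector"
 assumes "continuous_on {a..b} f"
 obtains L where "0 <= L" "\<And>v. v \<in> {a..b} ==> norm (f v) <= L"
proof -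
 have "bounded (f ` {a..b})"
  by (intro compact_imp_bounded compact_continuous_image assms compact_Icc)
 then obtain L where "0 < L" "\<forall>y\<in>f ` {a..b}. norm y <= L"
  by (auto simp: bounded_pos)
 thus ?thesis using that[of L] by auto
qed

lemma has_vector_derivative_norm_bound:
 fixes g :: "real => 'b::real_normed_vector"
 assumes "u <= s" and "\<And>v. v \<in> {u..s} ==> (g has_vector_derivative g' v) (at v within {u..s})"
  and "\<And>v. v \<in> {u..s} ==> norm (g' v) <= C"
 shows "norm (g s - g u) <= C * (s - u)"
proof -
 have "norm (g s - g u) <= C * norm (s - u)"
 proof (rule differentiable_bound[of "{u..s}" g "\<lambda>v h. h *\<^sub>R g' v"])
  fix v assume "v \<in> {u..s}"
  thus "(g has_derivative (\<lambda>h. h *\<^sub>R g' v)) (at v within {u..s})"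
   using assms(2) by (simp add: has_vector_derivative_def)
  show "onorm (\<lambda>h. h *\<^sub>R g' v) <= C"
   using assms(3)[OF \<open>v \<in> {u..s}\<close>] by (intro onorm_le) (simp add: mult.commute[of C] mult_left_mono)
 qed (use assms in auto)
 thus ?thesis using assms(1) by simp
qed

text \<open>The Peano--Baker series \<open>I + \<integral> B + \<integral>\<integral> B B + ...\<close> converges uniformly, since its \<open>k\<close>-th term is
 at most \<open>(L (b - a))\<^sup>k / k!\<close>, and may be differentiated term by term.\<close>

lemma linear_matrix_equation_solvable:
 fixes B :: "real => real^'d::finite^'d"
 assumes contB: "continuous_on {a..b} B" and "a <= b"
 obtains U where "U a = mat 1"
  "\<And>s. s \<in> {a..b} ==> (U has_vector_derivative U s ** B s) (at s within {a..b})"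
proof -
 obtain L where L: "0 <= L" "\<And>v. v \<in> {a..b} ==> norm (B v) <= L"
  using continuous_on_norm_bound[OF contB] by blast
 define T where "T = rec_nat (\<lambda>s. mat 1) (\<lambda>k g s. integral {a..s} (\<lambda>v. g v ** B v))"
 have T0: "T 0 = (\<lambda>s. mat 1)" and TS: "\<And>k. T (Suc k) = (\<lambda>s. integral {a..s} (\<lambda>v. T k v ** B v))"
  by (auto simp: T_def)
 define c where "c = norm (mat 1 :: real^'d^'d)"
 have T: "continuous_on {a..b} (T k) \<and> (\<forall>s\<in>{a..b}. norm (T k s) <= c * L ^ k * (s - a) ^ k / fact k)" for k
 proof (induction k)
  case 0 thus ?case by (simp add: T0 c_def)
 next
  case (Suc k)
  hence cont: "continuous_on {a..b} (\<lambda>v. T k v ** B v)"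
   by (intro continuous_intros contB) auto
  have "continuous_on {a..b} (T (Suc k))"
   unfolding TS by (intro indefinite_integral_continuous_1 integrable_continuous_real cont)
  moreover have "norm (T (Suc k) s) <= c * L ^ Suc k * (s - a) ^ Suc k / fact (Suc k)" if s: "s \<in> {a..b}" for s
  proof -
   have hi: "((\<lambda>v. c * L ^ Suc k * (v - a) ^ k / fact k) has_integral
     c * L ^ Suc k * (s - a) ^ Suc k / fact (Suc k) - c * L ^ Suc k * (a - a) ^ Suc k / fact (Suc k)) {a..s}"
   proof (rule fundamental_theorem_of_calculus)
    fix x assume "x \<in> {a..s}"
    have "((\<lambda>v. c * L ^ Suc k * (v - a) ^ Suc k / fact (Suc k)) has_real_derivative
      c * L ^ Suc k * (real (Suc k) * (x - a) ^ k) / fact (Suc k)) (at x within {a..s})"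
     by (rule derivative_eq_intros refl | simp)+
    moreover have "c * L ^ Suc k * (real (Suc k) * (x - a) ^ k) / fact (Suc k)
      = c * L ^ Suc k * (x - a) ^ k / fact k"
     by (simp add: fact_Suc del: of_nat_Suc power_Suc)
    ultimately show "((\<lambda>v. c * L ^ Suc k * (v - a) ^ Suc k / fact (Suc k)) has_vector_derivative
      c * L ^ Suc k * (x - a) ^ k / fact k) (at x within {a..s})"
     by (simp add: has_real_derivative_iff_has_vector_derivative mult.assoc)
   qed (use s in auto)
   have "norm (T (Suc k) s) <= integral {a..s} (\<lambda>v. c * L ^ Suc k * (v - a) ^ k / fact k)"
    unfolding TS
   proof (rule integral_norm_bound_integral)
    show "(\<lambda>v. T k v ** B v) integrable_on {a..s}"
     by (rule integrable_continuous_real, rule continuous_on_subset[OF cont]) (use s in auto)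
    show "norm (T k x ** B x) <= c * L ^ Suc k * (x - a) ^ k / fact k" if "x \<in> {a..s}" for x
    proof -
     have "norm (T k x ** B x) <= norm (T k x) * norm (B x)" by (rule norm_matrix_mult_le)
     also have "... <= c * L ^ k * (x - a) ^ k / fact k * L"
      using Suc that s L by (intro mult_mono) (auto simp: c_def intro!: divide_nonneg_pos mult_nonneg_nonneg)
     finally show ?thesis by (simp add: field_simps)
    qed
   qed (use hi in blast)
   also have "... = c * L ^ Suc k * (s - a) ^ Suc k / fact (Suc k)"
    using integral_unique[OF hi] by simp
   finally show ?thesis .
  qed
  ultimately show ?case by blast
 qed
 define m where "m k = c * (L * (b - a)) ^ k / fact k" for k
 have le_m: "norm (T k s) <= m k" if "s \<in> {a..b}" for k s
 proof -
  have "norm (T k s) <= c * L ^ k * (s - a) ^ k / fact k" using T that by blast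
  also have "... <= c * L ^ k * (b - a) ^ k / fact k"
   using that L by (intro divide_right_mono mult_left_mono power_mono) (auto simp: c_def)
  finally show ?thesis by (simp add: m_def power_mult_distrib mult.assoc)
 qed
 have sm: "summable m"
 proof -
  have "m = (\<lambda>k. c * (inverse (fact k) * (L * (b - a)) ^ k))"
   by (auto simp: m_def divide_inverse)
  thus ?thesis using summable_mult[OF summable_exp[of "L * (b - a)"], of c] by simp
 qed
 have ul: "uniform_limit {a..b} (\<lambda>n x. \<Sum>i<n. T i x) (\<lambda>x. \<Sum>i. T i x) sequentially"
  by (rule Weierstrass_m_test[OF le_m sm])
 define f' where "f' i x h = (if i = 0 then 0 else h *\<^sub>R (T (i - 1) x ** B x))" for i x and h :: real
 have der: "(T i has_derivative f' i x) (at x within {a..b})" if "x \<in> {a..b}" for i x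
 proof (cases i)
  case 0
  have "f' 0 x = (\<lambda>h. 0)" by (auto simp: f'_def)
  thus ?thesis by (simp add: T0 0)
 next
  case (Suc k)
  have "((\<lambda>s. integral {a..s} (\<lambda>v. T k v ** B v)) has_vector_derivative T k x ** B x) (at x within {a..b})"
   by (intro integral_has_vector_derivative continuous_intros contB that) (use T in auto)
  moreover have "f' (Suc k) x = (\<lambda>h. h *\<^sub>R (T k x ** B x))" by (auto simp: f'_def)
  ultimately show ?thesis by (simp add: Suc TS has_vector_derivative_def)
 qed
 have ex: "\<exists>g. \<forall>x\<in>{a..b}. (\<lambda>n. T n x) sums g x \<and>
   (g has_derivative (\<lambda>h. h *\<^sub>R ((\<Sum>i. T i x) ** B x))) (at x within {a..b})"
 proof (rule has_derivative_series[of "{a..b}" T f'])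
  fix e :: real assume "e > 0"
  hence "e / (L + 1) > 0" using L by simp
  with ul have "\<forall>\<^sub>F n in sequentially. \<forall>x\<in>{a..b}. norm ((\<Sum>i<n. T i x) - (\<Sum>i. T i x)) < e / (L + 1)"
   by (auto simp: uniform_limit_iff dist_norm)
  hence "\<forall>\<^sub>F n in sequentially. \<forall>x\<in>{a..b}. norm ((\<Sum>i<n - 1. T i x) - (\<Sum>i. T i x)) < e / (L + 1)"
   by (rule eventually_compose_filterlim) (rule filterlim_minus_const_nat_at_top)
  thus "\<forall>\<^sub>F n in sequentially. \<forall>x\<in>{a..b}. \<forall>h.
    norm ((\<Sum>i<n. f' i x h) - h *\<^sub>R ((\<Sum>i. T i x) ** B x)) <= e * norm h"
   using eventually_gt_at_top[of 0]
  proof eventually_elim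
   case (elim n)
   then obtain k where n: "n = Suc k" by (cases n) auto
   show ?case
   proof (intro ballI allI)
    fix x h assume x: "x \<in> {a..b}"
    have "(\<Sum>i<n. f' i x h) = (\<Sum>i<k. h *\<^sub>R (T i x ** B x))"
     unfolding n by (subst sum.lessThan_Suc_shift) (simp add: f'_def)
    also have "... = h *\<^sub>R ((\<Sum>i<k. T i x) ** B x)"
     by (simp add: scaleR_right.sum bounded_bilinear.sum_left[OF bounded_bilinear_matrix_mult])
    finally have "norm ((\<Sum>i<n. f' i x h) - h *\<^sub>R ((\<Sum>i. T i x) ** B x))
      = norm (h *\<^sub>R (((\<Sum>i<k. T i x) - (\<Sum>i. T i x)) ** B x))"
     by (simp add: bounded_bilinear.diff_left[OF bounded_bilinear_matrix_mult] scaleR_diff_right)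
    also have "... <= \<bar>h\<bar> * (norm ((\<Sum>i<k. T i x) - (\<Sum>i. T i x)) * norm (B x))"
     by (simp add: mult_left_mono norm_matrix_mult_le)
    also have "... <= \<bar>h\<bar> * (e / (L + 1) * (L + 1))"
     using elim(1) x L \<open>e / (L + 1) > 0\<close>
     by (intro mult_left_mono mult_mono) (auto simp: n intro: less_imp_le add_increasing2)
    finally show "norm ((\<Sum>i<n. f' i x h) - h *\<^sub>R ((\<Sum>i. T i x) ** B x)) <= e * norm h"
     using L by (simp add: mult.commute)
   qed
  qed
 next
  show "a \<in> {a..b}" using assms by simp
  show "(\<lambda>n. T n a) sums (\<Sum>n. T n a)"
   using summable_comparison_test'[OF sm, of 0 "\<lambda>n. T n a"] le_m[of a] \<open>a <= b\<close> by (intro summable_sums) auto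
 qed (use der in auto)
 then obtain g where g: "\<And>x. x \<in> {a..b} ==> (\<lambda>n. T n x) sums g x"
  "\<And>x. x \<in> {a..b} ==> (g has_derivative (\<lambda>h. h *\<^sub>R ((\<Sum>i. T i x) ** B x))) (at x within {a..b})"
  by blast
 show ?thesis
 proof (rule that[of g])
  have "T n a = (if n = 0 then mat 1 else 0)" for n by (cases n) (auto simp: T0 TS)
  hence "(\<lambda>n. T n a) = (\<lambda>n. if n = 0 then mat 1 else 0)" by auto
  hence "(\<lambda>n. T n a) sums mat 1" using sums_single[of 0 "\<lambda>_. mat 1 :: real^'d^'d"] by simp
  thus "g a = mat 1" using g(1)[of a] \<open>a <= b\<close> sums_unique2 by auto
  show "(g has_vector_derivative g s ** B s) (at s within {a..b})" if "s \<in> {a..b}" for s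
   using g(2)[OF that] sums_unique[OF g(1)[OF that]] by (simp add: has_vector_derivative_def)
 qed
qed
lemma fundamental_matrix_pair:
 fixes B :: "real => real^'d::finite^'d"
 assumes contB: "continuous_on {a..b} B" and "a <= b"
 obtains U V :: "real => real^'d^'d"
 where "\<And>s. s \<in> {a..b} ==> (U has_vector_derivative U s ** B s) (at s within {a..b})"
  "\<And>s. s \<in> {a..b} ==> (V has_vector_derivative - (B s ** V s)) (at s within {a..b})"
  "\<And>s. s \<in> {a..b} ==> U s ** V s = mat 1" "\<And>s. s \<in> {a..b} ==> V s ** U s = mat 1"
proof -
 obtain U where U: "U a = mat 1"
  "\<And>s. s \<in> {a..b} ==> (U has_vector_derivative U s ** B s) (at s within {a..b})"
  using linear_matrix_equation_solvable[OF assms] by blast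
 have "continuous_on {a..b} (\<lambda>s. - transpose (B s))" by (intro continuous_intros contB)
 then obtain W where W: "W a = mat 1"
  "\<And>s. s \<in> {a..b} ==> (W has_vector_derivative W s ** (- transpose (B s))) (at s within {a..b})"
  using linear_matrix_equation_solvable[OF _ \<open>a <= b\<close>] by blast
 define V where "V s = transpose (W s)" for s
 have V: "(V has_vector_derivative - (B s ** V s)) (at s within {a..b})" if "s \<in> {a..b}" for s
 proof -
  have "(V has_vector_derivative transpose (W s ** (- transpose (B s)))) (at s within {a..b})"
   unfolding V_def by (rule bounded_linear.has_vector_derivative[OF bounded_linear_transpose W(2)[OF that]])
  moreover have "transpose (W s ** (- transpose (B s))) = - (B s ** V s)"
   by (simp add: matrix_transpose_mul V_def bounded_bilinear.minus_right[OF bounded_bilinear_matrix_mult]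
     linear_simps[OF bounded_linear_transpose])
  ultimately show ?thesis by simp
 qed
 have "((\<lambda>s. U s ** V s) has_derivative (\<lambda>h. 0)) (at s within {a..b})" if s: "s \<in> {a..b}" for s
 proof -
  have "((\<lambda>s. U s ** V s) has_vector_derivative (U s ** (- (B s ** V s)) + (U s ** B s) ** V s)) (at s within {a..b})"
   by (rule bounded_bilinear.has_vector_derivative[OF bounded_bilinear_matrix_mult U(2)[OF s] V[OF s]])
  thus ?thesis
   by (simp add: bounded_bilinear.minus_right[OF bounded_bilinear_matrix_mult] matrix_mul_assoc has_vector_derivative_def)
 qed
 then obtain c where "\<And>s. s \<in> {a..b} ==> U s ** V s = c"
  using has_derivative_zero_constant[of "{a..b}" "\<lambda>s. U s ** V s"] by auto
 moreover have "U a ** V a = mat 1" by (simp add: U V_def W transpose_mat)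
 ultimately have UV: "\<And>s. s \<in> {a..b} ==> U s ** V s = mat 1"
  using \<open>a <= b\<close> by (metis atLeastAtMost_iff order_refl)
 hence "\<And>s. s \<in> {a..b} ==> V s ** U s = mat 1"
  by (simp add: matrix_left_right_inverse)
 with that[of U V] U(2) V UV show ?thesis by blast
qed

text \<open>Bounded measurable paths on a compact interval, the class on which all integrals below exist.\<close>

definition bdd_meas :: "real => real => (real => 'b::euclidean_space) => bool" where
 "bdd_meas a b g \<longleftrightarrow>
   g \<in> borel_measurable (restrict_space borel {a..b}) \<and> bounded (g ` {a..b})"

lemma bdd_meas_continuous:
 "continuous_on {a..b} g ==> bdd_meas a b g"
 unfolding bdd_meas_def
 by (auto intro!: borel_measurable_continuous_on_restrict compact_imp_bounded compact_continuous_image)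

lemma bdd_meas_bound:
 assumes "bdd_meas a b g"
 obtains C where "0 <= C" "\<And>t. t \<in> {a..b} ==> norm (g t) <= C"
proof -
 have "bounded (g ` {a..b})" using assms by (simp add: bdd_meas_def)
 then obtain C where "0 < C" "\<forall>y\<in>g ` {a..b}. norm y <= C" by (auto simp: bounded_pos)
 thus ?thesis using that[of C] by auto
qed

lemma bdd_meas_subset:
 assumes "bdd_meas a b g" "a <= u" "s <= b"
 shows "bdd_meas u s g"
proof -
 have "restrict_space borel {u..s} = restrict_space (restrict_space borel {a..b}) {u..s}"
  using assms(2,3) by (subst restrict_restrict_space) (auto intro!: arg_cong[where f="restrict_space borel"])
 moreover have "{u..s} \<subseteq> {a..b}" using assms(2,3) by auto
 ultimately show ?thesis
  using assms(1) unfolding bdd_meas_def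
  by (auto intro: measurable_restrict_space1 bounded_subset[OF _ image_mono])
qed

lemma bdd_meas_bilinear:
 fixes h :: "'x::euclidean_space => 'y::euclidean_space => 'z::euclidean_space"
 assumes h: "bounded_bilinear h" and f: "bdd_meas a b f" and g: "bdd_meas a b g"
 shows "bdd_meas a b (\<lambda>t. h (f t) (g t))"
proof -
 obtain F where F: "0 <= F" "\<And>t. t \<in> {a..b} ==> norm (f t) <= F"
  using bdd_meas_bound[OF f] by blast
 obtain G where G: "0 <= G" "\<And>t. t \<in> {a..b} ==> norm (g t) <= G"
  using bdd_meas_bound[OF g] by blast
 obtain K where K: "K >= 0" "\<And>x y. norm (h x y) <= norm x * norm y * K"
  using bounded_bilinear.nonneg_bounded[OF h] by blast
 have "bounded ((\<lambda>t. h (f t) (g t)) ` {a..b})"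
  unfolding bounded_iff
 proof (intro exI[of _ "F * G * K"] ballI)
  fix y assume "y \<in> (\<lambda>t. h (f t) (g t)) ` {a..b}"
  then obtain t where t: "t \<in> {a..b}" "y = h (f t) (g t)" by auto
  have "norm y <= norm (f t) * norm (g t) * K" unfolding t by (rule K)
  also have "... <= F * G * K"
   using F(1) F(2)[OF t(1)] G(2)[OF t(1)] K by (intro mult_right_mono mult_mono) auto
  finally show "norm y <= F * G * K" .
 qed
 moreover have "(\<lambda>t. h (f t) (g t)) \<in> borel_measurable (restrict_space borel {a..b})"
 proof (rule borel_measurable_continuous_Pair[where H=h])
  show "continuous_on UNIV (\<lambda>x. h (fst x) (snd x))"
   by (intro bounded_bilinear.continuous_on[OF h] continuous_intros)
 qed (use f g in "auto simp: bdd_meas_def")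
 ultimately show ?thesis by (simp add: bdd_meas_def)
qed

lemmas bdd_meas_matrix_vector =
 bdd_meas_bilinear[OF bounded_bilinear_matrix_vector]

lemma bdd_meas_add:
 assumes "bdd_meas a b f" "bdd_meas a b g"
 shows "bdd_meas a b (\<lambda>t. f t + g t)"
 using assms unfolding bdd_meas_def by (auto intro: bounded_plus_comp)

lemma bdd_meas_diff:
 assumes "bdd_meas a b f" "bdd_meas a b g"
 shows "bdd_meas a b (\<lambda>t. f t - g t)"
 using assms unfolding bdd_meas_def by (auto intro: bounded_minus_comp)

lemma bdd_meas_hazard:
 assumes "bdd_meas a b f" "b < 1"
 shows "bdd_meas a b (\<lambda>t. (1 / (1 - t)) *\<^sub>R f t)"
 by (rule bdd_meas_bilinear[OF bounded_bilinear_scaleR bdd_meas_continuous assms(1)])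
  (use assms(2) in "auto intro!: continuous_intros")

lemma bdd_meas_set_integrable:
 assumes "bdd_meas a b g"
 shows "set_integrable lborel {a..b} g"
proof -
 obtain G where G: "0 <= G" "\<And>t. t \<in> {a..b} ==> norm (g t) <= G"
  using bdd_meas_bound[OF assms] by blast
 have "(\<lambda>t. indicator {a..b} t *\<^sub>R g t) \<in> borel_measurable borel"
  using assms by (simp add: bdd_meas_def borel_measurable_restrict_space_iff mult.commute)
 thus ?thesis
  unfolding set_integrable_def
  by (intro integrableI_bounded_set[where A="{a..b}" and B=G])
   (use G in "auto simp: emeasure_lborel_Icc_eq indicator_def")
qed

lemma bdd_meas_integrable:
 assumes "bdd_meas a b g" "a <= u" "s <= b"
 shows "g integrable_on {u..s}"
 using set_borel_integral_eq_integral(1)[OF bdd_meas_set_integrable[OF bdd_meas_subset[OF assms]]] .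

text \<open>\<^const>\<open>dH\<close> has a Lebesgue density, so it does not matter which endpoints belong to the interval.\<close>

lemma hazard_integral_eq:
 assumes g: "bdd_meas a b g" and "a <= u" "s <= b" "b < 1"
  and S: "S = {u..<s} \<or> S = {u<..s} \<or> S = {u..s}"
 shows "(LINT v:S|dH. g v) = integral {u..s} (\<lambda>v. (1 / (1 - v)) *\<^sub>R g v)"
  and "set_integrable dH S g"
proof -
 have Sb: "S \<in> sets borel" "S \<subseteq> {a..b}" "S \<subseteq> {..<1}" using S assms by auto
 have gm: "(\<lambda>v. indicator S v *\<^sub>R g v) \<in> borel_measurable borel"
 proof -
  have *: "(\<lambda>t. indicator {a..b} t *\<^sub>R g t) \<in> borel_measurable borel"
   using g by (simp add: bdd_meas_def borel_measurable_restrict_space_iff mult.commute)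
  have "(\<lambda>v. indicator S v *\<^sub>R (indicator {a..b} v *\<^sub>R g v)) \<in> borel_measurable borel"
   by (rule borel_measurable_scaleR[OF borel_measurable_indicator[OF Sb(1)] *])
  moreover have "(\<lambda>v. indicator S v *\<^sub>R (indicator {a..b} v *\<^sub>R g v)) = (\<lambda>v. indicator S v *\<^sub>R g v)"
   using Sb by (auto simp: indicator_def fun_eq_iff)
  ultimately show ?thesis by simp
 qed
 hence gm': "(\<lambda>v. indicator S v *\<^sub>R g v) \<in> borel_measurable lborel" by simp
 let ?w = "\<lambda>u. indicator {..<1} u * (1 / (1 - u)) :: real"
 have w: "?w \<in> borel_measurable lborel" "AE x in lborel. 0 <= ?w x" by (auto simp: indicator_def)
 have eqf: "(\<lambda>v. ?w v *\<^sub>R (indicator S v *\<^sub>R g v)) = (\<lambda>v. indicator S v *\<^sub>R ((1 / (1 - v)) *\<^sub>R g v))"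
  using Sb by (auto simp: indicator_def fun_eq_iff)
 let ?h = "\<lambda>v. (1 / (1 - v)) *\<^sub>R g v"
 have hi: "set_integrable lborel {u..s} ?h"
  by (intro bdd_meas_set_integrable
    bdd_meas_subset[OF bdd_meas_hazard[OF g \<open>b < 1\<close>]] assms)
 have "(LINT v:S|dH. g v) = (LINT v:S|lborel. ?h v)"
  unfolding set_lebesgue_integral_def dH_def integral_density[OF gm' w] eqf ..
 also have "... = (LINT v:{u..s}|lborel. ?h v)"
  unfolding set_lebesgue_integral_def
 proof (rule integral_cong_AE)
  show "(\<lambda>x. indicator S x *\<^sub>R ?h x) \<in> borel_measurable lborel"
   by (subst eqf[symmetric]) (rule borel_measurable_scaleR[OF w(1) gm'])
  show "(\<lambda>x. indicator {u..s} x *\<^sub>R ?h x) \<in> borel_measurable lborel"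
   using hi by (simp add: set_integrable_def)
  show "AE x in lborel. indicator S x *\<^sub>R ?h x = indicator {u..s} x *\<^sub>R ?h x"
   using AE_lborel_singleton[of u] AE_lborel_singleton[of s]
   by eventually_elim (use S in "auto simp: indicator_def")
 qed
 also have "... = integral {u..s} ?h" by (rule set_borel_integral_eq_integral(2)[OF hi])
 finally show "(LINT v:S|dH. g v) = integral {u..s} ?h" .
 have "integrable lborel (\<lambda>x. indicator S x *\<^sub>R ?h x)"
 proof -
  have "S \<subseteq> {u..s}" using S by auto
  hence "set_integrable lborel S ?h" using set_integrable_subset[OF hi, of S] Sb by simp
  thus ?thesis by (simp only: set_integrable_def)
 qed
 thus "set_integrable dH S g"
  unfolding set_integrable_def dH_def integrable_density[OF gm' w] eqf .
qed

lemma norm_integral_le: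
 fixes f :: "real => 'b::euclidean_space"
 assumes "f integrable_on {u..s}" "u <= s" "\<And>v. v \<in> {u..s} ==> norm (f v) <= C"
 shows "norm (integral {u..s} f) <= C * (s - u)"
proof -
 have "0 <= C" using assms(2) assms(3)[of u] norm_ge_zero[of "f u"] by (auto intro: order_trans[OF norm_ge_zero])
 thus ?thesis
  using integrable_bound[of C f u s] assms by (simp add: cbox_interval)
qed

text \<open>A discrete Gronwall inequality: each factor has norm at most \<open>1 + L (t\<^sub>l\<^sub>+\<^sub>1 - t\<^sub>l)\<close>.\<close>

lemma partition_prod_norm_le:
 fixes A :: "real => real^'d::finite^'d"
 assumes X: "\<And>l. l < m ==> norm (LINT v:{t l<..t (Suc l)}|dH. A v) <= L * (t (Suc l) - t l)"
 shows "norm (partition_prod A t m) <= norm (mat 1 :: real^'d^'d) * exp (L * (t m - t 0))"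
 using X
proof (induction m)
 case (Suc m)
 let ?P = "partition_prod A t m" and ?X = "LINT v:{t m<..t (Suc m)}|dH. A v"
 have "norm (partition_prod A t (Suc m)) = norm (?P + ?P ** ?X)"
  by (simp add: matrix_add_ldistrib)
 also have "... <= norm ?P + norm ?P * norm ?X"
  by (rule order_trans[OF norm_triangle_ineq]) (simp add: norm_matrix_mult_le)
 also have "... <= norm ?P * (1 + L * (t (Suc m) - t m))"
  using mult_left_mono[OF Suc.prems[of m], of "norm ?P"] by (simp add: distrib_left)
 also have "... <= norm ?P * exp (L * (t (Suc m) - t m))"
  by (intro mult_left_mono exp_ge_add_one_self) auto
 also have "... <= norm (mat 1 :: real^'d^'d) * exp (L * (t m - t 0)) * exp (L * (t (Suc m) - t m))"
  using Suc by (intro mult_right_mono) auto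
 also have "... = norm (mat 1 :: real^'d^'d) * exp (L * (t (Suc m) - t 0))"
  by (simp add: exp_add[symmetric] mult.assoc algebra_simps)
 finally show ?case .
qed simp

text \<open>There are partitions of arbitrarily small mesh, so the limit in the definition is unique.\<close>

lemma prod_integral_unique:
 fixes A :: "real => real^'d::finite^'d"
 assumes "u <= s"
  and lim: "\<And>e. e > 0 ==> \<exists>r>0. \<forall>m t. t 0 = u \<and> t m = s \<and> (\<forall>l<m. t l < t (Suc l) \<and> t (Suc l) - t l < r)
   --> dist (partition_prod A t m) P < e"
 shows "prod_integral A u s = P"
 unfolding prod_integral_def
proof (rule the_equality)
 show "\<forall>e>0. \<exists>r>0. \<forall>m t. t 0 = u \<and> t m = s \<and> (\<forall>l<m. t l < t (Suc l) \<and> t (Suc l) - t l < r)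
   --> dist (partition_prod A t m) P < e" using lim by blast
 fix Q assume Q: "\<forall>e>0. \<exists>r>0. \<forall>m t. t 0 = u \<and> t m = s \<and> (\<forall>l<m. t l < t (Suc l) \<and> t (Suc l) - t l < r)
   --> dist (partition_prod A t m) Q < e"
 have part: "\<exists>m t. t 0 = u \<and> t m = s \<and> (\<forall>l<m. t l < t (Suc l) \<and> t (Suc l) - t l < r)" if "r > 0" for r
 proof (cases "u = s")
  case True thus ?thesis by (intro exI[of _ 0] exI[of _ "\<lambda>_. u"]) auto
 next
  case False
  hence us: "u < s" using assms by simp
  obtain m :: nat where m: "(s - u) / r < real m" using reals_Archimedean2 by blast
  hence m0: "0 < m" using us \<open>r > 0\<close> by (cases m) (auto simp: field_simps)
  define t where "t l = u + real l * (s - u) / real m" for l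
  have "t (Suc l) - t l = (s - u) / real m" for l by (simp add: t_def distrib_right add_divide_distrib)
  moreover have "(s - u) / real m < r" "0 < (s - u) / real m" using m m0 us \<open>r > 0\<close> by (auto simp: field_simps)
  moreover have "t 0 = u" "t m = s" using m0 by (auto simp: t_def)
  ultimately show ?thesis by (intro exI[of _ m] exI[of _ t]) (auto simp: algebra_simps dest: spec)
 qed
 show "Q = P"
 proof (rule ccontr)
  assume "Q \<noteq> P"
  hence e: "dist Q P / 2 > 0" by simp
  obtain r1 where r1: "r1 > 0" "\<And>m t. t 0 = u \<and> t m = s \<and> (\<forall>l<m. t l < t (Suc l) \<and> t (Suc l) - t l < r1)
   ==> dist (partition_prod A t m) P < dist Q P / 2" using lim[OF e] by blast
  obtain r2 where r2: "r2 > 0" "\<And>m t. t 0 = u \<and> t m = s \<and> (\<forall>l<m. t l < t (Suc l) \<and> t (Suc l) - t l < r2)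
   ==> dist (partition_prod A t m) Q < dist Q P / 2" using Q e by blast
  obtain m t where "t 0 = u" "t m = s" "\<forall>l<m. t l < t (Suc l) \<and> t (Suc l) - t l < min r1 r2"
   using part[of "min r1 r2"] r1(1) r2(1) by auto
  hence "dist (partition_prod A t m) P < dist Q P / 2" "dist (partition_prod A t m) Q < dist Q P / 2"
   using r1(2)[of t m] r2(2)[of t m] by auto
  thus False using dist_triangle_half_r[of "partition_prod A t m" Q "dist Q P" P] by simp
 qed
qed

text \<open>The telescoping argument: over an interval of length \<open>d\<close> the factor \<open>I + \<integral>A dH\<close> differs from the
 exact propagator \<open>V(t\<^sub>l) U(t\<^sub>l\<^sub>+\<^sub>1)\<close> by \<open>O(d\<^sup>2)\<close>, so the whole product differs by \<open>O(mesh)\<close>.\<close>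

lemma prod_integral_eq_propagator:
 fixes A :: "real => real^'d::finite^'d"
 assumes contA: "continuous_on {a..b} A" and b: "b < 1"
  and U: "\<And>s. s \<in> {a..b} ==> (U has_vector_derivative U s ** ((1 / (1 - s)) *\<^sub>R A s)) (at s within {a..b})"
  and V: "continuous_on {a..b} V"
  and UV: "\<And>s. s \<in> {a..b} ==> U s ** V s = mat 1" and VU: "\<And>s. s \<in> {a..b} ==> V s ** U s = mat 1"
  and us: "a <= u" "u <= s" "s <= b"
 shows "prod_integral A u s = V u ** U s"
proof (rule prod_integral_unique[OF us(2)])
 define B where "B v = (1 / (1 - v)) *\<^sub>R A v" for v
 have contB: "continuous_on {a..b} B" unfolding B_def using b by (intro continuous_intros contA) auto
 have contU: "continuous_on {a..b} U"
  unfolding continuous_on_eq_continuous_within by (intro ballI has_vector_derivative_continuous[OF U])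
 obtain L where L: "0 <= L" "\<And>v. v \<in> {a..b} ==> norm (B v) <= L" using continuous_on_norm_bound[OF contB] by blast
 obtain K where K: "0 <= K" "\<And>v. v \<in> {a..b} ==> norm (U v) <= K" using continuous_on_norm_bound[OF contU] by blast
 obtain J where J: "0 <= J" "\<And>v. v \<in> {a..b} ==> norm (V v) <= J" using continuous_on_norm_bound[OF V] by blast
 define C where "C = J * K * L"
 have C0: "0 <= C" unfolding C_def using L K J by simp
 define P where "P x y = V x ** U y" for x y
 have PP: "P x y ** P y z = P x z" if "x \<in> {a..b}" "y \<in> {a..b}" "z \<in> {a..b}" for x y z
 proof -
  have "P x y ** P y z = V x ** (U y ** V y) ** U z" by (simp add: P_def matrix_mul_assoc)
  thus ?thesis using UV that by (simp add: P_def)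
 qed
 have P1: "norm (P x y - mat 1) <= C * (y - x)" if "a <= x" "x <= y" "y <= b" for x y
 proof -
  have "norm (P x y - P x x) <= C * (y - x)"
  proof (rule has_vector_derivative_norm_bound[OF that(2)])
   fix v assume v: "v \<in> {x..y}"
   hence vab: "v \<in> {a..b}" using that by auto
   have "(U has_vector_derivative U v ** B v) (at v within {x..y})"
    using has_vector_derivative_within_subset[OF U[OF vab]] that by (auto simp: B_def)
   thus "((\<lambda>y. P x y) has_vector_derivative V x ** (U v ** B v)) (at v within {x..y})"
    unfolding P_def
    by (rule bounded_linear.has_vector_derivative[OF bounded_bilinear.bounded_linear_right[OF bounded_bilinear_matrix_mult]])
   have "norm (V x ** (U v ** B v)) <= norm (V x) * norm (U v ** B v)" by (rule norm_matrix_mult_le)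
   also have "... <= norm (V x) * (norm (U v) * norm (B v))" by (intro mult_left_mono norm_matrix_mult_le) auto
   also have "... <= J * (K * L)" using J K L vab that by (intro mult_mono) auto
   finally show "norm (V x ** (U v ** B v)) <= C" by (simp add: C_def)
  qed
  thus ?thesis using VU[of x] that by (simp add: P_def)
 qed
 have AB: "(LINT v:{x<..y}|dH. A v) = integral {x..y} B" if "a <= x" "x <= y" "y <= b" for x y
  unfolding B_def using that b
  by (intro hazard_integral_eq(1)[OF bdd_meas_continuous[OF contA]]) auto
 have intB: "B integrable_on {x..y}" if "a <= x" "x <= y" "y <= b" for x y
  by (rule integrable_continuous_real, rule continuous_on_subset[OF contB]) (use that in auto)
 have P2: "norm (P x y - (mat 1 + integral {x..y} B)) <= C * L * (y - x) * (y - x)" if xy: "a <= x" "x <= y" "y <= b" for x y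
 proof -
  define g where "g v = P x v - integral {x..v} B" for v
  have "norm (g y - g x) <= (C * L * (y - x)) * (y - x)"
  proof (rule has_vector_derivative_norm_bound[OF xy(2)])
   fix v assume v: "v \<in> {x..y}"
   hence vab: "v \<in> {a..b}" using xy by auto
   have "(U has_vector_derivative U v ** B v) (at v within {x..y})"
    using has_vector_derivative_within_subset[OF U[OF vab]] xy by (auto simp: B_def)
   hence 1: "((\<lambda>y. P x y) has_vector_derivative V x ** (U v ** B v)) (at v within {x..y})"
    unfolding P_def
    by (rule bounded_linear.has_vector_derivative[OF bounded_bilinear.bounded_linear_right[OF bounded_bilinear_matrix_mult]])
   have 2: "((\<lambda>v. integral {x..v} B) has_vector_derivative B v) (at v within {x..y})"
    by (rule integral_has_vector_derivative[OF continuous_on_subset[OF contB] v]) (use xy in auto)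
   have eq: "V x ** (U v ** B v) - B v = (P x v - mat 1) ** B v"
    by (simp add: P_def matrix_mul_assoc bounded_bilinear.diff_left[OF bounded_bilinear_matrix_mult])
   show "(g has_vector_derivative (P x v - mat 1) ** B v) (at v within {x..y})"
    unfolding g_def eq[symmetric] by (rule has_vector_derivative_diff[OF 1 2])
   have "norm ((P x v - mat 1) ** B v) <= norm (P x v - mat 1) * norm (B v)" by (rule norm_matrix_mult_le)
   also have "... <= (C * (y - x)) * L"
   proof (intro mult_mono)
    show "norm (P x v - mat 1) <= C * (y - x)"
     using P1[of x v] v xy C0 by (intro order_trans[OF P1 mult_left_mono]) auto
   qed (use L vab C0 xy in auto)
   finally show "norm ((P x v - mat 1) ** B v) <= C * L * (y - x)" by (simp add: mult_ac)
  qed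
  moreover have "g y - g x = P x y - (mat 1 + integral {x..y} B)"
   using VU[of x] xy by (simp add: g_def P_def)
  ultimately show ?thesis by simp
 qed
 define D where "D = norm (mat 1 :: real^'d^'d) * exp (L * (b - a)) * (C * L)"
 have D0: "0 <= D" unfolding D_def using C0 L by simp
 have main: "norm (partition_prod A t k - P u (t k)) <= D * r * (t k - u) * exp (C * (t k - u))
   \<and> u <= t k"
  if t: "t 0 = u" "t m = s" "\<forall>l<m. t l < t (Suc l) \<and> t (Suc l) - t l < r" and "r > 0" and km: "k <= m" for t m r k
 proof -
  have mono: "t i <= t j" if "i <= j" "j <= m" for i j
   using that
  proof (induction j)
   case (Suc j)
   show ?case
   proof (cases "i = Suc j")
    case False
    hence "t i <= t j" "t j < t (Suc j)" using Suc t(3) by auto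
    thus ?thesis by simp
   qed simp
  qed simp
  have in_ab: "a <= t i" "t i <= b" if "i <= m" for i
   using mono[of 0 i] mono[of i m] that t us by auto
  show ?thesis using km
  proof (induction k)
   case 0 show ?case using VU[of u] us t by (simp add: P_def)
  next
   case (Suc k)
   let ?Q = "partition_prod A t k" and ?x = "t k" and ?y = "t (Suc k)"
   have xy: "a <= ?x" "?x <= ?y" "?y <= b" "?y - ?x < r" using in_ab Suc.prems t(3) by (auto intro: less_imp_le)
   have ux: "u <= ?x" using mono[of 0 k] Suc.prems t by auto
   have Qn: "norm ?Q <= norm (mat 1 :: real^'d^'d) * exp (L * (b - a))"
   proof -
    have "norm ?Q <= norm (mat 1 :: real^'d^'d) * exp (L * (t k - t 0))"
    proof (rule partition_prod_norm_le)
     fix l assume l: "l < k"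
     hence l': "a <= t l" "t l <= t (Suc l)" "t (Suc l) <= b" using in_ab mono Suc.prems by auto
     show "norm (LINT v:{t l<..t (Suc l)}|dH. A v) <= L * (t (Suc l) - t l)"
      unfolding AB[OF l'] by (rule norm_integral_le[OF intB[OF l'] l'(2)]) (use L l' in auto)
    qed
    also have "... <= norm (mat 1 :: real^'d^'d) * exp (L * (b - a))"
     using in_ab[of k] Suc.prems t us L by (intro mult_left_mono) (auto intro!: mult_left_mono)
    finally show ?thesis .
   qed
   have split: "partition_prod A t (Suc k) - P u ?y =
     - (?Q ** (P ?x ?y - (mat 1 + integral {?x..?y} B))) + ((?Q - P u ?x) + (?Q - P u ?x) ** (P ?x ?y - mat 1))"
    using PP[of u ?x ?y] us xy ux
    by (simp add: AB[OF xy(1-3)] bounded_bilinear.diff_left[OF bounded_bilinear_matrix_mult]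
      bounded_bilinear.diff_right[OF bounded_bilinear_matrix_mult] algebra_simps)
   have n1: "norm (?Q ** (P ?x ?y - (mat 1 + integral {?x..?y} B))) <= D * r * (?y - ?x)"
   proof -
    have "norm (?Q ** (P ?x ?y - (mat 1 + integral {?x..?y} B)))
     <= norm ?Q * norm (P ?x ?y - (mat 1 + integral {?x..?y} B))" by (rule norm_matrix_mult_le)
    also have "... <= (norm (mat 1 :: real^'d^'d) * exp (L * (b - a))) * (C * L * (?y - ?x) * (?y - ?x))"
     using Qn P2[OF xy(1-3)] by (intro mult_mono) auto
    also have "... = D * (?y - ?x) * (?y - ?x)" by (simp add: D_def mult_ac)
    also have "... <= D * r * (?y - ?x)" using xy D0 by (intro mult_right_mono mult_left_mono) auto
    finally show ?thesis .
   qed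
   let ?E = "D * r * (?x - u) * exp (C * (?x - u))"
   have IH: "norm (?Q - P u ?x) <= ?E" using Suc by simp
   have "norm ((?Q - P u ?x) + (?Q - P u ?x) ** (P ?x ?y - mat 1)) <= norm (?Q - P u ?x) + norm (?Q - P u ?x) * norm (P ?x ?y - mat 1)"
    by (rule order_trans[OF norm_triangle_ineq]) (simp add: norm_matrix_mult_le)
   also have "... <= norm (?Q - P u ?x) + norm (?Q - P u ?x) * (C * (?y - ?x))"
    using P1[OF xy(1-3)] by (intro add_left_mono mult_left_mono) auto
   also have "... = norm (?Q - P u ?x) * (1 + C * (?y - ?x))" by (simp add: algebra_simps)
   also have "... <= ?E * exp (C * (?y - ?x))"
    using IH C0 xy order_trans[OF norm_ge_zero IH] by (intro mult_mono exp_ge_add_one_self) auto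
   also have "... = D * r * (?x - u) * exp (C * (?y - u))"
    by (simp add: exp_add[symmetric] algebra_simps)
   finally have n2: "norm ((?Q - P u ?x) + (?Q - P u ?x) ** (P ?x ?y - mat 1)) <= D * r * (?x - u) * exp (C * (?y - u))" .
   have "norm (partition_prod A t (Suc k) - P u ?y) <= D * r * (?y - ?x) + D * r * (?x - u) * exp (C * (?y - u))"
    unfolding split by (rule norm_triangle_le, rule add_mono) (use n1 n2 in simp_all)
   also have "... <= D * r * (?y - ?x) * exp (C * (?y - u)) + D * r * (?x - u) * exp (C * (?y - u))"
    using D0 \<open>r > 0\<close> xy C0 ux
     mult_left_mono[of 1 "exp (C * (?y - u))" "D * r * (?y - ?x)"] by simp
   also have "... = D * r * (?y - u) * exp (C * (?y - u))" by (simp add: algebra_simps)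
   finally show ?case using ux xy by simp
  qed
 qed
 fix e :: real assume e: "e > 0"
 define F where "F = D * (s - u) * exp (C * (s - u))"
 have F0: "0 <= F" unfolding F_def using D0 us by simp
 show "\<exists>r>0. \<forall>m t. t 0 = u \<and> t m = s \<and> (\<forall>l<m. t l < t (Suc l) \<and> t (Suc l) - t l < r)
   --> dist (partition_prod A t m) (V u ** U s) < e"
 proof (intro exI[of _ "e / (F + 1)"] conjI allI impI)
  show "0 < e / (F + 1)" using e F0 by simp
  fix m t assume "t 0 = u \<and> t m = s \<and> (\<forall>l<m. t l < t (Suc l) \<and> t (Suc l) - t l < e / (F + 1))"
  hence "norm (partition_prod A t m - P u s) <= D * (e / (F + 1)) * (s - u) * exp (C * (s - u))"
   using main[of t m "e / (F + 1)" m] e F0 by auto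
  also have "... = e * (F / (F + 1))" by (simp add: F_def)
  also have "... < e" using e F0 by (simp add: field_simps)
  finally show "dist (partition_prod A t m) (V u ** U s) < e" by (simp add: dist_norm P_def)
 qed
qed

text \<open>With \<open>Q\<close> and \<open>X\<close> the transposed fundamental matrices, the kernel of \<^const>\<open>duhamel\<close> separates
 into a factor depending on \<open>s\<close> and one depending on \<open>u\<close>.\<close>

lemma duhamel_separated:
 fixes Mv :: "real => real^'d::finite^'d"
 assumes contM: "continuous_on {a..b} Mv" and b: "b < 1" "a <= b"
 shows "\<exists>(Q :: real => real^'d^'d) (X :: real => real^'d^'d). continuous_on {a..b} Q \<and> continuous_on {a..b} X \<and>
  (\<forall>s\<in>{a..b}. Q s ** X s = mat 1) \<and>
  (\<forall>s\<in>{a..b}. (X has_vector_derivative - ((1 / (1 - s)) *\<^sub>R (X s ** Mv s))) (at s within {a..b})) \<and>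
  (\<forall>x. bdd_meas a b x --> (\<forall>s\<in>{a..b}. duhamel a Mv x s
    = x s + Q s *v integral {a..s} (\<lambda>u. (1 / (1 - u)) *\<^sub>R ((X u ** Mv u) *v x u))))"
proof -
 define A where "A = (\<lambda>v. transpose (Mv v))"
 have contA: "continuous_on {a..b} A" unfolding A_def by (intro continuous_intros contM)
 have contB: "continuous_on {a..b} (\<lambda>s. (1 / (1 - s)) *\<^sub>R A s)" using b by (intro continuous_intros contA) auto
 obtain U V :: "real => real^'d^'d" where U: "\<And>s. s \<in> {a..b} ==> (U has_vector_derivative U s ** ((1 / (1 - s)) *\<^sub>R A s)) (at s within {a..b})"
  and V: "\<And>s. s \<in> {a..b} ==> (V has_vector_derivative - (((1 / (1 - s)) *\<^sub>R A s) ** V s)) (at s within {a..b})"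
  and UV: "\<And>s. s \<in> {a..b} ==> U s ** V s = mat 1" "\<And>s. s \<in> {a..b} ==> V s ** U s = mat 1"
  using fundamental_matrix_pair[OF contB b(2)] by blast
 have contU: "continuous_on {a..b} U" and contV: "continuous_on {a..b} V"
  unfolding continuous_on_eq_continuous_within
  by (intro ballI has_vector_derivative_continuous[OF U] has_vector_derivative_continuous[OF V]; assumption)+
 note P = prod_integral_eq_propagator[OF contA b(1) U contV UV]
 define Q where "Q = (\<lambda>s. transpose (U s))"
 define X where "X = (\<lambda>s. transpose (V s))"
 have 1: "continuous_on {a..b} Q" "continuous_on {a..b} X"
  unfolding Q_def X_def by (intro continuous_intros contU contV)+
 have 2: "Q s ** X s = mat 1" if "s \<in> {a..b}" for s
  using UV(2)[OF that] by (simp add: Q_def X_def matrix_transpose_mul[symmetric] transpose_mat)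
 have 3: "(X has_vector_derivative - ((1 / (1 - s)) *\<^sub>R (X s ** Mv s))) (at s within {a..b})" if "s \<in> {a..b}" for s
 proof -
  have "(X has_vector_derivative transpose (- (((1 / (1 - s)) *\<^sub>R A s) ** V s))) (at s within {a..b})"
   unfolding X_def by (rule bounded_linear.has_vector_derivative[OF bounded_linear_transpose V[OF that]])
  moreover have "transpose (- (((1 / (1 - s)) *\<^sub>R A s) ** V s)) = - ((1 / (1 - s)) *\<^sub>R (X s ** Mv s))"
   by (simp add: A_def X_def matrix_transpose_mul linear_simps[OF bounded_linear_transpose]
     bounded_bilinear.scaleR_left[OF bounded_bilinear_matrix_mult]
     bounded_bilinear.scaleR_right[OF bounded_bilinear_matrix_mult] del: scaleR_scaleR)
  ultimately show ?thesis by simp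
 qed
 have 4: "duhamel a Mv x s = x s + Q s *v integral {a..s} (\<lambda>u. (1 / (1 - u)) *\<^sub>R ((X u ** Mv u) *v x u))"
  if x: "bdd_meas a b x" and s: "s \<in> {a..b}" for x s
 proof -
  have bm: "bdd_meas a b (\<lambda>u. (X u ** Mv u) *v x u)"
   by (intro bdd_meas_matrix_vector bdd_meas_continuous continuous_intros 1 contM x)
  have bm2: "bdd_meas a b (\<lambda>u. Q s *v ((X u ** Mv u) *v x u))"
   by (intro bdd_meas_matrix_vector[OF bdd_meas_continuous bm] continuous_intros)
  have "(LINT u:{a..<s}|dH. (transpose (prod_integral A u s) ** Mv u) *v x u)
    = (LINT u:{a..<s}|dH. Q s *v ((X u ** Mv u) *v x u))"
  proof (rule set_lebesgue_integral_cong)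
   show "{a..<s} \<in> sets dH" by (simp add: dH_def)
   show "\<forall>u. u \<in> {a..<s} --> (transpose (prod_integral A u s) ** Mv u) *v x u = Q s *v ((X u ** Mv u) *v x u)"
    using P s by (auto simp: Q_def X_def matrix_transpose_mul matrix_vector_mul_assoc matrix_mul_assoc)
  qed
  also have "... = integral {a..s} (\<lambda>u. (1 / (1 - u)) *\<^sub>R (Q s *v ((X u ** Mv u) *v x u)))"
   using s b by (intro hazard_integral_eq(1)[OF bm2]) auto
  also have "... = integral {a..s} (\<lambda>u. Q s *v ((1 / (1 - u)) *\<^sub>R ((X u ** Mv u) *v x u)))"
   by (simp add: matrix_vector_mult_scaleR)
  also have "... = Q s *v integral {a..s} (\<lambda>u. (1 / (1 - u)) *\<^sub>R ((X u ** Mv u) *v x u))"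
   using bdd_meas_integrable[OF bdd_meas_hazard[OF bm b(1)], of a s] s
   by (intro integral_linear[unfolded o_def] matrix_vector_mul_bounded_linear) auto
  finally show ?thesis by (simp add: duhamel_def A_def)
 qed
 show ?thesis
  by (rule exI[of _ Q], rule exI[of _ X], intro conjI ballI allI impI) (rule 1 2 3 4; assumption?)+
qed

lemma duhamel_linear:
 fixes Mv :: "real => real^'d::finite^'d"
 assumes contM: "continuous_on {a..b} Mv" and b: "b < 1" and s: "s \<in> {a..b}"
  and x: "bdd_meas a b x" and y: "bdd_meas a b y"
 shows "duhamel a Mv (\<lambda>u. x u + y u) s = duhamel a Mv x s + duhamel a Mv y s"
  and "duhamel a Mv (\<lambda>u. c *\<^sub>R x u) s = c *\<^sub>R duhamel a Mv x s"
proof -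
 have ab: "a <= b" using s by auto
 obtain P X :: "real => real^'d^'d" where ps: "continuous_on {a..b} P" "continuous_on {a..b} X"
  and inv0: "\<forall>s\<in>{a..b}. P s ** X s = mat 1"
  and der0: "\<forall>s\<in>{a..b}. (X has_vector_derivative - ((1 / (1 - s)) *\<^sub>R (X s ** Mv s))) (at s within {a..b})"
  and D0: "\<forall>x. bdd_meas a b x --> (\<forall>s\<in>{a..b}. duhamel a Mv x s
    = x s + P s *v integral {a..s} (\<lambda>u. (1 / (1 - u)) *\<^sub>R ((X u ** Mv u) *v x u)))"
  using duhamel_separated[OF contM b ab] by (elim exE conjE) (rule that)
 have D: "duhamel a Mv x s = x s + P s *v integral {a..s} (\<lambda>u. (1 / (1 - u)) *\<^sub>R ((X u ** Mv u) *v x u))"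
  if "bdd_meas a b x" "s \<in> {a..b}" for x s using D0 that by blast
 have int: "(\<lambda>u. (1 / (1 - u)) *\<^sub>R ((X u ** Mv u) *v x u)) integrable_on {a..s}" if "bdd_meas a b x" for x
 proof (rule bdd_meas_integrable)
  show "bdd_meas a b (\<lambda>u. (1 / (1 - u)) *\<^sub>R ((X u ** Mv u) *v x u))"
   by (rule bdd_meas_hazard[OF bdd_meas_matrix_vector[OF bdd_meas_continuous that] b])
    (intro continuous_intros ps contM)
 qed (use s in auto)
 have cx: "bdd_meas a b (\<lambda>u. c *\<^sub>R x u)"
  by (rule bdd_meas_bilinear[OF bounded_bilinear_scaleR bdd_meas_continuous x]) auto
 show "duhamel a Mv (\<lambda>u. x u + y u) s = duhamel a Mv x s + duhamel a Mv y s"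
  unfolding D[OF bdd_meas_add[OF x y] s] D[OF x s] D[OF y s]
  by (simp add: matrix_vector_right_distrib scaleR_add_right integral_add[OF int[OF x] int[OF y]])
 have "integral {a..s} (\<lambda>u. (1 / (1 - u)) *\<^sub>R ((X u ** Mv u) *v (c *\<^sub>R x u)))
   = integral {a..s} (\<lambda>u. c *\<^sub>R ((1 / (1 - u)) *\<^sub>R ((X u ** Mv u) *v x u)))"
  by (simp add: matrix_vector_mult_scaleR mult.commute)
 also have "... = c *\<^sub>R integral {a..s} (\<lambda>u. (1 / (1 - u)) *\<^sub>R ((X u ** Mv u) *v x u))"
  by (rule integral_cmul)
 finally show "duhamel a Mv (\<lambda>u. c *\<^sub>R x u) s = c *\<^sub>R duhamel a Mv x s"
  unfolding D[OF cx s] D[OF x s] by (simp add: matrix_vector_mult_scaleR scaleR_add_right)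
qed

lemma duhamel_bounded:
 fixes Mv :: "real => real^'d::finite^'d"
 assumes contM: "continuous_on {a..b} Mv" and b: "b < 1" "a <= b"
 obtains C where "1 <= C" "\<And>(x :: real => real^'d) e s. bdd_meas a b x ==> (\<And>u. u \<in> {a..b} ==> norm (x u) <= e)
  ==> s \<in> {a..b} ==> norm (duhamel a Mv x s) <= C * e"
  "\<And>x :: real => real^'d. bdd_meas a b x ==> continuous_on {a..b} (\<lambda>s. duhamel a Mv x s - x s)"
proof -
 obtain Q V :: "real => real^'d^'d" where ps: "continuous_on {a..b} Q" "continuous_on {a..b} V"
  and inv0: "\<forall>s\<in>{a..b}. Q s ** V s = mat 1"
  and der0: "\<forall>s\<in>{a..b}. (V has_vector_derivative - ((1 / (1 - s)) *\<^sub>R (V s ** Mv s))) (at s within {a..b})"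
  and D0: "\<forall>x. bdd_meas a b x --> (\<forall>s\<in>{a..b}. duhamel a Mv x s
    = x s + Q s *v integral {a..s} (\<lambda>u. (1 / (1 - u)) *\<^sub>R ((V u ** Mv u) *v x u)))"
  using duhamel_separated[OF contM b] by (elim exE conjE) (rule that)
 have D: "duhamel a Mv x s = x s + Q s *v integral {a..s} (\<lambda>u. (1 / (1 - u)) *\<^sub>R ((V u ** Mv u) *v x u))"
  if "bdd_meas a b x" "s \<in> {a..b}" for x s using D0 that by blast
 have bm: "bdd_meas a b (\<lambda>u. (1 / (1 - u)) *\<^sub>R ((V u ** Mv u) *v x u))" if "bdd_meas a b x" for x
  by (rule bdd_meas_hazard[OF bdd_meas_matrix_vector[OF bdd_meas_continuous that] b(1)])
   (intro continuous_intros ps contM)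
 obtain P where P: "0 <= P" "\<And>v. v \<in> {a..b} ==> norm (Q v) <= P" using continuous_on_norm_bound[OF ps(1)] by blast
 have "continuous_on {a..b} (\<lambda>u. (1 / (1 - u)) *\<^sub>R (V u ** Mv u))"
  using b by (intro continuous_intros ps contM) auto
 then obtain X where X: "0 <= X" "\<And>v. v \<in> {a..b} ==> norm ((1 / (1 - v)) *\<^sub>R (V v ** Mv v)) <= X"
  using continuous_on_norm_bound by blast
 show ?thesis
 proof (rule that[of "1 + P * (X * (b - a))"])
  show "1 <= 1 + P * (X * (b - a))" using P X b by simp
  fix x :: "real => real^'d" assume x: "bdd_meas a b x"
  show "norm (duhamel a Mv x s) <= (1 + P * (X * (b - a))) * e"
   if e: "\<And>u. u \<in> {a..b} ==> norm (x u) <= e" and s: "s \<in> {a..b}" for e s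
  proof -
   have e0: "0 <= e" using order_trans[OF norm_ge_zero e[OF s]] .
   have "norm (integral {a..s} (\<lambda>u. (1 / (1 - u)) *\<^sub>R ((V u ** Mv u) *v x u))) <= (X * e) * (s - a)"
   proof (rule norm_integral_le)
    show "(\<lambda>u. (1 / (1 - u)) *\<^sub>R ((V u ** Mv u) *v x u)) integrable_on {a..s}"
     using s by (intro bdd_meas_integrable[OF bm[OF x]]) auto
    fix v assume "v \<in> {a..s}"
    hence v: "v \<in> {a..b}" using s by auto
    have "norm ((1 / (1 - v)) *\<^sub>R ((V v ** Mv v) *v x v)) = norm (((1 / (1 - v)) *\<^sub>R (V v ** Mv v)) *v x v)"
     by (simp only: scaleR_matrix_vector_assoc)
    also have "... <= norm ((1 / (1 - v)) *\<^sub>R (V v ** Mv v)) * norm (x v)" by (rule norm_matrix_vector_le)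
    also have "... <= X * e" by (intro mult_mono X e v) auto
    finally show "norm ((1 / (1 - v)) *\<^sub>R ((V v ** Mv v) *v x v)) <= X * e" .
   qed (use s in auto)
   also have "... <= (X * e) * (b - a)" using s X e0 by (intro mult_left_mono) auto
   finally have I: "norm (integral {a..s} (\<lambda>u. (1 / (1 - u)) *\<^sub>R ((V u ** Mv u) *v x u))) <= X * e * (b - a)" .
   have "norm (duhamel a Mv x s) <= e + P * (X * e * (b - a))"
    unfolding D[OF x s]
   proof (rule norm_triangle_le, rule add_mono[OF e[OF s]])
    let ?J = "integral {a..s} (\<lambda>u. (1 / (1 - u)) *\<^sub>R ((V u ** Mv u) *v x u))"
    have "norm (Q s *v ?J) <= norm (Q s) * norm ?J" by (rule norm_matrix_vector_le)
    also have "... <= P * (X * e * (b - a))" by (rule mult_mono[OF P(2)[OF s] I P(1)]) simp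
    finally show "norm (Q s *v ?J) <= P * (X * e * (b - a))" .
   qed
   thus ?thesis by (simp add: algebra_simps)
  qed
  have "continuous_on {a..b} (\<lambda>s. Q s *v integral {a..s} (\<lambda>u. (1 / (1 - u)) *\<^sub>R ((V u ** Mv u) *v x u)))"
   by (intro continuous_intros ps indefinite_integral_continuous_1 bdd_meas_integrable[OF bm[OF x]]) auto
  thus "continuous_on {a..b} (\<lambda>s. duhamel a Mv x s - x s)"
   by (rule continuous_on_eq) (use D[OF x] in auto)
 qed
qed

text \<open>Variation of constants. \<open>D\<close> is only measurable, so the indefinite integral \<open>I\<close> of \<open>M D dH\<close> need not be
 differentiable; instead \<open>X I - \<integral> X M y dH\<close> has increments of order \<open>(t - s)\<^sup>2\<close>, hence is constant.\<close>

lemma volterra_solution: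
 fixes Mv :: "real => real^'d::finite^'d"
 assumes contM: "continuous_on {a..b} Mv" and b: "b < 1" "a <= b"
  and D: "bdd_meas a b D" and y: "bdd_meas a b y"
  and eq: "\<And>s. s \<in> {a..b} ==> D s = y s + (LINT u:{a..<s}|dH. Mv u *v D u)"
  and s: "s \<in> {a..b}"
 shows "D s = duhamel a Mv y s"
proof -
 obtain P X :: "real => real^'d^'d" where ps: "continuous_on {a..b} P" "continuous_on {a..b} X"
  and inv0: "\<forall>s\<in>{a..b}. P s ** X s = mat 1"
  and der0: "\<forall>s\<in>{a..b}. (X has_vector_derivative - ((1 / (1 - s)) *\<^sub>R (X s ** Mv s))) (at s within {a..b})"
  and D0: "\<forall>x. bdd_meas a b x --> (\<forall>s\<in>{a..b}. duhamel a Mv x s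
    = x s + P s *v integral {a..s} (\<lambda>u. (1 / (1 - u)) *\<^sub>R ((X u ** Mv u) *v x u)))"
  using duhamel_separated[OF contM b] by (elim exE conjE) (rule that)
 have Du: "duhamel a Mv x s = x s + P s *v integral {a..s} (\<lambda>u. (1 / (1 - u)) *\<^sub>R ((X u ** Mv u) *v x u))"
  if "bdd_meas a b x" "s \<in> {a..b}" for x s using D0 that by blast
 define B where "B u = (1 / (1 - u)) *\<^sub>R Mv u" for u
 have contB: "continuous_on {a..b} B" unfolding B_def using b by (intro continuous_intros contM) auto
 have der: "(X has_vector_derivative - (X s ** B s)) (at s within {a..b})" if "s \<in> {a..b}" for s
  using der0[rule_format, OF that] by (simp add: B_def bounded_bilinear.scaleR_right[OF bounded_bilinear_matrix_mult])
 define g where "g u = B u *v D u" for u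
 have bg: "bdd_meas a b g"
  unfolding g_def by (intro bdd_meas_matrix_vector bdd_meas_continuous contB D)
 note intg = bdd_meas_integrable
 define I where "I s = integral {a..s} g" for s
 have eqI: "D s = y s + I s" if "s \<in> {a..b}" for s
 proof -
  have "(LINT u:{a..<s}|dH. Mv u *v D u) = integral {a..s} (\<lambda>u. (1 / (1 - u)) *\<^sub>R (Mv u *v D u))"
   using that b
   by (intro hazard_integral_eq(1)[OF bdd_meas_matrix_vector[OF bdd_meas_continuous[OF contM] D]]) auto
  thus ?thesis using eq[OF that] by (simp add: I_def g_def[abs_def] B_def scaleR_matrix_vector_assoc)
 qed
 have contI: "continuous_on {a..b} I"
  unfolding I_def by (intro indefinite_integral_continuous_1 intg[OF bg]) auto
 define k where "k u = X u *v (B u *v y u)" for u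
 have bk: "bdd_meas a b k" unfolding k_def
  by (intro bdd_meas_matrix_vector bdd_meas_continuous contB y ps)
 define K where "K s = X s *v I s - integral {a..s} k" for s
 obtain G where G: "0 <= G" "\<And>t. t \<in> {a..b} ==> norm (g t) <= G" using bdd_meas_bound[OF bg] by blast
 obtain L where L: "0 <= L" "\<And>t. t \<in> {a..b} ==> norm (X t ** B t) <= L"
  using continuous_on_norm_bound[OF continuous_on_matrix_mult[OF ps(2) contB]] by blast
 define C where "C = 2 * (L * G)"
 have Xilip: "norm (X t - X s) <= L * (t - s)" if "a <= s" "s <= t" "t <= b" for s t
 proof (rule has_vector_derivative_norm_bound[OF that(2)])
  fix v assume v: "v \<in> {s..t}"
  hence "v \<in> {a..b}" using that by auto
  thus "(X has_vector_derivative - (X v ** B v)) (at v within {s..t})" "norm (- (X v ** B v)) <= L"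
   using has_vector_derivative_within_subset[OF der] L that by auto
 qed
 have Iinc: "I t - I s = integral {s..t} g" if "a <= s" "s <= t" "t <= b" for s t
  unfolding I_def using Henstock_Kurzweil_Integration.integral_combine[OF that(1,2) intg[OF bg]] that by (simp add: algebra_simps)
 have Ilip: "norm (I t - I s) <= G * (t - s)" if "a <= s" "s <= t" "t <= b" for s t
  unfolding Iinc[OF that] by (rule norm_integral_le[OF intg[OF bg]]) (use that G in auto)
 have Kinc: "norm (K t - K s) <= C * (t - s) * (t - s)" if st: "a <= s" "s <= t" "t <= b" for s t
 proof -
  have st': "s \<in> {a..b}" "t \<in> {a..b}" using st by auto
  have bXg: "bdd_meas a b (\<lambda>v. X v *v g v)"
   by (intro bdd_meas_matrix_vector bdd_meas_continuous ps bg)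
  have cXI: "continuous_on {a..b} (\<lambda>v. (X v ** B v) *v I v)"
   by (intro continuous_intros ps contB contI)
  have cXs: "continuous_on {a..b} (\<lambda>v. (X v ** B v) *v I s)"
   by (intro continuous_intros ps contB)
  note i1 = intg[OF bXg st(1,3)] and i2 = intg[OF bdd_meas_continuous[OF cXI] st(1,3)]
   and i3 = intg[OF bdd_meas_continuous[OF cXs] st(1,3)] and i0 = intg[OF bg st(1,3)]
  have kk: "integral {a..t} k - integral {a..s} k = integral {s..t} k"
   using Henstock_Kurzweil_Integration.integral_combine[OF st(1,2) intg[OF bk]] st by (simp add: algebra_simps)
  have "integral {s..t} k = integral {s..t} (\<lambda>v. X v *v g v - (X v ** B v) *v I v)"
   using st eqI by (intro integral_cong)
    (auto simp: k_def g_def matrix_vector_right_distrib matrix_vector_mul_assoc)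
  also have "... = integral {s..t} (\<lambda>v. X v *v g v) - integral {s..t} (\<lambda>v. (X v ** B v) *v I v)"
   by (rule integral_diff[OF i1 i2])
  finally have k2: "integral {s..t} k = integral {s..t} (\<lambda>v. X v *v g v) - integral {s..t} (\<lambda>v. (X v ** B v) *v I v)" .
  have X1: "X t *v integral {s..t} g = integral {s..t} (\<lambda>v. X t *v g v)"
   by (rule integral_linear[OF i0 matrix_vector_mul_bounded_linear, unfolded o_def, symmetric])
  have bt: "(\<lambda>v. X t *v g v) integrable_on {s..t}"
   using integrable_linear[OF i0 matrix_vector_mul_bounded_linear] by (simp add: o_def)
  have "((\<lambda>v. - (X v ** B v)) has_integral (X t - X s)) {s..t}"
   using st by (intro fundamental_theorem_of_calculus)
    (auto intro!: has_vector_derivative_within_subset[OF der])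
  from has_integral_linear[OF this bounded_bilinear.bounded_linear_left[OF bounded_bilinear_matrix_vector, of "I s"]]
  have "((\<lambda>v. (- (X v ** B v)) *v I s) has_integral (X t - X s) *v I s) {s..t}" by (simp add: o_def)
  from integral_unique[OF this] have X2: "(X t - X s) *v I s = - integral {s..t} (\<lambda>v. (X v ** B v) *v I s)"
   by (simp add: bounded_bilinear.minus_left[OF bounded_bilinear_matrix_vector])
  have "K t - K s = X t *v (I t - I s) + (X t - X s) *v I s - integral {s..t} k"
   by (simp add: K_def kk[symmetric] matrix_vector_mult_diff_distrib
     bounded_bilinear.diff_left[OF bounded_bilinear_matrix_vector])
  also have "... = integral {s..t} (\<lambda>v. X t *v g v - X v *v g v)
    + integral {s..t} (\<lambda>v. (X v ** B v) *v I v - (X v ** B v) *v I s)"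
   by (simp add: Iinc[OF st] X1 X2 k2 integral_diff[OF bt i1] integral_diff[OF i2 i3])
  also have "norm ... <= (L * (t - s) * G) * (t - s) + (L * (G * (t - s))) * (t - s)"
  proof (rule norm_triangle_le, rule add_mono)
   show "norm (integral {s..t} (\<lambda>v. X t *v g v - X v *v g v)) <= (L * (t - s) * G) * (t - s)"
   proof (rule norm_integral_le[OF integrable_diff[OF bt i1] st(2)])
    fix v assume v: "v \<in> {s..t}"
    have "norm (X t *v g v - X v *v g v) = norm ((X t - X v) *v g v)"
     by (simp add: bounded_bilinear.diff_left[OF bounded_bilinear_matrix_vector])
    also have "... <= norm (X t - X v) * norm (g v)" by (rule norm_matrix_vector_le)
    also have "... <= (L * (t - s)) * G"
     using v st G L by (intro mult_mono order_trans[OF Xilip]) (auto intro!: mult_left_mono)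
    finally show "norm (X t *v g v - X v *v g v) <= L * (t - s) * G" .
   qed
   show "norm (integral {s..t} (\<lambda>v. (X v ** B v) *v I v - (X v ** B v) *v I s)) <= (L * (G * (t - s))) * (t - s)"
   proof (rule norm_integral_le[OF integrable_diff[OF i2 i3] st(2)])
    fix v assume v: "v \<in> {s..t}"
    have "norm ((X v ** B v) *v I v - (X v ** B v) *v I s) = norm ((X v ** B v) *v (I v - I s))"
     by (simp add: matrix_vector_mult_diff_distrib)
    also have "... <= norm (X v ** B v) * norm (I v - I s)" by (rule norm_matrix_vector_le)
    also have "... <= L * (G * (t - s))"
     using v st G L by (intro mult_mono order_trans[OF Ilip]) (auto intro!: mult_left_mono)
    finally show "norm ((X v ** B v) *v I v - (X v ** B v) *v I s) <= L * (G * (t - s))" .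
   qed
  qed
  also have "... = C * (t - s) * (t - s)" by (simp add: C_def algebra_simps)
  finally show ?thesis .
 qed
 have "(K has_derivative (\<lambda>h. 0)) (at s within {a..b})" if s: "s \<in> {a..b}" for s
  unfolding has_derivative_within_alt
 proof (intro conjI allI impI bounded_linear_zero)
  fix e :: real assume e: "0 < e"
  have C0: "0 <= C" using L G by (simp add: C_def)
  show "\<exists>d>0. \<forall>y\<in>{a..b}. norm (y - s) < d --> norm (K y - K s - 0) <= e * norm (y - s)"
  proof (intro exI[of _ "e / (C + 1)"] conjI ballI impI)
   fix t assume t: "t \<in> {a..b}" "norm (t - s) < e / (C + 1)"
   have "norm (K t - K s) <= C * \<bar>t - s\<bar> * \<bar>t - s\<bar>"
   proof (cases "s <= t")
    case True thus ?thesis using Kinc[of s t] s t by simp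
   next
    case False thus ?thesis using Kinc[of t s] s t by (simp add: norm_minus_commute)
   qed
   also have "... <= e * \<bar>t - s\<bar>"
   proof (rule mult_right_mono)
    have "C * \<bar>t - s\<bar> <= (C + 1) * \<bar>t - s\<bar>" by (simp add: distrib_right)
    also have "... <= e" using t(2) C0 by (simp add: field_simps)
    finally show "C * \<bar>t - s\<bar> <= e" .
   qed auto
   finally show "norm (K t - K s - 0) <= e * norm (t - s)" by simp
  qed (use e C0 in auto)
 qed
 then obtain c where c: "\<And>s. s \<in> {a..b} ==> K s = c"
  using has_derivative_zero_constant[of "{a..b}" K] by auto
 have "K a = 0" by (simp add: K_def I_def)
 hence K0: "K s = 0" using c[of a] c[OF s] b by simp
 have "I s = P s *v (X s *v I s)" by (simp add: matrix_vector_mul_assoc inv0[rule_format, OF s])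
 also have "X s *v I s = integral {a..s} k" using K0 by (simp add: K_def)
 also have "... = integral {a..s} (\<lambda>u. (1 / (1 - u)) *\<^sub>R ((X u ** Mv u) *v y u))"
  by (simp add: k_def[abs_def] B_def matrix_vector_mul_assoc matrix_vector_mult_scaleR
    scaleR_matrix_vector_assoc[symmetric])
 finally show ?thesis using eqI[OF s] Du[OF y s] by simp
qed
section \<open>Right-continuous paths with left limits\<close>

lemma infnorm_le_iff: "infnorm (v :: real^'d::finite) <= r \<longleftrightarrow> (\<forall>i. \<bar>v $ i\<bar> <= r)"
proof
 assume "\<forall>i. \<bar>v $ i\<bar> <= r"
 thus "infnorm v <= r" unfolding infnorm_cart by (intro cSup_least) auto
qed (use component_le_infnorm_cart order_trans in blast)

lemma cadlag_right_limit: "x \<in> cadlag a b ==> t \<in> {a..<b} ==> (x \<longlongrightarrow> x t) (at_right t)"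
 by (simp add: cadlag_def)

lemma cadlag_left_limit: "x \<in> cadlag a b ==> t \<in> {a<..b} ==> \<exists>l. (x \<longlongrightarrow> l) (at_left t)"
 by (simp add: cadlag_def)

lemma continuous_imp_cadlag: "continuous_on {a..b} x ==> x \<in> cadlag a b"
proof -
 assume c: "continuous_on {a..b} x"
 have r: "(x \<longlongrightarrow> x t) (at_right t)" if "t \<in> {a..<b}" for t
 proof -
  have "continuous (at t within {t..b}) x"
   using that by (intro continuous_within_subset[OF c[unfolded continuous_on_eq_continuous_within, rule_format, of t]]) auto
  thus ?thesis using that
   by (simp add: continuous_within at_within_Icc_at_right)
 qed
 have l: "(x \<longlongrightarrow> x t) (at_left t)" if "t \<in> {a<..b}" for t
 proof -
  have "continuous (at t within {a..t}) x"
   using that by (intro continuous_within_subset[OF c[unfolded continuous_on_eq_continuous_within, rule_format, of t]]) auto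
  thus ?thesis using that
   by (simp add: continuous_within at_within_Icc_at_left)
 qed
 show ?thesis using r l unfolding cadlag_def by blast
qed

lemma cadlag_bilinear:
 fixes h :: "'x::euclidean_space => real^'d::finite => real^'e::finite"
 assumes h: "bounded_bilinear h" and A: "continuous_on {a..b} A" and x: "x \<in> cadlag a b"
 shows "(\<lambda>t. h (A t) (x t)) \<in> cadlag a b"
proof -
 have r: "((\<lambda>t. h (A t) (x t)) \<longlongrightarrow> h (A t) (x t)) (at_right t)" if "t \<in> {a..<b}" for t
 proof (rule bounded_bilinear.tendsto[OF h])
  have "continuous (at t within {t..b}) A"
   using that by (intro continuous_within_subset[OF A[unfolded continuous_on_eq_continuous_within, rule_format, of t]]) auto
  thus "(A \<longlongrightarrow> A t) (at_right t)" using that by (simp add: continuous_within at_within_Icc_at_right)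
  show "(x \<longlongrightarrow> x t) (at_right t)" using x that by (simp add: cadlag_def)
 qed
 have l: "\<exists>l. ((\<lambda>t. h (A t) (x t)) \<longlongrightarrow> l) (at_left t)" if t: "t \<in> {a<..b}" for t
 proof -
  have "continuous (at t within {a..t}) A"
   using that by (intro continuous_within_subset[OF A[unfolded continuous_on_eq_continuous_within, rule_format, of t]]) auto
  hence "(A \<longlongrightarrow> A t) (at_left t)" using that by (simp add: continuous_within at_within_Icc_at_left)
  moreover obtain l where "(x \<longlongrightarrow> l) (at_left t)" using cadlag_left_limit[OF x t] by blast
  ultimately show ?thesis using bounded_bilinear.tendsto[OF h] by blast
 qed
 show ?thesis using r l unfolding cadlag_def by blast
qed

lemma cadlag_add:
 assumes "x \<in> cadlag a b" "y \<in> cadlag a b" shows "(\<lambda>t. x t + y t) \<in> cadlag a b"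
proof -
 have r: "((\<lambda>t. x t + y t) \<longlongrightarrow> x t + y t) (at_right t)" if "t \<in> {a..<b}" for t
  using assms that by (intro tendsto_add cadlag_right_limit) auto
 have l: "\<exists>l. ((\<lambda>t. x t + y t) \<longlongrightarrow> l) (at_left t)" if t: "t \<in> {a<..b}" for t
 proof -
  obtain l k where "(x \<longlongrightarrow> l) (at_left t)" "(y \<longlongrightarrow> k) (at_left t)"
   using cadlag_left_limit[OF assms(1) t] cadlag_left_limit[OF assms(2) t] by blast
  thus ?thesis using tendsto_add by blast
 qed
 show ?thesis using r l unfolding cadlag_def by blast
qed

lemma cadlag_scaleR:
 assumes "x \<in> cadlag a b" shows "(\<lambda>t. c *\<^sub>R x t) \<in> cadlag a b"
 by (rule cadlag_bilinear[OF bounded_bilinear_scaleR _ assms]) auto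

lemma cadlag_diff:
 assumes "x \<in> cadlag a b" "y \<in> cadlag a b" shows "(\<lambda>t. x t - y t) \<in> cadlag a b"
 using cadlag_add[OF assms(1) cadlag_scaleR[OF assms(2), of "-1"]] by simp

lemma cadlag_bounded:
 assumes x: "x \<in> cadlag a b" and ab: "a <= b"
 shows "bounded (x ` {a..b})"
proof -
 have "bounded (x ` ({a..b} \<inter> {a..b}))"
 proof (rule Bolzano[OF ab, where P="\<lambda>u v. bounded (x ` ({u..v} \<inter> {a..b}))"])
  fix u v w assume "bounded (x ` ({u..v} \<inter> {a..b}))" "bounded (x ` ({v..w} \<inter> {a..b}))" "u <= v" "v <= w"
  moreover from this have "{u..w} \<inter> {a..b} = ({u..v} \<inter> {a..b}) \<union> ({v..w} \<inter> {a..b})" by auto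
  ultimately show "bounded (x ` ({u..w} \<inter> {a..b}))" by (simp add: image_Un)
 next
  fix t assume t: "a <= t" "t <= b"
  have "\<exists>d>0. \<forall>s\<in>{t<..<t+d} \<inter> {a..b}. norm (x s) <= norm (x t) + 1"
  proof (cases "t < b")
   case True
   hence "(x \<longlongrightarrow> x t) (at_right t)" using x t by (simp add: cadlag_def)
   hence "\<forall>\<^sub>F s in at_right t. dist (x s) (x t) < 1" by (rule tendstoD) simp
   then obtain d where d: "d > t" "\<And>s. t < s ==> s < d ==> dist (x s) (x t) < 1"
    by (auto simp: eventually_at_right_field)
   have "norm (x s) <= norm (x t) + 1" if "t < s" "s < d" for s
    using d(2)[OF that] norm_triangle_ineq2[of "x s" "x t"] by (simp add: dist_norm)
   thus ?thesis using d(1) by (intro exI[of _ "d - t"]) auto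
  qed (auto intro!: exI[of _ 1])
  then obtain d1 where d1: "d1 > 0" "\<And>s. s \<in> {t<..<t+d1} \<inter> {a..b} ==> norm (x s) <= norm (x t) + 1" by blast
  have "\<exists>d>0. \<exists>B. \<forall>s\<in>{t-d<..<t} \<inter> {a..b}. norm (x s) <= B"
  proof (cases "a < t")
   case True
   then obtain l where "(x \<longlongrightarrow> l) (at_left t)" using cadlag_left_limit[OF x, of t] t by auto
   hence "\<forall>\<^sub>F s in at_left t. dist (x s) l < 1" by (rule tendstoD) simp
   then obtain d where d: "d < t" "\<And>s. d < s ==> s < t ==> dist (x s) l < 1"
    by (auto simp: eventually_at_left_field)
   have "norm (x s) <= norm l + 1" if "d < s" "s < t" for s
    using d(2)[OF that] norm_triangle_ineq2[of "x s" l] by (simp add: dist_norm)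
   thus ?thesis using d(1) by (intro exI[of _ "t - d"] conjI exI[of _ "norm l + 1"]) auto
  qed (auto intro!: exI[of _ 1])
  then obtain d2 B where d2: "d2 > 0" "\<And>s. s \<in> {t-d2<..<t} \<inter> {a..b} ==> norm (x s) <= B" by blast
  show "\<exists>d>0. \<forall>u v. u <= t \<and> t <= v \<and> v - u < d --> bounded (x ` ({u..v} \<inter> {a..b}))"
  proof (intro exI[of _ "min d1 d2"] conjI allI impI)
   fix u v assume uv: "u <= t \<and> t <= v \<and> v - u < min d1 d2"
   have "norm (x s) <= max B (norm (x t) + 1)" if s: "s \<in> {u..v} \<inter> {a..b}" for s
   proof (cases s t rule: linorder_cases)
    case less thus ?thesis using d2(2)[of s] s uv by auto
   next
    case greater thus ?thesis using d1(2)[of s] s uv by auto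
   qed auto
   thus "bounded (x ` ({u..v} \<inter> {a..b}))" unfolding bounded_iff by blast
  qed (use d1 d2 in auto)
 qed
 thus ?thesis by simp
qed

text \<open>Approximation of \<open>s\<close> from the right by multiples of \<open>1 / (m + 1)\<close>, cut off at \<open>b\<close>. Right-continuous
 paths are the limits of their values at these countably many points.\<close>

definition round_right :: "real => nat => real => real" where
 "round_right b m s = min b ((of_int \<lfloor>real (Suc m) * s\<rfloor> + 1) / real (Suc m))"

lemma round_right:
 assumes "s \<in> {a..b}"
 shows "s <= round_right b m s" "round_right b m s <= b" "round_right b m s - s <= 1 / real (Suc m)"
  "s < b ==> s < round_right b m s" "round_right b m s \<in> {a..b} \<inter> (\<rat> \<union> {b})"
proof -
 have *: "s < (of_int \<lfloor>real (Suc m) * s\<rfloor> + 1) / real (Suc m)"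
  by (simp add: pos_less_divide_eq mult.commute del: of_nat_Suc) (simp add: floor_correct del: of_nat_Suc)?
 have **: "(of_int \<lfloor>real (Suc m) * s\<rfloor> + 1) / real (Suc m) <= s + 1 / real (Suc m)"
 proof -
  have "of_int \<lfloor>real (Suc m) * s\<rfloor> / real (Suc m) <= real (Suc m) * s / real (Suc m)"
   by (intro divide_right_mono of_int_floor_le) auto
  thus ?thesis by (simp add: add_divide_distrib del: of_nat_Suc)
 qed
 show "s <= round_right b m s" "round_right b m s <= b" "s < b ==> s < round_right b m s"
  using * assms by (auto simp: round_right_def less_imp_le)
 show "round_right b m s - s <= 1 / real (Suc m)"
  using ** unfolding round_right_def by linarith
 have "(of_int \<lfloor>real (Suc m) * s\<rfloor> + 1) / real (Suc m) \<in> \<rat>" by (intro Rats_divide Rats_add) auto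
 thus "round_right b m s \<in> {a..b} \<inter> (\<rat> \<union> {b})"
  using * assms unfolding round_right_def min_def by auto
qed

lemma round_right_tendsto:
 assumes "s \<in> {a..b}"
 shows "(\<lambda>m. round_right b m s) \<longlonglongrightarrow> s"
proof (rule real_tendsto_sandwich[where f="\<lambda>_. s" and h="\<lambda>m. s + 1 / real (Suc m)"])
 show "(\<lambda>m. s + 1 / real (Suc m)) \<longlonglongrightarrow> s"
  using tendsto_add[OF tendsto_const LIMSEQ_inverse_real_of_nat, of s] by (simp add: divide_inverse)
 show "\<forall>\<^sub>F m in sequentially. round_right b m s <= s + 1 / real (Suc m)"
  using round_right(3)[OF assms] by (intro always_eventually allI) (simp add: algebra_simps)
qed (use round_right(1)[OF assms] in auto)

lemma cadlag_round_right:
 assumes x: "x \<in> cadlag a b" and s: "s \<in> {a..b}"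
 shows "(\<lambda>m. x (round_right b m s)) \<longlonglongrightarrow> x s"
proof (cases "s < b")
 case True
 have "filterlim (\<lambda>m. round_right b m s) (at_right s) sequentially"
  unfolding filterlim_at using round_right_tendsto[OF s] round_right(4)[OF s True]
  by (auto intro!: always_eventually simp: less_imp_neq[THEN not_sym])
 thus ?thesis using filterlim_compose[OF cadlag_right_limit[OF x]] True s by auto
next
 case False
 hence "round_right b m s = s" for m using round_right(1,2)[OF s, of m] s by auto
 thus ?thesis by simp
qed

lemma cadlag_le_if_dense:
 assumes x: "x \<in> cadlag a b" and le: "\<And>s. s \<in> {a..b} \<inter> (\<rat> \<union> {b}) ==> infnorm (x s) <= r" and s: "s \<in> {a..b}"
 shows "infnorm (x s) <= r"
proof (rule tendsto_upperbound[OF tendsto_infnorm[OF cadlag_round_right[OF x s]]])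
 show "\<forall>\<^sub>F m in sequentially. infnorm (x (round_right b m s)) <= r"
  using round_right(5)[OF s] le by (intro always_eventually allI) blast
qed simp

lemma countable_dense: "countable ({a..b} \<inter> (\<rat> \<union> {b :: real}))"
 by (intro countable_Int2) (simp add: countable_rat)

lemma cadlag_bounded_measurable:
 assumes x: "x \<in> cadlag a b" and ab: "a <= b"
 shows "bdd_meas a b x"
proof -
 have "x \<in> borel_measurable (restrict_space borel {a..b})"
 proof (rule borel_measurable_LIMSEQ_metric)
  fix m
  show "(\<lambda>s. x (round_right b m s)) \<in> borel_measurable (restrict_space borel {a..b})"
   unfolding round_right_def
   by (rule measurable_restrict_space1)
    (rule measurable_compose_countable[where g="\<lambda>s. \<lfloor>real (Suc m) * s\<rfloor>"], auto simp del: of_nat_Suc)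
 next
  fix s assume "s \<in> space (restrict_space borel {a..b})"
  thus "(\<lambda>m. x (round_right b m s)) \<longlonglongrightarrow> x s"
   using cadlag_round_right[OF x] by (simp add: space_restrict_space)
 qed
 thus ?thesis using cadlag_bounded[OF assms] by (simp add: bdd_meas_def)
qed

lemma bdd_above_infnorm:
 assumes "bounded (x ` {a..b})"
 shows "bdd_above ((\<lambda>s. infnorm (x s)) ` {a..b})"
proof -
 from assms obtain B where "\<forall>y\<in>x ` {a..b}. norm y <= B" unfolding bounded_iff by blast
 hence "\<And>s. s \<in> {a..b} ==> norm (x s) <= B" by blast
 thus ?thesis by (intro bdd_aboveI[of _ B]) (auto intro: order_trans[OF infnorm_le_norm])
qed

lemma sup_dist_ge:
 assumes "x \<in> cadlag a b" "y \<in> cadlag a b" "s \<in> {a..b}"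
 shows "infnorm (x s - y s) <= sup_dist a b x y"
proof -
 have "a <= b" using assms by auto
 thus ?thesis
  unfolding sup_dist_def using bdd_above_infnorm[OF cadlag_bounded[OF cadlag_diff[OF assms(1,2)]]]
  by (intro cSUP_upper assms)
qed

lemma sup_dist_le:
 assumes "a <= b" "\<And>s. s \<in> {a..b} ==> infnorm (x s - y s) <= r"
 shows "sup_dist a b x y <= r"
 unfolding sup_dist_def using assms by (intro cSUP_least) auto

lemma sup_dist_triangle:
 assumes "a <= b" "x \<in> cadlag a b" "y \<in> cadlag a b" "z \<in> cadlag a b"
 shows "sup_dist a b x z <= sup_dist a b x y + sup_dist a b y z"
proof (rule sup_dist_le[OF assms(1)])
 fix s assume s: "s \<in> {a..b}"
 have "infnorm (x s - z s) <= infnorm (x s - y s) + infnorm (y s - z s)"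
  using infnorm_triangle[of "x s - y s" "y s - z s"] by simp
 thus "infnorm (x s - z s) <= sup_dist a b x y + sup_dist a b y z"
  using sup_dist_ge[OF assms(2,3) s] sup_dist_ge[OF assms(3,4) s] by linarith
qed

lemma sup_dist_commute: "sup_dist a b x y = sup_dist a b y x"
 unfolding sup_dist_def by (simp add: infnorm_sub)

lemma space_ball_algebra: "space (ball_algebra a b) = cadlag a b"
 unfolding ball_algebra_def by (rule space_measure_of) auto

lemma ball_in_ball_algebra:
 "x \<in> cadlag a b ==> 0 < r ==> {y \<in> cadlag a b. sup_dist a b x y < r} \<in> sets (ball_algebra a b)"
 unfolding ball_algebra_def by (subst sets_measure_of) (auto intro!: sigma_sets.Basic)

text \<open>Every coordinate is measurable: the half space \<open>{x. x(s) $ i > v}\<close> is the union of the balls of radius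
 \<open>n\<close> around \<open>v + n 1\<^bsub>[s, s + 1/n)\<^esub>\<close> in coordinate \<open>i\<close>, since paths are bounded and right-continuous.\<close>

lemma coordinate_measurable:
 fixes s :: real
 assumes s: "s \<in> {a..b}"
 shows "(\<lambda>x :: real => real^'d::finite. x s) \<in> borel_measurable (ball_algebra a b)"
proof -
 have ab: "a <= b" using s by auto
 have "(\<lambda>x :: real => real^'d. x s $ i) \<in> borel_measurable (ball_algebra a b)" for i
 proof (rule borel_measurableI_greater, unfold space_ball_algebra)
  fix v :: real
  define z where "z n t = (v + (if s <= t \<and> t < s + 1 / real (Suc n) then real (Suc n) else 0)) *\<^sub>R (axis i 1 :: real^'d)" for n t
  have z: "z n \<in> cadlag a b" for n
  proof -
   let ?e = "s + 1 / real (Suc n)"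
   have e: "s < ?e" by simp
   have right: "\<forall>\<^sub>F u in at_right t. z n u = z n t" for t
   proof (cases "t < s")
    case True
    hence "\<forall>\<^sub>F u in at_right t. u < s" by (simp add: eventually_at_right_field) (use dense in blast)
    thus ?thesis using True by (auto simp: z_def elim: eventually_mono)
   next
    case False
    show ?thesis
    proof (cases "t < ?e")
     case True
     hence "\<forall>\<^sub>F u in at_right t. u < ?e \<and> t < u"
      by (auto simp: eventually_at_right_field intro!: exI[of _ ?e])
     thus ?thesis using True False by (auto simp: z_def elim!: eventually_mono)
    next
     case False
     hence "\<forall>\<^sub>F u in at_right t. t < u" by (auto simp: eventually_at_right_field intro!: exI[of _ "t + 1"])
     thus ?thesis using False by (auto simp: z_def elim!: eventually_mono)
    qed
   qed
   have left: "\<exists>l. \<forall>\<^sub>F u in at_left t. z n u = l" for t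
   proof (cases "t <= s")
    case True
    have "\<forall>\<^sub>F u in at_left t. u < t" by (auto simp: eventually_at_left_field intro!: exI[of _ "t - 1"])
    hence "\<forall>\<^sub>F u in at_left t. z n u = v *\<^sub>R axis i 1" using True by (auto simp: z_def elim!: eventually_mono)
    thus ?thesis by blast
   next
    case False
    show ?thesis
    proof (cases "t <= ?e")
     case True
     have "\<forall>\<^sub>F u in at_left t. s < u \<and> u < t" using False by (auto simp: eventually_at_left_field intro!: exI[of _ s])
     hence "\<forall>\<^sub>F u in at_left t. z n u = (v + real (Suc n)) *\<^sub>R axis i 1"
      using True by (auto simp: z_def elim!: eventually_mono)
     thus ?thesis by blast
    next
     case False
     hence "\<forall>\<^sub>F u in at_left t. ?e < u" by (auto simp: eventually_at_left_field intro!: exI[of _ ?e])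
     hence "\<forall>\<^sub>F u in at_left t. z n u = v *\<^sub>R axis i 1" by (auto simp: z_def elim!: eventually_mono)
     thus ?thesis by blast
    qed
   qed
   have "(z n \<longlongrightarrow> z n t) (at_right t)" for t
    by (rule tendsto_eventually[OF right])
   moreover have "\<exists>l. (z n \<longlongrightarrow> l) (at_left t)" for t
    using left[of t] tendsto_eventually by blast
   ultimately show ?thesis unfolding cadlag_def by blast
  qed
  have zi: "z n t $ i = v + (if s <= t \<and> t < s + 1 / real (Suc n) then real (Suc n) else 0)" for n t
   by (simp add: z_def axis_def)
  have zj: "z n t $ j = 0" if "j \<noteq> i" for n t j using that by (simp add: z_def axis_def)
  have "{x \<in> cadlag a b. v < x s $ i} = (\<Union>n. {y \<in> cadlag a b. sup_dist a b (z n) y < real (Suc n)})"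
  proof (intro set_eqI iffI)
   fix x :: "real => real^'d" assume "x \<in> {x \<in> cadlag a b. v < x s $ i}"
   hence x: "x \<in> cadlag a b" "v < x s $ i" by auto
   obtain B where B0: "\<forall>y\<in>x ` {a..b}. norm y <= B" "0 < B"
    using cadlag_bounded[OF x(1) ab] unfolding bounded_pos by blast
   hence B: "\<And>t. t \<in> {a..b} ==> norm (x t) <= B" "0 < B" by auto
   have Bc: "\<bar>x t $ j\<bar> <= B" if "t \<in> {a..b}" for t j
    using B(1)[OF that] component_le_norm_cart[of "x t" j] by linarith
   define h where "h = min 1 ((x s $ i - v) / 2)"
   have h: "0 < h" "h <= 1" "v + h < x s $ i"
    unfolding h_def using x(2) by (auto simp: min_def field_simps)
   obtain d where d: "d > 0" "\<And>t. t \<in> {a..b} ==> s <= t ==> t < s + d ==> v + h < x t $ i"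
   proof (cases "s < b")
    case True
    have "((\<lambda>t. x t $ i) \<longlongrightarrow> x s $ i) (at_right s)"
     using cadlag_right_limit[OF x(1)] True s by (intro tendsto_vec_nth) auto
    hence "\<forall>\<^sub>F t in at_right s. v + h < x t $ i" using h(3) by (rule order_tendstoD)
    then obtain e where "e > s" "\<And>t. s < t ==> t < e ==> v + h < x t $ i"
     by (auto simp: eventually_at_right_field)
    thus ?thesis using that[of "e - s"] h(3) by (auto simp: le_less)
   next
    case False
    thus ?thesis using that[of 1] s h(3) by (metis atLeastAtMost_iff dual_order.antisym not_less order_trans zero_less_one)
   qed
   obtain n0 :: nat where n0: "B + \<bar>v\<bar> + 1 + 1 / d < real n0" using reals_Archimedean2 by blast
   let ?n = "real (Suc n0)"
   have n: "B + \<bar>v\<bar> + 1 < ?n" "1 / ?n < d"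
   proof -
    have "0 < 1 / d" using d by simp
    thus "B + \<bar>v\<bar> + 1 < ?n" using n0 of_nat_Suc[of n0, where 'a=real] by linarith
    have "1 / d < ?n" using n0 B(2) abs_ge_zero[of v] of_nat_Suc[of n0, where 'a=real] by linarith
    thus "1 / ?n < d" using d(1) by (simp add: field_simps del: of_nat_Suc)
   qed
   have "sup_dist a b (z n0) x <= ?n - h"
   proof (rule sup_dist_le[OF ab], unfold infnorm_le_iff, rule allI)
    fix t j assume t: "t \<in> {a..b}"
    show "\<bar>(z n0 t - x t) $ j\<bar> <= ?n - h"
    proof (cases "j = i")
     case False
     thus ?thesis using Bc[OF t, of j] n h zj[of j n0 t] by (simp del: of_nat_Suc)
    next
     case True
     show ?thesis
     proof (cases "s <= t \<and> t < s + 1 / ?n")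
      case c: True
      hence "v + h < x t $ i" using d(2)[OF t] n(2) by auto
      thus ?thesis using True c zi[of n0 t] Bc[OF t, of i] n h by (simp add: abs_if split: if_splits del: of_nat_Suc)
     next
      case c: False
      thus ?thesis using True zi[of n0 t] Bc[OF t, of i] n h by (auto simp: abs_if split: if_splits simp del: of_nat_Suc)
     qed
    qed
   qed
   thus "x \<in> (\<Union>n. {y \<in> cadlag a b. sup_dist a b (z n) y < real (Suc n)})"
    using x h by (auto intro!: exI[of _ n0] simp del: of_nat_Suc)
  next
   fix x :: "real => real^'d" assume "x \<in> (\<Union>n. {y \<in> cadlag a b. sup_dist a b (z n) y < real (Suc n)})"
   then obtain n where x: "x \<in> cadlag a b" "sup_dist a b (z n) x < real (Suc n)" by auto
   have "\<bar>(z n s - x s) $ i\<bar> <= infnorm (z n s - x s)" by (rule component_le_infnorm_cart)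
   also have "... < real (Suc n)" using sup_dist_ge[OF z x(1) s, of n] x(2) by linarith
   finally have "v < x s $ i" using zi[of n s] by (simp add: abs_if split: if_splits del: of_nat_Suc)
   thus "x \<in> {x \<in> cadlag a b. v < x s $ i}" using x by simp
  qed
  moreover have "(\<Union>n. {y \<in> cadlag a b. sup_dist a b (z n) y < real (Suc n)}) \<in> sets (ball_algebra a b)"
   by (intro sets.countable_UN) (auto intro!: ball_in_ball_algebra z simp del: of_nat_Suc)
  ultimately show "{x \<in> cadlag a b. v < x s $ i} \<in> sets (ball_algebra a b)" by simp
 qed
 thus ?thesis
  by (subst borel_measurable_euclidean_space) (auto simp: Basis_vec_def inner_axis)
qed

text \<open>A ball is cut out by its coordinates at the rationals and at \<open>b\<close>, so that coordinatewise measurability suffices.\<close>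

lemma measurable_ball_algebraI:
 fixes W :: "'w => real => real^'d::finite"
 assumes ab: "a <= b" and W: "\<And>z. z \<in> space N ==> W z \<in> cadlag a b"
  and meas: "\<And>s. s \<in> {a..b} ==> (\<lambda>z. W z s) \<in> borel_measurable N"
 shows "W \<in> N \<rightarrow>\<^sub>M ball_algebra a b"
 unfolding ball_algebra_def
proof (rule measurable_measure_of)
 let ?Q = "{a..b} \<inter> (\<rat> \<union> {b})"
 have meas_inf: "(\<lambda>z. infnorm (x s - W z s)) \<in> borel_measurable N" if "s \<in> {a..b}" for s and x :: "real => real^'d"
  by (intro borel_measurable_continuous_on[of infnorm] borel_measurable_diff meas that borel_measurable_const
    continuous_on_infnorm) auto
 fix A :: "(real => real^'d) set" assume "A \<in> {{y \<in> cadlag a b. sup_dist a b x y < r} |x r. x \<in> cadlag a b \<and> 0 < r}"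
 then obtain x :: "real => real^'d" and r where A: "A = {y \<in> cadlag a b. sup_dist a b x y < r}" and x: "x \<in> cadlag a b" and r: "0 < r" by auto
 have iff: "sup_dist a b x y < r \<longleftrightarrow> (\<exists>k::nat. \<forall>s\<in>?Q. infnorm (x s - y s) <= r - 1 / real (Suc k))"
  if y: "y \<in> cadlag a b" for y
 proof
  assume l: "sup_dist a b x y < r"
  then obtain k where k: "1 / real (Suc k) < r - sup_dist a b x y" using nat_approx_posE[of "r - sup_dist a b x y"] by auto
  have "infnorm (x s - y s) <= r - 1 / real (Suc k)" if "s \<in> ?Q" for s
   using sup_dist_ge[OF x y, of s] that k by (simp del: of_nat_Suc)
  thus "\<exists>k::nat. \<forall>s\<in>?Q. infnorm (x s - y s) <= r - 1 / real (Suc k)" by blast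
 next
  assume "\<exists>k::nat. \<forall>s\<in>?Q. infnorm (x s - y s) <= r - 1 / real (Suc k)"
  then obtain k where k: "\<forall>s\<in>?Q. infnorm (x s - y s) <= r - 1 / real (Suc k)" by blast
  have "sup_dist a b x y <= r - 1 / real (Suc k)"
   by (rule sup_dist_le[OF ab], rule cadlag_le_if_dense[OF cadlag_diff[OF x y]]) (use k in auto)
  moreover have "0 < 1 / real (Suc k)" by simp
  ultimately show "sup_dist a b x y < r" by linarith
 qed
 have "W -` A \<inter> space N = {z \<in> space N. \<exists>k::nat. \<forall>s\<in>?Q. infnorm (x s - W z s) <= r - 1 / real (Suc k)}"
  using iff W by (auto simp: A)
 also have "... \<in> sets N"
 proof (intro sets.sets_Collect_countable_Ex sets.sets_Collect_countable_All' countable_dense)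
  fix k :: nat and s assume "s \<in> ?Q"
  thus "{z \<in> space N. infnorm (x s - W z s) <= r - 1 / real (Suc k)} \<in> sets N"
   using meas_inf[of s x] by (intro borel_measurable_le) auto
 qed
 finally show "W -` A \<inter> space N \<in> sets N" .
qed (use W in auto)
section \<open>Outer probabilities and outer expectations\<close>

definition outer_prob :: "'a measure => 'a set => real" where
 "outer_prob M A = enn2real (outer_measure_of M A)"

context prob_space
begin

text \<open>The measurable cover. It transfers subadditivity and monotonicity from events to arbitrary sets.\<close>

lemma outer_prob_attain:
 assumes "A \<subseteq> space M"
 obtains E where "E \<in> events" "A \<subseteq> E" "outer_prob M A = prob E"
 using outer_measure_of_attain[OF assms] by (auto simp: outer_prob_def measure_def)

lemma outer_prob_nonneg: "0 <= outer_prob M A"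
 by (simp add: outer_prob_def)

lemma ennreal_outer_prob:
 assumes "A \<subseteq> space M"
 shows "outer_measure_of M A = ennreal (outer_prob M A)"
proof -
 obtain E where "E \<in> events" "outer_measure_of M A = emeasure M E"
  using outer_measure_of_attain[OF assms] by blast
 thus ?thesis by (simp add: outer_prob_def emeasure_eq_measure)
qed

lemma outer_prob_le:
 assumes "A \<subseteq> E" "E \<in> events"
 shows "outer_prob M A <= prob E"
proof -
 have "outer_measure_of M A <= emeasure M E"
  unfolding outer_measure_of_def using assms by (intro INF_lower) auto
 thus ?thesis unfolding outer_prob_def measure_def by (intro enn2real_mono) (auto simp: less_top[symmetric])
qed

lemma outer_prob_AE_mono:
 assumes "AE x in M. x \<in> A --> x \<in> B" "A \<subseteq> space M" "B \<subseteq> space M"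
 shows "outer_prob M A <= outer_prob M B"
proof -
 obtain E where E: "E \<in> events" "B \<subseteq> E" "outer_prob M B = prob E" using outer_prob_attain[OF assms(3)] .
 obtain N where N: "{x \<in> space M. \<not> (x \<in> A --> x \<in> B)} \<subseteq> N" "emeasure M N = 0" "N \<in> events"
  by (rule AE_E[OF assms(1)]) (rule that)
 have "outer_prob M A <= prob (E \<union> N)" using E N assms(2) by (intro outer_prob_le) auto
 also have "... <= prob E + prob N" using E N by (intro measure_Un_le) auto
 finally show ?thesis using N E by (simp add: measure_def)
qed

lemma outer_prob_Un:
 assumes "A \<subseteq> space M" "B \<subseteq> space M"
 shows "outer_prob M (A \<union> B) <= outer_prob M A + outer_prob M B"
proof -
 obtain E where E: "E \<in> events" "A \<subseteq> E" "outer_prob M A = prob E" using outer_prob_attain[OF assms(1)] .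
 obtain F where F: "F \<in> events" "B \<subseteq> F" "outer_prob M B = prob F" using outer_prob_attain[OF assms(2)] .
 have "outer_prob M (A \<union> B) <= prob (E \<union> F)" using E F by (intro outer_prob_le) auto
 also have "... <= prob E + prob F" using E F by (intro measure_Un_le) auto
 finally show ?thesis using E F by simp
qed

lemma outer_prob_cover2:
 assumes "AE x in M. P x --> Q x \<or> R x"
 shows "outer_prob M {x \<in> space M. P x} <= outer_prob M {x \<in> space M. Q x} + outer_prob M {x \<in> space M. R x}"
proof -
 have "outer_prob M {x \<in> space M. P x} <= outer_prob M ({x \<in> space M. Q x} \<union> {x \<in> space M. R x})"
  using assms by (intro outer_prob_AE_mono) (auto elim: AE_mp)
 also have "... <= outer_prob M {x \<in> space M. Q x} + outer_prob M {x \<in> space M. R x}"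
  by (intro outer_prob_Un) auto
 finally show ?thesis .
qed

lemma outer_prob_cover1:
 assumes "AE x in M. P x --> Q x"
 shows "outer_prob M {x \<in> space M. P x} <= outer_prob M {x \<in> space M. Q x}"
 using assms by (intro outer_prob_AE_mono) (auto elim: AE_mp)

lemma outer_expectation_le:
 assumes "AE x in M. - B <= g x" "integrable M h" "AE x in M. g x <= h x"
 shows "outer_expectation M g <= expectation h"
 unfolding outer_expectation_def
proof (rule cInf_lower)
 show "expectation h \<in> {(LINT x|M. h x) |h. integrable M h \<and> (AE x in M. g x <= h x)}"
  using assms by blast
 show "bdd_below {(LINT x|M. h x) |h. integrable M h \<and> (AE x in M. g x <= h x)}"
 proof (rule bdd_belowI)
  fix y assume "y \<in> {(LINT x|M. h x) |h. integrable M h \<and> (AE x in M. g x <= h x)}"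
  then obtain k where k: "y = expectation k" "integrable M k" "AE x in M. g x <= k x" by blast
  have "AE x in M. - B <= k x" using assms(1) k(3) by eventually_elim simp
  thus "- B <= y" unfolding k(1) by (rule integral_ge_const[OF k(2)])
 qed
qed

lemma outer_expectation_ge:
 assumes "AE x in M. g x <= B" and "\<And>h. integrable M h ==> AE x in M. g x <= h x ==> c <= expectation h"
 shows "c <= outer_expectation M g"
 unfolding outer_expectation_def
proof (rule cInf_greatest)
 show "{(LINT x|M. h x) |h. integrable M h \<and> (AE x in M. g x <= h x)} \<noteq> {}"
  using assms(1) integrable_const[of B] by blast
qed (use assms(2) in blast)

text \<open>Two bounded functions that are \<open>e\<close>-close off a set \<open>P\<close> of small outer probability have close outer
 expectations: add \<open>2 B\<close> times the indicator of the measurable cover of \<open>P\<close> to a majorant.\<close>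

lemma outer_expectation_perturb:
 assumes f: "AE x in M. \<bar>f x\<bar> <= B" and g: "AE x in M. \<bar>g x\<bar> <= B"
  and fg: "AE x in M. P x \<or> f x <= g x + e" and e: "0 <= e"
 shows "outer_expectation M f <= outer_expectation M g + e + 2 * B * outer_prob M {x \<in> space M. P x}"
proof -
 have "AE x in M. 0 <= B" using f by eventually_elim simp
 hence B: "0 <= B" using AE_const by simp
 obtain E where E: "E \<in> events" "{x \<in> space M. P x} \<subseteq> E" "outer_prob M {x \<in> space M. P x} = prob E"
  using outer_prob_attain[of "{x \<in> space M. P x}"] by blast
 have "outer_expectation M f - e - 2 * B * prob E <= outer_expectation M g"
 proof (rule outer_expectation_ge[of _ B])
  show "AE x in M. g x <= B" using g by eventually_elim simp
  fix h assume h: "integrable M h" "AE x in M. g x <= h x"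
  have iE: "integrable M (\<lambda>x. indicator E x :: real)"
   using E by (intro integrable_real_indicator) (auto simp: less_top[symmetric])
  have i: "integrable M (\<lambda>x. h x + e + 2 * B * indicator E x)"
   using h iE by (auto intro!: Bochner_Integration.integrable_add)
  have "outer_expectation M f <= expectation (\<lambda>x. h x + e + 2 * B * indicator E x)"
  proof (rule outer_expectation_le[of B, OF _ i])
   show "AE x in M. - B <= f x" using f by eventually_elim auto
   show "AE x in M. f x <= h x + e + 2 * B * indicator E x"
    using f g fg h(2) AE_space
   proof eventually_elim
    case (elim x)
    show ?case
    proof (cases "x \<in> E")
     case True thus ?thesis using elim e B by simp
    next
     case False thus ?thesis using elim E(2) B by (auto simp: indicator_def)
    qed
   qed
  qed
  also have "... = expectation h + e + 2 * B * prob E"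
   using h E iE by (simp add: prob_space)
  finally show "outer_expectation M f - e - 2 * B * prob E <= expectation h" by simp
 qed
 thus ?thesis using E by simp
qed

text \<open>Markov's inequality for outer expectations.\<close>

lemma outer_prob_le_outer_expectation:
 assumes g: "AE x in M. 0 <= g x \<and> g x <= B" and P: "AE x in M. P x --> 1 <= g x"
 shows "outer_prob M {x \<in> space M. P x} <= outer_expectation M g"
proof (rule outer_expectation_ge[of _ B])
 show "AE x in M. g x <= B" using g by eventually_elim simp
 fix h assume h: "integrable M h" "AE x in M. g x <= h x"
 have [measurable]: "h \<in> borel_measurable M" using h(1) by simp
 have "outer_prob M {x \<in> space M. P x} <= outer_prob M {x \<in> space M. 1 <= h x}"
 proof (rule outer_prob_cover1)
  show "AE x in M. P x --> 1 <= h x" using h(2) P by eventually_elim auto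
 qed
 also have "... <= prob {x \<in> space M. 1 <= h x}" by (intro outer_prob_le) auto
 also have "... = expectation (indicator {x \<in> space M. 1 <= h x})" by simp
 also have "... <= expectation h"
 proof (rule integral_mono_AE)
  show "AE x in M. indicator {x \<in> space M. 1 <= h x} x <= h x"
   using g h(2) by eventually_elim (auto simp: indicator_def)
  show "integrable M (indicator {x \<in> space M. 1 <= h x} :: 'a => real)"
   by (intro integrable_real_indicator) (auto simp: less_top[symmetric])
 qed (use h in auto)
 finally show "outer_prob M {x \<in> space M. P x} <= expectation h" .
qed

lemma small_oP1_iff: "small_oP1 M X \<longleftrightarrow> (\<forall>e>0. (\<lambda>n. outer_prob M {y \<in> space M. \<bar>X n y\<bar> > e}) \<longlonglongrightarrow> 0)"
proof -
 have "outer_measure_of M {y \<in> space M. \<bar>X n y\<bar> > e} = ennreal (outer_prob M {y \<in> space M. \<bar>X n y\<bar> > e})" for n e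
  by (intro ennreal_outer_prob) auto
 thus ?thesis
  unfolding small_oP1_def
  by (simp add: tendsto_ennreal_iff[where x=0, simplified ennreal_0] outer_prob_nonneg del: ennreal_0)
qed

lemma big_OP_iff: "big_OP M X R \<longleftrightarrow>
 (\<forall>h>0. \<exists>C>0. \<forall>\<^sub>F n in sequentially. outer_prob M {x \<in> space M. \<bar>X n x\<bar> > C * \<bar>R n x\<bar>} <= h)"
proof -
 have "outer_measure_of M {x \<in> space M. \<bar>X n x\<bar> > C * \<bar>R n x\<bar>}
   = ennreal (outer_prob M {x \<in> space M. \<bar>X n x\<bar> > C * \<bar>R n x\<bar>})" for n C
  by (intro ennreal_outer_prob) auto
 thus ?thesis unfolding big_OP_def by (auto simp: less_imp_le ennreal_le_iff cong: conj_cong)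
qed

end

section \<open>Weak convergence of random paths\<close>

lemma sup_dist_measurable:
 fixes z :: "real => real^'d::finite"
 assumes z: "z \<in> cadlag a b"
 shows "(\<lambda>x. sup_dist a b z x) \<in> borel_measurable (ball_algebra a b)"
proof (rule borel_measurableI_less, unfold space_ball_algebra)
 fix r :: real
 show "{x \<in> cadlag a b. sup_dist a b z x < r} \<in> sets (ball_algebra a b)"
 proof (cases "a <= b \<and> r <= 0")
  case True
  have "0 <= sup_dist a b z x" if "x \<in> cadlag a b" for x
   using sup_dist_ge[OF z that, of a] True infnorm_pos_le[of "z a - x a"] by auto
  hence "{x \<in> cadlag a b. sup_dist a b z x < r} = {}" using True by (force simp: not_less)
  thus ?thesis by (simp only: sets.empty_sets)
 next
  case False
  show ?thesis
  proof (cases "0 < r")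
   case True thus ?thesis using ball_in_ball_algebra[OF z] by blast
  next
   case f: False
   hence "{a..b} = {}" using False by auto
   define c where "c = sup_dist a b z z"
   have "sup_dist a b z x = c" for x by (simp add: c_def sup_dist_def \<open>{a..b} = {}\<close>)
   hence "{x \<in> cadlag a b. sup_dist a b z x < r} = (if c < r then cadlag a b else {})" by auto
   moreover have "cadlag a b \<in> sets (ball_algebra a b :: (real => real^'d) measure)"
    using sets.top[of "ball_algebra a b :: (real => real^'d) measure"] by (simp add: space_ball_algebra)
   ultimately show ?thesis by auto
  qed
 qed
qed

lemma weakly_convergesD:
 assumes "weakly_converges a b M X N W" "h \<in> borel_measurable (ball_algebra a b)" "bounded (h ` cadlag a b)"
  "sup_continuous a b h"
 shows "(\<lambda>n. outer_expectation M (\<lambda>x. h (X n x))) \<longlonglongrightarrow> (LINT w|N. h (W w))"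
 using assms unfolding weakly_converges_def by blast

lemma weakly_converges_AE: "weakly_converges a b M X N W ==> AE x in M. X n x \<in> cadlag a b"
 unfolding weakly_converges_def by blast

lemma weakly_converges_cadlag: "weakly_converges a b M X N W ==> w \<in> space N ==> W w \<in> cadlag a b"
 unfolding weakly_converges_def using measurable_space[of W N "ball_algebra a b" w] by (auto simp: space_ball_algebra)

text \<open>The continuous mapping theorem. A map with measurable coordinates is measurable for the ball
 algebra, so composition with it preserves the test functions.\<close>

lemma weakly_converges_map:
 fixes T :: "(real => real^'d::finite) => real => real^'d"
 assumes ab: "a <= b" and X: "weakly_converges a b M X N W"
  and T: "\<And>x. x \<in> cadlag a b ==> T x \<in> cadlag a b"
  and Tmeas: "\<And>s. s \<in> {a..b} ==> (\<lambda>x. T x s) \<in> borel_measurable (ball_algebra a b)"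
  and lip: "0 <= C" "\<And>x y. x \<in> cadlag a b ==> y \<in> cadlag a b ==> sup_dist a b (T x) (T y) <= C * sup_dist a b x y"
 shows "weakly_converges a b M (\<lambda>n z. T (X n z)) N (\<lambda>w. T (W w))"
proof -
 have TM: "T \<in> ball_algebra a b \<rightarrow>\<^sub>M ball_algebra a b"
  by (intro measurable_ball_algebraI ab T Tmeas) (auto simp: space_ball_algebra)
 show ?thesis
  unfolding weakly_converges_def
 proof (intro conjI allI impI)
  show "AE z in M. T (X n z) \<in> cadlag a b" for n
   using weakly_converges_AE[OF X, of n] by eventually_elim (rule T)
  have "W \<in> N \<rightarrow>\<^sub>M ball_algebra a b" using X by (simp add: weakly_converges_def)
  thus "(\<lambda>w. T (W w)) \<in> N \<rightarrow>\<^sub>M ball_algebra a b" by (rule measurable_compose[OF _ TM])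
  fix h :: "(real => real^'d) => real"
  assume h: "h \<in> borel_measurable (ball_algebra a b) \<and> bounded (h ` cadlag a b) \<and> sup_continuous a b h"
  show "(\<lambda>n. outer_expectation M (\<lambda>z. h (T (X n z)))) \<longlonglongrightarrow> (LINT w|N. h (T (W w)))"
  proof (rule weakly_convergesD[OF X, of "\<lambda>x. h (T x)"])
   show "(\<lambda>x. h (T x)) \<in> borel_measurable (ball_algebra a b)" using h by (intro measurable_compose[OF TM]) auto
   have "(\<lambda>x. h (T x)) ` cadlag a b \<subseteq> h ` cadlag a b" using T by auto
   thus "bounded ((\<lambda>x. h (T x)) ` cadlag a b)" using h bounded_subset by blast
   show "sup_continuous a b (\<lambda>x. h (T x))"
    unfolding sup_continuous_def
   proof (intro ballI allI impI)
    fix x :: "real => real^'d" and e :: real assume x: "x \<in> cadlag a b" and e: "0 < e"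
    obtain r where r: "r > 0" "\<And>y. y \<in> cadlag a b ==> sup_dist a b (T x) y < r ==> \<bar>h y - h (T x)\<bar> < e"
     using h T[OF x] e unfolding sup_continuous_def by blast
    show "\<exists>r>0. \<forall>y\<in>cadlag a b. sup_dist a b x y < r --> \<bar>h (T y) - h (T x)\<bar> < e"
    proof (intro exI[of _ "r / (C + 1)"] conjI ballI impI)
     show "0 < r / (C + 1)" using r lip by simp
     fix y assume y: "y \<in> cadlag a b" "sup_dist a b x y < r / (C + 1)"
     have d0: "0 <= sup_dist a b x y" using sup_dist_ge[OF x y(1), of a] ab infnorm_pos_le[of "x a - y a"] by auto
     have "sup_dist a b (T x) (T y) <= C * sup_dist a b x y" by (rule lip(2)[OF x y(1)])
     also have "... <= (C + 1) * sup_dist a b x y" using d0 by (simp add: distrib_right)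
     also have "... < r" using y(2) lip(1) by (simp add: field_simps)
     finally show "\<bar>h (T y) - h (T x)\<bar> < e" using r(2)[OF T[OF y(1)]] by blast
    qed
   qed
  qed
 qed
qed

lemma zero_cadlag: "(\<lambda>_. 0) \<in> cadlag a b"
 by (intro continuous_imp_cadlag continuous_on_const)

text \<open>Tightness of the suprema, tested by the continuous functions \<open>min 1 (\<parallel>x\<parallel> - k)\<^sup>+\<close>.\<close>

lemma weakly_converges_tight:
 fixes W :: "'w => real => real^'d::finite"
 assumes ab: "a <= b" and M: "prob_space M" and N: "prob_space N" and X: "weakly_converges a b M X N W" and h: "0 < h"
 obtains K where "0 < K"
  "\<forall>\<^sub>F n in sequentially. outer_prob M {z \<in> space M. \<not> (\<forall>s\<in>{a..b}. infnorm (X n z s) <= K)} <= h"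
proof -
 interpret M: prob_space M by (rule M)
 interpret N: prob_space N by (rule N)
 let ?d = "\<lambda>x. sup_dist a b (\<lambda>_. 0) x"
 define f where "f k x = min 1 (max 0 (?d x - real k))" for k :: nat and x :: "real => real^'d"
 have d_meas: "?d \<in> borel_measurable (ball_algebra a b)" by (rule sup_dist_measurable[OF zero_cadlag])
 have \<phi>_meas: "f k \<in> borel_measurable (ball_algebra a b)" for k
  unfolding f_def by (intro borel_measurable_min borel_measurable_max borel_measurable_diff d_meas borel_measurable_const)
 have \<phi>_bd: "0 <= f k x" "f k x <= 1" for k x by (auto simp: f_def)
 have \<phi>_cont: "sup_continuous a b (f k)" for k
  unfolding sup_continuous_def
 proof (intro ballI allI impI)
  fix x :: "real => real^'d" and e :: real assume x: "x \<in> cadlag a b" and e: "0 < e"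
  show "\<exists>r>0. \<forall>y\<in>cadlag a b. sup_dist a b x y < r --> \<bar>f k y - f k x\<bar> < e"
  proof (intro exI[of _ e] conjI ballI impI e)
   fix y assume y: "y \<in> cadlag a b" "sup_dist a b x y < e"
   have "?d y <= ?d x + sup_dist a b x y" "?d x <= ?d y + sup_dist a b y x"
    by (intro sup_dist_triangle ab zero_cadlag x y)+
   hence "\<bar>?d y - ?d x\<bar> < e" using y(2) sup_dist_commute[of a b y x] by linarith
   thus "\<bar>f k y - f k x\<bar> < e" unfolding f_def by linarith
  qed
 qed
 have lim: "(\<lambda>k. LINT w|N. f k (W w)) \<longlonglongrightarrow> (LINT w|N. 0)"
 proof (rule integral_dominated_convergence[where w="\<lambda>_. 1"])
  have WM: "W \<in> N \<rightarrow>\<^sub>M ball_algebra a b" using X by (simp add: weakly_converges_def)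
  show "(\<lambda>w. f k (W w)) \<in> borel_measurable N" for k by (rule measurable_compose[OF WM \<phi>_meas])
  show "AE w in N. (\<lambda>k. f k (W w)) \<longlonglongrightarrow> 0"
  proof (rule AE_I2)
   fix w
   obtain k0 :: nat where k0: "?d (W w) < real k0" using reals_Archimedean2 by blast
   have "\<forall>\<^sub>F k in sequentially. f k (W w) = 0"
    using eventually_ge_at_top[of k0] by eventually_elim (use k0 in "auto simp: f_def")
   thus "(\<lambda>k. f k (W w)) \<longlonglongrightarrow> 0" by (rule tendsto_eventually)
  qed
 qed (use \<phi>_bd in auto)
 have "\<forall>\<^sub>F k in sequentially. (LINT w|N. f k (W w)) < h"
  using order_tendstoD(2)[OF lim] h by simp
 then obtain k where k: "(LINT w|N. f k (W w)) < h" by (auto simp: eventually_sequentially)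
 have "bounded (f k ` cadlag a b)" using \<phi>_bd by (auto simp: bounded_iff intro!: exI[of _ 1])
 hence "(\<lambda>n. outer_expectation M (\<lambda>z. f k (X n z))) \<longlonglongrightarrow> (LINT w|N. f k (W w))"
  by (intro weakly_convergesD[OF X] \<phi>_meas \<phi>_cont)
 hence "\<forall>\<^sub>F n in sequentially. outer_expectation M (\<lambda>z. f k (X n z)) < h" using k by (rule order_tendstoD)
 hence "\<forall>\<^sub>F n in sequentially. outer_prob M {z \<in> space M. \<not> (\<forall>s\<in>{a..b}. infnorm (X n z s) <= real k + 1)} <= h"
 proof eventually_elim
  case (elim n)
  have "outer_prob M {z \<in> space M. \<not> (\<forall>s\<in>{a..b}. infnorm (X n z s) <= real k + 1)}
    <= outer_expectation M (\<lambda>z. f k (X n z))"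
  proof (rule M.outer_prob_le_outer_expectation[where B=1])
   show "AE z in M. \<not> (\<forall>s\<in>{a..b}. infnorm (X n z s) <= real k + 1) --> 1 <= f k (X n z)"
    using weakly_converges_AE[OF X, of n]
   proof eventually_elim
    case (elim z)
    show ?case
    proof
     assume "\<not> (\<forall>s\<in>{a..b}. infnorm (X n z s) <= real k + 1)"
     then obtain s where s: "s \<in> {a..b}" "infnorm (X n z s) > real k + 1" by auto
     have "infnorm (0 - X n z s) <= ?d (X n z)" by (rule sup_dist_ge[OF zero_cadlag elim s(1)])
     thus "1 <= f k (X n z)" using s by (simp add: f_def infnorm_neg)
    qed
   qed
  qed (use \<phi>_bd in auto)
  thus ?case using elim by linarith
 qed
 thus ?thesis using that[of "real k + 1"] by simp
qed

text \<open>From sequences to a uniform statement: otherwise for every \<open>k\<close> there were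
 infinitely many \<open>n\<close> with \<open>u (1 / k) n > e\<close>, and a null sequence \<open>r\<close> could be chosen along which
 \<open>u (r n) n > e\<close> infinitely often.\<close>

lemma null_sequences_imp_uniform:
 fixes u :: "real => nat => real"
 assumes "\<And>r. (\<And>n. 0 <= r n) ==> r \<longlonglongrightarrow> 0 ==> (\<lambda>n. u (r n) n) \<longlonglongrightarrow> 0" and e: "0 < e"
 obtains d where "0 < d" "\<forall>\<^sub>F n in sequentially. u d n <= e"
proof (rule ccontr)
 assume "\<not> thesis"
 hence no: "\<not> (\<forall>\<^sub>F n in sequentially. u d n <= e)" if "0 < d" for d using that \<open>\<And>d. 0 < d ==> _ ==> thesis\<close> by blast
 have ex: "\<exists>n>m. u (1 / real (Suc k)) n > e" for m k
  using no[of "1 / real (Suc k)"] unfolding eventually_sequentially by (auto simp: not_le dest: spec[of _ "Suc m"])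
   (metis Suc_le_lessD)
 have "\<exists>n. \<forall>k. u (1 / real (Suc k)) (n k) > e \<and> n k < n (Suc k)"
  by (rule dependent_nat_choice) (use ex in blast)+
 then obtain n where n: "\<And>k. u (1 / real (Suc k)) (n k) > e" "\<And>k. n k < n (Suc k)" by blast
 have sm: "strict_mono n" using n(2) by (rule strict_mono_Suc_iff[THEN iffD2, rule_format])
 define r where "r j = (if j \<in> range n then 1 / real (Suc (inv n j)) else 0)" for j
 have rn: "r (n k) = 1 / real (Suc k)" for k
  unfolding r_def by (simp add: inv_f_f[OF strict_mono_imp_inj_on[OF sm]] del: of_nat_Suc)
 have "r \<longlonglongrightarrow> 0"
 proof (rule LIMSEQ_I)
  fix c :: real assume c: "0 < c"
  obtain k0 where k0: "1 / real (Suc k0) < c" using nat_approx_posE[OF c] .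
  have "\<bar>r j\<bar> < c" if j: "n k0 <= j" for j
  proof (cases "j \<in> range n")
   case True
   then obtain k where k: "j = n k" by auto
   hence "k0 <= k" using j sm by (simp add: strict_mono_less_eq)
   hence "1 / real (Suc k) <= 1 / real (Suc k0)" by (simp add: field_simps)
   thus ?thesis using k0 by (simp add: k rn del: of_nat_Suc)
  qed (use c in "simp add: r_def")
  thus "\<exists>no. \<forall>j\<ge>no. norm (r j - 0) < c" by auto
 qed
 moreover have "0 <= r j" for j by (simp add: r_def)
 ultimately have "(\<lambda>j. u (r j) j) \<longlonglongrightarrow> 0" by (intro assms)
 hence "(\<lambda>k. u (r (n k)) (n k)) \<longlonglongrightarrow> 0" using LIMSEQ_subseq_LIMSEQ[OF _ sm] by (auto simp: o_def)
 hence "\<forall>\<^sub>F k in sequentially. u (1 / real (Suc k)) (n k) < e" using e by (auto dest: order_tendstoD simp: rn)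
 thus False using n(1) by (auto simp: eventually_sequentially dest: less_asym)
qed
lemma step_path_cadlag:
 fixes g :: "int => real^'d::finite"
 assumes q: "0 < q"
 shows "(\<lambda>t. g \<lfloor>(t - a) * q\<rfloor>) \<in> cadlag a b"
proof -
 have r: "((\<lambda>t. g \<lfloor>(t - a) * q\<rfloor>) \<longlongrightarrow> g \<lfloor>(t - a) * q\<rfloor>) (at_right t)" for t
 proof (rule tendsto_eventually)
  let ?u = "a + (of_int \<lfloor>(t - a) * q\<rfloor> + 1) / q"
  have "(t - a) * q < of_int \<lfloor>(t - a) * q\<rfloor> + 1" by linarith
  hence "t < ?u" using q by (simp add: field_simps)
  hence "\<forall>\<^sub>F u in at_right t. t < u \<and> u < ?u"
   by (auto simp: eventually_at_right_field intro!: exI[of _ ?u])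
  thus "\<forall>\<^sub>F u in at_right t. g \<lfloor>(u - a) * q\<rfloor> = g \<lfloor>(t - a) * q\<rfloor>"
  proof eventually_elim
   case (elim u)
   have "(t - a) * q <= (u - a) * q" using elim q by simp
   moreover have "(u - a) * q < of_int \<lfloor>(t - a) * q\<rfloor> + 1" using elim q by (simp add: field_simps)
   ultimately have "\<lfloor>(u - a) * q\<rfloor> = \<lfloor>(t - a) * q\<rfloor>" by (intro floor_unique) linarith+
   thus ?case by simp
  qed
 qed
 have l: "((\<lambda>t. g \<lfloor>(t - a) * q\<rfloor>) \<longlongrightarrow> g (\<lceil>(t - a) * q\<rceil> - 1)) (at_left t)" for t
 proof (rule tendsto_eventually)
  let ?u = "a + (of_int \<lceil>(t - a) * q\<rceil> - 1) / q"
  have "of_int \<lceil>(t - a) * q\<rceil> - 1 < (t - a) * q" by linarith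
  hence "?u < t" using q by (simp add: field_simps)
  hence "\<forall>\<^sub>F u in at_left t. ?u < u \<and> u < t"
   by (auto simp: eventually_at_left_field intro!: exI[of _ ?u])
  thus "\<forall>\<^sub>F u in at_left t. g \<lfloor>(u - a) * q\<rfloor> = g (\<lceil>(t - a) * q\<rceil> - 1)"
  proof eventually_elim
   case (elim u)
   have "(u - a) * q < (t - a) * q" using elim q by simp
   moreover have "of_int \<lceil>(t - a) * q\<rceil> - 1 <= (u - a) * q" using elim q by (simp add: field_simps)
   ultimately have "\<lfloor>(u - a) * q\<rfloor> = \<lceil>(t - a) * q\<rceil> - 1" by (intro floor_unique) (simp, linarith)
   thus ?case by simp
  qed
 qed
 show ?thesis using r l unfolding cadlag_def by blast
qed

text \<open>Step functions on grids of width \<open>1 / q\<close> with values in a countable dense set approximate every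
 continuous path. This separability of the set of continuous paths replaces compactness below.\<close>

lemma countable_approximation_of_continuous:
 fixes a b :: real
 obtains Zs :: "(real => real^'d::finite) set" where "countable Zs" "Zs \<subseteq> cadlag a b"
  "\<And>x e. continuous_on {a..b} x ==> 0 < e ==> \<exists>z\<in>Zs. \<forall>t\<in>{a..b}. infnorm (z t - x t) <= e"
proof -
 obtain D :: "(real^'d) set" where D: "countable D" "\<And>X. open X ==> X \<noteq> {} ==> \<exists>d\<in>D. d \<in> X"
  using countable_dense_exists by blast
 define step where "step = (\<lambda>(q :: nat, l :: (real^'d) list) t. l ! min (length l - 1) (nat \<lfloor>(t - a) * real (Suc q)\<rfloor>))"
 define Zs where "Zs = step ` (UNIV \<times> lists D)"
 show thesis
 proof (rule that[of Zs])
  show "countable Zs" unfolding Zs_def using D by (intro countable_image countable_SIGMA countable_lists) auto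
  show "Zs \<subseteq> cadlag a b"
   unfolding Zs_def step_def
   using step_path_cadlag[of "real (Suc _)" "\<lambda>k. _ ! min (length _ - 1) (nat k)"] by (auto simp del: of_nat_Suc)
  fix x :: "real => real^'d" and e :: real assume x: "continuous_on {a..b} x" and e: "0 < e"
  have "uniformly_continuous_on {a..b} x" by (rule compact_uniformly_continuous[OF x]) simp
  then obtain d where d: "d > 0" "\<And>s t. s \<in> {a..b} ==> t \<in> {a..b} ==> dist s t < d ==> dist (x s) (x t) < e / 2"
   unfolding uniformly_continuous_on_def using e by (meson half_gt_zero)
  obtain q where q: "1 / real (Suc q) < d" using nat_approx_posE[OF d(1)] .
  have "\<exists>v\<in>D. dist v (x (a + real k / real (Suc q))) < e / 2" for k
   using D(2)[of "ball (x (a + real k / real (Suc q))) (e / 2)"] e by (auto simp: dist_commute)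
  then obtain v where v: "\<And>k. v k \<in> D" "\<And>k. dist (v k) (x (a + real k / real (Suc q))) < e / 2" by metis
  define m where "m = Suc (nat \<lfloor>(b - a) * real (Suc q)\<rfloor>)"
  define l where "l = map v [0..<m]"
  have lD: "l \<in> lists D" using v by (auto simp: l_def)
  show "\<exists>z\<in>Zs. \<forall>t\<in>{a..b}. infnorm (z t - x t) <= e"
  proof (intro bexI[of _ "step (q, l)"] ballI)
   show "step (q, l) \<in> Zs" using lD by (auto simp: Zs_def)
   fix t assume t: "t \<in> {a..b}"
   define k where "k = nat \<lfloor>(t - a) * real (Suc q)\<rfloor>"
   have k: "real k <= (t - a) * real (Suc q)" "(t - a) * real (Suc q) < real k + 1"
    using t by (auto simp: k_def simp del: of_nat_Suc) (simp_all add: le_floor_iff del: of_nat_Suc)?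
   have km: "k < m"
    unfolding k_def m_def using t
    by (intro le_imp_less_Suc nat_mono floor_mono mult_right_mono) auto
   have "min (length l - 1) k = k" using km by (simp add: l_def)
   hence st: "step (q, l) t = v k" using km by (simp add: step_def k_def[symmetric] del: of_nat_Suc) (simp add: l_def)
   let ?s = "a + real k / real (Suc q)"
   have "real k / real (Suc q) <= t - a" using k(1) by (simp add: pos_divide_le_eq del: of_nat_Suc)
   moreover have "t - a < real k / real (Suc q) + 1 / real (Suc q)"
    using k(2) by (simp add: add_divide_distrib[symmetric] pos_less_divide_eq del: of_nat_Suc)
   ultimately have "?s \<in> {a..b}" "dist ?s t < d" using t q by (auto simp: dist_real_def)
   hence "dist (x ?s) (x t) < e / 2" by (intro d(2)) (use t in auto)
   hence "dist (v k) (x t) < e" using v(2)[of k] dist_triangle_half_l[of "v k" "x ?s" e "x t"]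
    by (metis dist_commute dist_triangle_half_l)
   thus "infnorm (step (q, l) t - x t) <= e"
    using infnorm_le_norm[of "v k - x t"] by (simp add: st dist_norm)
  qed
 qed
qed

lemma sup_continuous_mult:
 assumes f: "sup_continuous a b f" "\<And>x. \<bar>f x\<bar> <= 1" and g: "sup_continuous a b g" "\<And>x. \<bar>g x\<bar> <= 1"
 shows "sup_continuous a b (\<lambda>x. f x * g x)"
 unfolding sup_continuous_def
proof (intro ballI allI impI)
 fix x :: "real => real^'a" and e :: real assume x: "x \<in> cadlag a b" and e: "0 < e"
 hence e2: "0 < e / 2" by simp
 obtain r where r: "r > 0" "\<forall>y\<in>cadlag a b. sup_dist a b x y < r --> \<bar>f y - f x\<bar> < e / 2"
  using f(1) x e2 unfolding sup_continuous_def by blast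
 obtain r' where r': "r' > 0" "\<forall>y\<in>cadlag a b. sup_dist a b x y < r' --> \<bar>g y - g x\<bar> < e / 2"
  using g(1) x e2 unfolding sup_continuous_def by blast
 show "\<exists>r>0. \<forall>y\<in>cadlag a b. sup_dist a b x y < r --> \<bar>f y * g y - f x * g x\<bar> < e"
 proof (intro exI[of _ "min r r'"] conjI ballI impI)
  fix y assume y: "y \<in> cadlag a b" "sup_dist a b x y < min r r'"
  have "\<bar>f y * g y - f x * g x\<bar> = \<bar>(f y - f x) * g y + f x * (g y - g x)\<bar>" by (simp add: algebra_simps)
  also have "... <= \<bar>f y - f x\<bar> * \<bar>g y\<bar> + \<bar>f x\<bar> * \<bar>g y - g x\<bar>"
   by (rule order_trans[OF abs_triangle_ineq]) (simp add: abs_mult)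
  also have "... <= \<bar>f y - f x\<bar> + \<bar>g y - g x\<bar>"
   using mult_left_le[OF g(2)[of y], of "\<bar>f y - f x\<bar>"] mult_left_le[OF f(2)[of x], of "\<bar>g y - g x\<bar>"]
   by (simp add: mult.commute)
  also have "... < e" using r(2) r'(2) y by (smt (verit) field_sum_of_halves min_less_iff_conj)
  finally show "\<bar>f y * g y - f x * g x\<bar> < e" .
 qed (use r r' in auto)
qed

lemma sup_continuous_prod:
 assumes "\<And>i :: nat. sup_continuous a b (f i)" "\<And>i x. \<bar>f i x\<bar> <= 1"
 shows "sup_continuous a b (\<lambda>x. \<Prod>i\<le>m. f i x) \<and> (\<forall>x. \<bar>\<Prod>i\<le>m. f i x\<bar> <= 1)"
proof (induction m)
 case (Suc m)
 have "sup_continuous a b (\<lambda>x. (\<Prod>i\<le>m. f i x) * f (Suc m) x)"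
  using Suc assms by (intro sup_continuous_mult) auto
 moreover have "\<bar>(\<Prod>i\<le>m. f i x) * f (Suc m) x\<bar> <= 1" for x
  using Suc assms(2)[of "Suc m" x] by (auto simp: abs_mult intro!: mult_le_one)
 ultimately show ?case by simp
qed (use assms in simp)

text \<open>Slutsky's lemma. The test function \<open>h\<close> is merely continuous. Its oscillation is at most \<open>e\<close> on
 each of countably many balls whose concentric halves cover the continuous paths; finitely many of the
 halves carry the limit law up to \<open>e\<close>, hence the balls with radii scaled by \<open>3 / 4\<close> carry \<open>Y n\<close>
 up to \<open>2 e\<close>, and a uniformly small perturbation does not leave the full balls.\<close>

lemma weakly_converges_perturb:
 fixes V :: "'w => real => real^'d::finite"
 assumes ab: "a <= b" and M: "prob_space M" and N: "prob_space N" and Y: "weakly_converges a b M Y N V"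
  and cont: "AE w in N. continuous_on {a..b} (V w)" and X: "\<And>n. AE v in M. X n v \<in> cadlag a b"
  and close: "\<And>e. 0 < e ==> (\<lambda>n. outer_prob M {v \<in> space M. \<not> (\<forall>s\<in>{a..b}. infnorm (X n v s - Y n v s) <= e)}) \<longlonglongrightarrow> 0"
 shows "weakly_converges a b M X N V"
proof -
 interpret M: prob_space M by (rule M)
 interpret N: prob_space N by (rule N)
 have VM: "V \<in> N \<rightarrow>\<^sub>M ball_algebra a b" using Y by (simp add: weakly_converges_def)
 note Vc = weakly_converges_cadlag[OF Y]
 obtain Zs :: "(real => real^'d) set" where Zs: "countable Zs" "Zs \<subseteq> cadlag a b"
  "\<And>x e. continuous_on {a..b} x ==> 0 < e ==> \<exists>z\<in>Zs. \<forall>t\<in>{a..b}. infnorm (z t - x t) <= e"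
  using countable_approximation_of_continuous by blast
 have main: "(\<lambda>n. outer_expectation M (\<lambda>v. h (X n v))) \<longlonglongrightarrow> (LINT w|N. h (V w))"
  if h: "h \<in> borel_measurable (ball_algebra a b)" "bounded (h ` cadlag a b)" "sup_continuous a b h" for h
 proof -
  obtain B where B: "0 < B" "\<And>x. x \<in> cadlag a b ==> \<bar>h x\<bar> <= B"
   using h(2) unfolding bounded_pos by auto
  have key: "\<forall>\<^sub>F n in sequentially. \<bar>outer_expectation M (\<lambda>v. h (X n v)) - outer_expectation M (\<lambda>v. h (Y n v))\<bar>
    <= e + 2 * B * (3 * e)" if e: "0 < e" for e
  proof -
   define good where "good z k \<longleftrightarrow> (\<forall>y\<in>cadlag a b. \<forall>y'\<in>cadlag a b.
    sup_dist a b z y < 1 / real (Suc k) --> sup_dist a b z y' < 1 / real (Suc k) --> \<bar>h y - h y'\<bar> <= e)" for z and k :: nat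
   define J where "J = {(z, k). z \<in> Zs \<and> good z k}"
   have "countable (Zs \<times> (UNIV :: nat set))" using Zs(1) by auto
   hence Jc: "countable J" by (rule countable_subset[rotated]) (auto simp: J_def)
   have cover: "\<exists>(z, k)\<in>J. sup_dist a b z x < 1 / real (Suc k) / 2" if x: "continuous_on {a..b} x" for x
   proof -
    have xc: "x \<in> cadlag a b" by (rule continuous_imp_cadlag[OF x])
    obtain r where r: "r > 0" "\<And>y. y \<in> cadlag a b ==> sup_dist a b x y < r ==> \<bar>h y - h x\<bar> < e / 2"
     using h(3) xc e unfolding sup_continuous_def by (meson half_gt_zero)
    obtain k where k: "1 / real (Suc k) < r / 2" using nat_approx_posE[of "r / 2"] r by auto
    define kk where "kk = 1 / real (Suc k)"
    have k0: "0 < kk" by (simp add: kk_def)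
    note k = k[folded kk_def]
    obtain z where z: "z \<in> Zs" "\<And>t. t \<in> {a..b} ==> infnorm (z t - x t) <= kk / 4"
     using Zs(3)[OF x, of "kk / 4"] k0 by auto
    have zc: "z \<in> cadlag a b" using z Zs by auto
    have zx: "sup_dist a b z x <= kk / 4" using z(2) by (intro sup_dist_le ab) auto
    have "good z k"
     unfolding good_def kk_def[symmetric]
    proof (intro ballI impI)
     fix y y' assume y: "y \<in> cadlag a b" "y' \<in> cadlag a b" "sup_dist a b z y < kk" "sup_dist a b z y' < kk"
     have "sup_dist a b x y <= sup_dist a b x z + sup_dist a b z y" "sup_dist a b x y' <= sup_dist a b x z + sup_dist a b z y'"
      by (intro sup_dist_triangle ab xc zc y)+
     hence xy: "sup_dist a b x y < kk / 4 + kk" "sup_dist a b x y' < kk / 4 + kk"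
      using zx y(3,4) sup_dist_commute[of a b x z] by (simp_all del: of_nat_Suc)
     have "kk / 4 + kk < r" using k k0 by (simp del: of_nat_Suc)
     with xy have "sup_dist a b x y < r" "sup_dist a b x y' < r" by (simp_all only: less_trans)
     hence "\<bar>h y - h x\<bar> < e / 2" "\<bar>h y' - h x\<bar> < e / 2" using r(2) y by auto
     thus "\<bar>h y - h y'\<bar> <= e" by linarith
    qed
    moreover have "sup_dist a b z x < kk / 2" using zx k0 by simp
    ultimately show ?thesis using z(1) unfolding kk_def by (intro bexI[of _ "(z, k)"]) (simp_all only: J_def case_prod_conv mem_Collect_eq)
   qed
   have "J \<noteq> {}" using cover[of "\<lambda>_. 0"] by auto
   define j where "j = from_nat_into J"
   have jr: "range j = J" unfolding j_def by (rule range_from_nat_into[OF \<open>J \<noteq> {}\<close> Jc])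
   define z where "z i = fst (j i)" for i
   define u where "u i = 1 / real (Suc (snd (j i)))" for i
   have d0: "0 < u i" for i by (simp add: u_def)
   have jJ: "j i \<in> J" for i using jr by auto
   have zZ: "z i \<in> Zs" and gd: "good (z i) (snd (j i))" for i using jJ[of i] by (auto simp: J_def z_def split: prod.splits)
   have zc: "z i \<in> cadlag a b" for i using zZ Zs(2) by auto
   define A where "A m = {w \<in> space N. \<exists>i\<le>m. sup_dist a b (z i) (V w) < u i / 2}" for m
   have dm: "(\<lambda>w. sup_dist a b (z i) (V w)) \<in> borel_measurable N" for i
    by (rule measurable_compose[OF VM sup_dist_measurable[OF zc]])
   have Am: "A m \<in> sets N" for m unfolding A_def using dm by measurable
   have "(\<lambda>m. N.prob (A m)) \<longlonglongrightarrow> N.prob (\<Union>m. A m)"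
   proof (rule N.finite_Lim_measure_incseq)
    show "range A \<subseteq> sets N" using Am by blast
    show "incseq A" by (rule incseq_SucI) (auto simp: A_def intro: le_SucI)
   qed
   moreover have "N.prob (\<Union>m. A m) = 1"
   proof (rule N.prob_eq_1[THEN iffD2])
    show "AE w in N. w \<in> (\<Union>m. A m)"
     using cont AE_space
    proof eventually_elim
     case (elim w)
     obtain p where p: "p \<in> J" "sup_dist a b (fst p) (V w) < 1 / real (Suc (snd p)) / 2"
      using cover[OF elim(1)] by (auto split: prod.splits)
     then obtain i where "p = j i" using jr by blast
     hence "w \<in> A i" using p elim by (auto simp: A_def z_def u_def simp del: of_nat_Suc)
     thus ?case by blast
    qed
   qed (use Am in auto)
   ultimately have "(\<lambda>m. N.prob (A m)) \<longlonglongrightarrow> 1" by simp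
   hence "\<forall>\<^sub>F m in sequentially. N.prob (A m) > 1 - e" by (rule order_tendstoD(1)) (use e in simp)
   then obtain m where m: "N.prob (A m) > 1 - e" by (auto simp: eventually_sequentially)
   define g0 where "g0 i x = min 1 (max 0 (4 * sup_dist a b (z i) x / u i - 2))" for i x
   define g where "g x = (\<Prod>i\<le>m. g0 i x)" for x
   have g0: "0 <= g0 i x" "g0 i x <= 1" "\<bar>g0 i x\<bar> <= 1" for i x by (auto simp: g0_def)
   have g0c: "sup_continuous a b (g0 i)" for i
    unfolding sup_continuous_def
   proof (intro ballI allI impI)
    fix x :: "real => real^'d" and q :: real assume x: "x \<in> cadlag a b" and q: "0 < q"
    show "\<exists>r>0. \<forall>y\<in>cadlag a b. sup_dist a b x y < r --> \<bar>g0 i y - g0 i x\<bar> < q"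
    proof (intro exI[of _ "q * u i / 4"] conjI ballI impI)
     fix y assume y: "y \<in> cadlag a b" "sup_dist a b x y < q * u i / 4"
     have "sup_dist a b (z i) y <= sup_dist a b (z i) x + sup_dist a b x y"
      "sup_dist a b (z i) x <= sup_dist a b (z i) y + sup_dist a b y x"
      by (intro sup_dist_triangle ab zc x y)+
     hence "\<bar>sup_dist a b (z i) y - sup_dist a b (z i) x\<bar> < q * u i / 4"
      using y(2) sup_dist_commute[of a b x y] by linarith
     hence "4 * \<bar>sup_dist a b (z i) y - sup_dist a b (z i) x\<bar> / u i < q"
      using d0[of i] by (simp add: pos_divide_less_eq)
     moreover have "\<bar>4 * sup_dist a b (z i) y / u i - 4 * sup_dist a b (z i) x / u i\<bar>
       = 4 * \<bar>sup_dist a b (z i) y - sup_dist a b (z i) x\<bar> / u i"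
     proof -
      have "4 * sup_dist a b (z i) y / u i - 4 * sup_dist a b (z i) x / u i
        = 4 * (sup_dist a b (z i) y - sup_dist a b (z i) x) / u i"
       by (simp only: right_diff_distrib diff_divide_distrib)
      thus ?thesis using d0[of i] by (simp only: abs_mult abs_divide)
     qed
     ultimately have "\<bar>4 * sup_dist a b (z i) y / u i - 4 * sup_dist a b (z i) x / u i\<bar> < q" by simp
     thus "\<bar>g0 i y - g0 i x\<bar> < q" unfolding g0_def by linarith
    qed (use q d0 in auto)
   qed
   have gc: "sup_continuous a b g" and g1: "\<bar>g x\<bar> <= 1" for x
    using sup_continuous_prod[of a b g0 m, OF g0c g0(3)] by (auto simp: g_def[abs_def])
   have gnn: "0 <= g x" for x unfolding g_def by (intro prod_nonneg) (use g0 in auto)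
   have gm: "g \<in> borel_measurable (ball_algebra a b)"
    unfolding g_def g0_def
    by (intro borel_measurable_prod borel_measurable_min borel_measurable_max borel_measurable_diff
      borel_measurable_divide borel_measurable_times sup_dist_measurable zc borel_measurable_const)
   have gi: "(LINT w|N. g (V w)) <= e"
   proof -
    have "(LINT w|N. g (V w)) <= (LINT w|N. indicator (space N - A m) w)"
    proof (rule integral_mono_AE)
     show "integrable N (\<lambda>w. g (V w))"
      by (rule N.integrable_const_bound[of _ 1]) (use g1 measurable_compose[OF VM gm] in auto)
     show "integrable N (indicator (space N - A m) :: 'w => real)"
      using Am by (intro integrable_real_indicator) (auto simp: less_top[symmetric])
     show "AE w in N. g (V w) <= indicator (space N - A m) w"
     proof (rule AE_I2)
      fix w assume w: "w \<in> space N"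
      show "g (V w) <= indicator (space N - A m) w"
      proof (cases "w \<in> A m")
       case True
       then obtain i where i: "i <= m" "sup_dist a b (z i) (V w) < u i / 2" by (auto simp: A_def)
       hence "4 * sup_dist a b (z i) (V w) / u i - 2 <= 0" using d0[of i] by (simp add: field_simps)
       hence "g0 i (V w) = 0" by (simp add: g0_def)
       hence "g (V w) = 0" using i(1) by (auto simp: g_def)
       thus ?thesis by simp
      next
       case False
       thus ?thesis using w g1[of "V w"] by simp
      qed
     qed
    qed
    also have "... = N.prob (space N - A m)"
     using sets.Int_space_eq2[OF sets.compl_sets[OF Am[of m]]] by simp
    also have "... = 1 - N.prob (A m)" by (rule N.prob_compl[OF Am])
    finally show ?thesis using m by simp
   qed
   have "bounded (g ` cadlag a b)" using g1 by (auto simp: bounded_iff)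
   hence "(\<lambda>n. outer_expectation M (\<lambda>v. g (Y n v))) \<longlonglongrightarrow> (LINT w|N. g (V w))"
    by (intro weakly_convergesD[OF Y] gm gc)
   hence ev1: "\<forall>\<^sub>F n in sequentially. outer_expectation M (\<lambda>v. g (Y n v)) < 2 * e"
    by (rule order_tendstoD) (use gi e in linarith)
   define r where "r = Min (u ` {..m}) / 4"
   have r0: "0 < r" unfolding r_def using d0 by simp
   have r: "r <= u i / 4" if "i <= m" for i unfolding r_def using that by (intro divide_right_mono Min_le) auto
   have ev2: "\<forall>\<^sub>F n in sequentially. outer_prob M {v \<in> space M. \<not> (\<forall>s\<in>{a..b}. infnorm (X n v s - Y n v s) <= r / 2)} < e"
    using close[of "r / 2"] r0 e by (intro order_tendstoD(2)) auto
   show ?thesis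
    using ev1 ev2
   proof eventually_elim
    case (elim n)
    define P where "P v \<longleftrightarrow> (\<forall>i\<le>m. 3 / 4 * u i <= sup_dist a b (z i) (Y n v))" for v
    define Q where "Q v \<longleftrightarrow> \<not> (\<forall>s\<in>{a..b}. infnorm (X n v s - Y n v s) <= r / 2)" for v
    have "outer_prob M {v \<in> space M. P v} <= outer_expectation M (\<lambda>v. g (Y n v))"
    proof (rule M.outer_prob_le_outer_expectation[where B=1])
     show "AE v in M. 0 <= g (Y n v) \<and> g (Y n v) <= 1" using gnn g1 by (auto simp: abs_le_iff)
     show "AE v in M. P v --> 1 <= g (Y n v)"
     proof (intro AE_I2 impI)
      fix v assume "P v"
      hence "g0 i (Y n v) = 1" if "i <= m" for i
       using that d0[of i] unfolding P_def g0_def by (auto simp: field_simps min_def max_def)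
      thus "1 <= g (Y n v)" by (simp add: g_def)
     qed
    qed
    hence "outer_prob M {v \<in> space M. P v} <= 2 * e" using elim by linarith
    moreover have "outer_prob M {v \<in> space M. P v \<or> Q v} <= outer_prob M {v \<in> space M. P v} + outer_prob M {v \<in> space M. Q v}"
     by (rule M.outer_prob_cover2) auto
    ultimately have PQ: "outer_prob M {v \<in> space M. P v \<or> Q v} <= 3 * e" using elim by (simp add: Q_def)
    have osc: "AE v in M. (P v \<or> Q v) \<or> \<bar>h (X n v) - h (Y n v)\<bar> <= e"
     using X[of n] weakly_converges_AE[OF Y, of n]
    proof eventually_elim
     case (elim v)
     show ?case
     proof (rule disjCI)
      assume "\<not> \<bar>h (X n v) - h (Y n v)\<bar> <= e"
      show "P v \<or> Q v"
      proof (rule ccontr)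
       assume PQ: "\<not> (P v \<or> Q v)"
       then obtain i where i: "i <= m" "sup_dist a b (z i) (Y n v) < 3 / 4 * u i" by (auto simp: P_def not_le)
       have "sup_dist a b (Y n v) (X n v) <= r / 2"
        using PQ by (intro sup_dist_le ab) (auto simp: Q_def infnorm_sub)
       moreover have "sup_dist a b (z i) (X n v) <= sup_dist a b (z i) (Y n v) + sup_dist a b (Y n v) (X n v)"
        by (intro sup_dist_triangle ab zc elim)
       ultimately have "sup_dist a b (z i) (X n v) < u i" "sup_dist a b (z i) (Y n v) < u i"
        using i r[OF i(1)] r0 d0[of i] by simp_all
       hence "\<bar>h (X n v) - h (Y n v)\<bar> <= e" using gd[of i] elim unfolding good_def u_def by blast
       thus False using \<open>\<not> \<bar>h (X n v) - h (Y n v)\<bar> <= e\<close> by simp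
      qed
     qed
    qed
    have bX: "AE v in M. \<bar>h (X n v)\<bar> <= B" using X[of n] by eventually_elim (rule B(2))
    have bY: "AE v in M. \<bar>h (Y n v)\<bar> <= B" using weakly_converges_AE[OF Y, of n] by eventually_elim (rule B(2))
    have "outer_expectation M (\<lambda>v. h (X n v)) <= outer_expectation M (\<lambda>v. h (Y n v)) + e + 2 * B * outer_prob M {v \<in> space M. P v \<or> Q v}"
     by (rule M.outer_expectation_perturb[OF bX bY]) (use osc e in "auto elim!: eventually_mono")
    moreover have "outer_expectation M (\<lambda>v. h (Y n v)) <= outer_expectation M (\<lambda>v. h (X n v)) + e + 2 * B * outer_prob M {v \<in> space M. P v \<or> Q v}"
     by (rule M.outer_expectation_perturb[OF bY bX]) (use osc e in "auto elim!: eventually_mono")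
    moreover have "2 * B * outer_prob M {v \<in> space M. P v \<or> Q v} <= 2 * B * (3 * e)"
     using PQ B by (intro mult_left_mono) auto
    ultimately show ?case by linarith
   qed
  qed
  have "(\<lambda>n. outer_expectation M (\<lambda>v. h (X n v)) - outer_expectation M (\<lambda>v. h (Y n v))) \<longlonglongrightarrow> 0"
  proof (rule tendstoI)
   fix e :: real assume e: "0 < e"
   define c where "c = 1 + 6 * B"
   have c0: "0 < c" using B(1) by (simp add: c_def)
   define e' where "e' = e / (2 * c)"
   have e'0: "0 < e'" using e c0 by (simp add: e'_def)
   have "e' * c = e / 2" using c0 by (simp add: e'_def)
   moreover have "e' + 2 * B * (3 * e') = e' * c" by (simp add: c_def algebra_simps)
   ultimately have e': "0 < e'" "e' + 2 * B * (3 * e') < e" using e e'0 by simp_all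
   show "\<forall>\<^sub>F n in sequentially. dist (outer_expectation M (\<lambda>v. h (X n v)) - outer_expectation M (\<lambda>v. h (Y n v))) 0 < e"
    using key[OF e'(1)] by eventually_elim (use e'(2) in simp)
  qed
  from tendsto_add[OF this weakly_convergesD[OF Y h]] show ?thesis by simp
 qed
 show ?thesis unfolding weakly_converges_def using X VM main by blast
qed

text \<open>The oscillation over rational pairs at distance less than \<open>q\<close> is a continuous and measurable functional
 of the path. Equicontinuity makes its mean under the limit law small for small \<open>q\<close>.\<close>

lemma weak_limit_continuous:
 fixes W :: "'w => real => real^'d::finite"
 assumes ab: "a <= b" and M: "prob_space M" and N: "prob_space N" and X: "weakly_converges a b M X N W"
  and equi: "\<And>e u. 0 < e ==> 0 < u ==> \<exists>q>0. \<forall>\<^sub>F n in sequentially. outer_prob M {z \<in> space M.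
   \<not> (\<forall>s\<in>{a..b}. \<forall>t\<in>{a..b}. \<bar>s - t\<bar> < q --> infnorm (X n z s - X n z t) <= e)} <= u"
 shows "AE w in N. continuous_on {a..b} (W w)"
proof -
 interpret M: prob_space M by (rule M)
 interpret N: prob_space N by (rule N)
 have WM: "W \<in> N \<rightarrow>\<^sub>M ball_algebra a b" using X by (simp add: weakly_converges_def)
 note Wc = weakly_converges_cadlag[OF X]
 let ?Q = "{a..b} \<inter> (\<rat> \<union> {b})"
 define P where "P q = {p \<in> ?Q \<times> ?Q. \<bar>fst p - snd p\<bar> < q}" for q :: real
 have Pc: "countable (P q)" for q
  by (rule countable_subset[of _ "?Q \<times> ?Q"]) (use countable_dense in "auto simp: P_def")
 have Pne: "P q \<noteq> {}" if "0 < q" for q using ab that by (auto simp: P_def intro!: exI[of _ b])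
 define osc where "osc q x = (SUP p\<in>P q. infnorm (x (fst p) - x (snd p)))" for q and x :: "real => real^'d"
 have bdd: "bdd_above ((\<lambda>p. infnorm (x (fst p) - x (snd p))) ` P q)" if x: "x \<in> cadlag a b" for x :: "real => real^'d" and q
 proof -
  obtain B where B: "\<forall>y\<in>x ` {a..b}. norm y <= B" using cadlag_bounded[OF x ab] unfolding bounded_iff by blast
  show ?thesis
  proof (rule bdd_aboveI[of _ "B + B"], clarify)
   fix s t assume "(s, t) \<in> P q"
   hence st: "s \<in> {a..b}" "t \<in> {a..b}" by (auto simp: P_def)
   have "infnorm (x s - x t) <= norm (x s - x t)" by (rule infnorm_le_norm)
   also have "... <= norm (x s) + norm (x t)" by (rule norm_triangle_ineq4)
   also have "... <= B + B" using B st by (intro add_mono) auto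
   finally show "infnorm (x (fst (s, t)) - x (snd (s, t))) <= B + B" by simp
  qed
 qed
 have osc0: "0 <= osc q x" if "x \<in> cadlag a b" "0 < q" for x q
 proof -
  have "(b, b) \<in> P q" using ab that by (auto simp: P_def)
  thus ?thesis unfolding osc_def using cSUP_upper2[OF bdd[OF that(1)], of "(b,b)"] by (simp add: infnorm_0)
 qed
 have osc_mono: "osc q x <= osc d' x" if "x \<in> cadlag a b" "0 < q" "q <= d'" for x q d'
  unfolding osc_def by (rule cSUP_subset_mono[OF Pne bdd]) (use that in "auto simp: P_def")
 define g where "g q x = min 1 (osc q x)" for q x
 have gm: "g q \<in> borel_measurable (ball_algebra a b)" for q
  unfolding g_def osc_def
 proof (intro borel_measurable_min borel_measurable_const borel_measurable_cSUP Pc)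
  fix p assume "p \<in> P q"
  hence p: "fst p \<in> {a..b}" "snd p \<in> {a..b}" by (auto simp: P_def)
  show "(\<lambda>x :: real => real^'d. infnorm (x (fst p) - x (snd p))) \<in> borel_measurable (ball_algebra a b)"
   by (rule borel_measurable_continuous_on[OF continuous_on_infnorm[OF continuous_on_id]])
    (intro borel_measurable_diff coordinate_measurable p)
 next
  fix x :: "real => real^'d" assume "x \<in> space (ball_algebra a b)"
  thus "bdd_above ((\<lambda>p. infnorm (x (fst p) - x (snd p))) ` P q)" by (intro bdd) (simp add: space_ball_algebra)
 qed
 have g_le: "osc q y <= osc q x + 2 * sup_dist a b x y" if xy: "x \<in> cadlag a b" "y \<in> cadlag a b" and q: "0 < q" for x y q
  unfolding osc_def[of q y]
 proof (rule cSUP_least[OF Pne[OF q]])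
  fix p assume p: "p \<in> P q"
  hence st: "fst p \<in> {a..b}" "snd p \<in> {a..b}" by (auto simp: P_def)
  have "infnorm (y (fst p) - y (snd p)) <= infnorm (y (fst p) - x (fst p)) + infnorm (x (fst p) - x (snd p)) + infnorm (x (snd p) - y (snd p))"
   using infnorm_triangle[of "y (fst p) - x (fst p)" "x (fst p) - x (snd p)"]
    infnorm_triangle[of "y (fst p) - x (snd p)" "x (snd p) - y (snd p)"] by simp
  moreover have "infnorm (x (fst p) - x (snd p)) <= osc q x" unfolding osc_def by (rule cSUP_upper[OF p bdd[OF xy(1)]])
  ultimately show "infnorm (y (fst p) - y (snd p)) <= osc q x + 2 * sup_dist a b x y"
   using sup_dist_ge[OF xy st(2)] sup_dist_ge[OF xy st(1)] infnorm_sub[of "y (fst p)" "x (fst p)"] by linarith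
 qed
 have gc: "sup_continuous a b (g q)" if q: "0 < q" for q
  unfolding sup_continuous_def
 proof (intro ballI allI impI)
  fix x :: "real => real^'d" and h :: real assume x: "x \<in> cadlag a b" and h: "0 < h"
  show "\<exists>r>0. \<forall>y\<in>cadlag a b. sup_dist a b x y < r --> \<bar>g q y - g q x\<bar> < h"
  proof (intro exI[of _ "h / 2"] conjI ballI impI)
   fix y assume y: "y \<in> cadlag a b" "sup_dist a b x y < h / 2"
   show "\<bar>g q y - g q x\<bar> < h"
    using g_le[OF x y(1) q] g_le[OF y(1) x q] y(2) sup_dist_commute[of a b x y] unfolding g_def by linarith
  qed (use h in auto)
 qed
 have g01: "0 <= g q x" "g q x <= 1" if "x \<in> cadlag a b" "0 < q" for x q using osc0[OF that] by (auto simp: g_def)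
 have small: "\<exists>q>0. (LINT w|N. g q (W w)) <= e" if e: "0 < e" for e
 proof -
  obtain q where q: "q > 0" "\<forall>\<^sub>F n in sequentially. outer_prob M {z \<in> space M.
   \<not> (\<forall>s\<in>{a..b}. \<forall>t\<in>{a..b}. \<bar>s - t\<bar> < q --> infnorm (X n z s - X n z t) <= e / 3)} <= e / 3"
   using equi[of "e / 3" "e / 3"] e by auto
  have "bounded (g q ` cadlag a b)" using g01 q(1) by (auto simp: bounded_iff intro!: exI[of _ 1])
  hence lim: "(\<lambda>n. outer_expectation M (\<lambda>z. g q (X n z))) \<longlonglongrightarrow> (LINT w|N. g q (W w))"
   by (intro weakly_convergesD[OF X] gm gc q)
  have "\<forall>\<^sub>F n in sequentially. outer_expectation M (\<lambda>z. g q (X n z)) <= e"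
   using q(2)
  proof eventually_elim
   case (elim n)
   define R where "R z \<longleftrightarrow> \<not> (\<forall>s\<in>{a..b}. \<forall>t\<in>{a..b}. \<bar>s - t\<bar> < q --> infnorm (X n z s - X n z t) <= e / 3)" for z
   have "outer_expectation M (\<lambda>z. g q (X n z)) <= outer_expectation M (\<lambda>z. 0) + e / 3 + 2 * 1 * outer_prob M {z \<in> space M. R z}"
   proof (rule M.outer_expectation_perturb)
    show "AE z in M. \<bar>g q (X n z)\<bar> <= 1"
     using weakly_converges_AE[OF X, of n] by eventually_elim (use g01 q(1) in auto)
    show "AE z in M. R z \<or> g q (X n z) <= 0 + e / 3"
    proof (rule AE_I2, rule disjCI)
     fix z assume n: "\<not> g q (X n z) <= 0 + e / 3"
     show "R z"
     proof (rule ccontr)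
      assume "\<not> R z"
      hence "osc q (X n z) <= e / 3"
       unfolding osc_def R_def using e by (intro cSUP_least Pne q) (auto simp: P_def infnorm_0)
      thus False using n by (simp add: g_def)
     qed
    qed
   qed (use e in auto)
   moreover have "outer_expectation M (\<lambda>z. 0) <= 0"
    using M.outer_expectation_le[of 0 "\<lambda>_. 0" "\<lambda>_. 0"] by simp
   ultimately show ?case using elim by (simp add: R_def)
  qed
  hence "(LINT w|N. g q (W w)) <= e"
   by (rule tendsto_upperbound[OF lim]) simp
  thus ?thesis using q(1) by blast
 qed
 have gWm: "(\<lambda>w. g q (W w)) \<in> borel_measurable N" for q by (rule measurable_compose[OF WM gm])
 have "AE w in N. \<exists>k::nat. g (1 / real (Suc k)) (W w) < c" if c: "0 < c" for c
 proof -
  let ?A = "{w \<in> space N. \<forall>k::nat. c <= g (1 / real (Suc k)) (W w)}"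
  have Am: "?A \<in> sets N" using gWm by measurable
  have "N.prob ?A <= e" if e: "0 < e" for e
  proof -
   obtain q where q: "0 < q" "(LINT w|N. g q (W w)) <= c * e" using small[of "c * e"] c e by auto
   obtain k where k: "1 / real (Suc k) < q" using nat_approx_posE[OF q(1)] .
   have "c * N.prob ?A = (LINT w|N. c * indicator ?A w)" by (simp only: sets.Int_space_eq2[OF Am] integral_mult_right_zero Bochner_Integration.integral_indicator)
   also have "... <= (LINT w|N. g q (W w))"
   proof (rule integral_mono_AE)
    show "integrable N (\<lambda>w. c * indicator ?A w)"
     using Am by (intro integrable_mult_right integrable_real_indicator) (auto simp: less_top[symmetric])
    show "integrable N (\<lambda>w. g q (W w))"
     by (rule N.integrable_const_bound[of _ 1]) (use g01 Wc q gWm in auto)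
    show "AE w in N. c * indicator ?A w <= g q (W w)"
    proof (rule AE_I2)
     fix w assume w: "w \<in> space N"
     have "g (1 / real (Suc k)) (W w) <= g q (W w)"
      unfolding g_def using osc_mono[OF Wc[OF w], of "1 / real (Suc k)" q] k by (simp add: min_le_iff_disj)
     thus "c * indicator ?A w <= g q (W w)"
      using g01(1)[OF Wc[OF w] q(1)] by (auto simp: indicator_def intro: order_trans)
    qed
   qed
   finally show ?thesis using q(2) c by (meson mult_le_cancel_left_pos order_trans)
  qed
  hence "N.prob ?A <= 0" by (meson field_le_epsilon[of _ 0, simplified] add_0)
  hence "N.prob ?A = 0" by (simp add: measure_le_0_iff)
  hence "AE w in N. w \<notin> ?A" using Am by (simp add: N.prob_eq_0)
  thus ?thesis using AE_space by eventually_elim (auto simp: not_le)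
 qed
 hence "AE w in N. \<forall>j::nat. \<exists>k::nat. g (1 / real (Suc k)) (W w) < 1 / real (Suc j)"
  by (subst AE_all_countable) (auto simp del: of_nat_Suc)
 thus ?thesis
  using AE_space
 proof eventually_elim
  case (elim w)
  let ?x = "W w"
  have xc: "?x \<in> cadlag a b" by (rule Wc) (use elim in auto)
  show "continuous_on {a..b} ?x"
   unfolding continuous_on_iff
  proof (intro ballI allI impI)
   fix s h assume s: "s \<in> {a..b}" and h: "(0::real) < h"
   let ?D = "sqrt (real DIM(real^'d))"
   have D0: "0 < ?D" by simp
   obtain j where j: "1 / real (Suc j) < h / (2 * ?D)" using nat_approx_posE[of "h / (2 * ?D)"] h D0 by auto
   obtain k where k: "g (1 / real (Suc k)) ?x < 1 / real (Suc j)" using elim by blast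
   have "1 / real (Suc j) <= 1" by simp
   hence k': "osc (1 / real (Suc k)) ?x < 1 / real (Suc j)" using k unfolding g_def by linarith
   show "\<exists>d>0. \<forall>t\<in>{a..b}. dist t s < d --> dist (?x t) (?x s) < h"
   proof (intro exI[of _ "1 / real (Suc k)"] conjI ballI impI)
    fix t assume t: "t \<in> {a..b}" "dist t s < 1 / real (Suc k)"
    have lim: "(\<lambda>m. infnorm (?x (round_right b m t) - ?x (round_right b m s))) \<longlonglongrightarrow> infnorm (?x t - ?x s)"
     by (intro tendsto_infnorm tendsto_diff cadlag_round_right[OF xc] s t)
    have "(\<lambda>m. \<bar>round_right b m t - round_right b m s\<bar>) \<longlonglongrightarrow> \<bar>t - s\<bar>"
     by (intro tendsto_rabs tendsto_diff round_right_tendsto[OF s] round_right_tendsto[OF t(1)])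
    hence "\<forall>\<^sub>F m in sequentially. \<bar>round_right b m t - round_right b m s\<bar> < 1 / real (Suc k)"
     using t(2) by (intro order_tendstoD(2)) (auto simp: dist_real_def)
    hence "\<forall>\<^sub>F m in sequentially. infnorm (?x (round_right b m t) - ?x (round_right b m s)) <= 1 / real (Suc j)"
    proof eventually_elim
     case (elim m)
     hence "(round_right b m t, round_right b m s) \<in> P (1 / real (Suc k))"
      using round_right(5)[OF t(1)] round_right(5)[OF s] by (auto simp: P_def)
     hence "infnorm (?x (round_right b m t) - ?x (round_right b m s)) <= osc (1 / real (Suc k)) ?x"
      unfolding osc_def using cSUP_upper[OF _ bdd[OF xc]] by fastforce
     thus ?case using k' by linarith
    qed
    hence "infnorm (?x t - ?x s) <= 1 / real (Suc j)" by (rule tendsto_upperbound[OF lim]) simp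
    hence "?D * infnorm (?x t - ?x s) <= ?D * (1 / real (Suc j))" using D0 by (intro mult_left_mono) auto
    moreover have "?D * (1 / real (Suc j)) < h"
    proof -
     have "?D * (1 / real (Suc j)) < ?D * (h / (2 * ?D))" using j D0 by (rule mult_strict_left_mono)
     also have "... = h / 2" using D0 by simp
     finally show ?thesis using h by linarith
    qed
    ultimately show "dist (?x t) (?x s) < h"
     using norm_le_infnorm[of "?x t - ?x s"] by (simp add: dist_norm del: of_nat_Suc)
   qed simp
  qed
 qed
qed
section \<open>Conditional laws\<close>

text \<open>Both laws agree on rectangles, which generate the product sigma-algebra.\<close>

lemma disintegration:
 fixes Z :: "'a => 'c::{second_countable_topology,t2_space}" and V :: "'a => 'b::{second_countable_topology,t2_space}"
 assumes M: "prob_space M" and Z: "Z \<in> borel_measurable M" and V: "V \<in> borel_measurable M"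
  and K: "regular_cond_dist M V Z K"
 shows "(\<lambda>x. distr (K (Z x)) (borel \<Otimes>\<^sub>M borel) (Pair (Z x))) \<in> M \<rightarrow>\<^sub>M prob_algebra (borel \<Otimes>\<^sub>M borel)"
  and "distr M (borel \<Otimes>\<^sub>M borel) (\<lambda>x. (Z x, V x))
   = M \<bind> (\<lambda>x. distr (K (Z x)) (borel \<Otimes>\<^sub>M borel) (Pair (Z x)))"
proof -
 interpret prob_space M by (rule M)
 note [measurable] = Z V
 have Km[measurable]: "K \<in> borel \<rightarrow>\<^sub>M prob_algebra borel" using K by (simp add: regular_cond_dist_def)
 have Kp: "prob_space (K z)" and Ks: "sets (K z) = sets borel" for z
  using measurable_space[OF Km, of z] by (auto simp: space_prob_algebra)
 have P: "Pair z \<in> K z \<rightarrow>\<^sub>M borel \<Otimes>\<^sub>M borel" for z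
 proof -
  have "Pair z \<in> borel \<rightarrow>\<^sub>M borel \<Otimes>\<^sub>M borel" by (rule measurable_Pair1') simp
  thus ?thesis by (simp add: measurable_cong_sets[OF Ks refl])
 qed
 have KZ: "(\<lambda>x. K (Z x)) \<in> M \<rightarrow>\<^sub>M prob_algebra borel" by (rule measurable_compose[OF Z Km])
 show L: "(\<lambda>x. distr (K (Z x)) (borel \<Otimes>\<^sub>M borel) (Pair (Z x))) \<in> M \<rightarrow>\<^sub>M prob_algebra (borel \<Otimes>\<^sub>M borel)"
  by (rule measurable_distr_prob_space2[OF KZ]) measurable
 have Msp: "M \<in> space (prob_algebra M)" using M by (simp add: space_prob_algebra)
 let ?E = "{A \<times> B | A B. A \<in> sets (borel :: 'c measure) \<and> B \<in> sets (borel :: 'b measure)}"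
 let ?R = "M \<bind> (\<lambda>x. distr (K (Z x)) (borel \<Otimes>\<^sub>M borel) (Pair (Z x)))"
 show "distr M (borel \<Otimes>\<^sub>M borel) (\<lambda>x. (Z x, V x)) = ?R"
 proof (rule measure_eqI_generator_eq[where E="?E" and \<Omega>=UNIV and A="\<lambda>_. UNIV"])
  show "Int_stable ?E" by (rule Int_stable_pair_measure_generator)
  show "?E \<subseteq> Pow UNIV" by simp
  show "sets (distr M (borel \<Otimes>\<^sub>M borel) (\<lambda>x. (Z x, V x))) = sigma_sets UNIV ?E"
   by (simp add: sets_pair_measure)
  have "sets ?R = sets (borel \<Otimes>\<^sub>M borel :: ('c \<times> 'b) measure)"
   using L not_empty by (intro sets_bind) (auto dest: measurable_space simp: space_prob_algebra)
  thus "sets ?R = sigma_sets UNIV ?E" by (simp add: sets_pair_measure)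
  have "UNIV = (UNIV :: 'c set) \<times> (UNIV :: 'b set)" by simp
  thus "range (\<lambda>_. UNIV) \<subseteq> ?E" by (auto intro!: exI[of _ UNIV])
  show "emeasure (distr M (borel \<Otimes>\<^sub>M borel) (\<lambda>x. (Z x, V x))) UNIV \<noteq> \<infinity>"
  proof -
   have "UNIV \<in> sets (borel \<Otimes>\<^sub>M borel :: ('c \<times> 'b) measure)"
    using sets.top[of "borel \<Otimes>\<^sub>M borel :: ('c \<times> 'b) measure"] by (simp add: space_pair_measure)
   thus ?thesis by (subst emeasure_distr) (auto simp: emeasure_eq_measure)
  qed
  show "(\<Union>i::nat. UNIV) = (UNIV :: ('c \<times> 'b) set)" by simp
  fix X assume "X \<in> ?E"
  then obtain A B where X: "X = A \<times> B" "A \<in> sets borel" "B \<in> sets borel" by auto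
  have AM: "{x \<in> space M. Z x \<in> A} \<in> events" using X by measurable
  have m: "(\<lambda>x. measure (K (Z x)) B) \<in> borel_measurable M"
   using X by (intro measurable_compose[OF KZ measurable_measure_prob_algebra]) auto
  have "emeasure (distr M (borel \<Otimes>\<^sub>M borel) (\<lambda>x. (Z x, V x))) X = emeasure M {x \<in> space M. Z x \<in> A \<and> V x \<in> B}"
   using X by (subst emeasure_distr) (auto intro!: arg_cong[where f="emeasure M"])
  also have "... = ennreal (LINT x:{x \<in> space M. Z x \<in> A}|M. measure (K (Z x)) B)"
   using K X unfolding regular_cond_dist_def by (simp add: emeasure_eq_measure)
  also have "... = (\<integral>\<^sup>+ x. ennreal (indicator {x \<in> space M. Z x \<in> A} x * measure (K (Z x)) B) \<partial>M)"
  proof -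
   have "integrable M (\<lambda>x. indicator {x \<in> space M. Z x \<in> A} x * measure (K (Z x)) B)"
    by (rule integrable_const_bound[of _ 1])
     (use m AM prob_space.prob_le_1[OF Kp] in "auto simp: indicator_def intro!: borel_measurable_times")
   thus ?thesis
    unfolding set_lebesgue_integral_def by (subst nn_integral_eq_integral) auto
  qed
  also have "... = (\<integral>\<^sup>+ x. emeasure (distr (K (Z x)) (borel \<Otimes>\<^sub>M borel) (Pair (Z x))) X \<partial>M)"
  proof (rule nn_integral_cong)
   fix x assume x: "x \<in> space M"
   interpret KZ: prob_space "K (Z x)" by (rule Kp)
   have "Pair (Z x) -` X \<inter> space (K (Z x)) = (if Z x \<in> A then B else {})"
    using X sets_eq_imp_space_eq[OF Ks[of "Z x"]] by auto
   hence "emeasure (distr (K (Z x)) (borel \<Otimes>\<^sub>M borel) (Pair (Z x))) X = emeasure (K (Z x)) (if Z x \<in> A then B else {})"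
    using X P by (subst emeasure_distr) auto
   thus "ennreal (indicator {x \<in> space M. Z x \<in> A} x * measure (K (Z x)) B)
     = emeasure (distr (K (Z x)) (borel \<Otimes>\<^sub>M borel) (Pair (Z x))) X"
    using x by (simp add: KZ.emeasure_eq_measure indicator_def)
  qed
  also have "... = emeasure ?R X"
   using X by (intro emeasure_bind_prob_algebra[OF Msp L, symmetric]) auto
  finally show "emeasure (distr M (borel \<Otimes>\<^sub>M borel) (\<lambda>x. (Z x, V x))) X = emeasure ?R X" .
 qed
qed

lemma disintegration_integral:
 fixes Z :: "'a => 'c::{second_countable_topology,t2_space}" and V :: "'a => 'b::{second_countable_topology,t2_space}"
 assumes M: "prob_space M" and Z: "Z \<in> borel_measurable M" and V: "V \<in> borel_measurable M"
  and K: "regular_cond_dist M V Z K"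
  and f: "f \<in> borel_measurable (borel \<Otimes>\<^sub>M borel)" "\<And>p. \<bar>f p\<bar> <= (B::real)"
 shows "(LINT x|M. f (Z x, V x)) = (LINT x|M. LINT v|K (Z x). f (Z x, v))"
proof -
 interpret prob_space M by (rule M)
 note D = disintegration[OF M Z V K]
 have Km: "K \<in> borel \<rightarrow>\<^sub>M prob_algebra borel" using K by (simp add: regular_cond_dist_def)
 have Kp: "prob_space (K z)" and Ks: "sets (K z) = sets borel" for z
  using measurable_space[OF Km, of z] by (auto simp: space_prob_algebra)
 have P: "Pair z \<in> K z \<rightarrow>\<^sub>M borel \<Otimes>\<^sub>M borel" for z
 proof -
  have "Pair z \<in> borel \<rightarrow>\<^sub>M borel \<Otimes>\<^sub>M borel" by (rule measurable_Pair1') simp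
  thus ?thesis by (simp add: measurable_cong_sets[OF Ks refl])
 qed
 have "(LINT x|M. f (Z x, V x)) = integral\<^sup>L (distr M (borel \<Otimes>\<^sub>M borel) (\<lambda>x. (Z x, V x))) f"
  using Z V by (intro integral_distr[symmetric] f) auto
 also have "... = (LINT x|M. integral\<^sup>L (distr (K (Z x)) (borel \<Otimes>\<^sub>M borel) (Pair (Z x))) f)"
  unfolding D(2)
 proof (rule integral_bind[where B=B and B'=1])
  show "AE x in M. emeasure (distr (K (Z x)) (borel \<Otimes>\<^sub>M borel) (Pair (Z x))) (space (distr (K (Z x)) (borel \<Otimes>\<^sub>M borel) (Pair (Z x)))) <= ennreal 1"
   using prob_space.emeasure_space_1[OF prob_space.prob_space_distr[OF Kp P]] by simp
 qed (use f measurable_prob_algebraD[OF D(1)] in "auto intro: finite_measure_axioms")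
 also have "... = (LINT x|M. LINT v|K (Z x). f (Z x, v))"
  by (intro Bochner_Integration.integral_cong refl integral_distr[OF P f(1)])
 finally show ?thesis .
qed

lemma disintegration_AE:
 fixes Z :: "'a => 'c::{second_countable_topology,t2_space}" and V :: "'a => 'b::{second_countable_topology,t2_space}"
 assumes M: "prob_space M" and Z: "Z \<in> borel_measurable M" and V: "V \<in> borel_measurable M"
  and K: "regular_cond_dist M V Z K"
  and S: "S \<in> sets (borel \<Otimes>\<^sub>M borel)" and ae: "AE y in M. (Z y, V y) \<in> S"
 shows "AE y in M. AE v in K (Z y). (Z y, v) \<in> S"
proof -
 note D = disintegration[OF M Z V K]
 have Km: "K \<in> borel \<rightarrow>\<^sub>M prob_algebra borel" using K by (simp add: regular_cond_dist_def)
 have Ks: "sets (K z) = sets borel" for z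
  using measurable_space[OF Km, of z] by (auto simp: space_prob_algebra)
 have P: "Pair z \<in> K z \<rightarrow>\<^sub>M borel \<Otimes>\<^sub>M borel" for z
 proof -
  have "Pair z \<in> borel \<rightarrow>\<^sub>M borel \<Otimes>\<^sub>M borel" by (rule measurable_Pair1') simp
  thus ?thesis by (simp add: measurable_cong_sets[OF Ks refl])
 qed
 have pS: "Measurable.pred (borel \<Otimes>\<^sub>M borel) (\<lambda>p. p \<in> S)" using S by measurable
 have SS: "{x \<in> space (borel \<Otimes>\<^sub>M borel). x \<in> S} \<in> sets (borel \<Otimes>\<^sub>M borel)" using S by measurable
 have "AE p in distr M (borel \<Otimes>\<^sub>M borel) (\<lambda>y. (Z y, V y)). p \<in> S"
  using Z V ae by (subst AE_distr_iff[OF _ SS]) auto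
 hence "AE y in M. AE p in distr (K (Z y)) (borel \<Otimes>\<^sub>M borel) (Pair (Z y)). p \<in> S"
  unfolding D(2) by (subst (asm) AE_bind[OF measurable_prob_algebraD[OF D(1)] pS])
 thus ?thesis by (subst (asm) AE_distr_iff[OF P SS])
qed

text \<open>Applied to the components of \<open>Z\<close>, truncated at \<open>C\<close> to be bounded everywhere.\<close>

lemma expectation_indicator_covariate:
 fixes Z :: "'a => real^'d::finite" and V :: "'a => 'b::{second_countable_topology,t2_space}"
 assumes M: "prob_space M" and Z: "Z \<in> borel_measurable M" and V: "V \<in> borel_measurable M"
  and K: "regular_cond_dist M V Z K" and C: "AE x in M. norm (Z x) <= C"
  and S: "S \<in> sets (borel \<Otimes>\<^sub>M borel)"
 shows "(LINT x|M. of_bool ((Z x, V x) \<in> S) *\<^sub>R Z x) = (LINT x|M. measure (K (Z x)) (Pair (Z x) -` S) *\<^sub>R Z x)"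
  and "(\<lambda>x. measure (K (Z x)) (Pair (Z x) -` S)) \<in> borel_measurable M"
proof -
 interpret prob_space M by (rule M)
 note [measurable] = Z V
 have Km: "K \<in> borel \<rightarrow>\<^sub>M prob_algebra borel" using K by (simp add: regular_cond_dist_def)
 have Kp: "prob_space (K z)" and Ks: "sets (K z) = sets borel" for z
  using measurable_space[OF Km, of z] by (auto simp: space_prob_algebra)
 have SZ: "Pair z -` S \<in> sets borel" for z using sets_Pair1[OF S] by simp
 have KZ: "(\<lambda>x. K (Z x)) \<in> M \<rightarrow>\<^sub>M prob_algebra borel" by (rule measurable_compose[OF Z Km])
 have "(SIGMA z:space (borel :: (real^'d) measure). Pair z -` S) = S" by auto
 hence "(\<lambda>z. measure (K z) (Pair z -` S)) \<in> borel_measurable borel"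
  using S by (intro measure_measurable_prob_algebra2[where N=borel] Km) simp_all
 thus meas: "(\<lambda>x. measure (K (Z x)) (Pair (Z x) -` S)) \<in> borel_measurable M"
  by (rule measurable_compose[OF Z])
 have SV: "{x \<in> space M. (Z x, V x) \<in> S} \<in> events"
  using measurable_sets[OF measurable_Pair[OF Z V] S] by (simp add: vimage_def Int_def conj_commute)
 hence SVm: "(\<lambda>x. of_bool ((Z x, V x) \<in> S) :: real) \<in> borel_measurable M"
  by (simp add: of_bool_def measurable_If_set) measurable
 have C0: "0 <= C"
 proof -
  have "AE x in M. 0 <= C" using C by eventually_elim (rule order_trans[OF norm_ge_zero])
  thus ?thesis using AE_const by simp
 qed
 have int1: "integrable M (\<lambda>x. of_bool ((Z x, V x) \<in> S) *\<^sub>R Z x)"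
  by (rule integrable_const_bound[of _ C])
   (use C C0 SVm in "auto elim!: eventually_mono simp: of_bool_def")
 have int2: "integrable M (\<lambda>x. measure (K (Z x)) (Pair (Z x) -` S) *\<^sub>R Z x)"
 proof (rule integrable_const_bound[of _ C])
  show "AE x in M. norm (measure (K (Z x)) (Pair (Z x) -` S) *\<^sub>R Z x) <= C"
   using C
  proof eventually_elim
   case (elim x)
   have "measure (K (Z x)) (Pair (Z x) -` S) * norm (Z x) <= 1 * C"
    using elim prob_space.prob_le_1[OF Kp] by (intro mult_mono) auto
   thus ?case by simp
  qed
 qed (use meas in measurable)
 show "(LINT x|M. of_bool ((Z x, V x) \<in> S) *\<^sub>R Z x) = (LINT x|M. measure (K (Z x)) (Pair (Z x) -` S) *\<^sub>R Z x)"
  (is "?L = ?R")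
 proof (subst vec_eq_iff, rule allI)
  fix k
  define cl where "cl z = max (- C) (min C (z $ k))" for z :: "real^'d"
  have [measurable]: "cl \<in> borel_measurable borel" unfolding cl_def by measurable
  have clb: "\<bar>cl z\<bar> <= C" for z using C0 by (auto simp: cl_def)
  have clZ: "AE x in M. Z x $ k = cl (Z x)"
   using C
  proof eventually_elim
   case (elim x)
   hence "\<bar>Z x $ k\<bar> <= C" using component_le_norm_cart[of "Z x" k] by linarith
   thus ?case by (auto simp: cl_def)
  qed
  define f where "f p = cl (fst p) * indicator S p" for p :: "(real^'d) \<times> 'b"
  have fm: "f \<in> borel_measurable (borel \<Otimes>\<^sub>M borel)" unfolding f_def using S by measurable
  have fb: "\<bar>f p\<bar> <= C" for p using clb C0 by (auto simp: f_def indicator_def)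
  have "?L $ k = (LINT x|M. (of_bool ((Z x, V x) \<in> S) *\<^sub>R Z x) $ k)"
   by (rule integral_bounded_linear[OF bounded_linear_vec_nth int1, symmetric])
  also have "... = (LINT x|M. f (Z x, V x))"
  proof (rule integral_cong_AE)
   show "AE x in M. (of_bool ((Z x, V x) \<in> S) *\<^sub>R Z x) $ k = f (Z x, V x)"
    using clZ by eventually_elim (simp add: f_def indicator_def)
   show "(\<lambda>x. (of_bool ((Z x, V x) \<in> S) *\<^sub>R Z x) $ k) \<in> borel_measurable M"
   proof -
    have "(\<lambda>x. Z x $ k) \<in> borel_measurable M"
     by (rule borel_measurable_continuous_on[OF _ Z, of "\<lambda>z. z $ k"]) (intro continuous_intros)
    from borel_measurable_times[OF SVm this] show ?thesis by simp
   qed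
   show "(\<lambda>x. f (Z x, V x)) \<in> borel_measurable M" by (rule measurable_compose[OF measurable_Pair[OF Z V] fm])
  qed
  also have "... = (LINT x|M. LINT v|K (Z x). f (Z x, v))"
   by (rule disintegration_integral[OF M Z V K fm fb])
  also have "... = (LINT x|M. cl (Z x) * measure (K (Z x)) (Pair (Z x) -` S))"
  proof (intro Bochner_Integration.integral_cong refl)
   fix x
   have "(LINT v|K (Z x). f (Z x, v)) = (LINT v|K (Z x). cl (Z x) * indicator (Pair (Z x) -` S) v)"
    by (intro Bochner_Integration.integral_cong refl) (simp add: f_def indicator_def)
   also have "... = cl (Z x) * measure (K (Z x)) (Pair (Z x) -` S)"
    using sets_eq_imp_space_eq[OF Ks[of "Z x"]] by simp
   finally show "(LINT v|K (Z x). f (Z x, v)) = cl (Z x) * measure (K (Z x)) (Pair (Z x) -` S)" .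
  qed
  also have "... = (LINT x|M. (measure (K (Z x)) (Pair (Z x) -` S) *\<^sub>R Z x) $ k)"
  proof (rule integral_cong_AE)
   show "AE x in M. cl (Z x) * measure (K (Z x)) (Pair (Z x) -` S) = (measure (K (Z x)) (Pair (Z x) -` S) *\<^sub>R Z x) $ k"
    using clZ by eventually_elim simp
   have Zk: "(\<lambda>x. Z x $ k) \<in> borel_measurable M"
    by (rule borel_measurable_continuous_on[OF _ Z, of "\<lambda>z. z $ k"]) (intro continuous_intros)
   show "(\<lambda>x. (measure (K (Z x)) (Pair (Z x) -` S) *\<^sub>R Z x) $ k) \<in> borel_measurable M"
    using borel_measurable_times[OF meas Zk] by simp
  qed (use meas in measurable)
  also have "... = ?R $ k" by (rule integral_bounded_linear[OF bounded_linear_vec_nth int2])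
  finally show "?L $ k = ?R $ k" .
 qed
qed

lemma outer_prod_mult: "outer_prod z *v h = (z \<bullet> h) *\<^sub>R z"
 by (simp add: vec_eq_iff outer_prod_def matrix_vector_mult_def inner_vec_def sum_distrib_left sum_distrib_right mult_ac)

lemma norm_outer_prod: "norm (outer_prod z) = norm z * norm z"
proof -
 have row: "outer_prod z $ i = z $ i *\<^sub>R z" for i by (simp add: vec_eq_iff outer_prod_def)
 have "norm (outer_prod z) = L2_set (\<lambda>i. \<bar>z $ i\<bar> * norm z) UNIV"
  by (simp add: norm_vec_def[of "outer_prod z"] row)
 also have "... = norm z * norm z"
  by (simp add: L2_set_left_distrib[symmetric] norm_vec_def)
 finally show ?thesis .
qed

lemma outer_prod_measurable: "outer_prod \<in> borel_measurable borel"
 unfolding outer_prod_def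
 by (intro borel_measurable_continuous_onI continuous_on_vec_lambda continuous_intros)

text \<open>The smallest eigenvalue of a symmetric matrix bounds its quadratic form: a minimizer of the form
 on the unit sphere is an eigenvector, and eigenvectors for distinct eigenvalues are orthogonal, so
 that there are only finitely many eigenvalues.\<close>

lemma lambda_min_le_quadratic_form:
 fixes A :: "real^'d::finite^'d"
 assumes sym: "\<And>x y. x \<bullet> (A *v y) = (A *v x) \<bullet> y"
 shows "lambda_min A * (v \<bullet> v) <= v \<bullet> (A *v v)"
proof -
 define q where "q v = v \<bullet> (A *v v)" for v
 have "continuous_on (sphere 0 1) q" unfolding q_def by (intro continuous_intros)
 moreover have "sphere (0::real^'d) 1 \<noteq> {}" by simp
 ultimately obtain v0 where v0: "norm v0 = 1" "\<And>v. norm v = 1 ==> q v0 <= q v"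
  using continuous_attains_inf[OF compact_sphere, of "0::real^'d" 1 q] by auto
 define m where "m = q v0"
 have ge: "m * (v \<bullet> v) <= q v" for v
 proof (cases "v = 0")
  case False
  have "m <= q ((1 / norm v) *\<^sub>R v)" unfolding m_def using False by (intro v0) simp
  also have "... = q v / (norm v)\<^sup>2"
   by (simp add: q_def matrix_vector_mult_scaleR power2_eq_square)
  finally show ?thesis using False by (simp add: field_simps power2_norm_eq_inner)
 qed (simp add: q_def)
 define w where "w = A *v v0 - m *\<^sub>R v0"
 define c where "c = q w - m * (w \<bullet> w)"
 have c0: "0 <= c" using ge[of w] by (simp add: c_def)
 have v00: "v0 \<bullet> v0 = 1" using v0(1) by (simp add: norm_eq_1)
 have quad: "0 <= 2 * t * (w \<bullet> w) + t * t * c" for t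
 proof -
  have "0 <= q (v0 + t *\<^sub>R w) - m * ((v0 + t *\<^sub>R w) \<bullet> (v0 + t *\<^sub>R w))" using ge[of "v0 + t *\<^sub>R w"] by simp
  also have "... = (q v0 - m * (v0 \<bullet> v0)) + 2 * t * (w \<bullet> (A *v v0) - m * (w \<bullet> v0)) + t * t * c"
   by (simp add: q_def c_def matrix_vector_right_distrib matrix_vector_mult_scaleR inner_add_left inner_add_right
     sym[of v0 w] inner_commute[of "A *v v0" w] inner_commute[of v0 w] algebra_simps)
  also have "... = 2 * t * (w \<bullet> w) + t * t * c" by (simp add: v00 m_def w_def inner_diff_right)
  finally show ?thesis .
 qed
 have "w \<bullet> w = 0"
 proof (cases "c = 0")
  case True thus ?thesis using quad[of "- 1"] inner_ge_zero[of w] by simp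
 next
  case False
  have "0 <= - ((w \<bullet> w) * (w \<bullet> w)) / c"
   using quad[of "- (w \<bullet> w) / c"] False by (simp add: field_simps)
  hence "(w \<bullet> w) * (w \<bullet> w) <= 0" using c0 False by (simp add: field_simps)
  thus ?thesis by (metis mult_eq_0_iff mult_nonneg_nonneg inner_ge_zero order_antisym)
 qed
 hence eig: "A *v v0 = m *\<^sub>R v0" by (simp add: w_def)
 define S where "S = {l. \<exists>v. v \<noteq> 0 \<and> A *v v = l *\<^sub>R v}"
 have mS: "m \<in> S" using eig v0 by (auto simp: S_def intro!: exI[of _ v0])
 have "finite S"
 proof -
  define e where "e l = (SOME v. v \<noteq> 0 \<and> A *v v = l *\<^sub>R v)" for l
  have e: "e l \<noteq> 0" "A *v e l = l *\<^sub>R e l" if "l \<in> S" for l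
   using someI_ex[of "\<lambda>v. v \<noteq> 0 \<and> A *v v = l *\<^sub>R v"] that by (auto simp: S_def e_def)
  have orth: "e l \<bullet> e k = 0" if "l \<in> S" "k \<in> S" "l \<noteq> k" for l k
  proof -
   have "k * (e l \<bullet> e k) = e l \<bullet> (A *v e k)" using e[OF that(2)] by simp
   also have "... = l * (e l \<bullet> e k)" using e[OF that(1)] by (simp add: sym)
   finally show ?thesis using that(3) by simp
  qed
  have inj: "inj_on e S" using orth e by (metis inj_onI inner_eq_zero_iff)
  have "pairwise orthogonal (e ` S)" using orth by (auto simp: pairwise_def orthogonal_def)
  hence "independent (e ` S)" by (rule pairwise_orthogonal_independent) (use e in auto)
  hence "finite (e ` S)" by (rule independent_imp_finite)
  thus ?thesis using inj finite_imageD by blast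
 qed
 hence "lambda_min A <= m" unfolding lambda_min_def S_def[symmetric] using mS by simp
 hence "lambda_min A * (v \<bullet> v) <= m * (v \<bullet> v)" by (intro mult_right_mono) auto
 thus ?thesis using ge[of v] by (simp add: q_def)
qed

lemma lambda_min_zero: "lambda_min (0 :: real^'d::finite^'d) = 0"
proof -
 have "{l. \<exists>v. v \<noteq> 0 \<and> (0 :: real^'d^'d) *v v = l *\<^sub>R v} = {0}"
 proof (intro set_eqI iffI)
  fix l :: real assume "l \<in> {0}"
  moreover have "axis undefined 1 \<noteq> (0 :: real^'d)" by (simp add: axis_eq_0_iff)
  ultimately show "l \<in> {l. \<exists>v. v \<noteq> 0 \<and> (0 :: real^'d^'d) *v v = l *\<^sub>R v}"
   by (auto simp: matrix_vector_mult_0)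
 qed (auto simp: matrix_vector_mult_0)
 thus ?thesis by (simp add: lambda_min_def)
qed
section \<open>Integrals of Gaussian paths\<close>

definition centered_normal :: "'w measure => ('w => real) => bool" where
 "centered_normal N L \<longleftrightarrow> (AE w in N. L w = 0) \<or>
   (\<exists>s>0. distributed N lborel L (\<lambda>x. ennreal (normal_density 0 s x)))"

lemma centered_normal_char:
 assumes N: "prob_space N" and L: "L \<in> borel_measurable N" and c: "centered_normal N L"
 obtains v where "0 <= v" "\<And>t. char (distr N borel L) t = complex_of_real (exp (- (v * t\<^sup>2) / 2))"
proof -
 interpret prob_space N by (rule N)
 from c consider "AE w in N. L w = 0" | s where "s > 0" "distributed N lborel L (\<lambda>x. ennreal (normal_density 0 s x))"
  unfolding centered_normal_def by blast
 thus thesis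
 proof cases
  case 1
  have "char (distr N borel L) t = 1" for t
  proof -
   have "char (distr N borel L) t = (CLINT w|N. iexp (t * L w))"
    unfolding char_def using L by (intro integral_distr) auto
   also have "... = (CLINT w|N. 1)" using 1 L by (intro integral_cong_AE) auto
   finally show ?thesis by (simp add: prob_space)
  qed
  thus thesis using that[of 0] by simp
 next
  case 2
  have std: "distributed N lborel (\<lambda>w. L w / s) (\<lambda>x. ennreal (normal_density 0 1 x))"
   using normal_standard_normal_convert[OF 2(1), of L 0] 2(2) by simp
  have d: "distr N borel (\<lambda>w. L w / s) = std_normal_distribution"
   using distributed_distr_eq_density[OF std] by (simp add: distr_cong[OF refl sets_lborel refl] cong: distr_cong)
  have "char (distr N borel L) t = complex_of_real (exp (- (s\<^sup>2 * t\<^sup>2) / 2))" for t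
  proof -
   have "char (distr N borel L) t = (CLINT w|N. iexp (t * L w))"
    unfolding char_def using L by (intro integral_distr) auto
   also have "... = (CLINT w|N. iexp ((t * s) * (L w / s)))" using 2 by simp
   also have "... = char (distr N borel (\<lambda>w. L w / s)) (t * s)"
    unfolding char_def using L by (intro integral_distr[symmetric]) auto
   also have "... = complex_of_real (exp (- (t * s)\<^sup>2 / 2))" unfolding d by (simp add: char_std_normal_distribution)
   finally show ?thesis by (simp add: power_mult_distrib mult.commute)
  qed
  thus thesis using that[of "s\<^sup>2"] by simp
 qed
qed

lemma char_imp_centered_normal:
 assumes N: "prob_space N" and L: "L \<in> borel_measurable N" and v: "0 <= v"
  and ch: "\<And>t. char (distr N borel L) t = complex_of_real (exp (- (v * t\<^sup>2) / 2))"
 shows "centered_normal N L"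
proof -
 interpret prob_space N by (rule N)
 have chi: "char (distr N borel L) t = (CLINT w|N. iexp (t * L w))" for t
  unfolding char_def using L by (intro integral_distr) auto
 have rd: "real_distribution (distr N borel L)" using L by (rule real_distribution_distr)
 show ?thesis
 proof (cases "v = 0")
  case True
  have rz: "real_distribution (distr N borel (\<lambda>_. 0 :: real))" by (rule real_distribution_distr) simp
  have "char (distr N borel L) = char (distr N borel (\<lambda>_. 0))"
  proof
   fix t
   have "char (distr N borel (\<lambda>_. 0)) t = (CLINT w|N. iexp (t * 0))"
    unfolding char_def by (intro integral_distr) auto
   thus "char (distr N borel L) t = char (distr N borel (\<lambda>_. 0)) t"
    using ch[of t] True by (simp add: prob_space)
  qed
  hence eq: "distr N borel L = distr N borel (\<lambda>_. 0)" by (rule Levy_uniqueness[OF rd rz])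
  have "emeasure N {w \<in> space N. L w \<noteq> 0} = emeasure (distr N borel L) (- {0})"
   using L by (subst emeasure_distr) (auto intro!: arg_cong[where f="emeasure N"])
  also have "... = 0" unfolding eq by (subst emeasure_distr) auto
  finally have "AE w in N. L w = 0" using L by (intro AE_I[OF subset_refl]) auto
  thus ?thesis by (simp add: centered_normal_def)
 next
  case False
  hence v0: "0 < v" using v by simp
  define s where "s = sqrt v"
  have s: "0 < s" "s\<^sup>2 = v" using v0 by (auto simp: s_def)
  have "char (distr N borel (\<lambda>w. L w / s)) = char std_normal_distribution"
  proof
   fix t
   have "char (distr N borel (\<lambda>w. L w / s)) t = (CLINT w|N. iexp (t * (L w / s)))"
    unfolding char_def using L by (intro integral_distr) auto
   also have "... = (CLINT w|N. iexp ((t / s) * L w))" by simp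
   also have "... = complex_of_real (exp (- (v * (t / s)\<^sup>2) / 2))" using ch[of "t / s"] chi[of "t / s"] by simp
   also have "v * (t / s)\<^sup>2 = t\<^sup>2" using s v0 by (simp add: power_divide)
   finally show "char (distr N borel (\<lambda>w. L w / s)) t = char std_normal_distribution t"
    by (simp add: char_std_normal_distribution)
  qed
  hence "distr N borel (\<lambda>w. L w / s) = std_normal_distribution"
   using L by (intro Levy_uniqueness real_distribution_distr real_dist_normal_dist) auto
  moreover have "distr N lborel (\<lambda>w. L w / s) = distr N borel (\<lambda>w. L w / s)" by (rule distr_cong) auto
  ultimately have "distributed N lborel (\<lambda>w. L w / s) (\<lambda>x. ennreal (normal_density 0 1 x))"
   using L unfolding distributed_def by auto
  hence "distributed N lborel L (\<lambda>x. ennreal (normal_density 0 s x))"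
   using normal_standard_normal_convert[OF s(1), of L 0] by simp
  thus ?thesis using s(1) unfolding centered_normal_def by blast
 qed
qed

text \<open>Pointwise limits of centered normal variables are centered normal: the characteristic
 functions \<open>exp (- v\<^sub>k t\<^sup>2 / 2)\<close> converge, and their limit is not \<open>0\<close> near \<open>t = 0\<close>, which bounds \<open>v\<^sub>k\<close>.\<close>

lemma centered_normal_limit:
 assumes N: "prob_space N" and Lk: "\<And>k. Lk k \<in> borel_measurable N" "\<And>k. centered_normal N (Lk k)"
  and lim: "\<And>w. w \<in> space N ==> (\<lambda>k. Lk k w) \<longlonglongrightarrow> L w"
 shows "L \<in> borel_measurable N" "centered_normal N L"
proof -
 interpret prob_space N by (rule N)
 show L: "L \<in> borel_measurable N" by (rule borel_measurable_LIMSEQ_metric[OF Lk(1) lim])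
 have "\<exists>v\<ge>0. \<forall>t. char (distr N borel (Lk k)) t = complex_of_real (exp (- (v * t\<^sup>2) / 2))" for k
  using centered_normal_char[OF N Lk(1) Lk(2), of k] by metis
 then obtain v where v: "\<And>k. 0 <= v k" "\<And>k t. char (distr N borel (Lk k)) t = complex_of_real (exp (- (v k * t\<^sup>2) / 2))"
  by metis
 have chL: "char (distr N borel L) t = (CLINT w|N. iexp (t * L w))" for t
  unfolding char_def using L by (intro integral_distr) auto
 have chk: "char (distr N borel (Lk k)) t = (CLINT w|N. iexp (t * Lk k w))" for t k
  unfolding char_def using Lk(1)[of k] by (intro integral_distr) auto
 have conv: "(\<lambda>k. complex_of_real (exp (- (v k * t\<^sup>2) / 2))) \<longlonglongrightarrow> char (distr N borel L) t" for t
  unfolding v(2)[symmetric] chk chL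
 proof (rule integral_dominated_convergence[where w="\<lambda>_. 1"])
  show "(\<lambda>w. iexp (t * L w)) \<in> borel_measurable N" using L by measurable
  show "(\<lambda>w. iexp (t * Lk k w)) \<in> borel_measurable N" for k using Lk(1)[of k] by measurable
  show "AE w in N. (\<lambda>k. iexp (t * Lk k w)) \<longlonglongrightarrow> iexp (t * L w)"
   by (rule AE_I2) (intro tendsto_intros lim)
 qed auto
 define f where "f t = Re (char (distr N borel L) t)" for t
 have conv': "(\<lambda>k. exp (- (v k * t\<^sup>2) / 2)) \<longlonglongrightarrow> f t" for t
  using tendsto_Re[OF conv[of t]] by (simp add: f_def)
 have chreal: "char (distr N borel L) t = complex_of_real (f t)" for t
  by (rule LIMSEQ_unique[OF conv]) (intro tendsto_of_real conv')
 interpret L: real_distribution "distr N borel L" using L by (rule real_distribution_distr)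
 have "isCont (char (distr N borel L)) 0" by (rule L.isCont_char)
 hence "isCont f 0" unfolding f_def by (intro isCont_Re)
 moreover have "f 0 = 1" unfolding f_def by (simp add: L.char_zero)
 ultimately have "\<forall>\<^sub>F t in at 0. f t > 0"
  using order_tendstoD(1)[of f 1 "at 0" 0] by (simp add: isCont_def)
 hence "\<exists>t. t \<noteq> 0 \<and> f t > 0"
  using eventually_happens[of "\<lambda>t. t \<noteq> 0 \<and> f t > 0" "at 0"] by (auto simp: eventually_at_filter elim: eventually_mono)
 then obtain t0 where t0: "t0 \<noteq> 0" "f t0 > 0" by blast
 have "(\<lambda>k. ln (exp (- (v k * t0\<^sup>2) / 2))) \<longlonglongrightarrow> ln (f t0)" using t0 by (intro tendsto_ln conv') auto
 hence "(\<lambda>k. (- (v k * t0\<^sup>2) / 2) * (- 2 / t0\<^sup>2)) \<longlonglongrightarrow> ln (f t0) * (- 2 / t0\<^sup>2)"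
  unfolding ln_exp by (intro tendsto_intros)
 hence vl: "v \<longlonglongrightarrow> ln (f t0) * (- 2 / t0\<^sup>2)" using t0 by simp
 define V where "V = ln (f t0) * (- 2 / t0\<^sup>2)"
 have V0: "0 <= V" using LIMSEQ_le_const[OF vl] v(1) unfolding V_def by blast
 have "(\<lambda>k. exp (- (v k * t\<^sup>2) / 2)) \<longlonglongrightarrow> exp (- (V * t\<^sup>2) / 2)" for t
  unfolding V_def by (intro tendsto_intros vl) auto
 hence "f t = exp (- (V * t\<^sup>2) / 2)" for t using conv'[of t] LIMSEQ_unique by blast
 thus "centered_normal N L" by (intro char_imp_centered_normal[OF N L V0]) (simp add: chreal)
qed

text \<open>Right-endpoint Riemann sums of a bounded right-continuous function converge to its integral; for
 random paths this exhibits the integral as a limit of linear combinations of coordinates.\<close>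

lemma riemann_sums_right_continuous:
 fixes F :: "real => 'b::euclidean_space"
 assumes as: "a <= s" and F: "bdd_meas a s F"
  and rc: "\<And>t. t \<in> {a..<s} ==> (F \<longlongrightarrow> F t) (at_right t)"
 shows "(\<lambda>m. \<Sum>k\<le>m. ((s - a) / real (Suc m)) *\<^sub>R F (a + real (Suc k) * ((s - a) / real (Suc m)))) \<longlonglongrightarrow> integral {a..s} F"
proof (cases "a = s")
 case False
 hence lt: "a < s" using as by simp
 obtain B where B: "0 <= B" "\<And>t. t \<in> {a..s} ==> norm (F t) <= B" using bdd_meas_bound[OF F] by blast
 define d where "d m = (s - a) / real (Suc m)" for m
 have d0: "0 < d m" for m using lt by (simp add: d_def)
 define p where "p m k = a + real k * d m" for m k
 have pS: "p m (Suc m) = s" for m by (simp add: p_def d_def del: of_nat_Suc)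
 have p_in: "p m k \<in> {a..s}" if "k <= Suc m" for m k
 proof -
  have "real k * d m <= real (Suc m) * d m" using that d0[of m] by (intro mult_right_mono) auto
  thus ?thesis using pS[of m] d0[of m] by (auto simp: p_def)
 qed
 define G where "G m u = (\<Sum>k\<le>m. indicator {p m k..<p m (Suc k)} u *\<^sub>R F (p m (Suc k)))" for m u
 have ind: "indicator {p m k..<p m (Suc k)} u = (if k = nat \<lfloor>(u - a) / d m\<rfloor> then 1 else 0 :: real)" if u: "u \<in> {a..<s}" for m k u
 proof -
  have "0 <= (u - a) / d m" using u d0[of m] by simp
  moreover have "u \<in> {p m k..<p m (Suc k)} \<longleftrightarrow> real k <= (u - a) / d m \<and> (u - a) / d m < real k + 1"
   using d0[of m] by (auto simp: p_def field_simps)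
  ultimately have "u \<in> {p m k..<p m (Suc k)} \<longleftrightarrow> k = nat \<lfloor>(u - a) / d m\<rfloor>" by linarith
  thus ?thesis by (simp only: indicator_def of_bool_def)
 qed
 have km: "nat \<lfloor>(u - a) / d m\<rfloor> <= m" if u: "u \<in> {a..<s}" for m u
 proof -
  have "(u - a) / d m < real (Suc m)" using u d0[of m] pS[of m] by (simp add: pos_divide_less_eq p_def del: of_nat_Suc)
  hence "\<lfloor>(u - a) / d m\<rfloor> < int (Suc m)" by (simp add: floor_less_iff)
  thus ?thesis by linarith
 qed
 have Gu: "G m u = F (p m (Suc (nat \<lfloor>(u - a) / d m\<rfloor>)))" if u: "u \<in> {a..<s}" for m u
 proof -
  have "G m u = (\<Sum>k\<le>m. if k = nat \<lfloor>(u - a) / d m\<rfloor> then F (p m (Suc k)) else 0)"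
   unfolding G_def by (intro sum.cong refl) (simp add: ind[OF u])
  thus ?thesis using km[OF u, of m] by simp
 qed
 have G0: "G m u = 0" if "u \<notin> {a..<s}" for m u
  unfolding G_def
 proof (rule sum.neutral, rule ballI)
  fix k assume "k \<in> {..m}"
  hence "p m k \<in> {a..s}" "p m (Suc k) \<in> {a..s}" using p_in by auto
  hence "u \<notin> {p m k..<p m (Suc k)}" using that by auto
  thus "indicator {p m k..<p m (Suc k)} u *\<^sub>R F (p m (Suc k)) = 0" by simp
 qed
 have near: "u < p m (Suc (nat \<lfloor>(u - a) / d m\<rfloor>))" "p m (Suc (nat \<lfloor>(u - a) / d m\<rfloor>)) <= u + d m" if u: "u \<in> {a..<s}" for m u
 proof -
  have nn: "0 <= (u - a) / d m" using u d0[of m] by simp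
  have "(u - a) / d m < real (nat \<lfloor>(u - a) / d m\<rfloor>) + 1" "real (nat \<lfloor>(u - a) / d m\<rfloor>) <= (u - a) / d m"
   using nn by linarith+
  thus "u < p m (Suc (nat \<lfloor>(u - a) / d m\<rfloor>))" "p m (Suc (nat \<lfloor>(u - a) / d m\<rfloor>)) <= u + d m"
   using d0[of m] by (simp_all add: p_def field_simps)
 qed
 have dl: "d \<longlonglongrightarrow> 0"
  using tendsto_mult_right_zero[OF LIMSEQ_inverse_real_of_nat, of "s - a"] by (simp add: d_def[abs_def] divide_inverse)
 have Gconv: "(\<lambda>m. G m u) \<longlonglongrightarrow> indicator {a..<s} u *\<^sub>R F u" for u
 proof (cases "u \<in> {a..<s}")
  case True
  have "(\<lambda>m. p m (Suc (nat \<lfloor>(u - a) / d m\<rfloor>))) \<longlonglongrightarrow> u"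
  proof (rule real_tendsto_sandwich[where f="\<lambda>_. u" and h="\<lambda>m. u + d m"])
   show "(\<lambda>m. u + d m) \<longlonglongrightarrow> u" using tendsto_add[OF tendsto_const dl, of u] by simp
  qed (use near[OF True] in "auto intro!: always_eventually less_imp_le")
  hence "filterlim (\<lambda>m. p m (Suc (nat \<lfloor>(u - a) / d m\<rfloor>))) (at_right u) sequentially"
   unfolding filterlim_at using near(1)[OF True] by (auto intro!: always_eventually simp: less_imp_neq[THEN not_sym])
  from filterlim_compose[OF rc[OF True] this] show ?thesis using True by (simp add: Gu)
 qed (simp add: G0)
 have Gb: "norm (G m u) <= B * indicator {a..s} u" for m u
 proof (cases "u \<in> {a..<s}")
  case True
  have "p m (Suc (nat \<lfloor>(u - a) / d m\<rfloor>)) \<in> {a..s}" using km[OF True, of m] by (intro p_in) simp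
  thus ?thesis using True B(2) by (simp add: Gu)
 qed (use B in "simp add: G0")
 have Gm: "G m \<in> borel_measurable lborel" for m unfolding G_def by measurable
 have mF: "(\<lambda>u. indicator {a..s} u *\<^sub>R F u) \<in> borel_measurable lborel"
  using bdd_meas_set_integrable[OF F] by (simp add: set_integrable_def)
 have mf: "(\<lambda>u. indicator {a..<s} u *\<^sub>R F u) \<in> borel_measurable lborel"
 proof -
  have "(\<lambda>u. indicator {a..<s} u *\<^sub>R (indicator {a..s} u *\<^sub>R F u)) \<in> borel_measurable lborel"
   by (rule borel_measurable_scaleR[OF borel_measurable_indicator mF]) simp
  moreover have "(\<lambda>u. indicator {a..<s} u *\<^sub>R (indicator {a..s} u *\<^sub>R F u)) = (\<lambda>u. indicator {a..<s} u *\<^sub>R F u)"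
   by (auto simp: indicator_def fun_eq_iff)
  ultimately show ?thesis by simp
 qed
 have "(\<lambda>m. integral\<^sup>L lborel (G m)) \<longlonglongrightarrow> (LBINT u. indicator {a..<s} u *\<^sub>R F u)"
 proof (rule integral_dominated_convergence[where w="\<lambda>u. B * indicator {a..s} u"])
  show "integrable lborel (\<lambda>u. B * indicator {a..s} u :: real)"
   by (intro integrable_mult_right integrable_real_indicator) (auto simp: emeasure_lborel_Icc_eq)
 qed (use Gm mf Gconv Gb in auto)
 moreover have "integral\<^sup>L lborel (G m) = (\<Sum>k\<le>m. d m *\<^sub>R F (p m (Suc k)))" for m
 proof -
  have i: "integrable lborel (\<lambda>u. indicator {p m k..<p m (Suc k)} u :: real)" for k
  proof -
   have "p m k <= p m (Suc k)" using d0[of m] by (simp add: p_def distrib_right)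
   thus ?thesis by (intro integrable_real_indicator) auto
  qed
  have "integral\<^sup>L lborel (G m) = (\<Sum>k\<le>m. LBINT u. indicator {p m k..<p m (Suc k)} u *\<^sub>R F (p m (Suc k)))"
   unfolding G_def by (rule Bochner_Integration.integral_sum) (intro integrable_scaleR_left i)
  also have "... = (\<Sum>k\<le>m. (p m (Suc k) - p m k) *\<^sub>R F (p m (Suc k)))"
   using d0[of m] by (intro sum.cong refl) (simp add: integral_scaleR_left[OF i] measure_def emeasure_lborel_Ico p_def distrib_right)
  finally show ?thesis by (simp add: p_def distrib_right)
 qed
 moreover have "(LBINT u. indicator {a..<s} u *\<^sub>R F u) = integral {a..s} F"
 proof -
  have "(LBINT u. indicator {a..<s} u *\<^sub>R F u) = (LBINT u. indicator {a..s} u *\<^sub>R F u)"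
  proof (rule integral_cong_AE[OF mf mF])
   show "AE u in lborel. indicator {a..<s} u *\<^sub>R F u = indicator {a..s} u *\<^sub>R F u"
    using AE_lborel_singleton[of s] by eventually_elim (auto simp: indicator_def)
  qed
  also have "... = integral {a..s} F"
   using set_borel_integral_eq_integral(2)[OF bdd_meas_set_integrable[OF F]] by (simp add: set_lebesgue_integral_def)
  finally show ?thesis .
 qed
 ultimately show ?thesis by (simp add: d_def p_def)
qed simp
section \<open>Derivatives of the population functionals\<close>

text \<open>Differentiation under the expectation. The uniform Hoelder bound on the conditional densities makes
 the first-order remainder of order \<open>\<bar>b\<^sub>2 - b\<^sub>1\<bar>\<^sup>1\<^sup>+\<^sup>\<gamma>\<close>. Off the support of the covariate
 the densities are arbitrary, so the derivative is expressed through a limit of difference quotients,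
 which is measurable.\<close>

definition quotient_limit :: "(real => 'c => real) => real => 'c => real" where
 "quotient_limit G t z = lim (\<lambda>k. (G (t + 1 / real (Suc k)) z - G t z) * real (Suc k))"

lemma quotient_limit_eq:
 assumes "((\<lambda>s. G s z) has_real_derivative g) (at t)"
 shows "quotient_limit G t z = g"
proof -
 have "((\<lambda>h. (G (t + h) z - G t z) / h) \<longlongrightarrow> g) (at 0)" using assms by (simp add: DERIV_def)
 moreover have "filterlim (\<lambda>k. 1 / real (Suc k)) (at 0) sequentially"
  unfolding filterlim_at using LIMSEQ_inverse_real_of_nat by (auto simp: divide_inverse intro!: always_eventually)
 ultimately have "(\<lambda>k. (G (t + 1 / real (Suc k)) z - G t z) / (1 / real (Suc k))) \<longlonglongrightarrow> g"
  by (rule filterlim_compose)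
 thus ?thesis unfolding quotient_limit_def by (simp add: limI del: of_nat_Suc)
qed

locale smooth_functional = prob_space M for M :: "'a measure" +
 fixes Z :: "'a => real^'d::finite" and C L Hf \<gamma> :: real and supp :: "(real^'d) set"
  and G g :: "real => real^'d => real" and U :: "(real^'d) set"
 assumes Z[measurable]: "Z \<in> borel_measurable M" and C: "AE \<omega> in M. norm (Z \<omega>) <= C" and supp: "AE \<omega> in M. Z \<omega> \<in> supp"
  and Gm: "case_prod G \<in> borel_measurable (borel \<Otimes>\<^sub>M borel)" and Gb: "\<And>t z. \<bar>G t z\<bar> <= 1"
  and der: "\<And>z t. z \<in> supp ==> ((\<lambda>s. G s z) has_real_derivative g t z) (at t)"
  and gb: "\<And>b z. b \<in> U ==> z \<in> supp ==> \<bar>g (z \<bullet> b) z\<bar> <= L"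
  and hoelder: "\<And>b1 b2 z. b1 \<in> U ==> b2 \<in> U ==> z \<in> supp ==>
   \<bar>g (z \<bullet> b1) z - g (z \<bullet> b2) z\<bar> <= Hf * infnorm (b1 - b2) powr \<gamma>"
  and openU: "open U" and \<gamma>: "0 < \<gamma>" and Hf: "0 <= Hf" and L: "0 <= L"
begin

definition func :: "real^'d => real^'d" where
 "func b = (LINT x|M. G (Z x \<bullet> b) (Z x) *\<^sub>R Z x)"

definition density :: "real^'d => 'a => real" where
 "density b x = quotient_limit G (Z x \<bullet> b) (Z x)"

definition jac :: "real^'d => real^'d^'d" where
 "jac b = (LINT x|M. density b x *\<^sub>R outer_prod (Z x))"

lemma C0: "0 <= C"
proof -
 have "AE x in M. 0 <= C" using C by eventually_elim (rule order_trans[OF norm_ge_zero])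
 thus ?thesis using AE_const by simp
qed

lemma G_measurable: "(\<lambda>x. G (Z x \<bullet> b + c) (Z x)) \<in> borel_measurable M"
proof -
 have "(\<lambda>x. (Z x \<bullet> b + c, Z x)) \<in> M \<rightarrow>\<^sub>M borel \<Otimes>\<^sub>M borel" by measurable
 from measurable_compose[OF this Gm] show ?thesis by simp
qed

lemma density_measurable[measurable]: "density b \<in> borel_measurable M"
 unfolding density_def quotient_limit_def
 by (intro borel_measurable_lim_metric borel_measurable_times borel_measurable_diff borel_measurable_const
   G_measurable G_measurable[of b 0, simplified])

lemma outer_prod_Z_measurable[measurable]: "(\<lambda>x. outer_prod (Z x)) \<in> borel_measurable M"
 by (rule measurable_compose[OF Z outer_prod_measurable])

lemma density_AE: "AE x in M. density b x = g (Z x \<bullet> b) (Z x)"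
 using supp by eventually_elim (simp add: density_def quotient_limit_eq[OF der])

lemma G_integrable: "integrable M (\<lambda>x. G (Z x \<bullet> b) (Z x) *\<^sub>R Z x)"
proof (rule integrable_const_bound[of _ C])
 show "AE x in M. norm (G (Z x \<bullet> b) (Z x) *\<^sub>R Z x) <= C"
  using C
 proof eventually_elim
  case (elim x)
  have "\<bar>G (Z x \<bullet> b) (Z x)\<bar> * norm (Z x) <= 1 * C" using elim Gb by (intro mult_mono) auto
  thus ?case by simp
 qed
 show "(\<lambda>x. G (Z x \<bullet> b) (Z x) *\<^sub>R Z x) \<in> borel_measurable M"
  by (rule borel_measurable_scaleR[OF G_measurable[of b 0, simplified] Z])
qed

lemma density_outer_integrable:
 assumes b: "b \<in> U"
 shows "integrable M (\<lambda>x. density b x *\<^sub>R outer_prod (Z x))"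
proof (rule integrable_const_bound[of _ "L * (C * C)"])
 show "AE x in M. norm (density b x *\<^sub>R outer_prod (Z x)) <= L * (C * C)"
  using C supp density_AE[of b]
 proof eventually_elim
  case (elim x)
  have "\<bar>g (Z x \<bullet> b) (Z x)\<bar> * (norm (Z x) * norm (Z x)) <= L * (C * C)"
   using elim gb[OF b] C0 L by (intro mult_mono) auto
  thus ?case using elim by (simp add: norm_outer_prod)
 qed
qed measurable

lemma jac_mult:
 assumes b: "b \<in> U"
 shows "jac b *v h = (LINT x|M. (density b x * (Z x \<bullet> h)) *\<^sub>R Z x)"
  and "integrable M (\<lambda>x. (density b x * (Z x \<bullet> h)) *\<^sub>R Z x)"
proof -
 note bl = bounded_bilinear.bounded_linear_left[OF bounded_bilinear_matrix_vector, of h]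
 have eq: "(density b x *\<^sub>R outer_prod (Z x)) *v h = (density b x * (Z x \<bullet> h)) *\<^sub>R Z x" for x
  by (simp add: scaleR_matrix_vector_assoc[symmetric] outer_prod_mult)
 show "jac b *v h = (LINT x|M. (density b x * (Z x \<bullet> h)) *\<^sub>R Z x)"
  unfolding jac_def by (subst integral_bounded_linear[OF bl density_outer_integrable[OF b], symmetric]) (simp add: eq)
 show "integrable M (\<lambda>x. (density b x * (Z x \<bullet> h)) *\<^sub>R Z x)"
  using integrable_bounded_linear[OF bl density_outer_integrable[OF b]] by (simp add: eq)
qed

lemma func_remainder:
 assumes seg: "closed_segment b1 b2 \<subseteq> U"
 shows "norm (func b2 - func b1 - jac b1 *v (b2 - b1)) <= C * C * Hf * norm (b2 - b1) * norm (b2 - b1) powr \<gamma>"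
proof -
 let ?h = "b2 - b1"
 have b1: "b1 \<in> U" using seg by auto
 define R where "R x = G (Z x \<bullet> b2) (Z x) *\<^sub>R Z x - G (Z x \<bullet> b1) (Z x) *\<^sub>R Z x - (density b1 x * (Z x \<bullet> ?h)) *\<^sub>R Z x" for x
 have iR: "integrable M R" unfolding R_def
  by (intro Bochner_Integration.integrable_diff G_integrable jac_mult(2) b1)
 have "func b2 - func b1 - jac b1 *v ?h = (LINT x|M. R x)"
  unfolding func_def R_def jac_mult(1)[OF b1]
  by (subst Bochner_Integration.integral_diff; (intro Bochner_Integration.integrable_diff G_integrable jac_mult(2) b1)?)+ simp
 also have "norm ... <= (LINT x|M. norm (R x))" by (rule integral_norm_bound)
 also have "... <= C * C * Hf * norm ?h * norm ?h powr \<gamma>"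
 proof (rule integral_le_const[OF integrable_norm[OF iR]])
  show "AE x in M. norm (R x) <= C * C * Hf * norm ?h * norm ?h powr \<gamma>"
   using C supp density_AE[of b1]
  proof eventually_elim
   case (elim x)
   define z where "z = Z x"
   have z: "z \<in> supp" "norm z <= C" using elim by (auto simp: z_def)
   define p where "p t = b1 + t *\<^sub>R ?h" for t :: real
   have "\<exists>t. 0 < t \<and> t < 1 \<and> G (z \<bullet> p 1) z - G (z \<bullet> p 0) z = (1 - 0) * (g (z \<bullet> p t) z * (z \<bullet> ?h))"
   proof (rule MVT2)
    fix t :: real
    have "((\<lambda>t. z \<bullet> p t) has_real_derivative z \<bullet> ?h) (at t)"
     unfolding p_def by (auto intro!: derivative_eq_intros simp: inner_add_right)
    from DERIV_chain2[OF der[OF z(1)] this]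
    show "((\<lambda>t. G (z \<bullet> p t) z) has_real_derivative g (z \<bullet> p t) z * (z \<bullet> ?h)) (at t)" .
   qed simp
   then obtain t where t: "0 < t" "t < 1" "G (z \<bullet> b2) z - G (z \<bullet> b1) z = g (z \<bullet> p t) z * (z \<bullet> ?h)"
    by (auto simp: p_def)
   have "p t \<in> closed_segment b1 b2"
    using t by (auto simp: p_def closed_segment_def algebra_simps intro!: exI[of _ t])
   hence pU: "p t \<in> U" using seg by auto
   have "R x = ((g (z \<bullet> p t) z - g (z \<bullet> b1) z) * (z \<bullet> ?h)) *\<^sub>R z"
    using elim t(3) by (simp add: R_def z_def[symmetric] scaleR_diff_left[symmetric] left_diff_distrib)
   hence "norm (R x) = \<bar>g (z \<bullet> p t) z - g (z \<bullet> b1) z\<bar> * \<bar>z \<bullet> ?h\<bar> * norm z" by (simp add: abs_mult)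
   also have "... <= (Hf * norm ?h powr \<gamma>) * (C * norm ?h) * C"
   proof (intro mult_mono)
    have "infnorm (p t - b1) <= norm ?h"
    proof -
     have "infnorm (p t - b1) = \<bar>t\<bar> * infnorm ?h" by (simp add: p_def infnorm_mul)
     also have "... <= 1 * norm ?h" using t infnorm_le_norm[of ?h] by (intro mult_mono) (auto simp: infnorm_pos_le)
     finally show ?thesis by simp
    qed
    hence "infnorm (p t - b1) powr \<gamma> <= norm ?h powr \<gamma>"
     using \<gamma> by (intro powr_mono2) (auto simp: infnorm_pos_le)
    thus "\<bar>g (z \<bullet> p t) z - g (z \<bullet> b1) z\<bar> <= Hf * norm ?h powr \<gamma>"
     using hoelder[OF pU b1 z(1)] Hf by (meson mult_left_mono order_trans)
    have "\<bar>z \<bullet> ?h\<bar> <= norm z * norm ?h" by (rule Cauchy_Schwarz_ineq2)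
    thus "\<bar>z \<bullet> ?h\<bar> <= C * norm ?h" using z(2) by (meson mult_right_mono norm_ge_zero order_trans)
   qed (use z Hf C0 in auto)
   finally show ?case by (simp add: mult_ac)
  qed
 qed
 finally show ?thesis .
qed

lemma jac_hoelder:
 assumes b: "b1 \<in> U" "b2 \<in> U"
 shows "norm (jac b1 - jac b2) <= C * C * Hf * norm (b1 - b2) powr \<gamma>"
proof -
 have "jac b1 - jac b2 = (LINT x|M. density b1 x *\<^sub>R outer_prod (Z x) - density b2 x *\<^sub>R outer_prod (Z x))"
  unfolding jac_def by (rule Bochner_Integration.integral_diff[symmetric]) (intro density_outer_integrable b)+
 also have "norm ... <= (LINT x|M. norm (density b1 x *\<^sub>R outer_prod (Z x) - density b2 x *\<^sub>R outer_prod (Z x)))"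
  by (rule integral_norm_bound)
 also have "... <= C * C * Hf * norm (b1 - b2) powr \<gamma>"
 proof (rule integral_le_const)
  show "integrable M (\<lambda>x. norm (density b1 x *\<^sub>R outer_prod (Z x) - density b2 x *\<^sub>R outer_prod (Z x)))"
   by (intro integrable_norm Bochner_Integration.integrable_diff density_outer_integrable b)
  show "AE x in M. norm (density b1 x *\<^sub>R outer_prod (Z x) - density b2 x *\<^sub>R outer_prod (Z x)) <= C * C * Hf * norm (b1 - b2) powr \<gamma>"
   using C supp density_AE[of b1] density_AE[of b2]
  proof eventually_elim
   case (elim x)
   have "infnorm (b1 - b2) powr \<gamma> <= norm (b1 - b2) powr \<gamma>"
    using \<gamma> by (intro powr_mono2 infnorm_le_norm) (auto simp: infnorm_pos_le)
   hence "\<bar>density b1 x - density b2 x\<bar> <= Hf * norm (b1 - b2) powr \<gamma>"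
    using hoelder[OF b, of "Z x"] elim Hf by (metis mult_left_mono order_trans)
   hence "\<bar>density b1 x - density b2 x\<bar> * (norm (Z x) * norm (Z x)) <= (Hf * norm (b1 - b2) powr \<gamma>) * (C * C)"
    using elim C0 Hf by (intro mult_mono) auto
   thus ?case by (simp add: scaleR_diff_left[symmetric] norm_outer_prod mult_ac)
  qed
 qed
 finally show ?thesis .
qed

lemma jac_norm_le:
 assumes b: "b \<in> U"
 shows "norm (jac b) <= L * (C * C)"
proof -
 have "norm (jac b) <= (LINT x|M. norm (density b x *\<^sub>R outer_prod (Z x)))"
  unfolding jac_def by (rule integral_norm_bound)
 also have "... <= L * (C * C)"
 proof (rule integral_le_const[OF integrable_norm[OF density_outer_integrable[OF b]]])
  show "AE x in M. norm (density b x *\<^sub>R outer_prod (Z x)) <= L * (C * C)"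
   using C supp density_AE[of b]
  proof eventually_elim
   case (elim x)
   have "\<bar>g (Z x \<bullet> b) (Z x)\<bar> * (norm (Z x) * norm (Z x)) <= L * (C * C)"
    using elim gb[OF b] C0 L by (intro mult_mono) auto
   thus ?case using elim by (simp add: norm_outer_prod)
  qed
 qed
 finally show ?thesis .
qed

lemma func_has_derivative:
 assumes b: "b \<in> U"
 shows "(func has_derivative (*v) (jac b)) (at b)"
 unfolding has_derivative_at_alt
proof (intro conjI allI impI)
 show "bounded_linear ((*v) (jac b))" by simp
 fix e :: real assume e: "0 < e"
 obtain r where r: "r > 0" "ball b r \<subseteq> U" using openU b by (auto simp: open_contains_ball)
 define K where "K = C * C * Hf"
 have K0: "0 <= K" using C0 Hf by (simp add: K_def)
 define d where "d = min r ((e / (K + 1)) powr (1 / \<gamma>))"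
 have d0: "0 < d" using r e K0 by (auto simp: d_def)
 show "\<exists>d>0. \<forall>y. norm (y - b) < d --> norm (func y - func b - jac b *v (y - b)) <= e * norm (y - b)"
 proof (intro exI[of _ d] conjI allI impI d0)
  fix y assume y: "norm (y - b) < d"
  have "closed_segment b y \<subseteq> ball b r"
   using y r by (intro closed_segment_subset) (auto simp: d_def dist_norm norm_minus_commute)
  hence "norm (func y - func b - jac b *v (y - b)) <= K * norm (y - b) * norm (y - b) powr \<gamma>"
   unfolding K_def using r by (intro func_remainder) auto
  also have "... <= e * norm (y - b)"
  proof -
   have "norm (y - b) powr \<gamma> <= ((e / (K + 1)) powr (1 / \<gamma>)) powr \<gamma>"
    using y \<gamma> by (intro powr_mono2) (auto simp: d_def)
   also have "... = e / (K + 1)" using \<gamma> e K0 by (simp add: powr_powr)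
   finally have "K * norm (y - b) powr \<gamma> <= (K + 1) * (e / (K + 1))" using K0 by (intro mult_mono) auto
   hence "K * norm (y - b) powr \<gamma> <= e" using K0 by simp
   thus ?thesis using mult_right_mono[of "K * norm (y - b) powr \<gamma>" e "norm (y - b)"] by (simp add: mult_ac)
  qed
  finally show "norm (func y - func b - jac b *v (y - b)) <= e * norm (y - b)" .
 qed
qed

lemma func_lipschitz:
 assumes seg: "closed_segment b1 b2 \<subseteq> U"
 shows "norm (func b2 - func b1) <= L * (C * C) * norm (b2 - b1)"
proof (rule differentiable_bound[of "closed_segment b1 b2" func "\<lambda>b. (*v) (jac b)"])
 fix b assume "b \<in> closed_segment b1 b2"
 hence b: "b \<in> U" using seg by auto
 show "(func has_derivative (*v) (jac b)) (at b within closed_segment b1 b2)"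
  by (rule has_derivative_at_withinI[OF func_has_derivative[OF b]])
 show "onorm ((*v) (jac b)) <= L * (C * C)"
 proof (rule onorm_le)
  fix x show "norm (jac b *v x) <= L * (C * C) * norm x"
   using norm_matrix_vector_le[of "jac b" x] jac_norm_le[OF b] by (meson mult_right_mono norm_ge_zero order_trans)
 qed
qed auto

lemma jac_symmetric:
 assumes b: "b \<in> U"
 shows "x \<bullet> (jac b *v y) = (jac b *v x) \<bullet> y"
proof -
 have "x \<bullet> (jac b *v y) = (LINT z|M. x \<bullet> ((density b z * (Z z \<bullet> y)) *\<^sub>R Z z))"
  unfolding jac_mult(1)[OF b] by (rule integral_inner_right[symmetric]) (rule jac_mult(2)[OF b])
 also have "... = (LINT z|M. ((density b z * (Z z \<bullet> x)) *\<^sub>R Z z) \<bullet> y)"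
  by (intro Bochner_Integration.integral_cong refl) (simp add: inner_commute mult_ac)
 also have "... = (jac b *v x) \<bullet> y"
  unfolding jac_mult(1)[OF b] by (rule integral_inner_left) (rule jac_mult(2)[OF b])
 finally show ?thesis .
qed

end


section \<open>The population estimating equation\<close>

lemma Collect_in_sets: "Measurable.pred N P ==> space N = UNIV ==> {x. P x} \<in> sets N"
 by (simp add: pred_def)

text \<open>The law of the response is the image of the uniform law under its quantile function, so
 \<open>P(T <= Q(s), T <= C) = \<integral> 1{Q(u) <= Q(s)} P(C >= Q(u)) du\<close>. The response may have atoms, but continuity of
 the subdistribution of uncensored responses forces \<open>P(C >= x) = 0\<close> at every atom \<open>x\<close>. Hence the
 indicator may be replaced by \<open>1{u <= s}\<close>, and \<open>P(C >= Q(u)) = P(T \<and> C >= Q(u)) / (1 - u)\<close>.\<close>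

lemma quantile_identity:
 fixes P :: "(real \<times> real) measure" and q :: "real => real"
 assumes P: "prob_space P" and sP: "sets P = sets borel"
  and indep: "prob_space.indep_var P borel fst borel snd"
  and p: "0 < tL" "tU < 1"
  and q: "\<And>p. p \<in> {tL..tU} ==> Inf {t. measure P {(x, c). x <= t} >= p} = q p"
  and cont: "\<And>t. isCont (\<lambda>t. measure P {(x, c). min x c <= t \<and> min x c = x}) t"
  and t1: "t1 \<in> {tL..tU}" and early: "AE v in P. q t1 < snd v"
  and s: "s \<in> {tL..tU}"
 shows "measure P {(x, c). min x c <= q s \<and> min x c = x}
   = tL + integral {tL..s} (\<lambda>u. (1 / (1 - u)) *\<^sub>R measure P {(x, c). min x c >= q u})"
  and "s <= t1 ==> measure P {(x, c). min x c <= q s \<and> min x c = x} = s"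
  and "bdd_meas tL tU (\<lambda>u. measure P {(x, c). min x c >= q u})"
proof -
 interpret P: prob_space P by (rule P)
 have spP: "space P = UNIV" using sets_eq_imp_space_eq[OF sP] by simp
 have fst_m[measurable]: "fst \<in> borel_measurable P" and snd_m[measurable]: "snd \<in> borel_measurable P"
  using sP by (simp_all add: measurable_cong_sets[OF sP refl] borel_prod[symmetric])
 define D where "D = distr P borel fst"
 define E where "E = distr P borel snd"
 interpret D: cdf_distribution D
  unfolding D_def cdf_distribution_def by (rule P.real_distribution_distr) simp
 interpret E: real_distribution E unfolding E_def by (rule P.real_distribution_distr) simp
 have joint: "distr P (borel \<Otimes>\<^sub>M borel) (\<lambda>v. (fst v, snd v)) = D \<Otimes>\<^sub>M E"
  using indep unfolding P.indep_var_distribution_eq D_def E_def by simp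
 have idm: "(\<lambda>v. v) \<in> P \<rightarrow>\<^sub>M borel \<Otimes>\<^sub>M borel"
  by (simp add: measurable_cong_sets[OF sP refl] borel_prod)
 have meas_pair: "measure P A = measure (D \<Otimes>\<^sub>M E) A" if "A \<in> sets (borel \<Otimes>\<^sub>M borel)" for A
  using measure_distr[OF idm that] joint by (simp add: spP)
 define G where "G x = measure E {x..}" for x
 have prodset: "measure P {v. fst v \<in> A \<and> snd v \<in> B} = measure D A * measure E B" if "A \<in> sets borel" "B \<in> sets borel" for A B
 proof -
  have "{v. fst v \<in> A \<and> snd v \<in> B} = A \<times> B" by auto
  moreover have "emeasure (D \<Otimes>\<^sub>M E) (A \<times> B) = emeasure D A * emeasure E B"
   by (rule E.emeasure_pair_measure_Times) (simp_all add: that)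
  moreover have "A \<times> B \<in> sets (borel \<Otimes>\<^sub>M borel)" using that by (rule pair_measureI)
  ultimately show ?thesis using meas_pair[of "A \<times> B"] by (simp add: measure_def enn2real_mult)
 qed
 have G01: "0 <= G x" "G x <= 1" for x by (auto simp: G_def)
 have G_anti: "G y <= G x" if "x <= y" for x y unfolding G_def by (rule E.finite_measure_mono) (use that in auto)
 have Gm[measurable]: "G \<in> borel_measurable borel"
 proof -
  have "(\<lambda>x. - G x) \<in> borel_measurable borel" by (rule borel_measurable_mono) (auto simp: mono_def intro: G_anti)
  thus ?thesis using borel_measurable_uminus_eq by blast
 qed
 have cdfD: "cdf D t = measure P {(x, c). x <= t}" for t
  unfolding cdf_def D_def by (subst measure_distr) (auto intro!: arg_cong[where f="measure P"] simp: spP)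
 define J where "J u = Inf {x. u <= cdf D x}" for u
 have Jq: "J u = q u" if "u \<in> {tL..tU}" for u using q[OF that] by (simp add: J_def cdfD)
 have pinv: "u <= cdf D x \<longleftrightarrow> J u <= x" if "0 < u" "u < 1" for u x unfolding J_def by (rule D.pseudoinverse[OF that])
 have Jmono: "J u <= J v" if "0 < u" "u <= v" "v < 1" for u v
  using pinv[of u "J v"] pinv[of v "J v"] that by linarith
 define F where "F t = measure P {(x, c). min x c <= t \<and> min x c = x}" for t
 have Fset: "{(x, c). min x c <= t \<and> min x c = x} = {v :: real \<times> real. fst v <= t \<and> fst v <= snd v}" for t by auto
 have Fs_sets: "{v :: real \<times> real. fst v <= t \<and> fst v <= snd v} \<in> sets P" for t
 proof -
  have "{v :: real \<times> real. fst v <= t \<and> fst v <= snd v} \<in> sets (borel \<Otimes>\<^sub>M borel)"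
   by (rule Collect_in_sets) (measurable, simp add: space_pair_measure)
  thus ?thesis by (metis borel_prod sP)
 qed
 have jump: "measure D {x} * G x = 0" for x
 proof -
  have le: "measure D {x} * G x <= F x - F t" if "t < x" for t
  proof -
   have "measure D {x} * G x = measure P {v. fst v \<in> {x} \<and> snd v \<in> {x..}}" unfolding G_def by (rule prodset[symmetric]) auto
   also have "... <= measure P ({v. fst v <= x \<and> fst v <= snd v} - {v. fst v <= t \<and> fst v <= snd v})"
    by (rule P.finite_measure_mono) (use that Fs_sets in auto)
   also have "... = F x - F t"
    unfolding F_def Fset
    by (rule P.finite_measure_Diff) (use that Fs_sets in auto)
   finally show ?thesis .
  qed
  have "(F \<longlongrightarrow> F x) (at_left x)"
   using cont[of x] unfolding F_def[symmetric] isCont_def by (rule tendsto_mono[rotated]) (simp add: at_le)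
  hence "((\<lambda>t. F x - F t) \<longlongrightarrow> F x - F x) (at_left x)" by (intro tendsto_intros)
  hence "measure D {x} * G x <= F x - F x"
   by (rule tendsto_lowerbound) (use le in \<open>auto simp: eventually_at_left_field intro!: exI[of _ "x - 1"]\<close>)
  moreover have "0 <= measure D {x} * G x" using G01[of x] by simp
  ultimately show ?thesis by linarith
 qed
 have below: "measure D {..<J u} <= u" if u: "0 < u" "u < 1" for u
 proof (rule tendsto_upperbound[OF D.cdf_at_left])
  show "\<forall>\<^sub>F t in at_left (J u). cdf D t <= u"
  proof -
   have "cdf D t <= u" if "t < J u" for t using pinv[OF u, of t] that by linarith
   thus ?thesis by (auto simp: eventually_at_left_field intro!: exI[of _ "J u - 1"])
  qed
 qed simp
 have no_atom: "cdf D (J u) = u" "measure D {..<J u} = u" if u: "0 < u" "u < 1" and "measure D {J u} = 0" for u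
 proof -
  have "{..J u} = {..<J u} \<union> {J u}" by auto
  hence "cdf D (J u) = measure D ({..<J u} \<union> {J u})" by (simp only: cdf_def)
  also have "... = measure D {..<J u} + measure D {J u}" by (rule D.finite_measure_Union) auto
  finally have "cdf D (J u) = measure D {..<J u} + measure D {J u}" .
  moreover have "u <= cdf D (J u)" using pinv[OF u, of "J u"] by simp
  ultimately show "cdf D (J u) = u" "measure D {..<J u} = u" using below[OF u] that(3) by linarith+
 qed
 have surv: "measure P {(x, c). min x c >= J u} = (1 - u) * G (J u)" if u: "0 < u" "u < 1" for u
 proof -
  have "{(x, c). min x c >= J u} = {v :: real \<times> real. fst v \<in> {J u..} \<and> snd v \<in> {J u..}}" by auto
  hence eq: "measure P {(x, c). min x c >= J u} = measure D {J u..} * G (J u)"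
   using prodset[of "{J u..}" "{J u..}"] by (simp add: G_def)
  show ?thesis
  proof (cases "G (J u) = 0")
   case False
   hence "measure D {J u} = 0" using jump[of "J u"] by simp
   hence "measure D {..<J u} = u" by (rule no_atom(2)[OF u])
   moreover have "space D - {..<J u} = {J u..}" by auto
   ultimately have "measure D {J u..} = 1 - u" using D.prob_compl[of "{..<J u}"] by simp
   thus ?thesis using eq by simp
  qed (use eq in simp)
 qed
 have Jm: "(\<lambda>u. indicator {0<..<1} u * k (J u)) \<in> borel_measurable lborel" if "k \<in> borel_measurable borel" for k :: "real => real"
 proof -
  have "(\<lambda>u. k (J u)) \<in> borel_measurable (restrict_space borel {0<..<1})"
   using measurable_compose[OF D.measurable_CI that] by (simp add: J_def)
  thus ?thesis by (simp add: borel_measurable_restrict_space_iff mult.commute)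
 qed
 have F_int: "F t = (LINT u|lborel. indicator {0<..<1} u * (indicator {..t} (J u) * G (J u)))" for t
 proof -
  let ?X = "{v :: real \<times> real. fst v <= t \<and> fst v <= snd v}"
  have X: "?X \<in> sets (borel \<Otimes>\<^sub>M borel)"
   by (rule Collect_in_sets) (measurable, simp add: space_pair_measure)
  have intG: "integrable D (\<lambda>x. indicator {..t} x * G x)"
   by (rule D.integrable_const_bound[of _ 1]) (use G01 in "auto simp: indicator_def")
  have "ennreal (F t) = emeasure (D \<Otimes>\<^sub>M E) ?X"
   unfolding F_def Fset meas_pair[OF X] joint[symmetric]
   by (rule finite_measure.emeasure_eq_measure[symmetric], rule prob_space.finite_measure, rule P.prob_space_distr) (simp add: idm)
  also have "... = (\<integral>\<^sup>+ x. emeasure E (Pair x -` ?X) \<partial>D)"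
   by (rule E.emeasure_pair_measure_alt) (use X in "simp cong: sets_pair_measure_cong")
  also have "... = (\<integral>\<^sup>+ x. ennreal (indicator {..t} x * G x) \<partial>D)"
  proof (rule nn_integral_cong)
   fix x
   have "Pair x -` ?X = (if x <= t then {x..} else {})" by auto
   thus "emeasure E (Pair x -` ?X) = ennreal (indicator {..t} x * G x)"
    by (simp add: E.emeasure_eq_measure G_def indicator_def)
  qed
  also have "... = ennreal (LINT x|D. indicator {..t} x * G x)"
   using G01 by (intro nn_integral_eq_integral intG) auto
  finally have "F t = (LINT x|D. indicator {..t} x * G x)"
   by (subst (asm) ennreal_inj) (use G01 in "auto simp: F_def intro!: integral_nonneg_AE")
  also have "... = (LINT x|distr (restrict_space lborel {0<..<1}) borel J. indicator {..t} x * G x)"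
   using D.distr_I_eq_M by (simp add: J_def[abs_def])
  also have "... = (LINT u|restrict_space lborel {0<..<1}. indicator {..t} (J u) * G (J u))"
  proof (rule integral_distr)
   show "J \<in> restrict_space lborel {0<..<1} \<rightarrow>\<^sub>M borel"
    using D.measurable_CI by (simp add: J_def[abs_def] cong: measurable_cong_sets)
  qed measurable
  also have "... = (LINT u|lborel. indicator {0<..<1} u * (indicator {..t} (J u) * G (J u)))"
   by (subst integral_restrict_space) auto
  finally show ?thesis .
 qed
 have int_GJ: "set_integrable lborel S (\<lambda>u. G (J u))" if "S \<subseteq> {0<..<1}" "S \<in> sets borel" for S
 proof -
  have "set_integrable lborel {0<..<1} (\<lambda>u. G (J u))"
   unfolding set_integrable_def
   by (rule integrableI_bounded_set[where A="{0<..<1}" and B=1])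
    (use Jm[OF Gm] G01 in "auto simp: indicator_def")
  thus ?thesis by (rule set_integrable_subset) (use that in auto)
 qed
 have flat: "indicator {0<..<1} u * (indicator {..J t} (J u) * G (J u)) = indicator {0<..t} u * G (J u)"
  if t: "0 < t" "t < 1" for t u
 proof (cases "u \<in> {0<..<1}")
  case u: True
  show ?thesis
  proof (cases "u <= t")
   case True thus ?thesis using Jmono[of u t] u t by (simp add: indicator_def)
  next
   case False
   show ?thesis
   proof (cases "J u <= J t")
    case True
    hence eq: "J u = J t" using Jmono[of t u] False u t by auto
    have "G (J u) = 0"
    proof (rule ccontr)
     assume "G (J u) \<noteq> 0"
     hence at0: "measure D {J u} = 0" using jump[of "J u"] by simp
     have "cdf D (J u) = u" by (rule no_atom(1)[OF _ _ at0]) (use u in simp_all)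
     moreover have "cdf D (J t) = t" by (rule no_atom(1)[OF t at0[unfolded eq]])
     ultimately have "u = t" unfolding eq by simp
     thus False using False by simp
    qed
    thus ?thesis by simp
   qed (use False in "simp add: indicator_def")
  qed
 qed (use t in "auto simp: indicator_def")
 have G1: "G (J u) = 1" if u: "0 < u" "u <= t1" for u
 proof -
  have "J u <= q t1" using Jmono[of u t1] Jq[OF t1] u p t1 by auto
  hence "AE v in P. J u <= snd v" using early by (auto elim!: eventually_mono)
  hence "AE v in P. snd v \<in> {J u..}" by simp
  hence "AE x in E. x \<in> {J u..}" unfolding E_def by (subst AE_distr_iff) auto
  thus ?thesis unfolding G_def using E.prob_eq_1[of "{J u..}"] by simp
 qed
 have Fs: "F (J t) = (LINT u:{0<..t}|lborel. G (J u))" if "0 < t" "t < 1" for t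
  unfolding F_int set_lebesgue_integral_def by (intro Bochner_Integration.integral_cong refl) (simp add: flat[OF that])
 have one: "(LINT u:{0<..t}|lborel. G (J u)) = t" if "0 < t" "t <= t1" for t
 proof -
  have "(LINT u:{0<..t}|lborel. G (J u)) = (LINT u:{0<..t}|lborel. 1)"
   by (rule set_lebesgue_integral_cong) (use G1 that in auto)
  also have "... = t" using that by (simp add: set_lebesgue_integral_def)
  finally show ?thesis .
 qed
 have s01: "0 < s" "s < 1" and L1: "tL <= t1" using s p t1 by auto
 have survq: "measure P {(x, c). min x c >= q u} = (1 - u) * G (J u)" if "u \<in> {tL..tU}" for u
 proof -
  have "0 < u" "u < 1" using that p by auto
  from surv[OF this] show ?thesis unfolding Jq[OF that] .
 qed
 show bm: "bdd_meas tL tU (\<lambda>u. measure P {(x, c). min x c >= q u})"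
  unfolding bdd_meas_def
 proof
  have "(\<lambda>u. (1 - u) * (indicator {0<..<1} u * G (J u))) \<in> borel_measurable borel"
   using Jm[OF Gm] by simp
  hence "(\<lambda>u. (1 - u) * (indicator {0<..<1} u * G (J u))) \<in> borel_measurable (restrict_space borel {tL..tU})"
   by (rule measurable_restrict_space1)
  thus "(\<lambda>u. measure P {(x, c). min x c >= q u}) \<in> borel_measurable (restrict_space borel {tL..tU})"
  proof (rule measurable_cong[THEN iffD1, rotated])
   fix w assume "w \<in> space (restrict_space borel {tL..tU})"
   hence w: "w \<in> {tL..tU}" by (simp add: space_restrict_space)
   show "(1 - w) * (indicator {0<..<1} w * G (J w)) = measure P {(x, c). min x c >= q w}"
    unfolding survq[OF w] using w p by simp
  qed
  show "bounded ((\<lambda>u. measure P {(x, c). min x c >= q u}) ` {tL..tU})"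
   by (auto simp: bounded_iff intro!: exI[of _ 1])
 qed
 show "measure P {(x, c). min x c <= q s \<and> min x c = x} = s" if "s <= t1"
  using Fs[OF s01] one[OF s01(1) that] Jq[OF s] by (simp add: F_def)
 have "measure P {(x, c). min x c <= q s \<and> min x c = x} = (LINT u:{0<..s}|lborel. G (J u))"
  using Fs[OF s01] Jq[OF s] by (simp add: F_def)
 also have "{0<..s} = {0<..tL} \<union> {tL<..s}" using s p by auto
 also have "(LINT u:{0<..tL} \<union> {tL<..s}|lborel. G (J u)) = (LINT u:{0<..tL}|lborel. G (J u)) + (LINT u:{tL<..s}|lborel. G (J u))"
  by (rule set_integral_Un) (use s p in "auto intro!: int_GJ")
 also have "(LINT u:{0<..tL}|lborel. G (J u)) = tL" by (rule one[OF p(1) L1])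
 also have "(LINT u:{tL<..s}|lborel. G (J u)) = (LINT u:{tL<..s}|dH. measure P {(x, c). min x c >= q u})"
 proof -
  have gm: "(\<lambda>u. indicator {tL<..s} u *\<^sub>R measure P {(x, c). min x c >= q u}) \<in> borel_measurable lborel"
  proof -
   have "(\<lambda>u. indicator {tL<..s} u * ((1 - u) * (indicator {0<..<1} u * G (J u)))) \<in> borel_measurable lborel"
    using Jm[OF Gm] by simp
   moreover have "(\<lambda>u. indicator {tL<..s} u * ((1 - u) * (indicator {0<..<1} u * G (J u))))
     = (\<lambda>u. indicator {tL<..s} u *\<^sub>R measure P {(x, c). min x c >= q u})"
   proof
    fix u
    show "indicator {tL<..s} u * ((1 - u) * (indicator {0<..<1} u * G (J u)))
     = indicator {tL<..s} u *\<^sub>R measure P {(x, c). min x c >= q u}"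
    proof (cases "u \<in> {tL<..s}")
     case True
     hence u: "u \<in> {tL..tU}" using s by auto
     show ?thesis unfolding survq[OF u] using u p by simp
    qed simp
   qed
   ultimately show ?thesis by simp
  qed
  have w: "(\<lambda>u. indicator {..<1} u * (1 / (1 - u)) :: real) \<in> borel_measurable lborel"
   "AE x in lborel. 0 <= (indicator {..<1} x * (1 / (1 - x)) :: real)"
   by (auto simp: indicator_def intro!: AE_I2)
  show ?thesis
   unfolding set_lebesgue_integral_def dH_def integral_density[OF gm w]
  proof (intro Bochner_Integration.integral_cong refl)
   fix u
   show "indicator {tL<..s} u *\<^sub>R G (J u)
    = (indicator {..<1} u * (1 / (1 - u))) *\<^sub>R indicator {tL<..s} u *\<^sub>R measure P {(x, c). min x c >= q u}"
   proof (cases "u \<in> {tL<..s}")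
    case True
    hence u: "u \<in> {tL..tU}" using s by auto
    show ?thesis unfolding survq[OF u] using u p by simp
   qed simp
  qed
 qed
 also have "... = integral {tL..s} (\<lambda>u. (1 / (1 - u)) *\<^sub>R measure P {(x, c). min x c >= q u})"
  by (rule hazard_integral_eq(1)[OF bm]) (use s p in auto)
 finally show "measure P {(x, c). min x c <= q s \<and> min x c = x}
   = tL + integral {tL..s} (\<lambda>u. (1 / (1 - u)) *\<^sub>R measure P {(x, c). min x c >= q u})" .
qed
lemma AE_in_support:
 fixes Z :: "'a => 'b::second_countable_topology"
 assumes M: "prob_space M" and Z[measurable]: "Z \<in> borel_measurable M"
 shows "AE x in M. Z x \<in> support M Z"
proof -
 interpret prob_space M by (rule M)
 obtain B :: "'b set set" where B: "countable B" "topological_basis B" using ex_countable_basis by blast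
 have open_events: "{x \<in> space M. Z x \<in> b} \<in> events" if "open b" for b
  using measurable_sets[OF Z borel_open[OF that]] by (simp add: vimage_def Int_def conj_commute)
 have "AE x in M. Z x \<notin> b" if "b \<in> {b \<in> B. prob {x \<in> space M. Z x \<in> b} = 0}" for b
 proof -
  have "open b" using that B(2) topological_basis_open by blast
  hence "{x \<in> space M. Z x \<in> b} \<in> events" by (rule open_events)
  hence "AE x in M. x \<notin> {x \<in> space M. Z x \<in> b}" using that by (simp add: prob_eq_0)
  thus ?thesis using AE_space by eventually_elim auto
 qed
 moreover have "countable {b \<in> B. prob {x \<in> space M. Z x \<in> b} = 0}" using B(1) by (rule countable_subset[rotated]) auto
 ultimately have "AE x in M. \<forall>b\<in>{b \<in> B. prob {x \<in> space M. Z x \<in> b} = 0}. Z x \<notin> b"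
  by (subst AE_ball_countable) auto
 thus ?thesis
 proof eventually_elim
  case (elim x)
  show ?case
  proof (rule ccontr)
   assume "Z x \<notin> support M Z"
   then obtain U where U: "open U" "Z x \<in> U" "\<not> 0 < prob {x \<in> space M. Z x \<in> U}" by (auto simp: support_def)
   obtain b where b: "b \<in> B" "Z x \<in> b" "b \<subseteq> U" using topological_basisE[OF B(2) U(1,2)] by blast
   have "{x \<in> space M. Z x \<in> U} \<in> events" by (rule open_events[OF U(1)])
   hence "prob {x \<in> space M. Z x \<in> b} <= prob {x \<in> space M. Z x \<in> U}"
    using b by (intro finite_measure_mono) auto
   hence "prob {x \<in> space M. Z x \<in> b} = 0" using U(3) measure_nonneg[of M] by (metis not_less order_antisym)
   thus False using elim b by blast
  qed
 qed
qed

lemma quantile_mono: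
 fixes P :: "(real \<times> real) measure"
 assumes P: "prob_space P" and sP: "sets P = sets borel" and u: "0 < u" "u <= v" "v < 1"
 shows "Inf {t. measure P {(x, c). x <= t} >= u} <= Inf {t. measure P {(x, c). x <= t} >= v}"
proof -
 interpret P: prob_space P by (rule P)
 have spP: "space P = UNIV" using sets_eq_imp_space_eq[OF sP] by simp
 have fst_m[measurable]: "fst \<in> borel_measurable P"
  using sP by (simp_all add: measurable_cong_sets[OF sP refl] borel_prod[symmetric])
 interpret D: cdf_distribution "distr P borel fst"
  unfolding cdf_distribution_def by (rule P.real_distribution_distr) simp
 have cdfD: "cdf (distr P borel fst) t = measure P {(x, c). x <= t}" for t
  unfolding cdf_def by (subst measure_distr) (auto intro!: arg_cong[where f="measure P"] simp: spP)
 let ?J = "\<lambda>u. Inf {x. u <= cdf (distr P borel fst) x}"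
 have "v <= cdf (distr P borel fst) (?J v)" using D.pseudoinverse[of v "?J v"] u by simp
 hence "?J u <= ?J v" using D.pseudoinverse[of u "?J v"] u by linarith
 thus ?thesis by (simp add: cdfD)
qed

lemma nbhd_open_iff:
 assumes "tL <= tU"
 shows "b \<in> nbhd_open c tL tU e \<longleftrightarrow> (\<exists>t\<in>{tL..tU}. infnorm (b - c t) < e)"
 unfolding nbhd_open_def using assms
 by (simp, subst cINF_less_iff) (auto intro!: bdd_belowI[of _ 0] simp: infnorm_pos_le)

lemma nbhd_open_subset_closed: "nbhd_open b tL tU e \<subseteq> nbhd_closed b tL tU e"
 by (auto simp: nbhd_open_def nbhd_closed_def)

lemma open_nbhd_open:
 assumes "tL <= tU"
 shows "open (nbhd_open c tL tU e)"
proof -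
 have "nbhd_open c tL tU e = (\<Union>t\<in>{tL..tU}. {b. infnorm (b - c t) < e})"
  using nbhd_open_iff[OF assms] by blast
 moreover have "open {b. infnorm (b - c t) < e}" for t
  by (intro open_Collect_less continuous_intros continuous_on_infnorm)
 ultimately show ?thesis by auto
qed

text \<open>The population model, with the constants of the regularity conditions made explicit. All bounds are
 in terms of the Euclidean norm, which is equivalent to the maximum norm.\<close>

locale cqr_population = prob_space M for M :: "'a measure" +
 fixes Y :: "'a => 'd::finite datum" and K :: "real^'d => (real \<times> real) measure" and \<beta> :: "real => real^'d"
  and tL tU a \<epsilon> \<gamma> C L Hf l0 C4 :: real
  and Z :: "'a => real^'d" and U supp :: "(real^'d) set"
 defines "Z \<equiv> \<lambda>\<omega>. covar (Y \<omega>)" and "supp \<equiv> support M Z" and "U \<equiv> nbhd_open \<beta> tL tU \<epsilon>"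
 assumes Ym: "Y \<in> borel_measurable M" and taus: "0 < tL" "tL < tU" "tU < 1"
  and kernel: "regular_cond_dist M (\<lambda>\<omega>. (resp (Y \<omega>), cens (Y \<omega>))) Z K"
  and cond_indep: "AE \<omega> in M. prob_space.indep_var (K (Z \<omega>)) borel fst borel snd"
  and lin_quantile: "\<And>\<tau>. \<tau> \<in> {tL..tU} ==> AE \<omega> in M. cond_quantile K \<tau> (Z \<omega>) = Z \<omega> \<bullet> \<beta> \<tau>"
  and densities: "\<And>z t. z \<in> supp ==> (\<lambda>s. F_cond K s z) field_differentiable (at t)"
   "\<And>z t. z \<in> supp ==> (\<lambda>s. Ft_cond K s z) field_differentiable (at t)"
  and early: "0 < a" "tL + a <= tU" "AE \<omega> in M. cens (Y \<omega>) > Z \<omega> \<bullet> \<beta> (tL + a)"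
  and eps: "0 < \<epsilon>" and C: "AE \<omega> in M. norm (Z \<omega>) <= C"
  and C4: "0 <= C4" "\<And>\<tau> \<tau>'. \<tau> \<in> {tL..tU} ==> \<tau>' \<in> {tL..tU} ==> norm (\<beta> \<tau> - \<beta> \<tau>') <= C4 * \<bar>\<tau> - \<tau>'\<bar>"
  and L: "0 <= L" "\<And>b z. b \<in> U ==> z \<in> supp ==> f_cond K (z \<bullet> b) z <= L"
   "\<And>b z. b \<in> U ==> z \<in> supp ==> ft_cond K (z \<bullet> b) z <= L"
  and \<gamma>: "0 < \<gamma>" and Hf: "0 <= Hf"
   "\<And>b1 b2 z. b1 \<in> U ==> b2 \<in> U ==> z \<in> supp ==> \<bar>f_cond K (z \<bullet> b1) z - f_cond K (z \<bullet> b2) z\<bar> <= Hf * infnorm (b1 - b2) powr \<gamma>"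
   "\<And>b1 b2 z. b1 \<in> U ==> b2 \<in> U ==> z \<in> supp ==> \<bar>ft_cond K (z \<bullet> b1) z - ft_cond K (z \<bullet> b2) z\<bar> <= Hf * infnorm (b1 - b2) powr \<gamma>"
  and l0: "0 < l0" "\<And>b. b \<in> U ==> l0 <= lambda_min (LINT \<omega>|M. f_cond K (Z \<omega> \<bullet> b) (Z \<omega>) *\<^sub>R outer_prod (Z \<omega>))"
begin

abbreviation I :: "real set" where "I \<equiv> {tL..tU}"

definition V :: "'a => real \<times> real" where "V x = (resp (Y x), cens (Y x))"

lemma Z_measurable[measurable]: "Z \<in> borel_measurable M"
proof -
 have "(\<lambda>y. snd (snd y)) \<in> borel_measurable (borel :: 'd datum measure)"
  by (intro borel_measurable_continuous_onI continuous_intros)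
 from measurable_compose[OF Ym this] show ?thesis by (simp add: Z_def covar_def)
qed

lemma V_measurable[measurable]: "V \<in> borel_measurable M"
proof -
 have "(\<lambda>y :: 'd datum. (fst y, fst (snd y))) \<in> borel_measurable borel"
  by (intro borel_measurable_continuous_onI continuous_intros)
 from measurable_compose[OF Ym this] show ?thesis by (simp add: V_def[abs_def] resp_def cens_def)
qed

lemma kernelV: "regular_cond_dist M V Z K" using kernel by (simp add: V_def[abs_def])

lemma K_measurable: "K \<in> borel \<rightarrow>\<^sub>M prob_algebra borel" using kernel by (simp add: regular_cond_dist_def)

lemma K_prob: "prob_space (K z)" and K_sets: "sets (K z) = sets borel"
 using measurable_space[OF K_measurable, of z] by (auto simp: space_prob_algebra)

lemma K_space: "space (K z) = UNIV" using sets_eq_imp_space_eq[OF K_sets] by simp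

lemma U_open: "open U" unfolding U_def using taus by (intro open_nbhd_open) auto

lemma \<beta>_in_U: "t \<in> I ==> \<beta> t \<in> U"
 unfolding U_def using taus eps by (subst nbhd_open_iff) (auto intro!: bexI[of _ t] simp: infnorm_0)

lemma near_\<beta>_in_U: "t \<in> I ==> norm (b - \<beta> t) < \<epsilon> ==> b \<in> U"
 unfolding U_def using taus eps
 by (subst nbhd_open_iff) (auto intro!: bexI[of _ t] intro: le_less_trans[OF infnorm_le_norm])

lemma segment_in_U:
 assumes "t \<in> I" "norm (b1 - \<beta> t) < \<epsilon>" "norm (b2 - \<beta> t) < \<epsilon>"
 shows "closed_segment b1 b2 \<subseteq> U"
proof -
 have "closed_segment b1 b2 \<subseteq> ball (\<beta> t) \<epsilon>"
  using assms by (intro closed_segment_subset) (auto simp: dist_norm norm_minus_commute)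
 thus ?thesis using near_\<beta>_in_U[OF assms(1)] by (auto simp: dist_norm norm_minus_commute)
qed

lemma cond_sets:
 "{p :: (real \<times> (real^'d)) \<times> (real \<times> real). min (fst (snd p)) (snd (snd p)) <= fst (fst p) \<and> min (fst (snd p)) (snd (snd p)) = fst (snd p)}
   \<in> sets ((borel \<Otimes>\<^sub>M borel) \<Otimes>\<^sub>M borel)"
 "{p :: (real \<times> (real^'d)) \<times> (real \<times> real). min (fst (snd p)) (snd (snd p)) <= fst (fst p)} \<in> sets ((borel \<Otimes>\<^sub>M borel) \<Otimes>\<^sub>M borel)"
 "{p :: (real \<times> (real^'d)) \<times> (real \<times> real). min (fst (snd p)) (snd (snd p)) >= fst (fst p)} \<in> sets ((borel \<Otimes>\<^sub>M borel) \<Otimes>\<^sub>M borel)"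
 unfolding borel_prod[symmetric, where 'a=real and 'b=real] min.absorb_iff1[symmetric]
 by (rule Collect_in_sets, measurable, simp add: space_pair_measure)+

lemma kernel_measure_measurable:
 fixes A :: "real \<times> (real^'d) => (real \<times> real) set"
 assumes "{p. snd p \<in> A (fst p)} \<in> sets ((borel \<Otimes>\<^sub>M borel) \<Otimes>\<^sub>M (borel :: (real \<times> real) measure))"
 shows "(\<lambda>(t, z). measure (K z) (A (t, z))) \<in> borel_measurable (borel \<Otimes>\<^sub>M (borel :: (real^'d) measure))"
proof -
 have "(SIGMA p:space (borel \<Otimes>\<^sub>M borel :: (real \<times> (real^'d)) measure). A p) = {p. snd p \<in> A (fst p)}"
  by (auto simp: space_pair_measure)
 hence "(\<lambda>p. measure (K (snd p)) (A p)) \<in> borel_measurable (borel \<Otimes>\<^sub>M (borel :: (real^'d) measure))"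
  using assms by (intro measure_measurable_prob_algebra2[where N=borel] measurable_compose[OF measurable_snd K_measurable]) simp
 thus ?thesis by (simp add: case_prod_beta')
qed

lemma F_cond_measurable: "case_prod (F_cond K) \<in> borel_measurable (borel \<Otimes>\<^sub>M borel)"
 using kernel_measure_measurable[of "\<lambda>p. {(x, c). min x c <= fst p \<and> min x c = x}"] cond_sets(1)
 by (simp add: F_cond_def[abs_def] case_prod_beta')

lemma Ft_cond_measurable: "case_prod (Ft_cond K) \<in> borel_measurable (borel \<Otimes>\<^sub>M borel)"
 using kernel_measure_measurable[of "\<lambda>p. {(x, c). min x c <= fst p}"] cond_sets(2)
 by (simp add: Ft_cond_def[abs_def] case_prod_beta')

definition surv :: "real => real^'d => real" where
 "surv t z = measure (K z) {(x, c). min x c >= t}"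

lemma surv_measurable: "case_prod surv \<in> borel_measurable (borel \<Otimes>\<^sub>M borel)"
 using kernel_measure_measurable[of "\<lambda>p. {(x, c). min x c >= fst p}"] cond_sets(3)
 by (simp add: surv_def[abs_def] case_prod_beta')

lemma min_sets: "{(x, c). min x c <= t} \<in> sets (K z)" "{(x, c). min x c < t} \<in> sets (K z)"
 "{(x, c). min x c <= t \<and> min x c = x} \<in> sets (K z)"
proof -
 have "{v :: real \<times> real. min (fst v) (snd v) <= t} \<in> sets (borel \<Otimes>\<^sub>M borel)"
  "{v :: real \<times> real. min (fst v) (snd v) < t} \<in> sets (borel \<Otimes>\<^sub>M borel)"
  "{v :: real \<times> real. min (fst v) (snd v) <= t \<and> min (fst v) (snd v) = fst v} \<in> sets (borel \<Otimes>\<^sub>M borel)"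
  unfolding min.absorb_iff1[symmetric]
  by (rule Collect_in_sets, measurable, simp add: space_pair_measure)+
 thus "{(x, c). min x c <= t} \<in> sets (K z)" "{(x, c). min x c < t} \<in> sets (K z)"
  "{(x, c). min x c <= t \<and> min x c = x} \<in> sets (K z)"
  by (simp_all only: K_sets borel_prod[symmetric, where 'a=real and 'b=real] case_prod_beta')
qed

lemma Ft_mono: "s <= t ==> Ft_cond K s z <= Ft_cond K t z"
 unfolding Ft_cond_def using prob_space.finite_measure[OF K_prob] min_sets
 by (intro finite_measure.finite_measure_mono) auto

lemma F_mono: "s <= t ==> F_cond K s z <= F_cond K t z"
 unfolding F_cond_def using prob_space.finite_measure[OF K_prob] min_sets
 by (intro finite_measure.finite_measure_mono) auto

lemma der:
 assumes "z \<in> supp"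
 shows "((\<lambda>s. F_cond K s z) has_real_derivative f_cond K t z) (at t)"
  "((\<lambda>s. Ft_cond K s z) has_real_derivative ft_cond K t z) (at t)"
 using field_differentiable_derivI[OF densities(1)[OF assms]] field_differentiable_derivI[OF densities(2)[OF assms]]
 by (simp_all add: f_cond_def ft_cond_def)

lemma density_nonneg:
 assumes "z \<in> supp" shows "0 <= f_cond K t z" "0 <= ft_cond K t z"
 by (rule mono_on_imp_deriv_nonneg[OF _ der(1)[OF assms], where A=UNIV]; simp add: mono_on_def F_mono)
  (rule mono_on_imp_deriv_nonneg[OF _ der(2)[OF assms], where A=UNIV]; simp add: mono_on_def Ft_mono)

lemma Z_supp: "AE x in M. Z x \<in> supp"
 unfolding supp_def by (rule AE_in_support[OF prob_space_axioms Z_measurable])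

sublocale F: smooth_functional M Z C L Hf \<gamma> supp "F_cond K" "f_cond K" U
proof
 show "\<bar>F_cond K t z\<bar> <= 1" for t z using prob_space.prob_le_1[OF K_prob] by (simp add: F_cond_def)
 show "\<bar>f_cond K (z \<bullet> b) z\<bar> <= L" if "b \<in> U" "z \<in> supp" for b z
  using density_nonneg(1)[OF that(2), of "z \<bullet> b"] L(2)[OF that] by simp
qed (use C Z_supp F_cond_measurable der Hf U_open \<gamma> L in auto)

sublocale Ft: smooth_functional M Z C L Hf \<gamma> supp "Ft_cond K" "ft_cond K" U
proof
 show "\<bar>Ft_cond K t z\<bar> <= 1" for t z using prob_space.prob_le_1[OF K_prob] by (simp add: Ft_cond_def)
 show "\<bar>ft_cond K (z \<bullet> b) z\<bar> <= L" if "b \<in> U" "z \<in> supp" for b z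
  using density_nonneg(2)[OF that(2), of "z \<bullet> b"] L(3)[OF that] by simp
qed (use C Z_supp Ft_cond_measurable der Hf U_open \<gamma> L in auto)

lemma mu_eq: "mu M Y b = F.func b"
proof -
 let ?S = "{p :: (real^'d) \<times> (real \<times> real). min (fst (snd p)) (snd (snd p)) <= fst p \<bullet> b \<and> min (fst (snd p)) (snd (snd p)) = fst (snd p)}"
 have S: "?S \<in> sets (borel \<Otimes>\<^sub>M borel)"
  unfolding borel_prod[symmetric, where 'a=real and 'b=real] min.absorb_iff1[symmetric]
  by (rule Collect_in_sets) (measurable, simp add: space_pair_measure)
 have "mu M Y b = (LINT x|M. of_bool ((Z x, V x) \<in> ?S) *\<^sub>R Z x)"
  by (simp add: mu_def obs_def uncensored_def Z_def V_def)
 also have "... = (LINT x|M. measure (K (Z x)) (Pair (Z x) -` ?S) *\<^sub>R Z x)"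
  by (rule expectation_indicator_covariate(1)[OF prob_space_axioms Z_measurable V_measurable kernelV C S])
 also have "... = F.func b"
  unfolding F.func_def by (simp add: F_cond_def vimage_def case_prod_beta')
 finally show ?thesis .
qed

lemma Z_integrable: "integrable M Z"
 by (rule integrable_const_bound[OF C]) simp

text \<open>Continuity of the distribution function of the observed response makes the weak inequality harmless.\<close>

lemma surv_eq:
 assumes z: "z \<in> supp"
 shows "surv t z = 1 - Ft_cond K t z"
proof -
 interpret Kz: prob_space "K z" by (rule K_prob)
 have lt: "measure (K z) {(x, c). min x c < t} = Ft_cond K t z"
 proof (rule antisym)
  show "measure (K z) {(x, c). min x c < t} <= Ft_cond K t z"
   unfolding Ft_cond_def using min_sets by (intro Kz.finite_measure_mono) auto
  have "isCont (\<lambda>s. Ft_cond K s z) t" by (rule DERIV_isCont[OF der(2)[OF z]])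
  hence "((\<lambda>s. Ft_cond K s z) \<longlongrightarrow> Ft_cond K t z) (at_left t)"
   unfolding isCont_def by (rule tendsto_mono[rotated]) (simp add: at_le)
  thus "Ft_cond K t z <= measure (K z) {(x, c). min x c < t}"
  proof (rule tendsto_upperbound)
   have "Ft_cond K s z <= measure (K z) {(x, c). min x c < t}" if "s < t" for s
    unfolding Ft_cond_def using min_sets that by (intro Kz.finite_measure_mono) auto
   thus "\<forall>\<^sub>F s in at_left t. Ft_cond K s z <= measure (K z) {(x, c). min x c < t}"
    by (auto simp: eventually_at_left_field intro!: exI[of _ "t - 1"])
  qed simp
 qed
 have "{(x, c). min x c >= t} = space (K z) - {(x, c). min x c < t}" by (auto simp: K_space)
 thus ?thesis unfolding surv_def using Kz.prob_compl[OF min_sets(2)] lt by simp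
qed

lemma mut_eq: "mut M Y b = (LINT x|M. surv (Z x \<bullet> b) (Z x) *\<^sub>R Z x)"
proof -
 let ?S = "{p :: (real^'d) \<times> (real \<times> real). min (fst (snd p)) (snd (snd p)) >= fst p \<bullet> b}"
 have S: "?S \<in> sets (borel \<Otimes>\<^sub>M borel)"
  unfolding borel_prod[symmetric, where 'a=real and 'b=real] min.absorb_iff1[symmetric]
  by (rule Collect_in_sets) (measurable, simp add: space_pair_measure)
 have "mut M Y b = (LINT x|M. of_bool ((Z x, V x) \<in> ?S) *\<^sub>R Z x)"
  by (simp add: mut_def obs_def Z_def V_def)
 also have "... = (LINT x|M. measure (K (Z x)) (Pair (Z x) -` ?S) *\<^sub>R Z x)"
  by (rule expectation_indicator_covariate(1)[OF prob_space_axioms Z_measurable V_measurable kernelV C S])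
 also have "... = (LINT x|M. surv (Z x \<bullet> b) (Z x) *\<^sub>R Z x)"
  by (simp add: surv_def vimage_def case_prod_beta')
 finally show ?thesis .
qed

lemma mut_eq_Ft: "mut M Y b = (LINT x|M. Z x) - Ft.func b"
proof -
 have m: "(\<lambda>x. surv (Z x \<bullet> b) (Z x)) \<in> borel_measurable M"
 proof -
  have "(\<lambda>x. (Z x \<bullet> b, Z x)) \<in> M \<rightarrow>\<^sub>M borel \<Otimes>\<^sub>M borel" by measurable
  from measurable_compose[OF this surv_measurable] show ?thesis by simp
 qed
 have "mut M Y b = (LINT x|M. Z x - Ft_cond K (Z x \<bullet> b) (Z x) *\<^sub>R Z x)"
  unfolding mut_eq
 proof (rule integral_cong_AE)
  show "AE x in M. surv (Z x \<bullet> b) (Z x) *\<^sub>R Z x = Z x - Ft_cond K (Z x \<bullet> b) (Z x) *\<^sub>R Z x"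
   using Z_supp by eventually_elim (simp add: surv_eq scaleR_diff_left)
 qed (use m borel_measurable_integrable[OF Ft.G_integrable] in auto)
 also have "... = (LINT x|M. Z x) - Ft.func b"
  unfolding Ft.func_def by (rule Bochner_Integration.integral_diff[OF Z_integrable Ft.G_integrable])
 finally show ?thesis .
qed

lemma mu_has_derivative: "b \<in> U ==> (mu M Y has_derivative (*v) (F.jac b)) (at b)"
 using F.func_has_derivative by (simp add: mu_eq[abs_def])

lemma mut_has_derivative: "b \<in> U ==> (mut M Y has_derivative (*v) (- Ft.jac b)) (at b)"
proof -
 assume b: "b \<in> U"
 have "((\<lambda>b. (LINT x|M. Z x) - Ft.func b) has_derivative (\<lambda>h. 0 - Ft.jac b *v h)) (at b)"
  by (intro has_derivative_diff has_derivative_const Ft.func_has_derivative b)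
 moreover have "(\<lambda>h. 0 - Ft.jac b *v h) = (*v) (- Ft.jac b)"
  by (simp add: fun_eq_iff bounded_bilinear.minus_left[OF bounded_bilinear_matrix_vector])
 ultimately show ?thesis by (simp add: mut_eq_Ft[abs_def])
qed

lemma mu'_eq: "b \<in> U ==> mu' M Y b = F.jac b"
 unfolding mu'_def jacobian_def
 by (simp only: frechet_derivative_at[OF mu_has_derivative, symmetric] matrix_of_matrix_vector_mul)

lemma mut'_eq: "b \<in> U ==> mut' M Y b = - Ft.jac b"
 unfolding mut'_def jacobian_def
 by (simp only: frechet_derivative_at[OF mut_has_derivative, symmetric] matrix_of_matrix_vector_mul)

lemma quadratic_form:
 assumes b: "b \<in> U"
 shows "l0 * (v \<bullet> v) <= v \<bullet> (F.jac b *v v)"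
proof -
 let ?A = "LINT x|M. f_cond K (Z x \<bullet> b) (Z x) *\<^sub>R outer_prod (Z x)"
 have "integrable M (\<lambda>x. f_cond K (Z x \<bullet> b) (Z x) *\<^sub>R outer_prod (Z x))"
 proof (rule ccontr)
  assume "\<not> integrable M (\<lambda>x. f_cond K (Z x \<bullet> b) (Z x) *\<^sub>R outer_prod (Z x))"
  hence "?A = 0" by (rule not_integrable_integral_eq)
  thus False using l0(1) l0(2)[OF b] lambda_min_zero[where 'd='d] by simp
 qed
 hence "?A = F.jac b"
  unfolding F.jac_def
 proof (intro integral_cong_AE)
  show "AE x in M. f_cond K (Z x \<bullet> b) (Z x) *\<^sub>R outer_prod (Z x) = F.density b x *\<^sub>R outer_prod (Z x)"
   using F.density_AE[of b] by eventually_elim simp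
 qed (auto intro: borel_measurable_integrable)
 hence "l0 * (v \<bullet> v) <= lambda_min (F.jac b) * (v \<bullet> v)" using l0(2)[OF b] by (intro mult_right_mono) auto
 also have "... <= v \<bullet> (F.jac b *v v)" by (rule lambda_min_le_quadratic_form[OF F.jac_symmetric[OF b]])
 finally show ?thesis .
qed

lemma mu_strongly_monotone:
 assumes seg: "closed_segment b0 b1 \<subseteq> U"
 shows "l0 * (norm (b1 - b0))\<^sup>2 <= (mu M Y b1 - mu M Y b0) \<bullet> (b1 - b0)"
proof -
 let ?h = "b1 - b0"
 define p where "p q = b0 + q *\<^sub>R ?h" for q :: real
 have pU: "p q \<in> U" if "0 <= q" "q <= 1" for q
 proof -
  have "p q = (1 - q) *\<^sub>R b0 + q *\<^sub>R b1" by (simp add: p_def algebra_simps)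
  hence "p q \<in> closed_segment b0 b1" using that unfolding closed_segment_def by blast
  thus ?thesis using seg by blast
 qed
 have "\<exists>q. 0 < q \<and> q < 1 \<and> mu M Y (p 1) \<bullet> ?h - mu M Y (p 0) \<bullet> ?h = (1 - 0) * ((F.jac (p q) *v ?h) \<bullet> ?h)"
 proof (rule MVT2)
  fix q :: real assume q: "0 <= q" "q <= 1"
  have "(p has_derivative (\<lambda>t. t *\<^sub>R ?h)) (at q)" unfolding p_def by (auto intro!: derivative_eq_intros)
  hence "((\<lambda>q. mu M Y (p q)) has_derivative (\<lambda>t. F.jac (p q) *v (t *\<^sub>R ?h))) (at q)"
   by (rule has_derivative_compose) (rule mu_has_derivative[OF pU[OF q]])
  hence "((\<lambda>q. mu M Y (p q) \<bullet> ?h) has_derivative (\<lambda>t. (F.jac (p q) *v (t *\<^sub>R ?h)) \<bullet> ?h)) (at q)"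
   by (rule has_derivative_inner_left)
  moreover have "(\<lambda>t. (F.jac (p q) *v (t *\<^sub>R ?h)) \<bullet> ?h) = (*) ((F.jac (p q) *v ?h) \<bullet> ?h)"
   by (rule ext) (simp add: matrix_vector_mult_scaleR)
  ultimately show "((\<lambda>q. mu M Y (p q) \<bullet> ?h) has_real_derivative (F.jac (p q) *v ?h) \<bullet> ?h) (at q)"
   by (simp add: has_field_derivative_def)
 qed simp
 then obtain q where q: "0 < q" "q < 1" "mu M Y b1 \<bullet> ?h - mu M Y b0 \<bullet> ?h = (F.jac (p q) *v ?h) \<bullet> ?h"
  by (auto simp: p_def)
 have "l0 * (?h \<bullet> ?h) <= ?h \<bullet> (F.jac (p q) *v ?h)" by (rule quadratic_form) (use q pU in auto)
 hence "l0 * (norm ?h)\<^sup>2 <= ?h \<bullet> (F.jac (p q) *v ?h)" by (simp only: power2_norm_eq_inner)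
 also have "... = (F.jac (p q) *v ?h) \<bullet> ?h" by (rule inner_commute)
 also have "... = (mu M Y b1 - mu M Y b0) \<bullet> ?h"
  using q(3) unfolding inner_diff_left by (rule sym)
 finally show ?thesis .
qed

lemma \<beta>_continuous: "continuous_on I \<beta>"
 unfolding continuous_on_iff
proof (intro ballI allI impI)
 fix s e assume s: "s \<in> I" and e: "(0::real) < e"
 show "\<exists>d>0. \<forall>t\<in>I. dist t s < d --> dist (\<beta> t) (\<beta> s) < e"
 proof (intro exI[of _ "e / (C4 + 1)"] conjI ballI impI)
  show "0 < e / (C4 + 1)" using e C4 by simp
  fix t assume t: "t \<in> I" "dist t s < e / (C4 + 1)"
  have "norm (\<beta> t - \<beta> s) <= C4 * \<bar>t - s\<bar>" by (rule C4(2)[OF t(1) s])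
  also have "... <= (C4 + 1) * \<bar>t - s\<bar>" by (simp add: distrib_right)
  also have "... < e" using t(2) C4(1) by (simp add: dist_real_def pos_less_divide_eq mult.commute)
  finally show "dist (\<beta> t) (\<beta> s) < e" by (simp add: dist_norm)
 qed
qed

text \<open>For almost every value of the covariate the hypotheses of the one-dimensional identity hold
 simultaneously for all \<open>\<tau>\<close>: by monotonicity of quantile functions and continuity of \<open>\<beta>\<close> it suffices
 to consider countably many \<open>\<tau>\<close>.\<close>

lemma good_covariate:
 "AE x in M. Z x \<in> supp \<and> prob_space.indep_var (K (Z x)) borel fst borel snd \<and>
   (\<forall>q\<in>I. cond_quantile K q (Z x) = Z x \<bullet> \<beta> q) \<and> (AE v in K (Z x). Z x \<bullet> \<beta> (tL + a) < snd v)"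
proof -
 let ?Q = "I \<inter> (\<rat> \<union> {tL, tU})"
 have "countable ?Q" by (intro countable_Int2) (simp add: countable_rat)
 hence "AE x in M. \<forall>q\<in>?Q. cond_quantile K q (Z x) = Z x \<bullet> \<beta> q"
  using lin_quantile by (subst AE_ball_countable) auto
 moreover have "AE x in M. AE v in K (Z x). (Z x, v) \<in> {p. fst p \<bullet> \<beta> (tL + a) < snd (snd p)}"
 proof (rule disintegration_AE[OF prob_space_axioms Z_measurable V_measurable kernelV])
  show "{p :: (real^'d) \<times> (real \<times> real). fst p \<bullet> \<beta> (tL + a) < snd (snd p)} \<in> sets (borel \<Otimes>\<^sub>M borel)"
   unfolding borel_prod[symmetric, where 'a=real and 'b=real] min.absorb_iff1[symmetric]
  by (rule Collect_in_sets) (measurable, simp add: space_pair_measure)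
  show "AE x in M. (Z x, V x) \<in> {p. fst p \<bullet> \<beta> (tL + a) < snd (snd p)}"
   using early(3) by eventually_elim (simp add: V_def)
 qed
 ultimately show ?thesis
  using Z_supp cond_indep
 proof eventually_elim
  case (elim x)
  let ?z = "Z x" and ?J = "\<lambda>q. cond_quantile K q (Z x)"
  have mono: "?J u <= ?J v" if "0 < u" "u <= v" "v < 1" for u v
   unfolding cond_quantile_def by (rule quantile_mono[OF K_prob K_sets that])
  have "?J q = ?z \<bullet> \<beta> q" if q: "q \<in> I" for q
  proof (cases "q = tL \<or> q = tU")
   case True thus ?thesis using elim q by auto
  next
   case False
   hence t': "tL < q" "q < tU" using q by auto
   have "\<bar>?J q - ?z \<bullet> \<beta> q\<bar> <= e" if e: "0 < e" for e
   proof -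
    define d where "d = e / (norm ?z * C4 + 1)"
    have den: "0 < norm ?z * C4 + 1" using C4 by (simp add: add_nonneg_pos)
    have d: "0 < d" using e den by (simp add: d_def)
    obtain r where r: "r \<in> \<rat>" "max tL (q - d) < r" "r < q" using Rats_dense_in_real[of "max tL (q - d)" q] t' d by auto
    obtain r' where r': "r' \<in> \<rat>" "q < r'" "r' < min tU (q + d)" using Rats_dense_in_real[of q "min tU (q + d)"] t' d by auto
    have close: "\<bar>?z \<bullet> \<beta> t - ?z \<bullet> \<beta> q\<bar> <= e" if "t \<in> I" "\<bar>t - q\<bar> <= d" for t
    proof -
     have "\<bar>?z \<bullet> \<beta> t - ?z \<bullet> \<beta> q\<bar> = \<bar>?z \<bullet> (\<beta> t - \<beta> q)\<bar>" by (simp add: inner_diff_right)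
     also have "... <= norm ?z * norm (\<beta> t - \<beta> q)" by (rule Cauchy_Schwarz_ineq2)
     also have "... <= norm ?z * (C4 * d)"
      using C4(2)[OF that(1) q] that(2) C4(1) by (intro mult_left_mono) (auto intro: order_trans mult_left_mono)
     also have "... <= (norm ?z * C4 + 1) * d" using d by (simp add: distrib_right)
     also have "... = e" using den by (simp add: d_def)
     finally show ?thesis .
    qed
    have "?J r = ?z \<bullet> \<beta> r" "?J r' = ?z \<bullet> \<beta> r'" using elim r r' t' by auto
    moreover have "?J r <= ?J q" "?J q <= ?J r'" using r r' t' taus by (auto intro!: mono)
    moreover have "\<bar>?z \<bullet> \<beta> r - ?z \<bullet> \<beta> q\<bar> <= e" "\<bar>?z \<bullet> \<beta> r' - ?z \<bullet> \<beta> q\<bar> <= e" using r r' t' by (auto intro!: close)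
    ultimately show ?thesis by linarith
   qed
   hence "\<bar>?J q - ?z \<bullet> \<beta> q\<bar> <= 0" using field_le_epsilon[of "\<bar>?J q - ?z \<bullet> \<beta> q\<bar>" 0] by auto
   thus ?thesis by simp
  qed
  thus ?case using elim by auto
 qed
qed

lemma identity_given_covariate:
 assumes z: "z \<in> supp" "prob_space.indep_var (K z) borel fst borel snd"
  "\<forall>p\<in>I. cond_quantile K p z = z \<bullet> \<beta> p" "AE v in K z. z \<bullet> \<beta> (tL + a) < snd v" and s: "s \<in> I"
 shows "F_cond K (z \<bullet> \<beta> s) z = tL + integral {tL..s} (\<lambda>u. (1 / (1 - u)) *\<^sub>R surv (z \<bullet> \<beta> u) z)"
  and "s <= tL + a ==> F_cond K (z \<bullet> \<beta> s) z = s"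
  and "bdd_meas tL tU (\<lambda>u. surv (z \<bullet> \<beta> u) z)"
proof -
 have cont: "isCont (\<lambda>t. measure (K z) {(x, c). min x c <= t \<and> min x c = x}) t" for t
  using DERIV_isCont[OF der(1)[OF z(1)]] by (simp add: F_cond_def)
 have q: "Inf {t. measure (K z) {(x, c). x <= t} >= p} = z \<bullet> \<beta> p" if "p \<in> I" for p
  using z(3) that by (simp add: cond_quantile_def)
 have t1: "tL + a \<in> I" using early by simp
 note I = quantile_identity[OF K_prob K_sets z(2) taus(1,3) q cont t1 z(4) s]
 show "F_cond K (z \<bullet> \<beta> s) z = tL + integral {tL..s} (\<lambda>u. (1 / (1 - u)) *\<^sub>R surv (z \<bullet> \<beta> u) z)"
  using I(1) by (simp add: F_cond_def surv_def)
 show "s <= tL + a ==> F_cond K (z \<bullet> \<beta> s) z = s" using I(2) by (simp add: F_cond_def)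
 show "bdd_meas tL tU (\<lambda>u. surv (z \<bullet> \<beta> u) z)" using I(3) by (simp add: surv_def)
qed

lemma mut_\<beta>_continuous: "continuous_on I (\<lambda>u. mut M Y (\<beta> u))"
proof (rule continuous_on_compose2[OF _ \<beta>_continuous])
 show "continuous_on U (mut M Y)"
  by (intro continuous_at_imp_continuous_on ballI has_derivative_continuous[OF mut_has_derivative])
qed (use \<beta>_in_U in auto)

text \<open>The estimating equation of the population: multiply the one-dimensional identity by the covariate,
 take expectations and interchange the integrals.\<close>

lemma population_identity:
 assumes s: "s \<in> I"
 shows "mu M Y (\<beta> s) = tL *\<^sub>R (LINT x|M. Z x) + (LINT u:{tL..<s}|dH. mut M Y (\<beta> u))"
proof -
 define clamp where "clamp u = max tL (min tU u)" for u
 have clamp: "clamp u = u" if "u \<in> I" for u using that by (auto simp: clamp_def)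
 have clamp_in: "clamp u \<in> I" for u using taus by (auto simp: clamp_def)
 have cb: "continuous_on UNIV (\<lambda>u. \<beta> (clamp u))"
  by (rule continuous_on_compose2[OF \<beta>_continuous]) (use clamp_in in "auto simp: clamp_def intro!: continuous_intros")
 have bm: "(\<lambda>u. \<beta> (clamp u)) \<in> borel_measurable borel" by (rule borel_measurable_continuous_onI[OF cb])
 define w where "w u = indicator {tL..s} u * (1 / (1 - u))" for u :: real
 define k where "k u x = (w u * surv (Z x \<bullet> \<beta> (clamp u)) (Z x)) *\<^sub>R Z x" for u x
 have wm: "w \<in> borel_measurable lborel" unfolding w_def by measurable
 have w0: "0 <= w u" "w u <= indicator {tL..s} u * (1 / (1 - tU))" for u
  using s taus by (auto simp: w_def indicator_def frac_le)
 have surv01: "0 <= surv t z" "surv t z <= 1" for t z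
  using prob_space.prob_le_1[OF K_prob] by (auto simp: surv_def)
 interpret PS: pair_sigma_finite lborel M by (intro pair_sigma_finite.intro sigma_finite_lborel) unfold_locales
 have km: "case_prod k \<in> borel_measurable (lborel \<Otimes>\<^sub>M M)"
 proof -
  have 1: "(\<lambda>p. \<beta> (clamp (fst p))) \<in> borel_measurable (lborel \<Otimes>\<^sub>M M)"
   by (rule measurable_compose[OF measurable_fst]) (use bm in simp)
  have 2: "(\<lambda>p. Z (snd p)) \<in> borel_measurable (lborel \<Otimes>\<^sub>M M)" by (rule measurable_compose[OF measurable_snd Z_measurable])
  have 3: "(\<lambda>p. (Z (snd p) \<bullet> \<beta> (clamp (fst p)), Z (snd p))) \<in> lborel \<Otimes>\<^sub>M M \<rightarrow>\<^sub>M borel \<Otimes>\<^sub>M borel"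
   by (intro measurable_Pair borel_measurable_inner 1 2)
  have 4: "(\<lambda>p. surv (Z (snd p) \<bullet> \<beta> (clamp (fst p))) (Z (snd p))) \<in> borel_measurable (lborel \<Otimes>\<^sub>M M)"
   using measurable_compose[OF 3 surv_measurable] by simp
  have 5: "(\<lambda>p. w (fst p)) \<in> borel_measurable (lborel \<Otimes>\<^sub>M M)" by (rule measurable_compose[OF measurable_fst wm])
  show ?thesis unfolding k_def case_prod_beta'
   by (intro borel_measurable_scaleR borel_measurable_times 2 4 5)
 qed
 have kb: "AE x in M. norm (k u x) <= indicator {tL..s} u * (1 / (1 - tU)) * C" for u
  using C
 proof eventually_elim
  case (elim x)
  have "norm (k u x) = w u * surv (Z x \<bullet> \<beta> (clamp u)) (Z x) * norm (Z x)" using w0 surv01 by (simp add: k_def)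
  also have "... <= (indicator {tL..s} u * (1 / (1 - tU))) * 1 * C"
   using w0 surv01 elim taus by (intro mult_mono) (auto simp: indicator_def)
  finally show ?case by simp
 qed
 have ku: "integrable M (k u)" for u
 proof (rule integrable_const_bound[OF kb])
  show "k u \<in> borel_measurable M"
   using measurable_compose[OF measurable_Pair1'[of u lborel M] km] by simp
 qed
 have kn: "\<bar>LINT x|M. norm (k u x)\<bar> <= \<bar>indicator {tL..s} u * (1 / (1 - tU)) * C\<bar>" for u
 proof -
  have "(LINT x|M. norm (k u x)) <= indicator {tL..s} u * (1 / (1 - tU)) * C"
   by (rule integral_le_const[OF integrable_norm[OF ku] kb])
  moreover have "0 <= (LINT x|M. norm (k u x))" by (intro Bochner_Integration.integral_nonneg) simp
  ultimately show ?thesis by linarith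
 qed
 have A: "integrable lborel (\<lambda>u. LINT x|M. norm (k u x))"
 proof (rule Bochner_Integration.integrable_bound[of _ "\<lambda>u. indicator {tL..s} u * (1 / (1 - tU)) * C"])
  show "integrable lborel (\<lambda>u. indicator {tL..s} u * (1 / (1 - tU)) * C :: real)"
   by (intro integrable_mult_left integrable_real_indicator) (auto simp: emeasure_lborel_Icc_eq)
  have "(\<lambda>(u, x). norm (k u x)) \<in> borel_measurable (lborel \<Otimes>\<^sub>M M)"
   using measurable_compose[OF km borel_measurable_norm] by (simp add: case_prod_beta')
  thus "(\<lambda>u. LINT x|M. norm (k u x)) \<in> borel_measurable lborel"
   by (rule borel_measurable_lebesgue_integral)
 qed (use kn in "simp only: real_norm_def AE_I2")
 have int: "integrable (lborel \<Otimes>\<^sub>M M) (case_prod k)"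
  by (rule PS.Fubini_integrable[OF km]) (use A ku in simp_all)
 have bmm: "bdd_meas tL tU (\<lambda>u. mut M Y (\<beta> u))"
  by (rule bdd_meas_continuous[OF mut_\<beta>_continuous])
 have "(LINT u:{tL..<s}|dH. mut M Y (\<beta> u)) = (LBINT u. w u *\<^sub>R mut M Y (\<beta> (clamp u)))"
 proof -
  have "(LINT u:{tL..<s}|dH. mut M Y (\<beta> u)) = integral {tL..s} (\<lambda>u. (1 / (1 - u)) *\<^sub>R mut M Y (\<beta> u))"
   by (rule hazard_integral_eq(1)[OF bmm]) (use s taus in auto)
  also have "... = (LINT u:{tL..s}|lborel. (1 / (1 - u)) *\<^sub>R mut M Y (\<beta> u))"
   by (rule set_borel_integral_eq_integral(2)[symmetric], rule bdd_meas_set_integrable,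
     rule bdd_meas_subset[OF bdd_meas_hazard[OF bmm taus(3)]]) (use s in auto)
  also have "... = (LBINT u. w u *\<^sub>R mut M Y (\<beta> (clamp u)))"
   unfolding set_lebesgue_integral_def using s clamp
   by (intro Bochner_Integration.integral_cong refl) (auto simp: w_def indicator_def)
  finally show ?thesis .
 qed
 also have "... = (LBINT u. (LINT x|M. k u x))"
  by (intro Bochner_Integration.integral_cong refl) (simp add: mut_eq k_def flip: scaleR_scaleR)
 also have "... = (LINT x|M. (LBINT u. k u x))"
  by (rule PS.Fubini_integral[OF int, symmetric])
 also have "... = (LINT x|M. F_cond K (Z x \<bullet> \<beta> s) (Z x) *\<^sub>R Z x - tL *\<^sub>R Z x)"
 proof (rule integral_cong_AE)
  show "AE x in M. (LBINT u. k u x) = F_cond K (Z x \<bullet> \<beta> s) (Z x) *\<^sub>R Z x - tL *\<^sub>R Z x"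
   using good_covariate
  proof eventually_elim
   case (elim x)
   hence e: "Z x \<in> supp" "prob_space.indep_var (K (Z x)) borel fst borel snd"
    "\<forall>q\<in>I. cond_quantile K q (Z x) = Z x \<bullet> \<beta> q" "AE v in K (Z x). Z x \<bullet> \<beta> (tL + a) < snd v" by auto
   note I = identity_given_covariate[OF e s]
   have si: "set_integrable lborel {tL..s} (\<lambda>u. (1 / (1 - u)) *\<^sub>R surv (Z x \<bullet> \<beta> u) (Z x))"
    by (rule bdd_meas_set_integrable,
      rule bdd_meas_subset[OF bdd_meas_hazard[OF I(3) taus(3)]]) (use s in auto)
   have "(LBINT u. k u x) = (LBINT u. (w u * surv (Z x \<bullet> \<beta> (clamp u)) (Z x)) *\<^sub>R Z x)" by (simp add: k_def)
   also have "... = (LBINT u. (indicator {tL..s} u *\<^sub>R ((1 / (1 - u)) *\<^sub>R surv (Z x \<bullet> \<beta> u) (Z x))) *\<^sub>R Z x)"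
    using s clamp by (intro Bochner_Integration.integral_cong refl) (auto simp: w_def indicator_def)
   also have "... = (LBINT u. (indicator {tL..s} u *\<^sub>R ((1 / (1 - u)) *\<^sub>R surv (Z x \<bullet> \<beta> u) (Z x)))) *\<^sub>R Z x"
    by (rule integral_scaleR_left) (use si in "simp add: set_integrable_def")
   also have "(LBINT u. (indicator {tL..s} u *\<^sub>R ((1 / (1 - u)) *\<^sub>R surv (Z x \<bullet> \<beta> u) (Z x))))
     = integral {tL..s} (\<lambda>u. (1 / (1 - u)) *\<^sub>R surv (Z x \<bullet> \<beta> u) (Z x))"
    using set_borel_integral_eq_integral(2)[OF si] by (simp only: set_lebesgue_integral_def)
   also have "... = F_cond K (Z x \<bullet> \<beta> s) (Z x) - tL" using I(1) by simp
   finally show ?case by (simp add: scaleR_diff_left)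
  qed
  show "(\<lambda>x. (LBINT u. k u x)) \<in> borel_measurable M"
   by (rule borel_measurable_integrable[OF PS.integrable_snd[OF int]])
  show "(\<lambda>x. F_cond K (Z x \<bullet> \<beta> s) (Z x) *\<^sub>R Z x - tL *\<^sub>R Z x) \<in> borel_measurable M"
   by (intro borel_measurable_diff borel_measurable_integrable[OF F.G_integrable]) measurable
 qed
 also have "... = F.func (\<beta> s) - tL *\<^sub>R (LINT x|M. Z x)"
  unfolding F.func_def using Z_integrable
  by (subst Bochner_Integration.integral_diff[OF F.G_integrable]) auto
 finally show ?thesis by (simp add: mu_eq)
qed

text \<open>Uncensored mass \<open>a\<close> lies between the conditional quantiles at \<open>tL\<close> and \<open>tL + a\<close>, where the density is
 at most \<open>L\<close>; so these quantiles are uniformly separated.\<close>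

lemma quantile_gap:
 "AE x in M. a <= L * (Z x \<bullet> \<beta> (tL + a) - Z x \<bullet> \<beta> tL)"
 using good_covariate
proof eventually_elim
 case (elim x)
 hence e: "Z x \<in> supp" "prob_space.indep_var (K (Z x)) borel fst borel snd"
  "\<forall>p\<in>I. cond_quantile K p (Z x) = Z x \<bullet> \<beta> p" "AE v in K (Z x). Z x \<bullet> \<beta> (tL + a) < snd v" by auto
 let ?z = "Z x" and ?t = "tL + a"
 have tin: "tL \<in> I" "?t \<in> I" using early taus by auto
 have Fa: "F_cond K (?z \<bullet> \<beta> ?t) ?z - F_cond K (?z \<bullet> \<beta> tL) ?z = a"
  using identity_given_covariate(2)[OF e tin(1)] identity_given_covariate(2)[OF e tin(2)] early by simp
 have "?z \<bullet> \<beta> tL = cond_quantile K tL ?z" "?z \<bullet> \<beta> ?t = cond_quantile K ?t ?z" using e(3) tin by auto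
 moreover have "cond_quantile K tL ?z <= cond_quantile K ?t ?z"
  unfolding cond_quantile_def by (rule quantile_mono[OF K_prob K_sets]) (use taus early in auto)
 moreover have "?z \<bullet> \<beta> tL \<noteq> ?z \<bullet> \<beta> ?t" using Fa early by auto
 ultimately have lt: "?z \<bullet> \<beta> tL < ?z \<bullet> \<beta> ?t" by simp
 obtain y where y: "?z \<bullet> \<beta> tL < y" "y < ?z \<bullet> \<beta> ?t"
  "F_cond K (?z \<bullet> \<beta> ?t) ?z - F_cond K (?z \<bullet> \<beta> tL) ?z = (?z \<bullet> \<beta> ?t - ?z \<bullet> \<beta> tL) * f_cond K y ?z"
  using MVT2[OF lt der(1)[OF e(1)]] by auto
 have cont: "continuous_on {tL..?t} (\<lambda>p. ?z \<bullet> \<beta> p)"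
  by (intro continuous_on_inner continuous_on_const continuous_on_subset[OF \<beta>_continuous]) (use early in auto)
 obtain p where p: "tL <= p" "p <= ?t" "?z \<bullet> \<beta> p = y"
  using IVT'[of "\<lambda>p. ?z \<bullet> \<beta> p" tL y ?t] y cont early by auto
 have "f_cond K y ?z <= L"
  using L(2)[OF \<beta>_in_U e(1), of p] p early by auto
 hence "(?z \<bullet> \<beta> ?t - ?z \<bullet> \<beta> tL) * f_cond K y ?z <= (?z \<bullet> \<beta> ?t - ?z \<bullet> \<beta> tL) * L"
  using lt by (intro mult_left_mono) auto
 thus ?case using y(3) Fa by (simp add: mult.commute)
qed

end

section \<open>The estimating equations for a fixed sample\<close>

lemma hazard_set_integrable:
 assumes "bdd_meas a b g" "a <= u" "s <= b" "b < 1"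
 shows "set_integrable dH {u..<s} g"
 using hazard_integral_eq(2)[of a b g u s "{u..<s}"] assms by simp

lemma hazard_integral_diff:
 assumes f: "bdd_meas a b f" and g: "bdd_meas a b g" and s: "s \<in> {a..b}" and b: "b < 1"
 shows "(LINT u:{a..<s}|dH. f u - g u) = (LINT u:{a..<s}|dH. f u) - (LINT u:{a..<s}|dH. g u)"
 using s b by (intro set_integral_diff(2) hazard_set_integrable[OF f] hazard_set_integrable[OF g]) auto

lemma hazard_integral_dominated:
 fixes f :: "real => 'b::euclidean_space" and h :: "real => real"
 assumes f: "bdd_meas a b f" and s: "s \<in> {a..b}" and b: "b < 1"
  and bd: "\<And>u. u \<in> {a..<s} ==> norm (f u) <= h u" and h: "continuous_on {a..s} h" "\<And>u. u \<in> {a..s} ==> 0 <= h u"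
 shows "norm (LINT u:{a..<s}|dH. f u) <= integral {a..s} h / (1 - b)"
proof -
 define g where "g u = (if u \<in> {a..<s} then f u else 0)" for u
 have bg: "bdd_meas a b g"
 proof -
  have "(\<lambda>u. indicator {a..<s} u :: real) \<in> borel_measurable (restrict_space borel {a..b})"
   by (intro measurable_restrict_space1) simp
  hence "bdd_meas a b (\<lambda>u. indicator {a..<s} u :: real)"
   by (auto simp: bdd_meas_def bounded_iff intro!: exI[of _ 1])
  from bdd_meas_bilinear[OF bounded_bilinear_scaleR this f]
  have "bdd_meas a b (\<lambda>u. indicator {a..<s} u *\<^sub>R f u)" .
  moreover have "(\<lambda>u. indicator {a..<s} u *\<^sub>R f u) = g" by (auto simp: g_def indicator_def)
  ultimately show ?thesis by simp
 qed
 have "(LINT u:{a..<s}|dH. f u) = (LINT u:{a..<s}|dH. g u)"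
  by (rule set_lebesgue_integral_cong) (auto simp: g_def dH_def)
 also have "... = integral {a..s} (\<lambda>u. (1 / (1 - u)) *\<^sub>R g u)"
  using s b by (intro hazard_integral_eq(1)[OF bg]) auto
 also have "norm ... <= integral {a..s} (\<lambda>u. h u / (1 - b))"
 proof (rule integral_norm_bound_integral)
  show "(\<lambda>u. (1 / (1 - u)) *\<^sub>R g u) integrable_on {a..s}"
   using s by (intro bdd_meas_integrable[OF bdd_meas_hazard[OF bg b]]) auto
  show "(\<lambda>u. h u / (1 - b)) integrable_on {a..s}"
   by (intro integrable_continuous_real continuous_intros h) (use b in auto)
  fix u assume u: "u \<in> {a..s}"
  have "norm (g u) <= h u" using bd[of u] h(2)[OF u] by (auto simp: g_def)
  hence "norm (g u) / (1 - u) <= h u / (1 - b)" using u s b h(2)[OF u] by (intro frac_le) auto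
  thus "norm ((1 / (1 - u)) *\<^sub>R g u) <= h u / (1 - b)" using u s b by simp
 qed
 finally show ?thesis by simp
qed

lemma hazard_integral_increment:
 fixes f :: "real => 'b::euclidean_space"
 assumes f: "bdd_meas a b f" and st: "a <= s" "s <= t" "t <= b" and b: "b < 1"
  and bd: "\<And>u. u \<in> {s..<t} ==> norm (f u) <= B" and B: "0 <= B"
 shows "norm ((LINT u:{a..<t}|dH. f u) - (LINT u:{a..<s}|dH. f u)) <= B * (t - s) / (1 - b)"
proof -
 have "{a..<t} = {a..<s} \<union> {s..<t}" using st by auto
 hence "(LINT u:{a..<t}|dH. f u) = (LINT u:{a..<s}|dH. f u) + (LINT u:{s..<t}|dH. f u)"
  using st b by (simp only:) (intro set_integral_Un hazard_set_integrable[OF f], auto)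
 moreover have "norm (LINT u:{s..<t}|dH. f u) <= integral {s..t} (\<lambda>_. B) / (1 - b)"
  by (rule hazard_integral_dominated[OF bdd_meas_subset[OF f st(1) order_refl]]) (use st b bd B in auto)
 ultimately show ?thesis using st by (simp add: mult.commute)
qed

lemma hazard_integral_bound:
 fixes f :: "real => 'b::euclidean_space"
 assumes f: "bdd_meas a b f" and s: "s \<in> {a..b}" and b: "b < 1"
  and bd: "\<And>u. u \<in> {a..<s} ==> norm (f u) <= B" and B: "0 <= B"
 shows "norm (LINT u:{a..<s}|dH. f u) <= B * (s - a) / (1 - b)"
proof -
 have "(LINT u:{a..<a}|dH. f u) = 0" by (simp add: set_lebesgue_integral_def)
 thus ?thesis using hazard_integral_increment[OF f, of a s B] s b bd B by auto
qed

text \<open>Both objective functions are, up to a constant, a sum of hinges minus a linear function. At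
 every point they have an explicit subgradient.\<close>

definition hinge_obj :: "nat => (nat => real) => (nat => real) => (nat => real^'d::finite) => real^'d => real => real^'d => real" where
 "hinge_obj n wt x z g c b = c + (\<Sum>i<n. wt i * max 0 (z i \<bullet> b - x i)) - b \<bullet> g"

definition hinge_subgrad :: "nat => (nat => real) => (nat => real) => (nat => real^'d::finite) => real^'d => real^'d" where
 "hinge_subgrad n wt x z b = (\<Sum>i<n. (wt i * of_bool (x i <= z i \<bullet> b)) *\<^sub>R z i)"

lemma hinge_subgradient:
 assumes "\<And>i. i < n ==> 0 <= wt i"
 shows "hinge_obj n wt x z g c b' >= hinge_obj n wt x z g c b + (hinge_subgrad n wt x z b - g) \<bullet> (b' - b)"
proof -
 have "(\<Sum>i<n. wt i * max 0 (z i \<bullet> b - x i)) + (\<Sum>i<n. wt i * (of_bool (x i <= z i \<bullet> b) * (z i \<bullet> (b' - b))))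
   <= (\<Sum>i<n. wt i * max 0 (z i \<bullet> b' - x i))"
  unfolding sum.distrib[symmetric] distrib_left[symmetric]
  by (intro sum_mono mult_left_mono assms) (auto simp: inner_diff_right max_def)
 moreover have "hinge_subgrad n wt x z b \<bullet> (b' - b) = (\<Sum>i<n. wt i * (of_bool (x i <= z i \<bullet> b) * (z i \<bullet> (b' - b))))"
  by (simp add: hinge_subgrad_def inner_sum_left mult.assoc)
 ultimately show ?thesis
  unfolding hinge_obj_def by (simp add: inner_diff_left inner_diff_right[of g] inner_commute[of _ g])
qed

lemma hinge_convex:
 assumes "\<And>i. i < n ==> 0 <= wt i"
 shows "convex_on UNIV (hinge_obj n wt x z g c)"
proof (rule convex_onI)
 fix t :: real and p q :: "real^'a" assume t: "0 < t" "t < 1"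
 let ?o = "hinge_obj n wt x z g c"
 let ?r = "(1 - t) *\<^sub>R p + t *\<^sub>R q"
 let ?d = "hinge_subgrad n wt x z ?r - g"
 have "(1 - t) * (?o ?r + ?d \<bullet> (p - ?r)) <= (1 - t) * ?o p" "t * (?o ?r + ?d \<bullet> (q - ?r)) <= t * ?o q"
  using t by (intro mult_left_mono hinge_subgradient assms; simp)+
 moreover have "(1 - t) * (?o ?r + ?d \<bullet> (p - ?r)) + t * (?o ?r + ?d \<bullet> (q - ?r)) = ?o ?r"
 proof -
  have "(1 - t) *\<^sub>R (p - ?r) + t *\<^sub>R (q - ?r) = 0" by (simp add: algebra_simps)
  hence "?d \<bullet> ((1 - t) *\<^sub>R (p - ?r) + t *\<^sub>R (q - ?r)) = 0" by simp
  hence "(1 - t) * (?d \<bullet> (p - ?r)) + t * (?d \<bullet> (q - ?r)) = 0" by (simp only: inner_add_right inner_scaleR_right)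
  thus ?thesis by (simp add: algebra_simps)
 qed
 ultimately show "?o ?r <= (1 - t) * ?o p + t * ?o q" by linarith
qed simp

lemma hinge_continuous: "continuous_on UNIV (hinge_obj n wt x z g c)"
 unfolding hinge_obj_def by (intro continuous_intros)

text \<open>Convexity localizes minimizers: if the objective is larger on a sphere than at its centre, then it
 has a minimizer and all its minimizers lie in the ball.\<close>

lemma minimizer_in_ball:
 fixes obj :: "real^'d::finite => real"
 assumes conv: "convex_on UNIV obj" and cont: "continuous_on UNIV obj" and r: "0 < r"
  and sphere: "\<And>b. norm (b - b0) = r ==> obj b0 < obj b" and min: "minimizer_if_any obj x"
 shows "norm (x - b0) < r \<and> (\<forall>b. obj x <= obj b)"
proof -
 have out: "obj b0 < obj b" if b: "r <= norm (b - b0)" for b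
 proof -
  define t where "t = r / norm (b - b0)"
  have nz: "0 < norm (b - b0)" using r b by linarith
  have t: "0 < t" "t <= 1" using r b nz by (simp_all add: t_def)
  define p where "p = (1 - t) *\<^sub>R b0 + t *\<^sub>R b"
  have "p - b0 = t *\<^sub>R (b - b0)" by (simp add: p_def algebra_simps)
  hence "norm (p - b0) = r" using r nz by (simp add: t_def)
  hence "obj b0 < obj p" by (rule sphere)
  also have "... <= (1 - t) * obj b0 + t * obj b" unfolding p_def using t by (intro convex_onD[OF conv]) auto
  finally have "t * obj b0 < t * obj b" by (simp add: algebra_simps)
  thus ?thesis using t by simp
 qed
 have "cball b0 r \<noteq> {}" using r by simp
 then obtain y where y: "y \<in> cball b0 r" "\<And>b. b \<in> cball b0 r ==> obj y <= obj b"
  using continuous_attains_inf[OF compact_cball _ continuous_on_subset[OF cont]] by blast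
 have "obj y <= obj b" for b
 proof (cases "b \<in> cball b0 r")
  case False
  hence "obj b0 < obj b" by (intro out) (auto simp: dist_norm norm_minus_commute)
  moreover have "obj y <= obj b0" using y(2)[of b0] r by simp
  ultimately show ?thesis by linarith
 qed (rule y(2))
 hence "is_arg_min obj (\<lambda>_. True) y" by (simp add: is_arg_min_def not_less)
 hence "is_arg_min obj (\<lambda>_. True) x" using min unfolding minimizer_if_any_def by blast
 hence xm: "\<And>b. obj x <= obj b" by (simp add: is_arg_min_def not_less)
 have "norm (x - b0) < r"
 proof (rule ccontr)
  assume "\<not> norm (x - b0) < r"
  hence "obj b0 < obj x" by (intro out) simp
  thus False using xm[of b0] by simp
 qed
 thus ?thesis using xm by blast
qed

text \<open>The quantitative form. \<open>S\<close> is the empirical subgradient, \<open>mu\<close> its mean, \<open>y\<close> bounds the fluctuation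
 of \<open>S - mu\<close> near \<open>b\<^sub>0\<close>; applying the subgradient inequality at \<open>b\<^sub>0\<close> and at the midpoint of \<open>b\<^sub>0\<close> and a point
 of the sphere brings in the strong monotonicity of \<open>mu\<close>.\<close>

lemma hinge_minimizer_distance:
 fixes S mu :: "real^'d::finite => real^'d" and G b0 x :: "real^'d"
 assumes wt: "\<And>i. i < n ==> 0 <= wt i" and k: "0 < k" and l0: "0 < l0"
  and sub: "\<And>b. norm (b - b0) < r ==> hinge_subgrad n wt xs z b = k *\<^sub>R S b"
  and mono: "\<And>b. norm (b - b0) < r ==> l0 * (norm (b - b0))\<^sup>2 <= (mu b - mu b0) \<bullet> (b - b0)"
  and fluct: "\<And>b. norm (b - b0) < r ==> norm ((S b - mu b) - (S b0 - mu b0)) <= y"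
  and small: "(2 * y + 4 * norm (S b0 - G)) / l0 < r" and r: "0 < r"
  and min: "minimizer_if_any (hinge_obj n wt xs z (k *\<^sub>R G) c) x"
 shows "norm (x - b0) <= (2 * y + 4 * norm (S b0 - G)) / l0"
  and "\<forall>b. hinge_obj n wt xs z (k *\<^sub>R G) c x <= hinge_obj n wt xs z (k *\<^sub>R G) c b"
proof -
 let ?o = "hinge_obj n wt xs z (k *\<^sub>R G) c"
 define D where "D = norm (S b0 - G)"
 define \<beta> where "\<beta> = (2 * y + 4 * D) / l0"
 have key: "norm (x - b0) < p \<and> (\<forall>b. ?o x <= ?o b)" if p: "\<beta> < p" "p < r" "0 < p" for p
 proof (rule minimizer_in_ball[OF hinge_convex[OF wt] hinge_continuous p(3) _ min])
  fix b assume b: "norm (b - b0) = p"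
  define m where "m = b0 + (1 / 2) *\<^sub>R (b - b0)"
  let ?h = "b - b0"
  have mb: "m - b0 = (1 / 2) *\<^sub>R ?h" by (simp add: m_def)
  have "b - m = b - b0 - (1 / 2) *\<^sub>R (b - b0)" by (simp add: m_def)
  also have "... = (1 - 1 / 2) *\<^sub>R ?h" by (simp only: scaleR_diff_left scaleR_one)
  finally have mb2: "b - m = (1 / 2) *\<^sub>R ?h" by simp
  have nm: "norm (m - b0) = p / 2" unfolding mb using b p by simp
  hence mr: "norm (m - b0) < r" using p by simp
  have 1: "?o b >= ?o m + (k *\<^sub>R S m - k *\<^sub>R G) \<bullet> (b - m)"
   using hinge_subgradient[of n wt xs z "k *\<^sub>R G" c m b, OF wt] sub[OF mr] by simp
  have 2: "?o m >= ?o b0 + (k *\<^sub>R S b0 - k *\<^sub>R G) \<bullet> (m - b0)"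
   using hinge_subgradient[of n wt xs z "k *\<^sub>R G" c b0 m, OF wt] sub[of b0] p by simp
  have e1: "(k *\<^sub>R S m - k *\<^sub>R G) \<bullet> (b - m) = k / 2 * ((S m - G) \<bullet> ?h)"
   unfolding mb2 by (simp add: scaleR_diff_right[symmetric])
  have e2: "(k *\<^sub>R S b0 - k *\<^sub>R G) \<bullet> (m - b0) = k / 2 * ((S b0 - G) \<bullet> ?h)"
   unfolding mb by (simp add: scaleR_diff_right[symmetric])
  have dec: "(S m - G) \<bullet> ?h = (mu m - mu b0) \<bullet> ?h + ((S m - mu m) - (S b0 - mu b0)) \<bullet> ?h + (S b0 - G) \<bullet> ?h"
   by (simp add: inner_diff_left)
  have "l0 * (p / 2)\<^sup>2 <= (mu m - mu b0) \<bullet> ((1 / 2) *\<^sub>R ?h)" using mono[OF mr] unfolding nm unfolding mb .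
  hence a1: "l0 * p\<^sup>2 / 2 <= (mu m - mu b0) \<bullet> ?h" by (simp add: power2_eq_square mult_ac)
  have "\<bar>((S m - mu m) - (S b0 - mu b0)) \<bullet> ?h\<bar> <= norm ((S m - mu m) - (S b0 - mu b0)) * norm ?h" by (rule Cauchy_Schwarz_ineq2)
  also have "... <= y * p" unfolding b using fluct[OF mr] p by (intro mult_right_mono) auto
  finally have a2: "- (y * p) <= ((S m - mu m) - (S b0 - mu b0)) \<bullet> ?h" by simp
  have "\<bar>(S b0 - G) \<bullet> ?h\<bar> <= D * norm ?h" unfolding D_def by (rule Cauchy_Schwarz_ineq2)
  hence a3: "- (D * p) <= (S b0 - G) \<bullet> ?h" unfolding b by simp
  have "2 * y + 4 * D < l0 * p" using p(1) l0 by (simp add: \<beta>_def pos_divide_less_eq mult.commute)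
  hence "(2 * y + 4 * D) * p < l0 * p * p" using p(3) by simp
  hence "0 < (S m - G) \<bullet> ?h + (S b0 - G) \<bullet> ?h"
   using a1 a2 a3 unfolding dec by (simp add: power2_eq_square algebra_simps)
  hence "0 < k / 2 * ((S m - G) \<bullet> ?h + (S b0 - G) \<bullet> ?h)" using k by simp
  thus "?o b0 < ?o b" using 1 2 unfolding e1 e2 by (simp add: distrib_left)
 qed
 have x0: "0 <= y" using fluct[of b0] r by simp
 have c0: "0 <= \<beta>" using x0 l0 by (simp add: \<beta>_def D_def)
 have br: "\<beta> < r" using small by (simp add: \<beta>_def D_def)
 obtain p where "\<beta> < p" "p < r" using dense[OF br] by blast
 thus "\<forall>b. ?o x <= ?o b" using key[of p] c0 by auto
 have "norm (x - b0) <= \<beta>"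
 proof (rule dense_ge_bounded[OF br])
  fix p assume "\<beta> < p" "p < r"
  thus "norm (x - b0) <= p" using key[of p] c0 by auto
 qed
 thus "norm (x - b0) <= (2 * y + 4 * norm (S b0 - G)) / l0" by (simp add: \<beta>_def D_def)
qed

text \<open>At a minimizer the estimating function vanishes up to the local oscillation of the empirical
 process: the inequality \<open>(S(x + v) - G) \<bullet> v >= 0\<close> holds for all \<open>v\<close>, and \<open>v\<close> is taken to be a
 small negative multiple of \<open>S(x) - G\<close>.\<close>

lemma hinge_minimizer_gradient:
 fixes S mu :: "real^'d::finite => real^'d" and G b0 x :: "real^'d"
 assumes wt: "\<And>i. i < n ==> 0 <= wt i" and k: "0 < k" and r: "0 < r"
  and sub: "\<And>b. norm (b - x) < r ==> hinge_subgrad n wt xs z b = k *\<^sub>R S b"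
  and cont: "isCont mu x"
  and fluct: "\<And>b. norm (b - x) < r ==> norm ((S b - mu b) - (S x - mu x)) <= y"
  and min: "\<forall>b. hinge_obj n wt xs z (k *\<^sub>R G) c x <= hinge_obj n wt xs z (k *\<^sub>R G) c b"
 shows "norm (S x - G) <= y"
proof (rule field_le_epsilon)
 fix e :: real assume e: "0 < e"
 have x0: "0 <= y" using fluct[of x] r by simp
 let ?o = "hinge_obj n wt xs z (k *\<^sub>R G) c" and ?A = "S x - G"
 obtain d where d: "d > 0" "\<And>b. norm (b - x) < d ==> norm (mu b - mu x) < e"
  using cont e unfolding continuous_at_eps_delta dist_norm by blast
 show "norm ?A <= y + e"
 proof (cases "?A = 0")
  case False
  define h where "h = min d r / 2"
  have h: "0 < h" "h < d" "h < r" using d r by (auto simp: h_def)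
  define v where "v = - (h / norm ?A) *\<^sub>R ?A"
  have nv: "norm v = h" using False h by (simp add: v_def)
  have Av: "?A \<bullet> v = - (h * norm ?A)" using False
   by (simp add: v_def power2_norm_eq_inner[symmetric] power2_eq_square)
  have "?o x >= ?o (x + v) + (k *\<^sub>R S (x + v) - k *\<^sub>R G) \<bullet> (x - (x + v))"
   using hinge_subgradient[of n wt xs z "k *\<^sub>R G" c "x + v" x, OF wt] sub[of "x + v"] nv h by simp
  hence "(k *\<^sub>R S (x + v) - k *\<^sub>R G) \<bullet> (- v) <= 0" using min[rule_format, of "x + v"] by simp
  hence "0 <= k * ((S (x + v) - G) \<bullet> v)" by (simp add: scaleR_diff_right[symmetric])
  hence "0 <= (S (x + v) - G) \<bullet> v" using k by (simp add: zero_le_mult_iff)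
  also have "... = ?A \<bullet> v + (((S (x + v) - mu (x + v)) - (S x - mu x)) + (mu (x + v) - mu x)) \<bullet> v"
   by (simp add: inner_diff_left inner_add_left)
  also have "... <= - (h * norm ?A) + (y + e) * h"
  proof -
   have "(((S (x + v) - mu (x + v)) - (S x - mu x)) + (mu (x + v) - mu x)) \<bullet> v
     <= norm (((S (x + v) - mu (x + v)) - (S x - mu x)) + (mu (x + v) - mu x)) * norm v"
    by (rule norm_cauchy_schwarz)
   also have "... <= (y + e) * h"
    unfolding nv using fluct[of "x + v"] d(2)[of "x + v"] nv h
    by (intro mult_right_mono order_trans[OF norm_triangle_ineq] add_mono) (auto intro: less_imp_le)
   finally show ?thesis using Av by simp
  qed
  finally have "h * norm ?A <= h * (y + e)" by (simp add: mult.commute)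
  thus ?thesis using h by simp
 qed (use x0 e in simp)
qed
lemma closed_threshold_measurable:
 fixes \<beta> :: "real => real^'d::finite" and x :: real and z :: "real^'d"
 assumes \<beta>: "continuous_on {a..b} \<beta>"
 shows "(\<lambda>u. of_bool (z \<bullet> \<beta> u <= x) :: real) \<in> borel_measurable (restrict_space borel {a..b})"
  and "(\<lambda>u. of_bool (x <= z \<bullet> \<beta> u) :: real) \<in> borel_measurable (restrict_space borel {a..b})"
proof -
 have m: "(\<lambda>u. z \<bullet> \<beta> u) \<in> borel_measurable (restrict_space borel {a..b})"
  by (intro borel_measurable_continuous_on_restrict continuous_intros \<beta>)
 show "(\<lambda>u. of_bool (z \<bullet> \<beta> u <= x) :: real) \<in> borel_measurable (restrict_space borel {a..b})"
  using measurable_compose[OF m, of "\<lambda>y. of_bool (y <= x) :: real" borel] by simp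
 show "(\<lambda>u. of_bool (x <= z \<bullet> \<beta> u) :: real) \<in> borel_measurable (restrict_space borel {a..b})"
  using measurable_compose[OF m, of "\<lambda>y. of_bool (x <= y) :: real" borel] by simp
qed

lemma continuous_on_matrix_columns:
 fixes A :: "real => real^'d::finite^'d"
 assumes "\<And>x. continuous_on I (\<lambda>s. A s *v x)"
 shows "continuous_on I A"
proof -
 have "continuous_on I (\<lambda>s. \<chi> i j. (A s *v axis j 1) $ i)"
  by (intro continuous_on_vec_lambda continuous_on_component assms)
 moreover have "(\<lambda>s. \<chi> i j. (A s *v axis j 1) $ i) = A"
  by (simp add: fun_eq_iff vec_eq_iff matrix_vector_mult_basis column_def)
 ultimately show ?thesis by (simp only:)
qed

context cqr_population
begin

text \<open>Within this distance of \<open>\<beta> tL\<close> the fitted values stay below the fit at \<open>tL + a\<close>, and hence below all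
 censoring times; see \<open>quantile_gap\<close>.\<close>

definition radius :: real where "radius = min \<epsilon> (a / (L * C + 1))"

lemma C_nonneg: "0 <= C" by (rule F.C0)

lemma radius: "0 < radius" "radius <= \<epsilon>" "L * (C * radius) < a"
proof -
 have p: "0 < L * C + 1" using L(1) C_nonneg by (simp add: add_nonneg_pos)
 show "0 < radius" "radius <= \<epsilon>" using eps early(1) p by (auto simp: radius_def)
 have "L * C * radius <= L * C * (a / (L * C + 1))" using L(1) C_nonneg by (intro mult_left_mono) (auto simp: radius_def)
 also have "... < a" using p early(1) by (simp add: pos_divide_less_eq distrib_left)
 finally show "L * (C * radius) < a" by (simp add: mult.assoc)
qed

lemma mut_lipschitz:
 assumes "closed_segment b1 b2 \<subseteq> U"
 shows "norm (mut M Y b2 - mut M Y b1) <= L * (C * C) * norm (b2 - b1)"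
 using Ft.func_lipschitz[OF assms] by (simp add: mut_eq_Ft norm_minus_commute)

lemma mu_remainder:
 assumes "closed_segment b1 b2 \<subseteq> U"
 shows "norm (mu M Y b2 - mu M Y b1 - mu' M Y b1 *v (b2 - b1)) <= C * C * Hf * norm (b2 - b1) * norm (b2 - b1) powr \<gamma>"
proof -
 have "b1 \<in> U" using assms by auto
 thus ?thesis using F.func_remainder[OF assms] by (simp add: mu_eq mu'_eq)
qed

lemma mut_remainder:
 assumes "closed_segment b1 b2 \<subseteq> U"
 shows "norm (mut M Y b2 - mut M Y b1 - mut' M Y b1 *v (b2 - b1)) <= C * C * Hf * norm (b2 - b1) * norm (b2 - b1) powr \<gamma>"
proof -
 have b: "b1 \<in> U" using assms by auto
 have "mut M Y b2 - mut M Y b1 - mut' M Y b1 *v (b2 - b1) = - (Ft.func b2 - Ft.func b1 - Ft.jac b1 *v (b2 - b1))"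
  by (simp add: mut_eq_Ft mut'_eq[OF b] bounded_bilinear.minus_left[OF bounded_bilinear_matrix_vector])
 thus ?thesis using Ft.func_remainder[OF assms] by (simp add: norm_minus_cancel del: minus_diff_eq)
qed

definition Ainv :: "real => real^'d^'d" where "Ainv s = matrix_inv (mu' M Y (\<beta> s))"

definition Mu :: "real => real^'d^'d" where "Mu u = mut' M Y (\<beta> u) ** Ainv u"

lemma mu'_lower:
 assumes s: "s \<in> I"
 shows "l0 * norm v <= norm (mu' M Y (\<beta> s) *v v)"
proof (cases "v = 0")
 case False
 have "l0 * (norm v * norm v) <= v \<bullet> (mu' M Y (\<beta> s) *v v)"
  using quadratic_form[OF \<beta>_in_U[OF s], of v] by (simp add: mu'_eq[OF \<beta>_in_U[OF s]] power2_norm_eq_inner[symmetric] power2_eq_square)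
 also have "... <= norm v * norm (mu' M Y (\<beta> s) *v v)" by (rule norm_cauchy_schwarz)
 finally have "norm v * (l0 * norm v) <= norm v * norm (mu' M Y (\<beta> s) *v v)" by (simp add: mult_ac)
 thus ?thesis using False by (simp add: mult_le_cancel_left_pos)
qed simp

lemma Ainv:
 assumes s: "s \<in> I"
 shows "Ainv s ** mu' M Y (\<beta> s) = mat 1" "mu' M Y (\<beta> s) ** Ainv s = mat 1" "norm (Ainv s *v x) <= norm x / l0"
proof -
 have "\<forall>v. mu' M Y (\<beta> s) *v v = 0 --> v = 0"
 proof (intro allI impI)
  fix v assume "mu' M Y (\<beta> s) *v v = 0"
  hence "l0 * norm v <= 0" using mu'_lower[OF s, of v] by simp
  thus "v = 0" using l0(1) by (simp add: mult_le_0_iff)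
 qed
 then obtain B where B: "B ** mu' M Y (\<beta> s) = mat 1" using matrix_left_invertible_ker[of "mu' M Y (\<beta> s)"] by blast
 hence "mu' M Y (\<beta> s) ** B = mat 1" using matrix_left_right_inverse by blast
 hence "\<exists>B. mu' M Y (\<beta> s) ** B = mat 1 \<and> B ** mu' M Y (\<beta> s) = mat 1" using B by blast
 hence i: "mu' M Y (\<beta> s) ** Ainv s = mat 1 \<and> Ainv s ** mu' M Y (\<beta> s) = mat 1"
  unfolding Ainv_def matrix_inv_def by (rule someI_ex)
 thus "Ainv s ** mu' M Y (\<beta> s) = mat 1" "mu' M Y (\<beta> s) ** Ainv s = mat 1" by auto
 from i have "l0 * norm (Ainv s *v x) <= norm x"
  using mu'_lower[OF s, of "Ainv s *v x"] by (simp add: matrix_vector_mul_assoc)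
 thus "norm (Ainv s *v x) <= norm x / l0" using l0(1) by (simp add: pos_le_divide_eq mult.commute)
qed

lemma continuous_if_hoelder:
 fixes J :: "real^'d => real^'d^'d"
 assumes "\<And>b1 b2. b1 \<in> U ==> b2 \<in> U ==> norm (J b1 - J b2) <= T * norm (b1 - b2) powr \<gamma>"
 shows "continuous_on I (\<lambda>s. J (\<beta> s))"
proof (rule continuous_on_compose2[OF _ \<beta>_continuous])
 show "continuous_on U J"
  unfolding continuous_on_def
 proof
  fix x assume x: "x \<in> U"
  have "((\<lambda>b. T * norm (b - x) powr \<gamma>) \<longlongrightarrow> T * norm (x - x) powr \<gamma>) (at x within U)"
   using \<gamma> by (intro tendsto_intros tendsto_powr2) auto
  hence "((\<lambda>b. T * norm (b - x) powr \<gamma>) \<longlongrightarrow> 0) (at x within U)" using \<gamma> by simp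
  thus "(J \<longlongrightarrow> J x) (at x within U)"
   by (rule Lim_transform_bound[where f="\<lambda>b. J b - J x", THEN Lim_null[THEN iffD2], rotated])
    (auto simp: eventually_at_filter intro!: always_eventually order_trans[OF assms[OF _ x]])
 qed
qed (use \<beta>_in_U in auto)

lemma mu'_continuous: "continuous_on I (\<lambda>s. mu' M Y (\<beta> s))"
 by (rule continuous_on_cong[THEN iffD1, OF refl _ continuous_if_hoelder[OF F.jac_hoelder]]) (simp add: mu'_eq \<beta>_in_U)

lemma mut'_continuous: "continuous_on I (\<lambda>s. mut' M Y (\<beta> s))"
 by (rule continuous_on_cong[THEN iffD1, OF refl _ continuous_on_minus[OF continuous_if_hoelder[OF Ft.jac_hoelder]]])
  (simp add: mut'_eq \<beta>_in_U)

lemma Ainv_continuous: "continuous_on I Ainv"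
proof (rule continuous_on_matrix_columns)
 fix x
 show "continuous_on I (\<lambda>s. Ainv s *v x)"
  unfolding continuous_on_def
 proof
  fix t assume t: "t \<in> I"
  let ?A = "\<lambda>s. mu' M Y (\<beta> s)"
  have "(?A \<longlongrightarrow> ?A t) (at t within I)" using mu'_continuous t by (simp add: continuous_on_def)
  hence "((\<lambda>s. norm ((?A t - ?A s) *v (Ainv t *v x)) / l0) \<longlongrightarrow> norm ((?A t - ?A t) *v (Ainv t *v x)) / l0) (at t within I)"
   using l0(1) by (intro tendsto_intros bounded_bilinear.tendsto[OF bounded_bilinear_matrix_vector]) auto
  hence lim: "((\<lambda>s. norm ((?A t - ?A s) *v (Ainv t *v x)) / l0) \<longlongrightarrow> 0) (at t within I)" by simp
  have "norm (Ainv s *v x - Ainv t *v x) <= norm ((?A t - ?A s) *v (Ainv t *v x)) / l0" if s: "s \<in> I" for s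
  proof -
   have "Ainv s *v ((?A t - ?A s) *v (Ainv t *v x)) = Ainv s *v ((?A t ** Ainv t) *v x) - (Ainv s ** ?A s) *v (Ainv t *v x)"
    by (simp only: matrix_vector_mult_diff_rdistrib matrix_vector_mult_diff_distrib) (simp only: matrix_vector_mul_assoc matrix_mul_assoc)
   hence "Ainv s *v ((?A t - ?A s) *v (Ainv t *v x)) = Ainv s *v x - Ainv t *v x"
    using Ainv(1)[OF s] Ainv(2)[OF t] by simp
   thus ?thesis using Ainv(3)[OF s, of "(?A t - ?A s) *v (Ainv t *v x)"] by simp
  qed
  thus "((\<lambda>s. Ainv s *v x) \<longlongrightarrow> Ainv t *v x) (at t within I)"
   by (intro Lim_transform_bound[where f="\<lambda>s. Ainv s *v x - Ainv t *v x", THEN Lim_null[THEN iffD2], OF _ lim])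
    (use l0(1) in "auto simp: eventually_at_filter intro!: always_eventually")
 qed
qed

lemma Mu_continuous: "continuous_on I Mu"
 unfolding Mu_def[abs_def] by (intro continuous_intros mut'_continuous Ainv_continuous)

end

text \<open>A fixed sample outside the exceptional null sets. \<open>S\<close> and \<open>St\<close> are the empirical versions of \<open>mu\<close> and
 \<open>mut\<close>, \<open>v\<close> and \<open>vt\<close> the centered ones; \<open>G\<close> is the right-hand side of the estimating equation at the
 estimator, and \<open>h\<close> the mesh.\<close>

locale cqr_sample = cqr_population M Y K \<beta> tL tU a \<epsilon> \<gamma> C L Hf l0 C4 Z U supp
 for M :: "'a measure" and Y :: "'a => 'd::finite datum" and K \<beta> tL tU a \<epsilon> \<gamma> C L Hf l0 C4 Z U supp +
 fixes ys :: "nat => 'd datum" and n m :: nat and bh :: "real => real^'d"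
 assumes n: "0 < n" and m: "0 < m" and est: "cqr_estimator tL tU m ys n bh"
  and covar_le: "\<And>i. norm (covar (ys i)) <= C"
  and uncensored_early: "\<And>i. covar (ys i) \<bullet> \<beta> (tL + a) < cens (ys i)"
  and gap: "\<And>i. a <= L * (covar (ys i) \<bullet> \<beta> (tL + a) - covar (ys i) \<bullet> \<beta> tL)"
begin

definition S :: "real^'d => real^'d" where
 "S b = (1 / real n) *\<^sub>R (\<Sum>i<n. of_bool (uncensored (ys i) \<and> obs (ys i) <= covar (ys i) \<bullet> b) *\<^sub>R covar (ys i))"

definition St :: "real^'d => real^'d" where
 "St b = (1 / real n) *\<^sub>R (\<Sum>i<n. of_bool (covar (ys i) \<bullet> b <= obs (ys i)) *\<^sub>R covar (ys i))"

definition v :: "real^'d => real^'d" where "v b = S b - mu M Y b"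

definition vt :: "real^'d => real^'d" where "vt b = St b - mut M Y b"

definition Zbar :: "real^'d" where "Zbar = (1 / real n) *\<^sub>R (\<Sum>i<n. covar (ys i))"

definition w :: "real => real^'d" where
 "w s = tL *\<^sub>R (Zbar - (LINT x|M. Z x)) - v (\<beta> s) + (LINT u:{tL..<s}|dH. vt (\<beta> u))"

definition G :: "real => real^'d" where
 "G t = tL *\<^sub>R Zbar + (LINT u:{tL..<t}|dH. St (bh u))"

definition h :: real where "h = (tU - tL) / real m"

definition gp :: "nat => real" where "gp j = grid tL tU m j"

definition cell :: "real => nat" where "cell s = nat \<lfloor>(s - tL) / h\<rfloor>"

lemma h_pos: "0 < h" using taus m by (simp add: h_def)

lemma gp_eq: "gp j = tL + real j * h" by (simp add: gp_def grid_def h_def)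

lemma gp_m: "gp m = tU" using m by (simp add: gp_eq h_def)

lemma gp_mono: "i <= j ==> gp i <= gp j" using h_pos by (simp add: gp_eq)

lemma gp_in: "j <= m ==> gp j \<in> I"
 using gp_mono[of 0 j] gp_mono[of j m] gp_m by (auto simp: gp_eq)

lemma cell:
 assumes s: "s \<in> I"
 shows "gp (cell s) <= s" "s < gp (cell s) + h" "cell s <= m" "s < gp j ==> cell s < j"
proof -
 have p: "0 <= (s - tL) / h" using s h_pos by simp
 have r: "real (cell s) <= (s - tL) / h" "(s - tL) / h < real (cell s) + 1"
  using p by (auto simp: cell_def)
 thus 1: "gp (cell s) <= s" and "s < gp (cell s) + h"
  using h_pos by (auto simp: gp_eq field_simps)
 show "cell s < j" if "s < gp j" for j
 proof (rule ccontr)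
  assume "\<not> cell s < j"
  hence "gp j <= gp (cell s)" by (intro gp_mono) simp
  thus False using 1 that by simp
 qed
 from this[of "Suc m"] show "cell s <= m" using s gp_m h_pos by (simp add: gp_eq distrib_right)
qed

lemma bh_step:
 assumes s: "s \<in> I"
 shows "bh s = bh (gp (cell s))"
proof (cases "cell s < m")
 case True
 have "s < gp (Suc (cell s))" using cell(2)[OF s] by (simp add: gp_eq distrib_right)
 hence "s \<in> {gp (cell s)..<gp (Suc (cell s))}" using cell(1)[OF s] by simp
 moreover have "\<forall>j<m. \<forall>t\<in>{gp j..<gp (Suc j)}. bh t = bh (gp j)"
  using est unfolding cqr_estimator_def gp_def by blast
 ultimately show ?thesis using True by blast
next
 case False
 hence "gp (cell s) = tU" using cell(3)[OF s] gp_m by simp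
 thus ?thesis using cell(1)[OF s] s by simp
qed

lemma step_bounded_measurable:
 fixes F :: "real^'d => 'b::euclidean_space"
 shows "bdd_meas tL tU (\<lambda>u. F (bh u))"
 unfolding bdd_meas_def
proof
 have "(\<lambda>u. F (bh (gp (cell u)))) \<in> borel_measurable borel"
  unfolding cell_def
  by (rule measurable_compose[where N="count_space UNIV" and g="\<lambda>k. F (bh (gp (nat k)))"]) measurable
 hence "(\<lambda>u. F (bh (gp (cell u)))) \<in> borel_measurable (restrict_space borel I)"
  by (rule measurable_restrict_space1)
 thus "(\<lambda>u. F (bh u)) \<in> borel_measurable (restrict_space borel I)"
  by (rule measurable_cong[THEN iffD1, rotated]) (simp add: space_restrict_space bh_step)
 have "(\<lambda>u. F (bh u)) ` I \<subseteq> (\<lambda>j. F (bh (gp j))) ` {..m}"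
  using bh_step cell(3) by auto
 thus "bounded ((\<lambda>u. F (bh u)) ` I)"
  by (rule bounded_subset[OF finite_imp_bounded, rotated]) simp
qed

lemma average_le: "(\<And>i. norm (f i) <= norm (covar (ys i))) ==> norm ((1 / real n) *\<^sub>R (\<Sum>i<n. f i :: real^'d)) <= C"
proof -
 assume f: "\<And>i. norm (f i) <= norm (covar (ys i))"
 have "norm (\<Sum>i<n. f i) <= (\<Sum>i<n. C)" by (intro sum_norm_le order_trans[OF f covar_le])
 thus ?thesis using n by (simp add: pos_divide_le_eq mult.commute)
qed

lemma St_le: "norm (St b) <= C" and S_le: "norm (S b) <= C"
 unfolding St_def S_def by (intro average_le; simp)+

lemma St_\<beta>_measurable: "bdd_meas tL tU (\<lambda>u. St (\<beta> u))"
 and S_\<beta>_measurable: "bdd_meas tL tU (\<lambda>u. S (\<beta> u))"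
proof -
 show "bdd_meas tL tU (\<lambda>u. St (\<beta> u))"
  unfolding bdd_meas_def
 proof
  show "(\<lambda>u. St (\<beta> u)) \<in> borel_measurable (restrict_space borel I)"
   unfolding St_def
   by (intro borel_measurable_scaleR borel_measurable_const borel_measurable_sum closed_threshold_measurable \<beta>_continuous)
  show "bounded ((\<lambda>u. St (\<beta> u)) ` I)" using St_le by (auto simp: bounded_iff)
 qed
 show "bdd_meas tL tU (\<lambda>u. S (\<beta> u))"
  unfolding bdd_meas_def
 proof
  show "(\<lambda>u. S (\<beta> u)) \<in> borel_measurable (restrict_space borel I)"
   unfolding S_def of_bool_conj
   by (intro borel_measurable_scaleR borel_measurable_const borel_measurable_sum borel_measurable_times closed_threshold_measurable \<beta>_continuous)
  show "bounded ((\<lambda>u. S (\<beta> u)) ` I)" using S_le by (auto simp: bounded_iff)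
 qed
qed

lemma vt_\<beta>_measurable: "bdd_meas tL tU (\<lambda>u. vt (\<beta> u))"
 unfolding vt_def by (intro bdd_meas_diff St_\<beta>_measurable bdd_meas_continuous mut_\<beta>_continuous)

lemma v_\<beta>_measurable: "bdd_meas tL tU (\<lambda>u. v (\<beta> u))"
proof -
 have "continuous_on I (\<lambda>u. mu M Y (\<beta> u))"
 proof (rule continuous_on_compose2[OF _ \<beta>_continuous])
  show "continuous_on U (mu M Y)"
   by (intro continuous_at_imp_continuous_on ballI has_derivative_continuous[OF mu_has_derivative])
 qed (use \<beta>_in_U in auto)
 thus ?thesis unfolding v_def by (intro bdd_meas_diff S_\<beta>_measurable bdd_meas_continuous)
qed

lemma hazard_integral_continuous:
 fixes f :: "real => real^'d"
 assumes f: "bdd_meas tL tU f"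
 shows "continuous_on I (\<lambda>s. LINT u:{tL..<s}|dH. f u)"
proof -
 have "continuous_on I (\<lambda>s. integral {tL..s} (\<lambda>u. (1 / (1 - u)) *\<^sub>R f u))"
  by (rule indefinite_integral_continuous_1)
   (intro bdd_meas_integrable[OF bdd_meas_hazard[OF f taus(3)]] order_refl)
 thus ?thesis
 proof (rule continuous_on_cong[THEN iffD1, OF refl, rotated])
  show "integral {tL..s} (\<lambda>u. (1 / (1 - u)) *\<^sub>R f u) = (LINT u:{tL..<s}|dH. f u)" if "s \<in> I" for s
   using that taus by (intro hazard_integral_eq(1)[OF f, symmetric]) auto
 qed
qed

lemma w_measurable: "bdd_meas tL tU w"
 unfolding w_def[abs_def]
 by (intro bdd_meas_add bdd_meas_diff v_\<beta>_measurable
   bdd_meas_continuous[OF hazard_integral_continuous[OF vt_\<beta>_measurable]]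
   bdd_meas_continuous continuous_on_const)

lemma step_obj_eq:
 assumes t: "t \<in> I"
 shows "\<exists>c. step_obj ys n tL bh t = hinge_obj n (\<lambda>i. 2 * of_bool (uncensored (ys i)) / real n) (\<lambda>i. obs (ys i)) (\<lambda>i. covar (ys i)) (2 *\<^sub>R G t) c"
proof -
 define p where "p i = (LINT u:{tL..<t}|dH. (of_bool (covar (ys i) \<bullet> bh u <= obs (ys i)) :: real))" for i
 have si: "set_integrable dH {tL..<t} (\<lambda>u. of_bool (covar (ys i) \<bullet> bh u <= obs (ys i)) :: real)" for i
  using t taus by (intro hazard_set_integrable[OF step_bounded_measurable[of "\<lambda>b. of_bool (covar (ys i) \<bullet> b <= obs (ys i))"]]) auto
 have "(LINT u:{tL..<t}|dH. St (bh u)) = (1 / real n) *\<^sub>R (\<Sum>i<n. p i *\<^sub>R covar (ys i))"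
 proof -
  have "(LINT u:{tL..<t}|dH. St (bh u))
    = (LINT u|dH. (1 / real n) *\<^sub>R (\<Sum>i<n. (indicator {tL..<t} u *\<^sub>R of_bool (covar (ys i) \<bullet> bh u <= obs (ys i))) *\<^sub>R covar (ys i)))"
   unfolding set_lebesgue_integral_def St_def
   by (intro Bochner_Integration.integral_cong refl) (simp add: scaleR_sum_right mult_ac)
  also have "... = (1 / real n) *\<^sub>R (\<Sum>i<n. (LINT u|dH. (indicator {tL..<t} u *\<^sub>R of_bool (covar (ys i) \<bullet> bh u <= obs (ys i)))) *\<^sub>R covar (ys i))"
   using si unfolding set_integrable_def
   by (subst integral_scaleR_right, subst Bochner_Integration.integral_sum)
    (auto intro!: integrable_scaleR_left simp del: real_scaleR_def)
  finally show ?thesis by (simp add: p_def set_lebesgue_integral_def)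
 qed
 hence Gt: "G t = (1 / real n) *\<^sub>R (\<Sum>i<n. (p i + tL) *\<^sub>R covar (ys i))"
  by (simp add: G_def Zbar_def scaleR_add_left sum.distrib scaleR_add_right scaleR_sum_right[symmetric])
 show ?thesis
 proof (intro exI ext)
  fix b
  let ?z = "\<lambda>i. covar (ys i)" and ?x = "\<lambda>i. obs (ys i)" and ?d = "\<lambda>i. of_bool (uncensored (ys i)) :: real"
  have "step_obj ys n tL bh t b = (1 / real n) * (\<Sum>i<n. ?d i * \<bar>?x i - ?z i \<bullet> b\<bar> + (?z i \<bullet> b) * (?d i - 2 * p i - 2 * tL))"
   by (simp add: step_obj_def p_def)
  also have "(\<Sum>i<n. ?d i * \<bar>?x i - ?z i \<bullet> b\<bar> + (?z i \<bullet> b) * (?d i - 2 * p i - 2 * tL))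
    = (\<Sum>i<n. (?d i * ?x i + 2 * (?d i * max 0 (?z i \<bullet> b - ?x i))) - 2 * ((p i + tL) * (b \<bullet> ?z i)))"
   by (intro sum.cong refl) (auto simp: abs_if max_def algebra_simps inner_commute)
  also have "... = (\<Sum>i<n. ?d i * ?x i) + 2 * (\<Sum>i<n. ?d i * max 0 (?z i \<bullet> b - ?x i)) - 2 * (\<Sum>i<n. (p i + tL) * (b \<bullet> ?z i))"
   by (simp only: sum.distrib sum_subtractf sum_distrib_left)
  finally have 1: "step_obj ys n tL bh t b = (1 / real n) *
   ((\<Sum>i<n. ?d i * ?x i) + 2 * (\<Sum>i<n. ?d i * max 0 (?z i \<bullet> b - ?x i)) - 2 * (\<Sum>i<n. (p i + tL) * (b \<bullet> ?z i)))" .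
  have 2: "(\<Sum>i<n. 2 * ?d i / real n * max 0 (?z i \<bullet> b - ?x i)) = (2 / real n) * (\<Sum>i<n. ?d i * max 0 (?z i \<bullet> b - ?x i))"
   unfolding sum_distrib_left by (intro sum.cong refl) simp
  have 3: "b \<bullet> (2 *\<^sub>R G t) = (2 / real n) * (\<Sum>i<n. (p i + tL) * (b \<bullet> ?z i))"
   unfolding Gt by (simp only: inner_scaleR_right inner_sum_right)
  show "step_obj ys n tL bh t b = hinge_obj n (\<lambda>i. 2 * ?d i / real n) ?x ?z (2 *\<^sub>R G t) ((1 / real n) * (\<Sum>i<n. ?d i * ?x i)) b"
  proof -
   have "(1 / real n) * (A + 2 * B - 2 * P) = (1 / real n) * A + (2 / real n) * B - (2 / real n) * P" for A B P
    by (simp add: distrib_left right_diff_distrib add_divide_distrib diff_divide_distrib)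
   thus ?thesis unfolding hinge_obj_def 1 2 3 .
  qed
 qed
qed

lemma init_obj_eq:
 "\<exists>c. init_obj ys n tL = hinge_obj n (\<lambda>i. 1 / real n) (\<lambda>i. obs (ys i)) (\<lambda>i. covar (ys i)) (1 *\<^sub>R G tL) c"
proof (intro exI ext)
 fix b
 let ?z = "\<lambda>i. covar (ys i)" and ?x = "\<lambda>i. obs (ys i)"
 have "G tL = tL *\<^sub>R Zbar" by (simp add: G_def set_lebesgue_integral_def)
 hence 3: "b \<bullet> (1 *\<^sub>R G tL) = (1 / real n) * (tL * (\<Sum>i<n. b \<bullet> ?z i))"
  by (simp add: Zbar_def inner_sum_right)
 have "(\<Sum>i<n. check_loss tL (?x i - ?z i \<bullet> b)) = (\<Sum>i<n. (tL * ?x i + max 0 (?z i \<bullet> b - ?x i)) - tL * (b \<bullet> ?z i))"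
  by (intro sum.cong refl) (auto simp: check_loss_def max_def algebra_simps inner_commute)
 also have "... = (\<Sum>i<n. tL * ?x i) + (\<Sum>i<n. max 0 (?z i \<bullet> b - ?x i)) - tL * (\<Sum>i<n. b \<bullet> ?z i)"
  by (simp only: sum.distrib sum_subtractf sum_distrib_left)
 finally have 1: "(\<Sum>i<n. check_loss tL (?x i - ?z i \<bullet> b))
  = (\<Sum>i<n. tL * ?x i) + (\<Sum>i<n. max 0 (?z i \<bullet> b - ?x i)) - tL * (\<Sum>i<n. b \<bullet> ?z i)" .
 have 2: "(\<Sum>i<n. 1 / real n * max 0 (?z i \<bullet> b - ?x i)) = (1 / real n) * (\<Sum>i<n. max 0 (?z i \<bullet> b - ?x i))"
  unfolding sum_distrib_left ..
 show "init_obj ys n tL b = hinge_obj n (\<lambda>i. 1 / real n) ?x ?z (1 *\<^sub>R G tL) ((1 / real n) * (\<Sum>i<n. tL * ?x i)) b"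
 proof -
  have "(1 / real n) * (A + B - P) = (1 / real n) * A + (1 / real n) * B - (1 / real n) * P" for A B P
   by (simp only: distrib_left right_diff_distrib)
  thus ?thesis unfolding init_obj_def hinge_obj_def 1 2 3 .
 qed
qed

lemma step_subgrad:
 "hinge_subgrad n (\<lambda>i. 2 * of_bool (uncensored (ys i)) / real n) (\<lambda>i. obs (ys i)) (\<lambda>i. covar (ys i)) b = 2 *\<^sub>R S b"
 unfolding hinge_subgrad_def S_def scaleR_sum_right of_bool_conj
 by (intro sum.cong refl) simp

text \<open>Near \<open>\<beta> tL\<close> no observation below the fitted value is censored.\<close>

lemma init_subgrad:
 assumes b: "norm (b - \<beta> tL) < radius"
 shows "hinge_subgrad n (\<lambda>i. 1 / real n) (\<lambda>i. obs (ys i)) (\<lambda>i. covar (ys i)) b = 1 *\<^sub>R S b"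
proof -
 have "uncensored (ys i)" if "obs (ys i) <= covar (ys i) \<bullet> b" for i
 proof -
  let ?z = "covar (ys i)"
  have "?z \<bullet> (b - \<beta> tL) <= norm ?z * norm (b - \<beta> tL)" by (rule norm_cauchy_schwarz)
  also have "... <= C * radius" using b covar_le C_nonneg by (intro mult_mono) auto
  finally have "L * (?z \<bullet> (b - \<beta> tL)) <= L * (C * radius)" using L(1) by (rule mult_left_mono)
  also have "... < a" by (rule radius(3))
  also have "... <= L * (?z \<bullet> \<beta> (tL + a) - ?z \<bullet> \<beta> tL)" by (rule gap)
  finally have "?z \<bullet> (b - \<beta> tL) < ?z \<bullet> \<beta> (tL + a) - ?z \<bullet> \<beta> tL"
   using L(1) by (rule mult_left_less_imp_less)
  hence "?z \<bullet> b < cens (ys i)" using uncensored_early[of i] by (simp add: inner_diff_right)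
  thus ?thesis using that by (auto simp: obs_def uncensored_def min_def split: if_splits)
 qed
 thus ?thesis
  unfolding hinge_subgrad_def S_def scaleR_sum_right
  by (intro sum.cong refl) auto
qed

end

section \<open>The limiting linear map on paths\<close>

definition gaussian_combinations :: "'w measure => real set => ('w => real => real^'d::finite) => bool" where
 "gaussian_combinations N I W \<longleftrightarrow> (\<forall>S c. finite S \<and> S \<subseteq> I --> centered_normal N (\<lambda>w. \<Sum>s\<in>S. c s \<bullet> W w s))"

lemma gaussian_combination:
 fixes W :: "'w => real => real^'d::finite" and d :: "'j => real^'d"
 assumes g: "gaussian_combinations N I W" and J: "finite J" "p ` J \<subseteq> I"
 shows "centered_normal N (\<lambda>w. \<Sum>j\<in>J. d j \<bullet> W w (p j))"
proof -
 have "(\<Sum>j\<in>J. d j \<bullet> W w (p j)) = (\<Sum>s\<in>p ` J. (\<Sum>j\<in>{j \<in> J. p j = s}. d j) \<bullet> W w s)" for w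
  by (subst sum.image_gen[OF J(1), of _ p]) (auto intro!: sum.cong simp: inner_sum_left)
 thus ?thesis using g J by (simp add: gaussian_combinations_def)
qed

text \<open>\<open>duhamel\<close> is a limit of finite linear combinations of coordinates; this gives measurability and
 preserves normality.\<close>

lemma duhamel_riemann_sums:
 fixes Mv :: "real => real^'d::finite^'d"
 assumes contM: "continuous_on {a..b} Mv" and b: "b < 1" "a <= b"
 obtains p :: "real => nat => nat => real" and B :: "real => nat => nat => real^'d^'d"
 where "\<And>s m k. s \<in> {a..b} ==> k <= m ==> p s m k \<in> {a..b}"
  "\<And>x s. x \<in> cadlag a b ==> s \<in> {a..b} ==>
   (\<lambda>m. x s + (\<Sum>k\<le>m. B s m k *v x (p s m k))) \<longlonglongrightarrow> duhamel a Mv x s"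
proof -
 obtain P X :: "real => real^'d^'d" where X: "continuous_on {a..b} X"
  and du: "\<And>x s. bdd_meas a b x ==> s \<in> {a..b} ==>
   duhamel a Mv x s = x s + P s *v integral {a..s} (\<lambda>u. (1 / (1 - u)) *\<^sub>R ((X u ** Mv u) *v x u))"
  using duhamel_separated[OF contM b] by blast
 define A where "A u = (1 / (1 - u)) *\<^sub>R (X u ** Mv u)" for u
 have cA: "continuous_on {a..b} A"
  unfolding A_def by (intro continuous_intros X contM) (use b in auto)
 define p where "p s m k = a + real (Suc k) * ((s - a) / real (Suc m))" for s :: real and m k
 define B where "B s m k = ((s - a) / real (Suc m)) *\<^sub>R (P s ** A (p s m k))" for s m k
 show thesis
 proof (rule that[of p B])
  show "p s m k \<in> {a..b}" if "s \<in> {a..b}" "k <= m" for s m k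
  proof -
   have "real (Suc k) * (s - a) <= real (Suc m) * (s - a)" using that by (intro mult_right_mono) auto
   hence "real (Suc k) * ((s - a) / real (Suc m)) <= s - a"
    by (simp add: pos_divide_le_eq mult.commute del: of_nat_Suc)
   thus ?thesis using that by (auto simp: p_def simp del: of_nat_Suc)
  qed
  fix x :: "real => real^'d" and s assume x: "x \<in> cadlag a b" and s: "s \<in> {a..b}"
  note xm = cadlag_bounded_measurable[OF x b(2)]
  define F where "F u = A u *v x u" for u
  have Fc: "F \<in> cadlag a b"
   unfolding F_def[abs_def] by (rule cadlag_bilinear[OF bounded_bilinear_matrix_vector cA x])
  have lim: "(\<lambda>m. \<Sum>k\<le>m. ((s - a) / real (Suc m)) *\<^sub>R F (p s m k)) \<longlonglongrightarrow> integral {a..s} F"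
   unfolding p_def
  proof (rule riemann_sums_right_continuous)
   show "a <= s" using s by simp
   show "bdd_meas a s F"
    by (rule bdd_meas_subset[OF cadlag_bounded_measurable[OF Fc b(2)]]) (use s in auto)
   show "(F \<longlongrightarrow> F t) (at_right t)" if "t \<in> {a..<s}" for t
    by (rule cadlag_right_limit[OF Fc]) (use that s in auto)
  qed
  have "(\<lambda>m. x s + P s *v (\<Sum>k\<le>m. ((s - a) / real (Suc m)) *\<^sub>R F (p s m k))) \<longlonglongrightarrow> x s + P s *v integral {a..s} F"
   by (intro tendsto_intros bounded_bilinear.tendsto[OF bounded_bilinear_matrix_vector] lim)
  moreover have "x s + P s *v integral {a..s} F = duhamel a Mv x s"
   by (simp add: du[OF xm s] F_def[abs_def] A_def scaleR_matrix_vector_assoc)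
  moreover have "P s *v (\<Sum>k\<le>m. ((s - a) / real (Suc m)) *\<^sub>R F (p s m k)) = (\<Sum>k\<le>m. B s m k *v x (p s m k))" for m
   by (simp add: linear_sum[OF matrix_vector_mul_linear] B_def F_def matrix_vector_mult_scaleR
    matrix_vector_mul_assoc flip: scaleR_matrix_vector_assoc)
  ultimately show "(\<lambda>m. x s + (\<Sum>k\<le>m. B s m k *v x (p s m k))) \<longlonglongrightarrow> duhamel a Mv x s" by simp
 qed
qed

lemma matrix_vector_measurable:
 fixes A :: "real^'d::finite^'d"
 assumes "f \<in> borel_measurable N"
 shows "(\<lambda>x. A *v f x) \<in> borel_measurable N"
 by (rule measurable_compose[OF assms borel_measurable_continuous_onI])
  (intro continuous_intros)

lemma duhamel_coordinate_measurable:
 fixes Mv :: "real => real^'d::finite^'d"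
 assumes contM: "continuous_on {a..b} Mv" and b: "b < 1" "a <= b" and s: "s \<in> {a..b}"
 shows "(\<lambda>x. duhamel a Mv x s) \<in> borel_measurable (ball_algebra a b)"
proof -
 obtain p and B :: "real => nat => nat => real^'d^'d" where p: "\<And>s m k. s \<in> {a..b} ==> k <= m ==> p s m k \<in> {a..b}"
  and lim: "\<And>x s. x \<in> cadlag a b ==> s \<in> {a..b} ==>
   (\<lambda>m. x s + (\<Sum>k\<le>m. B s m k *v x (p s m k))) \<longlonglongrightarrow> duhamel a Mv x s"
  using duhamel_riemann_sums[OF contM b] by blast
 show ?thesis
 proof (rule borel_measurable_LIMSEQ_metric)
  show "(\<lambda>x. x s + (\<Sum>k\<le>m. B s m k *v x (p s m k))) \<in> borel_measurable (ball_algebra a b)" for m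
   using s p[OF s] by (intro borel_measurable_add borel_measurable_sum matrix_vector_measurable coordinate_measurable) auto
  show "(\<lambda>m. x s + (\<Sum>k\<le>m. B s m k *v x (p s m k))) \<longlonglongrightarrow> duhamel a Mv x s" if "x \<in> space (ball_algebra a b)" for x
   using that by (intro lim s) (simp add: space_ball_algebra)
 qed
qed

lemma centered_gaussian_process_iff:
 "centered_gaussian_process N I W \<longleftrightarrow> (\<forall>s\<in>I. (\<lambda>w. W w s) \<in> borel_measurable N) \<and> gaussian_combinations N I W"
 unfolding centered_gaussian_process_def gaussian_combinations_def centered_normal_def by blast

lemma duhamel_gaussian:
 fixes Mv :: "real => real^'d::finite^'d" and W :: "'w => real => real^'d"
 assumes contM: "continuous_on {a..b} Mv" and b: "b < 1" "a <= b" and N: "prob_space N"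
  and W: "centered_gaussian_process N {a..b} W" and path: "\<And>w. w \<in> space N ==> W w \<in> cadlag a b"
 shows "centered_gaussian_process N {a..b} (\<lambda>w. duhamel a Mv (W w))"
proof -
 have Wm: "\<And>s. s \<in> {a..b} ==> (\<lambda>w. W w s) \<in> borel_measurable N" and Wg: "gaussian_combinations N {a..b} W"
  using W by (auto simp: centered_gaussian_process_iff)
 obtain p and B :: "real => nat => nat => real^'d^'d" where p: "\<And>s m k. s \<in> {a..b} ==> k <= m ==> p s m k \<in> {a..b}"
  and lim: "\<And>x s. x \<in> cadlag a b ==> s \<in> {a..b} ==>
   (\<lambda>m. x s + (\<Sum>k\<le>m. B s m k *v x (p s m k))) \<longlonglongrightarrow> duhamel a Mv x s"
  using duhamel_riemann_sums[OF contM b] by blast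
 have "centered_normal N (\<lambda>w. \<Sum>s\<in>S. c s \<bullet> duhamel a Mv (W w) s)" if S: "finite S" "S \<subseteq> {a..b}" for S and c :: "real => real^'d"
 proof (rule centered_normal_limit(2)[OF N])
  let ?L = "\<lambda>m w. \<Sum>s\<in>S. c s \<bullet> (W w s + (\<Sum>k\<le>m. B s m k *v W w (p s m k)))"
  show "?L m \<in> borel_measurable N" for m
   using S p Wm by (intro borel_measurable_sum borel_measurable_inner borel_measurable_const borel_measurable_add matrix_vector_measurable) auto
  show "(\<lambda>m. ?L m w) \<longlonglongrightarrow> (\<Sum>s\<in>S. c s \<bullet> duhamel a Mv (W w) s)" if "w \<in> space N" for w
   using S by (intro tendsto_sum tendsto_inner tendsto_const lim path that) auto
  show "centered_normal N (?L m)" for m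
  proof -
   define d where "d = (\<lambda>(s, k). case k of 0 => c s | Suc k => transpose (B s m k) *v c s)"
   define q where "q = (\<lambda>(s, k). case k of 0 => s | Suc k => p s m k)"
   have "?L m w = (\<Sum>j\<in>S \<times> {..Suc m}. d j \<bullet> W w (q j))" for w
    unfolding sum.cartesian_product[symmetric, of "\<lambda>s k. d (s, k) \<bullet> W w (q (s, k))", simplified]
    by (simp add: sum.atMost_Suc_shift d_def q_def inner_add_right inner_sum_right dot_lmul_matrix[symmetric] del: sum.atMost_Suc)
   moreover have "centered_normal N (\<lambda>w. \<Sum>j\<in>S \<times> {..Suc m}. d j \<bullet> W w (q j))"
    using S p by (intro gaussian_combination[OF Wg]) (auto simp: q_def split: nat.split)
   ultimately show ?thesis by simp
  qed
 qed
 hence "gaussian_combinations N {a..b} (\<lambda>w. duhamel a Mv (W w))" by (simp add: gaussian_combinations_def)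
 moreover have "(\<lambda>w. duhamel a Mv (W w) s) \<in> borel_measurable N" if s: "s \<in> {a..b}" for s
 proof (rule borel_measurable_LIMSEQ_metric[where f="\<lambda>m w. W w s + (\<Sum>k\<le>m. B s m k *v W w (p s m k))"])
  show "(\<lambda>w. W w s + (\<Sum>k\<le>m. B s m k *v W w (p s m k))) \<in> borel_measurable N" for m
   using s p[OF s] Wm by (intro borel_measurable_add borel_measurable_sum matrix_vector_measurable) auto
 qed (use lim path s in blast)
 ultimately show ?thesis by (simp add: centered_gaussian_process_iff)
qed

context cqr_population
begin

definition path_map :: "(real => real^'d) => real => real^'d" where
 "path_map x s = Ainv s *v duhamel tL Mu x s"

lemma tL_le: "tL <= tU" using taus by simp

lemma path_map_cadlag:
 assumes x: "x \<in> cadlag tL tU"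
 shows "path_map x \<in> cadlag tL tU"
proof -
 obtain C' :: real where "1 <= C'" "\<And>x :: real => real^'d. bdd_meas tL tU x ==> continuous_on I (\<lambda>s. duhamel tL Mu x s - x s)"
  using duhamel_bounded[OF Mu_continuous taus(3) tL_le] by blast
 hence "(\<lambda>s. x s + (duhamel tL Mu x s - x s)) \<in> cadlag tL tU"
  by (intro cadlag_add x continuous_imp_cadlag) (simp add: cadlag_bounded_measurable[OF x tL_le])
 hence "duhamel tL Mu x \<in> cadlag tL tU" by simp
 thus ?thesis
  unfolding path_map_def[abs_def] by (rule cadlag_bilinear[OF bounded_bilinear_matrix_vector Ainv_continuous])
qed

lemma path_map_continuous:
 assumes x: "continuous_on I x"
 shows "continuous_on I (path_map x)"
proof -
 obtain C' :: real where "1 <= C'" "\<And>x :: real => real^'d. bdd_meas tL tU x ==> continuous_on I (\<lambda>s. duhamel tL Mu x s - x s)"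
  using duhamel_bounded[OF Mu_continuous taus(3) tL_le] by blast
 hence "continuous_on I (\<lambda>s. x s + (duhamel tL Mu x s - x s))"
  by (intro continuous_on_add x) (simp add: bdd_meas_continuous[OF x])
 thus ?thesis unfolding path_map_def[abs_def] by (intro continuous_intros Ainv_continuous) simp
qed

lemma path_map_measurable: "s \<in> I ==> (\<lambda>x. path_map x s) \<in> borel_measurable (ball_algebra tL tU)"
 unfolding path_map_def
 by (intro matrix_vector_measurable duhamel_coordinate_measurable[OF Mu_continuous taus(3) tL_le])

lemma path_map_scaleR:
 "bdd_meas tL tU x ==> s \<in> I ==> path_map (\<lambda>u. c *\<^sub>R x u) s = c *\<^sub>R path_map x s"
 unfolding path_map_def
 by (subst duhamel_linear(2)[OF Mu_continuous taus(3)]) (auto simp: matrix_vector_mult_scaleR)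

lemma norm_le_infnorm_card: "norm (x :: real^'d) <= sqrt (real CARD('d)) * infnorm x"
 using norm_le_infnorm[of x] by simp

definition Cd :: real where
 "Cd = (SOME c. 1 <= c \<and> (\<forall>x e s. bdd_meas tL tU x --> (\<forall>u\<in>I. norm (x u) <= e) -->
  s \<in> I --> norm (duhamel tL Mu x s) <= c * e))"

lemma Cd:
 shows "1 <= Cd"
  and "bdd_meas tL tU x ==> (\<And>u. u \<in> I ==> norm (x u) <= e) ==> s \<in> I ==> norm (duhamel tL Mu x s) <= Cd * e"
proof -
 let ?P = "\<lambda>c. 1 <= c \<and> (\<forall>x e s. bdd_meas tL tU x --> (\<forall>u\<in>I. norm (x u) <= e) -->
  s \<in> I --> norm (duhamel tL Mu x s) <= c * e)"
 have "\<exists>c. ?P c"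
 proof (rule duhamel_bounded[OF Mu_continuous taus(3) tL_le])
  fix c :: real assume "1 <= c"
   "\<And>(x :: real => real^'d) e s. bdd_meas tL tU x ==> (\<And>u. u \<in> I ==> norm (x u) <= e)
    ==> s \<in> I ==> norm (duhamel tL Mu x s) <= c * e"
  hence "?P c" by simp
  thus ?thesis ..
 qed
 hence "?P Cd" unfolding Cd_def by (rule someI_ex)
 thus "1 <= Cd"
  and "bdd_meas tL tU x ==> (\<And>u. u \<in> I ==> norm (x u) <= e) ==> s \<in> I ==> norm (duhamel tL Mu x s) <= Cd * e"
  by simp_all
qed

lemma path_map_lipschitz:
 obtains C' where "0 <= C'"
  "\<And>x y. x \<in> cadlag tL tU ==> y \<in> cadlag tL tU ==> sup_dist tL tU (path_map x) (path_map y) <= C' * sup_dist tL tU x y"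
proof -
 let ?c = "sqrt (real CARD('d))"
 show thesis
 proof (rule that[of "Cd * ?c / l0"])
  show "0 <= Cd * ?c / l0" using Cd(1) l0(1) by simp
  fix x y :: "real => real^'d" assume x: "x \<in> cadlag tL tU" and y: "y \<in> cadlag tL tU"
  let ?D = "sup_dist tL tU x y"
  note ym = cadlag_bounded_measurable[OF y tL_le]
  note dm = bdd_meas_diff[OF cadlag_bounded_measurable[OF x tL_le] ym]
  show "sup_dist tL tU (path_map x) (path_map y) <= Cd * ?c / l0 * ?D"
  proof (rule sup_dist_le[OF tL_le])
   fix s assume s: "s \<in> I"
   have "duhamel tL Mu x s = duhamel tL Mu (\<lambda>u. (x u - y u) + y u) s" by simp
   also have "... = duhamel tL Mu (\<lambda>u. x u - y u) s + duhamel tL Mu y s"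
    by (rule duhamel_linear(1)[OF Mu_continuous taus(3) s dm ym])
   finally have "path_map x s - path_map y s = Ainv s *v duhamel tL Mu (\<lambda>u. x u - y u) s"
    unfolding path_map_def by (simp only: matrix_vector_right_distrib) simp
   also have "norm ... <= norm (duhamel tL Mu (\<lambda>u. x u - y u) s) / l0" by (rule Ainv(3)[OF s])
   also have "... <= Cd * (?c * ?D) / l0"
   proof (intro divide_right_mono Cd(2)[OF dm _ s])
    show "norm (x u - y u) <= ?c * ?D" if "u \<in> I" for u
     by (rule order_trans[OF norm_le_infnorm_card mult_left_mono[OF sup_dist_ge[OF x y that]]]) simp
   qed (use l0(1) in simp)
   finally have "norm (path_map x s - path_map y s) <= Cd * ?c / l0 * ?D" by simp
   thus "infnorm (path_map x s - path_map y s) <= Cd * ?c / l0 * ?D" by (rule order_trans[OF infnorm_le_norm])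
  qed
 qed
qed

end
context cqr_sample
begin

text \<open>The true coefficients miss the empirical estimating equation by \<open>w\<close> and by the error made at smaller
 levels; this is the input of the Gronwall argument.\<close>

lemma score_at_truth:
 assumes t: "t \<in> I"
 shows "S (\<beta> t) - G t = - w t - (LINT u:{tL..<t}|dH. St (bh u) - St (\<beta> u))"
proof -
 let ?I = "\<lambda>f. (LINT u:{tL..<t}|dH. f u) :: real^'d"
 have 1: "?I (\<lambda>u. St (bh u) - St (\<beta> u)) = ?I (\<lambda>u. St (bh u)) - ?I (\<lambda>u. St (\<beta> u))"
  by (rule hazard_integral_diff[OF step_bounded_measurable St_\<beta>_measurable t taus(3)])
 have 2: "?I (\<lambda>u. vt (\<beta> u)) = ?I (\<lambda>u. St (\<beta> u)) - ?I (\<lambda>u. mut M Y (\<beta> u))"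
  unfolding vt_def
  by (rule hazard_integral_diff[OF St_\<beta>_measurable bdd_meas_continuous[OF mut_\<beta>_continuous] t taus(3)])
 show ?thesis
  unfolding G_def w_def v_def 1 2 population_identity[OF t] by (simp add: algebra_simps)
qed

lemma minimizer_near_truth:
 assumes t: "t \<in> I" and r: "0 < r" "r <= radius"
  and wt: "\<And>i. i < n ==> 0 <= wt i" and k: "0 < k"
  and sub: "\<And>b. norm (b - \<beta> t) < r ==> hinge_subgrad n wt xs z b = k *\<^sub>R S b"
  and min: "minimizer_if_any (hinge_obj n wt xs z (k *\<^sub>R G t) c) x"
  and fluct: "\<And>b1 b2. b1 \<in> U ==> b2 \<in> U ==> norm (b1 - b2) < r ==> norm (v b1 - v b2) <= y"
  and e: "norm (S (\<beta> t) - G t) <= e" "(2 * y + 4 * e) / l0 < r"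
 shows "norm (x - \<beta> t) <= (2 * y + 4 * e) / l0"
  and "0 < d ==> (\<And>b1 b2. b1 \<in> U ==> b2 \<in> U ==> norm (b1 - b2) <= d ==> norm (v b1 - v b2) <= x1)
   ==> norm (S x - G t) <= x1"
proof -
 have inU: "b \<in> U" if "norm (b - \<beta> t) < r" for b using near_\<beta>_in_U[OF t, of b] that r radius by linarith
 have tU: "\<beta> t \<in> U" by (rule \<beta>_in_U[OF t])
 have le: "(2 * y + 4 * norm (S (\<beta> t) - G t)) / l0 <= (2 * y + 4 * e) / l0"
  using e(1) l0(1) by (intro divide_right_mono) auto
 have mono: "l0 * (norm (b - \<beta> t))\<^sup>2 <= (mu M Y b - mu M Y (\<beta> t)) \<bullet> (b - \<beta> t)" if "norm (b - \<beta> t) < r" for b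
  using that r radius eps by (intro mu_strongly_monotone segment_in_U[OF t]) auto
 have fl: "norm ((S b - mu M Y b) - (S (\<beta> t) - mu M Y (\<beta> t))) <= y" if "norm (b - \<beta> t) < r" for b
  using fluct[OF inU[OF that] tU that] by (simp add: v_def)
 have sm: "(2 * y + 4 * norm (S (\<beta> t) - G t)) / l0 < r" using le e(2) by linarith
 note dist = hinge_minimizer_distance[OF wt k l0(1) sub mono fl sm r(1) min]
 show near: "norm (x - \<beta> t) <= (2 * y + 4 * e) / l0" using dist(1) le by linarith
 show "norm (S x - G t) <= x1"
  if d: "0 < d" and fl1: "\<And>b1 b2. b1 \<in> U ==> b2 \<in> U ==> norm (b1 - b2) <= d ==> norm (v b1 - v b2) <= x1"
 proof (rule hinge_minimizer_gradient[where r="min d (r - norm (x - \<beta> t))" and mu="mu M Y", OF wt k _ _ _ _ dist(2)])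
  have xr: "norm (x - \<beta> t) < r" using near e(2) by linarith
  show "0 < min d (r - norm (x - \<beta> t))" using d xr by simp
  show "isCont (mu M Y) x" by (rule has_derivative_continuous[OF mu_has_derivative[OF inU[OF xr]]])
  have close: "norm (b - \<beta> t) < r" if "norm (b - x) < min d (r - norm (x - \<beta> t))" for b
   using that norm_triangle_ineq[of "b - x" "x - \<beta> t"] by simp
  show "hinge_subgrad n wt xs z b = k *\<^sub>R S b" if "norm (b - x) < min d (r - norm (x - \<beta> t))" for b
   by (rule sub[OF close[OF that]])
  show "norm ((S b - mu M Y b) - (S x - mu M Y x)) <= x1" if "norm (b - x) < min d (r - norm (x - \<beta> t))" for b
   using fl1[OF inU[OF close[OF that]] inU[OF xr]] that by (simp add: v_def)
 qed
qed

definition Lm :: real where "Lm = L * (C * C)"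

definition rate :: real where "rate = 4 * Lm / (l0 * (1 - tU)) + 1"

definition initial_error :: "real => real => real" where
 "initial_error x W = (2 * x + 4 * (W + (x + Lm * (C4 * h)) * (tU - tL) / (1 - tU))) / l0"

text \<open>Induction along the grid. By \<open>score_at_truth\<close> the score at \<open>\<beta>\<close> is at most \<open>W\<close> plus the integral of the errors
 at smaller levels, and \<open>minimizer_near_truth\<close> turns it into an error bound, at the cost of the factor
 \<open>4 / l0\<close>. The exponential bound reproduces itself because \<open>rate >= 4 Lm / (l0 (1 - tU))\<close>; the summand \<open>1\<close>
 in \<open>rate\<close> avoids division by zero. As the error stays below \<open>r\<close>, all moduli remain applicable.\<close>

lemma path_error:
 assumes r: "0 < r" "r <= radius"
  and fl: "\<And>b1 b2. b1 \<in> U ==> b2 \<in> U ==> norm (b1 - b2) < r ==> norm (v b1 - v b2) <= x"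
   "\<And>b1 b2. b1 \<in> U ==> b2 \<in> U ==> norm (b1 - b2) < r ==> norm (vt b1 - vt b2) <= x"
  and W: "\<And>s. s \<in> I ==> norm (w s) <= W"
  and small: "initial_error x W * exp (rate * (tU - tL)) + C4 * h < r"
  and j: "j <= m"
 shows "norm (bh (gp j) - \<beta> (gp j)) <= initial_error x W * exp (rate * (gp j - tL)) \<and>
  (\<forall>d x1. 0 < d --> (\<forall>b1\<in>U. \<forall>b2\<in>U. norm (b1 - b2) <= d --> norm (v b1 - v b2) <= x1) --> norm (S (bh (gp j)) - G (gp j)) <= x1)"
 using j
proof (induction j rule: less_induct)
 case (less j)
 define A where "A = initial_error x W"
 let ?t = "gp j"
 have t: "?t \<in> I" by (rule gp_in[OF less.prems])
 have bL: "\<beta> tL \<in> U" using taus by (intro \<beta>_in_U) auto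
 have x0: "0 <= x" using fl(1)[OF bL bL] r by simp
 have "norm (w tL) <= W" using taus by (intro W) auto
 hence W0: "0 <= W" by (rule order_trans[OF norm_ge_zero])
 have Lm0: "0 <= Lm" using L(1) by (simp add: Lm_def)
 have k0: "0 < 1 - tU" using taus by simp
 have rate1: "1 <= rate" using Lm0 l0(1) k0 by (simp add: rate_def)
 have A0: "0 <= A" using x0 W0 Lm0 k0 l0(1) taus C4(1) h_pos by (simp add: A_def initial_error_def)
 let ?E = "\<lambda>u. A * exp (rate * (u - tL))"
 have E_mono: "?E u <= ?E u'" if "u <= u'" for u u' using that A0 rate1 by (intro mult_left_mono) auto
 have path: "norm (bh u - \<beta> u) <= ?E u + C4 * h" if u: "u \<in> {tL..<?t}" for u
 proof -
  have uI: "u \<in> I" using u t by auto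
  note c = cell[OF uI]
  have cj: "cell u < j" using c(4)[of j] u by simp
  have g: "gp (cell u) \<in> I" by (rule gp_in[OF c(3)])
  have "norm (bh (gp (cell u)) - \<beta> (gp (cell u))) <= ?E (gp (cell u))"
   using less.IH[OF cj c(3)] by (simp add: A_def)
  moreover have "norm (\<beta> (gp (cell u)) - \<beta> u) <= C4 * h"
   using c(1,2) by (intro order_trans[OF C4(2)[OF g uI]] mult_left_mono C4(1)) auto
  moreover have "?E (gp (cell u)) <= ?E u" by (rule E_mono[OF c(1)])
  ultimately show ?thesis unfolding bh_step[OF uI]
   using norm_triangle_ineq[of "bh (gp (cell u)) - \<beta> (gp (cell u))" "\<beta> (gp (cell u)) - \<beta> u"] by simp
 qed
 have path_r: "norm (bh u - \<beta> u) < r" if u: "u \<in> {tL..<?t}" for u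
  using path[OF u] E_mono[of u tU] small u t by (simp add: A_def)
 have int: "norm (LINT u:{tL..<?t}|dH. St (bh u) - St (\<beta> u))
   <= integral {tL..?t} (\<lambda>u. x + Lm * (?E u + C4 * h)) / (1 - tU)"
 proof (rule hazard_integral_dominated[OF bdd_meas_diff[OF step_bounded_measurable St_\<beta>_measurable] t taus(3)])
  show "continuous_on {tL..?t} (\<lambda>u. x + Lm * (?E u + C4 * h))" by (intro continuous_intros)
  show "0 <= x + Lm * (?E u + C4 * h)" for u using x0 Lm0 A0 C4(1) h_pos by simp
  fix u assume u: "u \<in> {tL..<?t}"
  have uI: "u \<in> I" using u t by auto
  have near: "norm (bh u - \<beta> u) < \<epsilon>" using path_r[OF u] r radius by linarith
  have "norm (vt (bh u) - vt (\<beta> u)) <= x"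
   by (rule fl(2)[OF near_\<beta>_in_U[OF uI near] \<beta>_in_U[OF uI] path_r[OF u]])
  moreover have "norm (mut M Y (bh u) - mut M Y (\<beta> u)) <= Lm * norm (bh u - \<beta> u)"
   unfolding Lm_def using near eps by (intro mut_lipschitz segment_in_U[OF uI]) auto
  moreover have "Lm * norm (bh u - \<beta> u) <= Lm * (?E u + C4 * h)" by (intro mult_left_mono path[OF u] Lm0)
  moreover have "St (bh u) - St (\<beta> u) = (vt (bh u) - vt (\<beta> u)) + (mut M Y (bh u) - mut M Y (\<beta> u))"
   by (simp add: vt_def)
  ultimately show "norm (St (bh u) - St (\<beta> u)) <= x + Lm * (?E u + C4 * h)"
   using norm_triangle_ineq[of "vt (bh u) - vt (\<beta> u)" "mut M Y (bh u) - mut M Y (\<beta> u)"] by simp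
 qed
 have "((\<lambda>u. (x + Lm * (C4 * h)) * u + Lm * A / rate * exp (rate * (u - tL))) has_vector_derivative
   (x + Lm * (?E u + C4 * h))) (at u within {tL..?t})" for u
  using rate1 by (auto intro!: derivative_eq_intros simp: algebra_simps simp flip: has_real_derivative_iff_has_vector_derivative)
 hence "((\<lambda>u. x + Lm * (?E u + C4 * h)) has_integral
   ((x + Lm * (C4 * h)) * ?t + Lm * A / rate * exp (rate * (?t - tL)) - ((x + Lm * (C4 * h)) * tL + Lm * A / rate * exp (rate * (tL - tL)))))
   {tL..?t}"
  using t by (intro fundamental_theorem_of_calculus) auto
 hence "integral {tL..?t} (\<lambda>u. x + Lm * (?E u + C4 * h))
   = (x + Lm * (C4 * h)) * (?t - tL) + Lm * A / rate * (exp (rate * (?t - tL)) - 1)"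
  by (simp add: integral_unique algebra_simps)
 also have "... <= (x + Lm * (C4 * h)) * (tU - tL) + l0 * (1 - tU) / 4 * A * (exp (rate * (?t - tL)) - 1)"
 proof (intro add_mono mult_left_mono mult_right_mono)
  show "?t - tL <= tU - tL" using t by simp
  show "0 <= x + Lm * (C4 * h)" using x0 Lm0 C4(1) h_pos by simp
  show "0 <= exp (rate * (?t - tL)) - 1" using rate1 t by simp
  have "Lm = l0 * (1 - tU) / 4 * (rate - 1)" using l0(1) k0 by (simp add: rate_def)
  also have "... <= l0 * (1 - tU) / 4 * rate" using l0(1) k0 by (intro mult_left_mono) auto
  finally have "A * Lm <= A * (l0 * (1 - tU) / 4 * rate)" using A0 by (rule mult_left_mono)
  thus "Lm * A / rate <= l0 * (1 - tU) / 4 * A" using rate1 by (simp add: pos_divide_le_eq mult_ac)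
 qed
 finally have "integral {tL..?t} (\<lambda>u. x + Lm * (?E u + C4 * h)) / (1 - tU)
   <= ((x + Lm * (C4 * h)) * (tU - tL) + l0 * (1 - tU) / 4 * A * (exp (rate * (?t - tL)) - 1)) / (1 - tU)"
  using k0 by (intro divide_right_mono) auto
 also have "... = (x + Lm * (C4 * h)) * (tU - tL) / (1 - tU) + l0 / 4 * A * (exp (rate * (?t - tL)) - 1)"
 proof -
  have "(P + l0 * k / 4 * A * X) / k = P / k + l0 / 4 * A * X" if "0 < k" for P X k :: real
   using that by (simp add: add_divide_distrib)
  from this[OF k0] show ?thesis .
 qed
 finally have bound: "norm (LINT u:{tL..<?t}|dH. St (bh u) - St (\<beta> u))
   <= (x + Lm * (C4 * h)) * (tU - tL) / (1 - tU) + l0 / 4 * A * (exp (rate * (?t - tL)) - 1)"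
  using int by linarith
 define e where "e = W + ((x + Lm * (C4 * h)) * (tU - tL) / (1 - tU) + l0 / 4 * A * (exp (rate * (?t - tL)) - 1))"
 have "norm (S (\<beta> ?t) - G ?t) <= norm (w ?t) + norm (LINT u:{tL..<?t}|dH. St (bh u) - St (\<beta> u))"
  unfolding score_at_truth[OF t] using norm_triangle_ineq4[of "- w ?t"] by simp
 hence e: "norm (S (\<beta> ?t) - G ?t) <= e" using bound W[OF t] by (simp add: e_def)
 have "2 * x + 4 * e = l0 * A + l0 * A * (exp (rate * (?t - tL)) - 1)"
  using l0(1) by (simp add: e_def A_def initial_error_def)
 also have "... = l0 * ?E ?t" by (simp add: algebra_simps)
 finally have eE: "(2 * x + 4 * e) / l0 = ?E ?t" using l0(1) by simp
 have "?E ?t <= ?E tU" using t by (intro E_mono) auto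
 also have "... < r" using small C4(1) h_pos by (smt (verit) A_def mult_nonneg_nonneg)
 finally have eR: "(2 * x + 4 * e) / l0 < r" using eE by simp
 show ?case
 proof (cases "j = 0")
  case True
  hence t0: "?t = tL" by (simp add: gp_eq)
  obtain c where c: "init_obj ys n tL = hinge_obj n (\<lambda>i. 1 / real n) (\<lambda>i. obs (ys i)) (\<lambda>i. covar (ys i)) (1 *\<^sub>R G tL) c"
   using init_obj_eq by blast
  have min: "minimizer_if_any (hinge_obj n (\<lambda>i. 1 / real n) (\<lambda>i. obs (ys i)) (\<lambda>i. covar (ys i)) (1 *\<^sub>R G ?t) c) (bh ?t)"
   using est unfolding cqr_estimator_def t0 c by blast
  have sub: "hinge_subgrad n (\<lambda>i. 1 / real n) (\<lambda>i. obs (ys i)) (\<lambda>i. covar (ys i)) b = 1 *\<^sub>R S b" if "norm (b - \<beta> ?t) < r" for b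
   using that r by (intro init_subgrad) (simp add: t0)
  note res = minimizer_near_truth[OF t r _ zero_less_one sub min fl(1) e eR]
  show ?thesis using res(1) res(2) unfolding eE A_def[symmetric] by auto
 next
  case False
  obtain c where c: "step_obj ys n tL bh ?t = hinge_obj n (\<lambda>i. 2 * of_bool (uncensored (ys i)) / real n) (\<lambda>i. obs (ys i)) (\<lambda>i. covar (ys i)) (2 *\<^sub>R G ?t) c"
   using step_obj_eq[OF t] by blast
  have "\<forall>j\<in>{1..m}. minimizer_if_any (step_obj ys n tL bh (gp j)) (bh (gp j))"
   using est unfolding cqr_estimator_def gp_def by blast
  hence min: "minimizer_if_any (hinge_obj n (\<lambda>i. 2 * of_bool (uncensored (ys i)) / real n) (\<lambda>i. obs (ys i)) (\<lambda>i. covar (ys i)) (2 *\<^sub>R G ?t) c) (bh ?t)"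
   using False less.prems unfolding c[symmetric] by simp
  note res = minimizer_near_truth[OF t r _ zero_less_numeral step_subgrad min fl(1) e eR]
  show ?thesis using res(1) res(2) unfolding eE A_def[symmetric] by auto
 qed
qed

end
lemma cadlag_cong:
 assumes y: "y \<in> cadlag a b" and eq: "\<And>t. t \<in> {a..b} ==> x t = y t"
 shows "x \<in> cadlag a b"
 unfolding cadlag_def
proof (intro CollectI conjI ballI)
 fix t assume t: "t \<in> {a..<b}"
 have "\<forall>\<^sub>F s in at_right t. y s = x s"
  using t eq by (intro eventually_at_rightI[of t b]) auto
 thus "(x \<longlongrightarrow> x t) (at_right t)"
  using Lim_transform_eventually[OF cadlag_right_limit[OF y t]] eq[of t] t by simp
next
 fix t assume t: "t \<in> {a<..b}"
 obtain l where "(y \<longlongrightarrow> l) (at_left t)" using cadlag_left_limit[OF y t] by blast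
 moreover have "\<forall>\<^sub>F s in at_left t. y s = x s"
  using t eq by (intro eventually_at_leftI[of a t]) auto
 ultimately show "\<exists>l. (x \<longlongrightarrow> l) (at_left t)" using Lim_transform_eventually by blast
qed

context cqr_sample
begin

text \<open>\<open>scaled_error\<close> solves a Volterra equation by construction, with the inhomogeneity \<open>forcing\<close>; the content
 of the linearization is that \<open>forcing\<close> is close to \<open>w\<close>.\<close>

definition scaled_error :: "real => real^'d" where "scaled_error s = mu' M Y (\<beta> s) *v (bh s - \<beta> s)"

definition forcing :: "real => real^'d" where
 "forcing s = scaled_error s - (LINT u:{tL..<s}|dH. Mu u *v scaled_error u)"

lemma error_eq:
 assumes s: "s \<in> I"
 shows "bh s - \<beta> s = Ainv s *v scaled_error s" "Mu s *v scaled_error s = mut' M Y (\<beta> s) *v (bh s - \<beta> s)"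
 using Ainv(1)[OF s] by (simp_all add: scaled_error_def Mu_def matrix_vector_mul_assoc flip: matrix_mul_assoc)

lemma scaled_error_measurable: "bdd_meas tL tU scaled_error"
 unfolding scaled_error_def[abs_def]
 by (intro bdd_meas_matrix_vector bdd_meas_continuous[OF mu'_continuous]
   bdd_meas_diff step_bounded_measurable[of "\<lambda>b. b"] bdd_meas_continuous[OF \<beta>_continuous])

lemma Mu_scaled_error_measurable: "bdd_meas tL tU (\<lambda>u. Mu u *v scaled_error u)"
 by (intro bdd_meas_matrix_vector bdd_meas_continuous[OF Mu_continuous] scaled_error_measurable)

lemma forcing_measurable: "bdd_meas tL tU forcing"
 unfolding forcing_def[abs_def]
 by (intro bdd_meas_diff scaled_error_measurable
   bdd_meas_continuous[OF hazard_integral_continuous[OF Mu_scaled_error_measurable]])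

lemma error_eq_duhamel:
 assumes s: "s \<in> I"
 shows "bh s - \<beta> s = Ainv s *v duhamel tL Mu forcing s"
proof -
 have "scaled_error s = duhamel tL Mu forcing s"
  by (rule volterra_solution[OF Mu_continuous taus(3) _ scaled_error_measurable forcing_measurable _ s])
   (use taus in "auto simp: forcing_def")
 thus ?thesis using error_eq(1)[OF s] by simp
qed

text \<open>Expand both estimating equations to first order at \<open>\<beta>\<close>. The score vanishes up to \<open>y\<close> only at grid points,
 and moving to the nearest one changes \<open>G\<close> by at most \<open>C h / (1 - tU)\<close>.\<close>

lemma forcing_near_w:
 assumes e: "0 <= e" "e < \<epsilon>" "\<And>s. s \<in> I ==> norm (bh s - \<beta> s) <= e"
  and score: "\<And>j. j <= m ==> norm (S (bh (gp j)) - G (gp j)) <= r"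
  and fl: "\<And>b1 b2. b1 \<in> U ==> b2 \<in> U ==> norm (b1 - b2) <= e ==> norm (v b1 - v b2) <= r"
   "\<And>b1 b2. b1 \<in> U ==> b2 \<in> U ==> norm (b1 - b2) <= e ==> norm (vt b1 - vt b2) <= xt"
  and s: "s \<in> I"
 shows "norm (forcing s - w s) <= C * C * Hf * e * e powr \<gamma> + 2 * r + C * h / (1 - tU)
  + (xt + C * C * Hf * e * e powr \<gamma>) * (tU - tL) / (1 - tU)"
proof -
 let ?T = "C * C * Hf * e * e powr \<gamma>"
 have near: "norm (bh u - \<beta> u) < \<epsilon>" if "u \<in> I" for u using e(2) e(3)[OF that] by linarith
 have seg: "closed_segment (\<beta> u) (bh u) \<subseteq> U" if "u \<in> I" for u
  using near[OF that] eps by (intro segment_in_U[OF that]) auto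
 have T: "C * C * Hf * norm (bh u - \<beta> u) * norm (bh u - \<beta> u) powr \<gamma> <= ?T" if "u \<in> I" for u
  using e(1) e(3)[OF that] C_nonneg Hf(1) \<gamma> by (intro mult_mono powr_mono2) auto
 have T0: "0 <= ?T" using C_nonneg Hf(1) e(1) by simp
 note U = near_\<beta>_in_U[OF _ near] and bU = \<beta>_in_U
 let ?I = "\<lambda>f. (LINT u:{tL..<s}|dH. f u) :: real^'d"
 define q where "q u = (St (bh u) - St (\<beta> u)) - Mu u *v scaled_error u" for u
 have qm: "bdd_meas tL tU q"
  unfolding q_def by (intro bdd_meas_diff step_bounded_measurable St_\<beta>_measurable Mu_scaled_error_measurable)
 have qI: "?I q = ?I (\<lambda>u. St (bh u) - St (\<beta> u)) - ?I (\<lambda>u. Mu u *v scaled_error u)"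
  unfolding q_def
  by (rule hazard_integral_diff[OF bdd_meas_diff[OF step_bounded_measurable St_\<beta>_measurable] Mu_scaled_error_measurable s taus(3)])
 have qb: "norm (q u) <= xt + ?T" if u: "u \<in> {tL..<s}" for u
 proof -
  have uI: "u \<in> I" using u s by auto
  have "q u = (vt (bh u) - vt (\<beta> u)) + (mut M Y (bh u) - mut M Y (\<beta> u) - mut' M Y (\<beta> u) *v (bh u - \<beta> u))"
   by (simp add: q_def error_eq(2)[OF uI] vt_def)
  also have "norm ... <= xt + ?T"
   by (rule order_trans[OF norm_triangle_ineq add_mono[OF fl(2)[OF U[OF uI uI] bU[OF uI] e(3)[OF uI]]
    order_trans[OF mut_remainder[OF seg[OF uI]] T[OF uI]]]])
  finally show ?thesis .
 qed
 have xt0: "0 <= xt" using fl(2)[OF bU[OF s] bU[OF s]] e(1) by simp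
 have "norm (?I q) <= (xt + ?T) * (s - tL) / (1 - tU)"
  by (rule hazard_integral_bound[OF qm s taus(3) qb]) (use xt0 T0 in auto)
 also have "... <= (xt + ?T) * (tU - tL) / (1 - tU)"
  using s taus xt0 T0 by (intro divide_right_mono mult_left_mono) auto
 finally have b1: "norm (?I q) <= (xt + ?T) * (tU - tL) / (1 - tU)" .
 let ?p = "gp (cell s)"
 note c = cell[OF s]
 have b2: "norm (G s - G ?p) <= C * h / (1 - tU)"
 proof -
  have "norm (G s - G ?p) = norm (?I (\<lambda>u. St (bh u)) - (LINT u:{tL..<?p}|dH. St (bh u)))" by (simp add: G_def)
  also have "... <= C * (s - ?p) / (1 - tU)"
   by (rule hazard_integral_increment[OF step_bounded_measurable _ c(1) _ taus(3) St_le C_nonneg])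
    (use s gp_in[OF c(3)] in auto)
  also have "... <= C * h / (1 - tU)"
   using c(2) taus C_nonneg by (intro divide_right_mono mult_left_mono) auto
  finally show ?thesis .
 qed
 have b3: "norm (S (bh s) - G ?p) <= r" using score[OF c(3)] bh_step[OF s] by simp
 have b4: "norm (v (bh s) - v (\<beta> s)) <= r" by (rule fl(1)[OF U[OF s s] bU[OF s] e(3)[OF s]])
 let ?m = "mu M Y (bh s) - mu M Y (\<beta> s) - scaled_error s"
 have b5: "norm ?m <= ?T"
  unfolding scaled_error_def by (rule order_trans[OF mu_remainder[OF seg[OF s]] T[OF s]])
 have "forcing s - w s = - ?m - (v (bh s) - v (\<beta> s)) + (S (bh s) - G ?p) - (G s - G ?p) + ?I q"
  unfolding forcing_def qI using score_at_truth[OF s] by (simp add: v_def algebra_simps)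
 also have "norm ... <= ?T + r + r + C * h / (1 - tU) + (xt + ?T) * (tU - tL) / (1 - tU)"
 proof -
  have "norm (- k - x + y - z + i) <= norm k + norm x + norm y + norm z + norm i" for k x y z i :: "real^'d"
   using norm_triangle_ineq[of "- k - x + y - z" i] norm_triangle_ineq4[of "- k - x + y" z] norm_triangle_ineq[of "- k - x" y]
    norm_triangle_ineq4[of "- k" x] by simp
  thus ?thesis by (rule order_trans) (intro add_mono b1 b2 b3 b4 b5)
 qed
 finally show ?thesis by simp
qed

definition remainder :: "real => real^'d" where
 "remainder s = bh s - \<beta> s - Ainv s *v duhamel tL Mu w s"

lemma remainder_bound:
 assumes d: "\<And>s. s \<in> I ==> norm (forcing s - w s) <= d"
  and s: "s \<in> I"
 shows "norm (remainder s) <= Cd * d / l0"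
proof -
 have dm: "bdd_meas tL tU (\<lambda>s. forcing s - w s)"
  by (intro bdd_meas_diff forcing_measurable w_measurable)
 have "duhamel tL Mu forcing s = duhamel tL Mu (\<lambda>s. w s + (forcing s - w s)) s" by simp
 also have "... = duhamel tL Mu w s + duhamel tL Mu (\<lambda>s. forcing s - w s) s"
  by (rule duhamel_linear(1)[OF Mu_continuous taus(3) s w_measurable dm])
 finally have "remainder s = Ainv s *v duhamel tL Mu (\<lambda>s. forcing s - w s) s"
  unfolding remainder_def error_eq_duhamel[OF s] by (simp only: matrix_vector_right_distrib) simp
 also have "norm ... <= norm (duhamel tL Mu (\<lambda>s. forcing s - w s) s) / l0" by (rule Ainv(3)[OF s])
 also have "... <= Cd * d / l0" using Cd(2)[OF dm d s] l0(1) by (intro divide_right_mono) auto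
 finally show ?thesis .
qed

lemma path_error_everywhere:
 assumes r: "0 < r" "r <= radius"
  and fl: "\<And>b1 b2. b1 \<in> U ==> b2 \<in> U ==> norm (b1 - b2) < r ==> norm (v b1 - v b2) <= x"
   "\<And>b1 b2. b1 \<in> U ==> b2 \<in> U ==> norm (b1 - b2) < r ==> norm (vt b1 - vt b2) <= x"
  and W: "\<And>s. s \<in> I ==> norm (w s) <= W"
  and small: "initial_error x W * exp (rate * (tU - tL)) + C4 * h < r"
  and s: "s \<in> I"
 shows "norm (bh s - \<beta> s) <= initial_error x W * exp (rate * (tU - tL)) + C4 * h"
proof -
 note c = cell[OF s]
 let ?p = "gp (cell s)"
 have p: "?p \<in> I" by (rule gp_in[OF c(3)])
 have 1: "norm (bh ?p - \<beta> ?p) <= initial_error x W * exp (rate * (?p - tL))"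
  using path_error[OF r fl W small c(3)] by blast
 hence "0 <= initial_error x W * exp (rate * (?p - tL))" by (rule order_trans[OF norm_ge_zero])
 hence A0: "0 <= initial_error x W" by (simp add: zero_le_mult_iff)
 have "0 <= Lm" using L(1) by (simp add: Lm_def)
 hence "0 <= rate" using l0(1) taus by (simp add: rate_def)
 hence 2: "initial_error x W * exp (rate * (?p - tL)) <= initial_error x W * exp (rate * (tU - tL))"
  using A0 p by (simp add: mult_left_mono)
 have 3: "norm (\<beta> ?p - \<beta> s) <= C4 * h"
  using c(1,2) by (intro order_trans[OF C4(2)[OF p s]] mult_left_mono C4(1)) auto
 show ?thesis unfolding bh_step[OF s]
  using 1 2 3 norm_triangle_ineq[of "bh ?p - \<beta> ?p" "\<beta> ?p - \<beta> s"] by simp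
qed

lemma w_increment:
 assumes st: "tL <= s" "s <= t" "t <= tU"
 shows "w t - w s = - (v (\<beta> t) - v (\<beta> s)) + integral {s..t} (\<lambda>u. (1 / (1 - u)) *\<^sub>R vt (\<beta> u))"
proof -
 have 1: "(LINT u:{tL..<r}|dH. vt (\<beta> u)) = integral {tL..r} (\<lambda>u. (1 / (1 - u)) *\<^sub>R vt (\<beta> u))" if "r <= tU" for r
  using that taus by (intro hazard_integral_eq(1)[OF vt_\<beta>_measurable]) auto
 have "integral {tL..s} (\<lambda>u. (1 / (1 - u)) *\<^sub>R vt (\<beta> u)) + integral {s..t} (\<lambda>u. (1 / (1 - u)) *\<^sub>R vt (\<beta> u))
   = integral {tL..t} (\<lambda>u. (1 / (1 - u)) *\<^sub>R vt (\<beta> u))"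
  using st by (intro Henstock_Kurzweil_Integration.integral_combine
   bdd_meas_integrable[OF bdd_meas_hazard[OF vt_\<beta>_measurable taus(3)]]) auto
 thus ?thesis unfolding w_def using st by (simp add: 1 algebra_simps)
qed

text \<open>Over a short interval the increment of \<open>w\<close> is the increment of \<open>v\<close> plus an average of \<open>vt\<close>, so that
 a bound for \<open>w\<close> and moduli of continuity for \<open>v\<close> and \<open>vt\<close> control the size of \<open>vt\<close>.\<close>

lemma vt_bound:
 assumes c: "0 < c" "c <= tU - tL"
  and fl: "\<And>s t. s \<in> I ==> t \<in> I ==> \<bar>s - t\<bar> <= c ==> norm (v (\<beta> s) - v (\<beta> t)) <= y"
   "\<And>s t. s \<in> I ==> t \<in> I ==> \<bar>s - t\<bar> <= c ==> norm (vt (\<beta> s) - vt (\<beta> t)) <= y"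
  and W: "\<And>s. s \<in> I ==> norm (w s) <= W"
  and u: "u \<in> I"
 shows "norm (vt (\<beta> u)) <= (2 * W + y) / c + y / (1 - tU)"
proof -
 define p where "p = min u (tU - c)"
 have p: "p \<in> I" "p + c \<in> I" "u \<in> {p..p + c}" using u c by (auto simp: p_def)
 let ?h = "\<lambda>x :: real. 1 / (1 - x)"
 let ?J = "{p..p + c}"
 have Jt: "x < 1" if "x \<in> ?J" for x using that p taus by auto
 have im: "(\<lambda>x. ?h x *\<^sub>R vt (\<beta> x)) integrable_on ?J"
  by (rule bdd_meas_integrable[OF bdd_meas_hazard[OF vt_\<beta>_measurable taus(3)]]) (use p in auto)
 have ch: "continuous_on ?J ?h" using Jt by (intro continuous_intros) force
 have ih: "(\<lambda>x. ?h x *\<^sub>R vt (\<beta> u)) integrable_on ?J"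
  by (intro integrable_continuous_real continuous_intros ch)
 have "norm (integral ?J (\<lambda>x. ?h x *\<^sub>R vt (\<beta> x) - ?h x *\<^sub>R vt (\<beta> u))) <= y / (1 - tU) * (p + c - p)"
 proof (rule norm_integral_le[OF integrable_diff[OF im ih]])
  fix x assume x: "x \<in> ?J"
  have "norm (vt (\<beta> x) - vt (\<beta> u)) <= y" using x p by (intro fl(2)) auto
  moreover have "0 <= y" using fl(2)[OF u u] c by simp
  ultimately have "norm (vt (\<beta> x) - vt (\<beta> u)) / (1 - x) <= y / (1 - tU)" using x p taus by (intro frac_le) auto
  moreover have "?h x *\<^sub>R vt (\<beta> x) - ?h x *\<^sub>R vt (\<beta> u) = ?h x *\<^sub>R (vt (\<beta> x) - vt (\<beta> u))" by (simp only: scaleR_diff_right)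
  ultimately show "norm (?h x *\<^sub>R vt (\<beta> x) - ?h x *\<^sub>R vt (\<beta> u)) <= y / (1 - tU)" using Jt[OF x] by simp
 qed (use c in simp)
 hence d: "norm (integral ?J (\<lambda>x. ?h x *\<^sub>R vt (\<beta> x)) - integral ?J (\<lambda>x. ?h x *\<^sub>R vt (\<beta> u))) <= y / (1 - tU) * c"
  by (simp add: Henstock_Kurzweil_Integration.integral_diff[OF im ih])
 have "integral ?J (\<lambda>x. ?h x *\<^sub>R vt (\<beta> x)) = (w (p + c) - w p) + (v (\<beta> (p + c)) - v (\<beta> p))"
  using w_increment[of p "p + c"] p c by simp
 hence i: "norm (integral ?J (\<lambda>x. ?h x *\<^sub>R vt (\<beta> x))) <= 2 * W + y"
  using norm_triangle_ineq[of "w (p + c) - w p" "v (\<beta> (p + c)) - v (\<beta> p)"] norm_triangle_ineq4[of "w (p + c)" "w p"]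
   W[OF p(1)] W[OF p(2)] fl(1)[OF p(2,1)] c by simp
 have "integral ?J (\<lambda>x. 1) <= integral ?J ?h"
  using Jt p taus by (intro integral_le integrable_continuous_real ch continuous_on_const) (auto simp: field_simps)
 hence m: "c <= integral ?J ?h" using c by simp
 have "integral ?J (\<lambda>x. ?h x *\<^sub>R vt (\<beta> u)) = integral ?J ?h *\<^sub>R vt (\<beta> u)"
  by (rule integral_unique[OF has_integral_scaleR_left[OF integrable_integral[OF integrable_continuous_real[OF ch]]]])
 hence "c * norm (vt (\<beta> u)) <= norm (integral ?J (\<lambda>x. ?h x *\<^sub>R vt (\<beta> u)))"
  using m c by (simp add: mult_right_mono)
 also have "... <= (2 * W + y) + y / (1 - tU) * c"
  using d i norm_triangle_ineq4[of "integral ?J (\<lambda>x. ?h x *\<^sub>R vt (\<beta> x))" "integral ?J (\<lambda>x. ?h x *\<^sub>R vt (\<beta> x)) - integral ?J (\<lambda>x. ?h x *\<^sub>R vt (\<beta> u))"]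
  by simp
 finally have "norm (vt (\<beta> u)) <= ((2 * W + y) + y / (1 - tU) * c) / c"
  using c by (simp add: pos_le_divide_eq mult.commute)
 thus ?thesis using c by (simp add: add_divide_distrib)
qed

lemma bh_cadlag: "bh \<in> cadlag tL tU"
proof -
 have st: "(\<lambda>t. bh (gp (nat \<lfloor>(t - tL) * (1 / h)\<rfloor>))) \<in> cadlag tL tU"
  using step_path_cadlag[of "1 / h" "\<lambda>k. bh (gp (nat k))" tL tU] h_pos by simp
 have eq: "bh t = bh (gp (nat \<lfloor>(t - tL) * (1 / h)\<rfloor>))" if "t \<in> I" for t
  using bh_step[OF that] by (simp add: cell_def)
 show ?thesis by (rule cadlag_cong[OF st eq])
qed

end

section \<open>The remainder in probability\<close>

locale cqr_asymptotic = cqr_population M Y K \<beta> tL tU a \<epsilon> \<gamma> C L Hf l0 C4 Z U supp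
 for M :: "'a measure" and Y :: "'a => 'd::finite datum" and K \<beta> tL tU a \<epsilon> \<gamma> C L Hf l0 C4 Z U supp +
 fixes Ys :: "nat => 'a => 'd datum" and Ngrid :: "nat => nat" and bhat :: "nat => 'a => real => real^'d"
  and N :: "'w measure" and W :: "'w => real => real^'d"
 assumes Ysm: "\<And>i. Ys i \<in> borel_measurable M" and ident: "\<And>i. distr M borel (Ys i) = distr M borel Y"
  and mesh: "\<And>n. 0 < Ngrid n" "(\<lambda>n. (tU - tL) / real (Ngrid n)) \<in> o(\<lambda>n. real n powr (- 1 / 2))"
  and estimator: "\<And>n \<omega>. 0 < n ==> \<omega> \<in> space M ==> cqr_estimator tL tU (Ngrid n) (\<lambda>i. Ys i \<omega>) n (bhat n \<omega>)"
  and D2: "\<And>r. (\<And>n. 0 <= r n) ==> r \<longlonglongrightarrow> 0 ==>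
    small_oP1 M (\<lambda>n \<omega>. modulus (nbhd_closed \<beta> tL tU \<epsilon>) (r n) (\<lambda>b. sqrt (real n) *\<^sub>R nu M Y Ys n \<omega> b))"
   "\<And>r. (\<And>n. 0 <= r n) ==> r \<longlonglongrightarrow> 0 ==>
    small_oP1 M (\<lambda>n \<omega>. modulus (nbhd_closed \<beta> tL tU \<epsilon>) (r n) (\<lambda>b. sqrt (real n) *\<^sub>R nut M Y Ys n \<omega> b))"
  and N_prob: "prob_space N"
  and D3: "weakly_converges tL tU M (\<lambda>n \<omega> s. sqrt (real n) *\<^sub>R wn M Y Ys tL \<beta> n \<omega> s) N W"
begin

definition an :: "nat => real" where "an n = (tU - tL) / real (Ngrid n)"

text \<open>The moduli of continuity of the scaled empirical processes.\<close>

definition m1 :: "nat => 'a => real => real" where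
 "m1 n x r = modulus (nbhd_closed \<beta> tL tU \<epsilon>) r (\<lambda>b. sqrt (real n) *\<^sub>R nu M Y Ys n x b)"

definition m2 :: "nat => 'a => real => real" where
 "m2 n x r = modulus (nbhd_closed \<beta> tL tU \<epsilon>) r (\<lambda>b. sqrt (real n) *\<^sub>R nut M Y Ys n x b)"

definition R :: "nat => 'a => real => real^'d" where
 "R n x s = bhat n x s - \<beta> s - Ainv s *v duhamel tL Mu (wn M Y Ys tL \<beta> n x) s"

text \<open>The almost sure event on which all samples satisfy the assumptions of \<^locale>\<open>cqr_sample\<close>.\<close>

definition ok :: "'a => bool" where
 "ok x \<longleftrightarrow> (\<forall>i. norm (covar (Ys i x)) <= C \<and> covar (Ys i x) \<bullet> \<beta> (tL + a) < cens (Ys i x) \<and>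
   a <= L * (covar (Ys i x) \<bullet> \<beta> (tL + a) - covar (Ys i x) \<bullet> \<beta> tL))"

lemma ok_AE: "AE x in M. ok x"
proof -
 define P where "P y \<longleftrightarrow> norm (covar y) <= C \<and> covar y \<bullet> \<beta> (tL + a) < cens y \<and>
   a <= L * (covar y \<bullet> \<beta> (tL + a) - covar y \<bullet> \<beta> tL)" for y :: "'d datum"
 have [measurable]: "(covar :: 'd datum => _) \<in> borel_measurable borel" "(cens :: 'd datum => _) \<in> borel_measurable borel"
  unfolding covar_def[abs_def] cens_def[abs_def]
  by (intro borel_measurable_continuous_onI continuous_intros)+
 have P: "{y \<in> space borel. P y} \<in> sets borel" unfolding P_def by measurable
 have "AE x in M. P (Y x)" using C early(3) quantile_gap by eventually_elim (simp add: P_def Z_def)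
 hence "AE y in distr M borel Y. P y" using AE_distr_iff[OF Ym P] by simp
 hence "AE x in M. P (Ys i x)" for i unfolding ident[of i, symmetric] using AE_distr_iff[OF Ysm P] by simp
 hence "AE x in M. \<forall>i. P (Ys i x)" by (simp add: AE_all_countable)
 thus ?thesis by (simp add: ok_def P_def)
qed

lemma covariate_mean: "(LINT x|M. covar (Ys i x)) = (LINT x|M. Z x)"
proof -
 have m: "(covar :: 'd datum => _) \<in> borel_measurable borel"
  unfolding covar_def[abs_def] by (intro borel_measurable_continuous_onI continuous_intros)
 show ?thesis using integral_distr[OF Ysm m, of i] integral_distr[OF Ym m] by (simp add: ident Z_def)
qed

lemma sample:
 assumes "ok x" "0 < n" "x \<in> space M"
 shows "cqr_sample M Y K \<beta> tL tU a \<epsilon> \<gamma> C L Hf l0 C4 (\<lambda>i. Ys i x) n (Ngrid n) (bhat n x)"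
 using assms mesh estimator
 by (intro cqr_sample.intro cqr_sample_axioms.intro) (unfold_locales, auto simp: ok_def)

end
context cqr_asymptotic
begin

lemma norm_expectation_le:
 fixes f :: "'a => real^'d"
 assumes f: "AE x in M. norm (f x) <= C"
 shows "norm (LINT x|M. f x) <= C"
proof (cases "integrable M f")
 case True
 have "norm (LINT x|M. f x) <= (LINT x|M. norm (f x))" by (rule integral_norm_bound)
 also have "... <= C" by (rule integral_le_const[OF integrable_norm[OF True] f])
 finally show ?thesis .
qed (simp add: not_integrable_integral_eq C_nonneg)

lemma mu_le: "norm (mu M Y b) <= C" and mut_le: "norm (mut M Y b) <= C"
 unfolding mu_def mut_def
 by (rule norm_expectation_le, use C in eventually_elim, simp add: Z_def of_bool_def C_nonneg)+

context
 fixes n :: nat and \<omega> :: 'a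
 assumes ok: "ok \<omega>" and n: "0 < n" and \<omega>: "\<omega> \<in> space M"
begin

interpretation s: cqr_sample M Y K \<beta> tL tU a \<epsilon> \<gamma> C L Hf l0 C4 Z U supp "\<lambda>i. Ys i \<omega>" n "Ngrid n" "bhat n \<omega>"
 by (rule sample[OF ok n \<omega>], rule Z_def, rule supp_def, rule U_def)

lemma v_eq: "s.v = nu M Y Ys n \<omega>" and vt_eq: "s.vt = nut M Y Ys n \<omega>"
 by (simp_all add: fun_eq_iff s.v_def s.vt_def s.S_def s.St_def nu_def nut_def)

lemma w_eq: "s.w = wn M Y Ys tL \<beta> n \<omega>"
proof
 fix t
 have "tL *\<^sub>R (s.Zbar - (LINT \<omega>|M. Z \<omega>)) = (tL / real n) *\<^sub>R (\<Sum>i<n. covar (Ys i \<omega>) - (LINT x'|M. covar (Ys i x')))"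
  using n by (simp add: s.Zbar_def covariate_mean sum_subtractf scaleR_diff_right sum_constant_scaleR del: sum_constant)
 thus "s.w t = wn M Y Ys tL \<beta> n \<omega> t" by (simp add: s.w_def wn_def v_eq vt_eq)
qed

lemma h_eq: "s.h = an n" by (simp add: s.h_def an_def)

lemma wn_measurable: "bdd_meas tL tU (wn M Y Ys tL \<beta> n \<omega>)"
 using s.w_measurable by (simp add: w_eq)

lemma estimator_cadlag: "bhat n \<omega> \<in> cadlag tL tU" by (rule s.bh_cadlag)

lemma modulus_bound:
 assumes g: "\<And>b. norm (g b) <= 2 * C" and b: "b1 \<in> U" "b2 \<in> U" "norm (b1 - b2) <= r"
 shows "norm (g b1 - g b2) <= sqrt (real CARD('d)) * modulus (nbhd_closed \<beta> tL tU \<epsilon>) r (\<lambda>b. sqrt (real n) *\<^sub>R g b) / sqrt (real n)"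
  and "0 <= modulus (nbhd_closed \<beta> tL tU \<epsilon>) r (\<lambda>b. sqrt (real n) *\<^sub>R g b)"
proof -
 let ?X = "{infnorm (sqrt (real n) *\<^sub>R g b1 - sqrt (real n) *\<^sub>R g b2) |b1 b2.
  b1 \<in> nbhd_closed \<beta> tL tU \<epsilon> \<and> b2 \<in> nbhd_closed \<beta> tL tU \<epsilon> \<and> infnorm (b1 - b2) <= r}"
 have bdd: "bdd_above ?X"
 proof (rule bdd_aboveI)
  fix x assume "x \<in> ?X"
  then obtain b1 b2 where x: "x = infnorm (sqrt (real n) *\<^sub>R g b1 - sqrt (real n) *\<^sub>R g b2)" by blast
  have "x <= norm (sqrt (real n) *\<^sub>R (g b1 - g b2))" unfolding x by (simp only: scaleR_diff_right infnorm_le_norm)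
  also have "... <= sqrt (real n) * (4 * C)"
   using norm_triangle_ineq4[of "g b1" "g b2"] g[of b1] g[of b2] by (simp add: mult_left_mono)
  finally show "x <= sqrt (real n) * (4 * C)" .
 qed
 have "b1 \<in> nbhd_closed \<beta> tL tU \<epsilon>" "b2 \<in> nbhd_closed \<beta> tL tU \<epsilon>"
  using b nbhd_open_subset_closed unfolding U_def by blast+
 moreover have "infnorm (b1 - b2) <= r" by (rule order_trans[OF infnorm_le_norm b(3)])
 ultimately have m: "infnorm (sqrt (real n) *\<^sub>R g b1 - sqrt (real n) *\<^sub>R g b2) <= modulus (nbhd_closed \<beta> tL tU \<epsilon>) r (\<lambda>b. sqrt (real n) *\<^sub>R g b)"
  unfolding modulus_def by (intro cSup_upper bdd) blast
 thus "0 <= modulus (nbhd_closed \<beta> tL tU \<epsilon>) r (\<lambda>b. sqrt (real n) *\<^sub>R g b)"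
  by (rule order_trans[OF infnorm_pos_le])
 have "norm (sqrt (real n) *\<^sub>R (g b1 - g b2)) <= sqrt (real CARD('d)) * infnorm (sqrt (real n) *\<^sub>R (g b1 - g b2))"
  by (rule norm_le_infnorm_card)
 also have "... <= sqrt (real CARD('d)) * modulus (nbhd_closed \<beta> tL tU \<epsilon>) r (\<lambda>b. sqrt (real n) *\<^sub>R g b)"
  using m by (intro mult_left_mono) (simp_all add: scaleR_diff_right)
 finally show "norm (g b1 - g b2) <= sqrt (real CARD('d)) * modulus (nbhd_closed \<beta> tL tU \<epsilon>) r (\<lambda>b. sqrt (real n) *\<^sub>R g b) / sqrt (real n)"
  using n by (simp add: pos_le_divide_eq mult.commute)
qed

lemma nu_le: "norm (nu M Y Ys n \<omega> b) <= 2 * C" and nut_le: "norm (nut M Y Ys n \<omega> b) <= 2 * C"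
 using norm_triangle_ineq4[of "s.S b" "mu M Y b"] norm_triangle_ineq4[of "s.St b" "mut M Y b"] s.S_le[of b] s.St_le[of b] mu_le[of b] mut_le[of b]
 by (auto simp: s.v_def s.vt_def simp flip: v_eq vt_eq)

lemma nu_modulus: "b1 \<in> U ==> b2 \<in> U ==> norm (b1 - b2) <= r ==>
  norm (nu M Y Ys n \<omega> b1 - nu M Y Ys n \<omega> b2) <= sqrt (real CARD('d)) * m1 n \<omega> r / sqrt (real n)"
 unfolding m1_def by (rule modulus_bound(1)[OF nu_le])

lemma nut_modulus: "b1 \<in> U ==> b2 \<in> U ==> norm (b1 - b2) <= r ==>
  norm (nut M Y Ys n \<omega> b1 - nut M Y Ys n \<omega> b2) <= sqrt (real CARD('d)) * m2 n \<omega> r / sqrt (real n)"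
 unfolding m2_def by (rule modulus_bound(1)[OF nut_le])

lemma moduli_nonneg: "0 <= r ==> 0 <= m1 n \<omega> r" "0 <= r ==> 0 <= m2 n \<omega> r"
proof -
 have b: "\<beta> tL \<in> U" using taus by (intro \<beta>_in_U) auto
 show "0 <= m1 n \<omega> r" if "0 <= r" unfolding m1_def using that by (intro modulus_bound(2)[OF nu_le b b]) simp
 show "0 <= m2 n \<omega> r" if "0 <= r" unfolding m2_def using that by (intro modulus_bound(2)[OF nut_le b b]) simp
qed

lemma w_le:
 assumes "\<And>s. s \<in> I ==> infnorm (sqrt (real n) *\<^sub>R wn M Y Ys tL \<beta> n \<omega> s) <= Kw" and "s \<in> I"
 shows "norm (s.w s) <= sqrt (real CARD('d)) * Kw / sqrt (real n)"
proof -
 have "norm (sqrt (real n) *\<^sub>R s.w s) <= sqrt (real CARD('d)) * infnorm (sqrt (real n) *\<^sub>R s.w s)" by (rule norm_le_infnorm_card)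
 also have "... <= sqrt (real CARD('d)) * Kw" using assms by (intro mult_left_mono) (auto simp: w_eq)
 finally show ?thesis using n by (simp add: pos_le_divide_eq mult.commute)
qed

lemma unit_moduli:
 assumes "m1 n \<omega> r <= 1" "m2 n \<omega> r <= 1" "b1 \<in> U" "b2 \<in> U" "norm (b1 - b2) <= r"
 shows "norm (s.v b1 - s.v b2) <= sqrt (real CARD('d)) / sqrt (real n)" "norm (s.vt b1 - s.vt b2) <= sqrt (real CARD('d)) / sqrt (real n)"
proof -
 have "x <= 1 ==> sqrt (real CARD('d)) * x / sqrt (real n) <= sqrt (real CARD('d)) / sqrt (real n)" for x
  by (intro divide_right_mono) (auto simp: mult_left_le)
 from order_trans[OF nu_modulus this] order_trans[OF nut_modulus this]
 show "norm (s.v b1 - s.v b2) <= sqrt (real CARD('d)) / sqrt (real n)" "norm (s.vt b1 - s.vt b2) <= sqrt (real CARD('d)) / sqrt (real n)"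
  unfolding v_eq vt_eq using assms by blast+
qed

text \<open>The deterministic bounds on the scale \<open>1 / sqrt n\<close>. Moduli at most \<open>1\<close> at radius \<open>r\<close> give the error
 bound \<open>Q / sqrt n\<close>; the final bound then only involves the moduli at a radius \<open>y\<close> of this order.\<close>

lemma remainder_le:
 fixes A Kw P Q c r y :: real
 defines "c \<equiv> (tU - tL) / (1 - tU)" and "P \<equiv> exp ((4 * (L * (C * C)) / (l0 * (1 - tU)) + 1) * (tU - tL))"
  and "A \<equiv> (2 * sqrt (real CARD('d)) + 4 * (sqrt (real CARD('d)) * Kw + (sqrt (real CARD('d)) + L * (C * C) * C4) * c)) / l0"
  and "Q \<equiv> A * P + C4 + 1"
 assumes Kw: "0 <= Kw" "\<And>s. s \<in> I ==> infnorm (sqrt (real n) *\<^sub>R wn M Y Ys tL \<beta> n \<omega> s) <= Kw"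
  and r: "0 < r" "r <= radius" "m1 n \<omega> r <= 1" "m2 n \<omega> r <= 1" "Q / sqrt (real n) < r"
  and an: "an n <= 1 / sqrt (real n)" and y: "Q / sqrt (real n) <= y" and s: "s \<in> I"
 shows "sqrt (real n) * infnorm (R n \<omega> s) <= Cd / l0 * ((1 + c) * (C * C * Hf * Q * Q powr \<gamma>) * real n powr (- \<gamma> / 2)
  + 2 * (sqrt (real CARD('d)) * m1 n \<omega> y) + C * (sqrt (real n) * (an n / (1 - tU))) + c * (sqrt (real CARD('d)) * m2 n \<omega> y))"
proof -
 let ?d = "sqrt (real CARD('d))" and ?n = "sqrt (real n)"
 have n0: "0 < ?n" using n by simp
 have k0: "0 <= c" using taus by (simp add: c_def)
 have A0: "0 <= A" using Kw(1) l0(1) L(1) C4(1) k0 by (simp add: A_def)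
 have P0: "0 <= P" by (simp add: P_def)
 have Q0: "1 <= Q" using A0 P0 C4(1) by (simp add: Q_def)
 have P: "exp (s.rate * (tU - tL)) = P" by (simp add: P_def s.rate_def s.Lm_def)
 have small: "s.initial_error (?d / ?n) (?d * Kw / ?n) * P + C4 * s.h <= Q / ?n - 1 / ?n"
 proof -
  have h: "s.h <= 1 / ?n" using an by (simp add: h_eq)
  have "s.initial_error (?d / ?n) (?d * Kw / ?n) <= (2 * (?d / ?n) + 4 * (?d * Kw / ?n + (?d / ?n + L * (C * C) * (C4 * (1 / ?n))) * c)) / l0"
   unfolding s.initial_error_def s.Lm_def c_def times_divide_eq_right[symmetric]
   using h L(1) C4(1) taus l0(1)
   by (intro divide_right_mono add_mono mult_left_mono mult_right_mono order_refl) auto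
  also have "... = A / ?n" using n0 l0(1) by (simp add: A_def field_simps)
  finally have "s.initial_error (?d / ?n) (?d * Kw / ?n) * P + C4 * s.h <= A / ?n * P + C4 * (1 / ?n)"
   using h C4(1) P0 by (intro add_mono mult_right_mono mult_left_mono) auto
  thus ?thesis by (simp add: Q_def add_divide_distrib)
 qed
 have fl1: "norm (s.v b1 - s.v b2) <= ?d / ?n" and fl2: "norm (s.vt b1 - s.vt b2) <= ?d / ?n"
  if "b1 \<in> U" "b2 \<in> U" "norm (b1 - b2) < r" for b1 b2
  using unit_moduli[OF r(3,4) that(1,2)] that(3) by auto
 note W = w_le[OF Kw(2)]
 have sm: "s.initial_error (?d / ?n) (?d * Kw / ?n) * exp (s.rate * (tU - tL)) + C4 * s.h < r"
  using small r(5) n0 unfolding P by (smt (verit) divide_pos_pos)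
 define e where "e = Q / ?n"
 have e0: "0 < e" using Q0 n0 by (simp add: e_def)
 have e: "norm (bhat n \<omega> s - \<beta> s) <= e" if "s \<in> I" for s
  using s.path_error_everywhere[OF r(1,2) fl1 fl2 W sm that] small n0 unfolding P e_def by (smt (verit) divide_pos_pos)
 have g1: "norm (s.v b1 - s.v b2) <= ?d * m1 n \<omega> y / ?n" if "b1 \<in> U" "b2 \<in> U" "norm (b1 - b2) <= e" for b1 b2
  unfolding v_eq using that y by (intro nu_modulus) (auto simp: e_def)
 have g2: "norm (s.vt b1 - s.vt b2) <= ?d * m2 n \<omega> y / ?n" if "b1 \<in> U" "b2 \<in> U" "norm (b1 - b2) <= e" for b1 b2
  unfolding vt_eq using that y by (intro nut_modulus) (auto simp: e_def)
 have score: "norm (s.S (bhat n \<omega> (s.gp j)) - s.G (s.gp j)) <= ?d * m1 n \<omega> y / ?n" if "j <= Ngrid n" for j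
  using s.path_error[OF r(1,2) fl1 fl2 W sm that] e0 g1 by blast
 define q where "q = C * C * Hf * e * e powr \<gamma> + 2 * (?d * m1 n \<omega> y / ?n) + C * s.h / (1 - tU)
  + (?d * m2 n \<omega> y / ?n + C * C * Hf * e * e powr \<gamma>) * (tU - tL) / (1 - tU)"
 have e\<epsilon>: "e < \<epsilon>" using r radius by (simp add: e_def)
 have "norm (s.forcing t - s.w t) <= q" if "t \<in> I" for t
  unfolding q_def by (rule s.forcing_near_w[OF less_imp_le[OF e0] e\<epsilon> e score g1 g2 that])
 hence "norm (s.remainder s) <= Cd * q / l0" by (rule s.remainder_bound[OF _ s])
 hence "infnorm (R n \<omega> s) <= Cd * q / l0"
  unfolding s.remainder_def w_eq R_def by (rule order_trans[OF infnorm_le_norm])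
 hence "?n * infnorm (R n \<omega> s) <= ?n * (Cd * q / l0)" using n0 by (intro mult_left_mono) auto
 also have "... = Cd / l0 * (?n * q)" by simp
 also have "?n * q = (1 + c) * (C * C * Hf * (?n * (e * e powr \<gamma>))) + 2 * (?d * m1 n \<omega> y) + C * (?n * (an n / (1 - tU))) + c * (?d * m2 n \<omega> y)"
 proof -
  have "x * (T * e * p + 2 * (k / x) + C * h / u + (l / x + T * e * p) * D / u)
    = (1 + D / u) * (T * (x * (e * p))) + 2 * k + C * (x * (h / u)) + D / u * l"
   if "0 < x" "0 < u" for x u T e p k h l D :: real
   using that by (simp add: field_simps)
  thus ?thesis unfolding q_def h_eq c_def using n0 taus by simp
 qed
 also have "?n * (e * e powr \<gamma>) = Q * Q powr \<gamma> * real n powr (- \<gamma> / 2)"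
 proof -
  have "e powr \<gamma> = Q powr \<gamma> / ?n powr \<gamma>" using Q0 n0 by (simp add: e_def powr_divide)
  also have "?n powr \<gamma> = real n powr (\<gamma> / 2)" using n by (simp add: powr_half_sqrt[symmetric] powr_powr)
  finally show ?thesis using n0 by (simp add: e_def powr_minus_divide minus_divide_left[symmetric])
 qed
 finally show ?thesis by (simp add: mult_ac)
qed

lemma nut_bound:
 assumes c: "0 < c" "c <= tU - tL" and m: "m1 n \<omega> (C4 * c) <= 1" "m2 n \<omega> (C4 * c) <= 1"
  and Kw: "\<And>s. s \<in> I ==> infnorm (sqrt (real n) *\<^sub>R wn M Y Ys tL \<beta> n \<omega> s) <= Kw" and u: "u \<in> I"
 shows "sqrt (real n) * norm (nut M Y Ys n \<omega> (\<beta> u)) <= sqrt (real CARD('d)) * ((2 * Kw + 1) / c + 1 / (1 - tU))"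
proof -
 let ?d = "sqrt (real CARD('d))" and ?n = "sqrt (real n)"
 have n0: "0 < ?n" using n by simp
 have bd: "norm (\<beta> s - \<beta> t) <= C4 * c" if "s \<in> I" "t \<in> I" "\<bar>s - t\<bar> <= c" for s t
  using that by (intro order_trans[OF C4(2)] mult_left_mono C4(1)) auto
 have fl1: "norm (s.v (\<beta> s) - s.v (\<beta> t)) <= ?d / ?n" and fl2: "norm (s.vt (\<beta> s) - s.vt (\<beta> t)) <= ?d / ?n"
  if "s \<in> I" "t \<in> I" "\<bar>s - t\<bar> <= c" for s t
  by (intro unit_moduli[OF m] \<beta>_in_U bd that)+
 note W = w_le[OF Kw]
 have "norm (s.vt (\<beta> u)) <= (2 * (?d * Kw / ?n) + ?d / ?n) / c + ?d / ?n / (1 - tU)"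
  by (rule s.vt_bound[OF c fl1 fl2 W u])
 also have "... = ?d * ((2 * Kw + 1) / c + 1 / (1 - tU)) / ?n"
 proof -
  have "(2 * (d * k / x) + d / x) / y + d / x / u = d * ((2 * k + 1) / y + 1 / u) / x"
   if "0 < x" "0 < y" "0 < u" for d k x y u :: real
   using that by (simp add: field_simps)
  thus ?thesis using n0 c(1) taus by simp
 qed
 finally show ?thesis using n0 by (simp add: vt_eq pos_le_divide_eq mult.commute)
qed

lemma w_oscillation:
 assumes B: "\<And>u. u \<in> I ==> sqrt (real n) * norm (nut M Y Ys n \<omega> (\<beta> u)) <= B"
  and s: "s \<in> I" and t: "t \<in> I" and c: "\<bar>s - t\<bar> <= c"
 shows "norm (sqrt (real n) *\<^sub>R (wn M Y Ys tL \<beta> n \<omega> s - wn M Y Ys tL \<beta> n \<omega> t))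
  <= sqrt (real CARD('d)) * m1 n \<omega> (C4 * c) + B * c / (1 - tU)"
proof -
 let ?d = "sqrt (real CARD('d))" and ?n = "sqrt (real n)"
 have n0: "0 < ?n" using n by simp
 have B0: "0 <= B" by (rule order_trans[OF _ B[OF s]]) simp
 have *: "norm (?n *\<^sub>R (s.w t - s.w s)) <= ?d * m1 n \<omega> (C4 * c) + B * c / (1 - tU)"
  if st: "s \<in> I" "t \<in> I" "s <= t" "t - s <= c" for s t
 proof -
  have "norm (\<beta> t - \<beta> s) <= C4 * c" using st by (intro order_trans[OF C4(2)] mult_left_mono C4(1)) auto
  hence 1: "norm (s.v (\<beta> t) - s.v (\<beta> s)) <= ?d * m1 n \<omega> (C4 * c) / ?n"
   unfolding v_eq by (intro nu_modulus \<beta>_in_U st)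
  have "norm (integral {s..t} (\<lambda>u. (1 / (1 - u)) *\<^sub>R s.vt (\<beta> u))) <= (B / ?n / (1 - tU)) * (t - s)"
  proof (rule norm_integral_le)
   show "(\<lambda>u. (1 / (1 - u)) *\<^sub>R s.vt (\<beta> u)) integrable_on {s..t}"
    by (rule bdd_meas_integrable[OF bdd_meas_hazard[OF s.vt_\<beta>_measurable taus(3)]]) (use st in auto)
   fix u assume u: "u \<in> {s..t}"
   have "norm (s.vt (\<beta> u)) <= B / ?n" using B[of u] u st n0 by (simp add: vt_eq pos_le_divide_eq mult.commute)
   hence "norm (s.vt (\<beta> u)) / (1 - u) <= B / ?n / (1 - tU)" using u st taus B0 by (intro frac_le) auto
   thus "norm ((1 / (1 - u)) *\<^sub>R s.vt (\<beta> u)) <= B / ?n / (1 - tU)" using u st taus by simp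
  qed (rule st)
  also have "... <= (B / ?n / (1 - tU)) * c" using st B0 taus by (intro mult_left_mono) auto
  finally have 2: "norm (integral {s..t} (\<lambda>u. (1 / (1 - u)) *\<^sub>R s.vt (\<beta> u))) <= B * c / (1 - tU) / ?n" by (simp add: mult_ac)
  have "norm (s.w t - s.w s) <= ?d * m1 n \<omega> (C4 * c) / ?n + B * c / (1 - tU) / ?n"
   using 1 2 s.w_increment[of s t] st
    norm_triangle_ineq[of "- (s.v (\<beta> t) - s.v (\<beta> s))" "integral {s..t} (\<lambda>u. (1 / (1 - u)) *\<^sub>R s.vt (\<beta> u))"]
   by (simp add: norm_minus_commute)
  also have "... = (?d * m1 n \<omega> (C4 * c) + B * c / (1 - tU)) / ?n" by (simp add: add_divide_distrib)
  finally show ?thesis using n0 by (simp add: pos_le_divide_eq mult.commute)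
 qed
 show ?thesis
 proof (cases "s <= t")
  case True
  thus ?thesis using *[OF s t True] c by (simp add: w_eq norm_minus_commute)
 next
  case False
  thus ?thesis using *[OF t s] c by (simp add: w_eq)
 qed
qed

end

end

context prob_space
begin

lemma eventually_outer_prob_or:
 assumes "\<forall>\<^sub>F n in sequentially. outer_prob M {x \<in> space M. P n x} <= p"
  and "\<forall>\<^sub>F n in sequentially. outer_prob M {x \<in> space M. Q n x} <= q"
 shows "\<forall>\<^sub>F n in sequentially. outer_prob M {x \<in> space M. P n x \<or> Q n x} <= p + q"
 using assms
proof eventually_elim
 case (elim n)
 have "outer_prob M {x \<in> space M. P n x \<or> Q n x} <= outer_prob M {x \<in> space M. P n x} + outer_prob M {x \<in> space M. Q n x}"
  by (rule outer_prob_cover2) simp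
 thus ?case using elim by linarith
qed

lemma eventually_outer_prob_mono:
 assumes "\<forall>\<^sub>F n in sequentially. AE x in M. P n x --> Q n x"
  and "\<forall>\<^sub>F n in sequentially. outer_prob M {x \<in> space M. Q n x} <= q"
 shows "\<forall>\<^sub>F n in sequentially. outer_prob M {x \<in> space M. P n x} <= q"
 using assms
proof eventually_elim
 case (elim n)
 thus ?case using outer_prob_cover1[of "P n" "Q n"] by linarith
qed

lemma small_oP1_eventually:
 assumes X: "small_oP1 M X" and "0 < e" "0 < h"
 shows "\<forall>\<^sub>F n in sequentially. outer_prob M {x \<in> space M. \<bar>X n x\<bar> > e} <= h"
proof -
 have "(\<lambda>n. outer_prob M {x \<in> space M. \<bar>X n x\<bar> > e}) \<longlonglongrightarrow> 0"
  using X \<open>0 < e\<close> by (simp add: small_oP1_iff)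
 from order_tendstoD(2)[OF this \<open>0 < h\<close>] show ?thesis by eventually_elim simp
qed

end

lemma powr_null: "s < 0 ==> (\<lambda>n. real n powr s) \<longlonglongrightarrow> 0"
 by (rule tendsto_neg_powr) (auto intro: filterlim_real_sequentially)

context cqr_asymptotic
begin

abbreviation \<open>wsc n \<omega> s \<equiv> sqrt (real n) *\<^sub>R wn M Y Ys tL \<beta> n \<omega> s\<close>

definition rt :: "(nat => real) => nat => 'a => real" where
 "rt c n x = sqrt (real n) * (an n / (1 - tU)) + real n powr (- \<gamma> / 2)
   + m1 n x (c n * real n powr (- 1 / 2)) + m2 n x (c n * real n powr (- 1 / 2))"

text \<open>The radius \<open>n\<^sup>-\<^sup>1\<^sup>/\<^sup>4\<close> is small enough for the moduli to vanish in probability and large compared with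
 the error \<open>n\<^sup>-\<^sup>1\<^sup>/\<^sup>2\<close> of the estimator.\<close>

definition regular :: "real => nat => 'a => bool" where
 "regular Kw n x \<longleftrightarrow> (\<forall>s\<in>I. infnorm (wsc n x s) <= Kw) \<and>
   \<bar>m1 n x (real n powr (- 1 / 4))\<bar> <= 1 \<and> \<bar>m2 n x (real n powr (- 1 / 4))\<bar> <= 1"

lemma modulus_null:
 assumes "\<And>n. 0 <= r n" "r \<longlonglongrightarrow> 0" "0 < e" "0 < h"
 shows "\<forall>\<^sub>F n in sequentially. outer_prob M {x \<in> space M. \<bar>m1 n x (r n)\<bar> > e} <= h"
  and "\<forall>\<^sub>F n in sequentially. outer_prob M {x \<in> space M. \<bar>m2 n x (r n)\<bar> > e} <= h"
 unfolding m1_def m2_def using assms by (intro small_oP1_eventually D2; simp)+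

lemma tight:
 assumes "0 < h"
 obtains Kw where "0 < Kw" "\<forall>\<^sub>F n in sequentially. outer_prob M {x \<in> space M. \<not> (\<forall>s\<in>I. infnorm (wsc n x s) <= Kw)} <= h"
 using weakly_converges_tight[OF tL_le prob_space_axioms N_prob D3 assms] by blast

lemma regular_likely:
 assumes h: "0 < h"
 obtains Kw where "0 < Kw" "\<forall>\<^sub>F n in sequentially. outer_prob M {x \<in> space M. \<not> regular Kw n x} <= h"
proof -
 obtain Kw where K: "0 < Kw" "\<forall>\<^sub>F n in sequentially. outer_prob M {x \<in> space M. \<not> (\<forall>s\<in>I. infnorm (wsc n x s) <= Kw)} <= h / 3"
  using tight[of "h / 3"] h by auto
 have z: "(\<lambda>n. real n powr (- 1 / 4)) \<longlonglongrightarrow> 0" by (rule powr_null) simp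
 have e3: "0 < h / 3" using h by simp
 have "\<forall>\<^sub>F n in sequentially. outer_prob M {x \<in> space M. \<not> (\<forall>s\<in>I. infnorm (wsc n x s) <= Kw) \<or>
   \<bar>m1 n x (real n powr (- 1 / 4))\<bar> > 1 \<or> \<bar>m2 n x (real n powr (- 1 / 4))\<bar> > 1} <= h / 3 + (h / 3 + h / 3)"
  using K(2) modulus_null[OF _ z zero_less_one e3] by (intro eventually_outer_prob_or) auto
 hence "\<forall>\<^sub>F n in sequentially. outer_prob M {x \<in> space M. \<not> regular Kw n x} <= h / 3 + (h / 3 + h / 3)"
  by (rule eventually_outer_prob_mono[rotated]) (simp add: regular_def not_le)
 thus thesis using K(1) by (intro that[of Kw]) auto
qed

lemma remainder_eventually:
 assumes K: "0 < Kw" and c: "filterlim c at_top sequentially"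
 obtains B where "0 < B" "\<forall>\<^sub>F n in sequentially. \<forall>x\<in>space M. ok x --> regular Kw n x -->
   0 <= rt c n x \<and> (\<forall>s\<in>I. sqrt (real n) * infnorm (R n x s) <= B * rt c n x)"
proof -
 let ?d = "sqrt (real CARD('d))"
 define k where "k = (tU - tL) / (1 - tU)"
 define P where "P = exp ((4 * (L * (C * C)) / (l0 * (1 - tU)) + 1) * (tU - tL))"
 define A where "A = (2 * ?d + 4 * (?d * Kw + (?d + L * (C * C) * C4) * k)) / l0"
 define Q where "Q = A * P + C4 + 1"
 have k0: "0 <= k" using taus by (simp add: k_def)
 have "0 <= A" using K l0(1) L(1) C4(1) k0 by (simp add: A_def)
 hence Q0: "1 <= Q" using C4(1) by (simp add: Q_def P_def)
 define T where "T = C * C * Hf * Q * Q powr \<gamma>"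
 have T0: "0 <= T" using C_nonneg Hf(1) Q0 by (simp add: T_def)
 define B0 where "B0 = (1 + k) * T + 2 * ?d + C + k * ?d"
 have B00: "0 <= B0" using k0 T0 C_nonneg by (simp add: B0_def)
 define B where "B = Cd / l0 * B0 + 1"
 have c0: "0 <= Cd / l0" using Cd(1) l0(1) by simp
 have "0 <= Cd / l0 * B0" using c0 B00 by (rule mult_nonneg_nonneg)
 hence B: "0 < B" by (simp add: B_def)
 have "(\<lambda>n. real n powr (- 1 / 4)) \<longlonglongrightarrow> 0" by (rule powr_null) simp
 hence e1: "\<forall>\<^sub>F n in sequentially. real n powr (- 1 / 4) < radius"
  using radius(1) by (rule order_tendstoD)
 have "(\<lambda>n. Q * real n powr (- 1 / 4)) \<longlonglongrightarrow> Q * 0" by (intro tendsto_mult tendsto_const powr_null) simp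
 hence "(\<lambda>n. Q * real n powr (- 1 / 4)) \<longlonglongrightarrow> 0" by simp
 hence e2: "\<forall>\<^sub>F n in sequentially. Q * real n powr (- 1 / 4) < 1"
  using zero_less_one by (rule order_tendstoD)
 have e3: "\<forall>\<^sub>F n in sequentially. norm (an n) <= 1 * norm (real n powr (- 1 / 2))"
  using landau_o.smallD[OF mesh(2) zero_less_one] by (simp add: an_def)
 have e4: "\<forall>\<^sub>F n in sequentially. Q <= c n" using c by (simp add: filterlim_at_top)
 have "\<forall>\<^sub>F n in sequentially. \<forall>x\<in>space M. ok x --> regular Kw n x -->
   0 <= rt c n x \<and> (\<forall>s\<in>I. sqrt (real n) * infnorm (R n x s) <= B * rt c n x)"
  using e1 e2 e3 e4 eventually_gt_at_top[of "0::nat"]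
 proof eventually_elim
  case (elim n)
  show ?case
  proof (intro ballI impI)
   fix x assume x: "x \<in> space M" "ok x" "regular Kw n x"
   have n: "0 < n" by (rule elim(5))
   have hn: "real n powr (- 1 / 2) = 1 / sqrt (real n)"
    using n by (simp add: powr_minus_divide powr_half_sqrt minus_divide_left[symmetric])
   have an: "an n <= 1 / sqrt (real n)" using elim(3) unfolding hn by simp
   have small: "Q / sqrt (real n) < real n powr (- 1 / 4)"
   proof -
    have "Q / sqrt (real n) = (Q * real n powr (- 1 / 4)) * real n powr (- 1 / 4)"
     unfolding mult.assoc powr_add[symmetric] using hn by (simp add: field_simps)
    also have "... < 1 * real n powr (- 1 / 4)" using elim(2) n by (intro mult_strict_right_mono) auto
    finally show ?thesis by simp
   qed
   have r0: "0 < real n powr (- 1 / 4)" using n by simp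
   let ?r = "c n * real n powr (- 1 / 2)"
   have r: "Q / sqrt (real n) <= ?r" unfolding hn using elim(4) n by (simp add: divide_right_mono)
   moreover have "0 <= Q / sqrt (real n)" using Q0 by simp
   ultimately have d0: "0 <= ?r" by linarith
   note m0 = moduli_nonneg[OF x(2) n x(1) d0]
   have x1: "0 <= sqrt (real n) * (an n / (1 - tU))" using taus by (simp add: an_def)
   have x2: "0 <= real n powr (- \<gamma> / 2)" by simp
   have rt0: "0 <= rt c n x" unfolding rt_def using m0 x1 x2 by linarith
   have "sqrt (real n) * infnorm (R n x s) <= B * rt c n x" if s: "s \<in> I" for s
   proof -
    have "sqrt (real n) * infnorm (R n x s) <= Cd / l0 * ((1 + k) * T * real n powr (- \<gamma> / 2)
      + 2 * (?d * m1 n x ?r) + C * (sqrt (real n) * (an n / (1 - tU))) + k * (?d * m2 n x ?r))"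
     unfolding T_def
     by (rule remainder_le[OF x(2) n x(1), of Kw "real n powr (- 1 / 4)", folded P_def k_def, folded A_def, folded Q_def])
      (use K x(3) r0 elim(1) small an r s in "auto simp: regular_def")
    also have "... <= Cd / l0 * (B0 * rt c n x)"
    proof (rule mult_left_mono[OF _ c0])
     have "(1 + k) * T * real n powr (- \<gamma> / 2) <= B0 * real n powr (- \<gamma> / 2)"
      using k0 T0 C_nonneg by (intro mult_right_mono) (auto simp: B0_def)
     moreover have "2 * ?d * m1 n x ?r <= B0 * m1 n x ?r"
      using k0 T0 C_nonneg m0 by (intro mult_right_mono) (auto simp: B0_def)
     moreover have "C * (sqrt (real n) * (an n / (1 - tU))) <= B0 * (sqrt (real n) * (an n / (1 - tU)))"
      using k0 T0 C_nonneg x1 by (intro mult_right_mono) (auto simp: B0_def)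
     moreover have "k * ?d * m2 n x ?r <= B0 * m2 n x ?r"
      using k0 T0 C_nonneg m0 by (intro mult_right_mono) (auto simp: B0_def)
     ultimately show "(1 + k) * T * real n powr (- \<gamma> / 2) + 2 * (?d * m1 n x ?r)
       + C * (sqrt (real n) * (an n / (1 - tU))) + k * (?d * m2 n x ?r) <= B0 * rt c n x"
      unfolding rt_def distrib_left by (simp only: mult.assoc)
    qed
    also have "... <= B * rt c n x" using rt0 by (simp add: B_def distrib_right)
    finally show ?thesis .
   qed
   with rt0 show "0 <= rt c n x \<and> (\<forall>s\<in>I. sqrt (real n) * infnorm (R n x s) <= B * rt c n x)" by blast
  qed
 qed
 thus thesis by (rule that[OF B])
qed

lemma remainder_likely:
 assumes c: "filterlim c at_top sequentially" and h: "0 < h"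
 obtains B where "0 < B" "\<forall>\<^sub>F n in sequentially. outer_prob M {x \<in> space M.
   \<not> (0 <= rt c n x \<and> (\<forall>s\<in>I. sqrt (real n) * infnorm (R n x s) <= B * rt c n x))} <= h"
proof -
 obtain Kw where K: "0 < Kw" "\<forall>\<^sub>F n in sequentially. outer_prob M {x \<in> space M. \<not> regular Kw n x} <= h"
  by (rule regular_likely[OF h])
 obtain B where B: "0 < B" and ev: "\<forall>\<^sub>F n in sequentially. \<forall>x\<in>space M. ok x --> regular Kw n x -->
   0 <= rt c n x \<and> (\<forall>s\<in>I. sqrt (real n) * infnorm (R n x s) <= B * rt c n x)"
  by (rule remainder_eventually[OF K(1) c])
 show thesis
 proof (rule that[OF B], rule eventually_outer_prob_mono[OF _ K(2)], use ev in eventually_elim)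
  case (elim n)
  note uniform = elim
  show ?case using ok_AE AE_space by eventually_elim (use uniform in blast)
 qed
qed

lemma remainder_big_OP:
 assumes c: "filterlim c at_top sequentially"
 shows "big_OP M (\<lambda>n x. SUP s\<in>I. sqrt (real n) * infnorm (R n x s)) (rt c)"
 unfolding big_OP_iff
proof (intro allI impI)
 fix h :: real assume h: "0 < h"
 obtain B where B: "0 < B" and ev: "\<forall>\<^sub>F n in sequentially. outer_prob M {x \<in> space M.
   \<not> (0 <= rt c n x \<and> (\<forall>s\<in>I. sqrt (real n) * infnorm (R n x s) <= B * rt c n x))} <= h"
  by (rule remainder_likely[OF c h])
 have sup: "\<bar>SUP s\<in>I. sqrt (real n) * infnorm (R n x s)\<bar> <= B * \<bar>rt c n x\<bar>"
  if b: "0 <= rt c n x \<and> (\<forall>s\<in>I. sqrt (real n) * infnorm (R n x s) <= B * rt c n x)" for n x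
 proof -
  have "(SUP s\<in>I. sqrt (real n) * infnorm (R n x s)) <= B * rt c n x"
   using b tL_le by (intro cSUP_least) auto
  moreover have "0 <= (SUP s\<in>I. sqrt (real n) * infnorm (R n x s))"
   using b tL_le by (intro cSUP_upper2[of _ _ tL] bdd_aboveI2[of _ _ "B * rt c n x"]) (auto simp: infnorm_pos_le)
  ultimately show ?thesis using b by simp
 qed
 show "\<exists>B>0. \<forall>\<^sub>F n in sequentially.
   outer_prob M {x \<in> space M. \<bar>SUP s\<in>I. sqrt (real n) * infnorm (R n x s)\<bar> > B * \<bar>rt c n x\<bar>} <= h"
 proof (intro exI[of _ B] conjI B, rule eventually_outer_prob_mono[OF _ ev], intro always_eventually allI AE_I2 impI notI)
  fix n x assume gt: "B * \<bar>rt c n x\<bar> < \<bar>SUP s\<in>I. sqrt (real n) * infnorm (R n x s)\<bar>"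
   and b: "0 <= rt c n x \<and> (\<forall>s\<in>I. sqrt (real n) * infnorm (R n x s) <= B * rt c n x)"
  show False using sup[OF b] gt by linarith
 qed
qed

text \<open>The rate tends to zero for a slowly growing radius, here \<open>c\<^sub>n = n\<^sup>1\<^sup>/\<^sup>4\<close>.\<close>

lemma remainder_negligible:
 assumes e: "0 < e"
 shows "(\<lambda>n. outer_prob M {x \<in> space M. \<not> (\<forall>s\<in>I. sqrt (real n) * infnorm (R n x s) <= e)}) \<longlonglongrightarrow> 0"
proof -
 have main: "\<forall>\<^sub>F n in sequentially. outer_prob M {x \<in> space M. \<not> (\<forall>s\<in>I. sqrt (real n) * infnorm (R n x s) <= e)} <= h"
  if h: "0 < h" for h :: real
 proof -
  have e3: "0 < h / 3" using h by simp
  define c where "c n = real n powr (1 / 4)" for n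
  have c: "filterlim c at_top sequentially"
   unfolding c_def by (rule filterlim_compose[OF _ filterlim_real_sequentially]) (rule real_powr_at_top, simp)
  have cn: "c n * real n powr (- 1 / 2) = real n powr (- 1 / 4)" for n
   by (simp add: c_def powr_add[symmetric])
  obtain B where B: "0 < B" and ev: "\<forall>\<^sub>F n in sequentially. outer_prob M {x \<in> space M.
    \<not> (0 <= rt c n x \<and> (\<forall>s\<in>I. sqrt (real n) * infnorm (R n x s) <= B * rt c n x))} <= h / 3"
   by (rule remainder_likely[OF c e3])
  define e' where "e' = e / (4 * B)"
  have e': "0 < e'" using e B by (simp add: e'_def)
  have z: "(\<lambda>n. real n powr (- 1 / 4)) \<longlonglongrightarrow> 0" by (rule powr_null) simp
  have "(\<lambda>n. real n powr (- \<gamma> / 2)) \<longlonglongrightarrow> 0" using \<gamma> by (intro powr_null) simp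
  hence e1: "\<forall>\<^sub>F n in sequentially. real n powr (- \<gamma> / 2) < e'" using e' by (rule order_tendstoD)
  have "0 < e' * (1 - tU)" using e' taus by simp
  from landau_o.smallD[OF mesh(2) this]
  have e2: "\<forall>\<^sub>F n in sequentially. norm (an n) <= e' * (1 - tU) * norm (real n powr (- 1 / 2))" by (simp add: an_def)
  have "\<forall>\<^sub>F n in sequentially. outer_prob M {x \<in> space M.
   \<not> (0 <= rt c n x \<and> (\<forall>s\<in>I. sqrt (real n) * infnorm (R n x s) <= B * rt c n x)) \<or>
   \<bar>m1 n x (real n powr (- 1 / 4))\<bar> > e' \<or> \<bar>m2 n x (real n powr (- 1 / 4))\<bar> > e'} <= h / 3 + (h / 3 + h / 3)"
   using ev modulus_null[OF _ z e' e3] by (intro eventually_outer_prob_or) auto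
  hence "\<forall>\<^sub>F n in sequentially. outer_prob M {x \<in> space M. \<not> (\<forall>s\<in>I. sqrt (real n) * infnorm (R n x s) <= e)} <= h / 3 + (h / 3 + h / 3)"
  proof (rule eventually_outer_prob_mono[rotated], use e1 e2 eventually_gt_at_top[of "0::nat"] in eventually_elim)
   case (elim n)
   have hn: "real n powr (- 1 / 2) = 1 / sqrt (real n)"
    using elim(3) by (simp add: powr_minus_divide powr_half_sqrt minus_divide_left[symmetric])
   have "an n <= e' * (1 - tU) / sqrt (real n)" using elim(2) unfolding hn by simp
   hence "sqrt (real n) * an n <= e' * (1 - tU)" using elim(3) by (simp add: pos_le_divide_eq mult.commute)
   hence x1: "sqrt (real n) * (an n / (1 - tU)) <= e'" using taus by (simp add: pos_divide_le_eq)
   have "sqrt (real n) * infnorm (R n x s) <= e"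
    if "\<forall>s\<in>I. sqrt (real n) * infnorm (R n x s) <= B * rt c n x" "\<bar>m1 n x (real n powr (- 1 / 4))\<bar> <= e'" "\<bar>m2 n x (real n powr (- 1 / 4))\<bar> <= e'" "s \<in> I" for x s
   proof -
    have "sqrt (real n) * infnorm (R n x s) <= B * rt c n x" using that by blast
    also have "rt c n x <= 4 * e'" unfolding rt_def cn using x1 elim(1) that by linarith
    hence "B * rt c n x <= B * (4 * e')" using B by (intro mult_left_mono) auto
    also have "... = e" using B by (simp add: e'_def)
    finally show ?thesis .
   qed
   thus ?case by (intro AE_I2) (metis not_le_imp_less)
  qed
  thus ?thesis by simp
 qed
 show ?thesis
 proof (rule order_tendstoI)
  fix y :: real assume "y < 0"
  thus "\<forall>\<^sub>F n in sequentially. y < outer_prob M {x \<in> space M. \<not> (\<forall>s\<in>I. sqrt (real n) * infnorm (R n x s) <= e)}"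
   by (intro always_eventually allI less_le_trans[OF _ outer_prob_nonneg])
 next
  fix y :: real assume "0 < y"
  thus "\<forall>\<^sub>F n in sequentially. outer_prob M {x \<in> space M. \<not> (\<forall>s\<in>I. sqrt (real n) * infnorm (R n x s) <= e)} < y"
   using main[of "y / 2"] by (auto elim!: eventually_mono)
 qed
qed

end

context cqr_asymptotic
begin

section \<open>Weak convergence of the estimator\<close>

text \<open>The increments of \<open>w\<close> consist of increments of \<open>nu\<close>, controlled by its modulus, and of short integrals of
 \<open>nut\<close>. The size of \<open>nut\<close> itself is controlled by \<open>nut_bound\<close> and the tightness of \<open>w\<close>.\<close>

lemma w_equicontinuous:
 assumes e: "0 < e" and p: "0 < p"
 shows "\<exists>h>0. \<forall>\<^sub>F n in sequentially. outer_prob M {x \<in> space M.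
   \<not> (\<forall>s\<in>I. \<forall>t\<in>I. \<bar>s - t\<bar> < h --> infnorm (wsc n x s - wsc n x t) <= e)} <= p"
proof -
 let ?d = "sqrt (real CARD('d))"
 have d0: "0 < ?d" by simp
 have small_radius: "(\<lambda>n. C4 * min (r n) b) \<longlonglongrightarrow> 0" "\<And>n. 0 <= C4 * min (r n) b"
  if "\<And>n. 0 <= r n" "r \<longlonglongrightarrow> 0" "0 < b" for r :: "nat => real" and b
 proof -
  have "(\<lambda>n. C4 * min (r n) b) \<longlonglongrightarrow> C4 * min 0 b" by (intro tendsto_intros that)
  thus "(\<lambda>n. C4 * min (r n) b) \<longlonglongrightarrow> 0" using that by simp
  show "0 <= C4 * min (r n) b" for n using C4(1) that by simp
 qed
 have null: "(\<lambda>n. outer_prob M {x \<in> space M. \<bar>m1 n x (C4 * min (r n) b)\<bar> > c}) \<longlonglongrightarrow> 0"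
  "(\<lambda>n. outer_prob M {x \<in> space M. \<bar>m2 n x (C4 * min (r n) b)\<bar> > c}) \<longlonglongrightarrow> 0"
  if "\<And>n. 0 <= r n" "r \<longlonglongrightarrow> 0" "0 < b" "0 < c" for r :: "nat => real" and b c
  using D2[OF small_radius(2)[OF that(1-3)] small_radius(1)[OF that(1-3)]] that(4)
  unfolding m1_def m2_def small_oP1_iff by blast+
 have D: "0 < tU - tL" using taus by simp
 have e4: "0 < p / 4" using p by simp
 obtain Kw where K: "0 < Kw" "\<forall>\<^sub>F n in sequentially. outer_prob M {x \<in> space M. \<not> (\<forall>s\<in>I. infnorm (wsc n x s) <= Kw)} <= p / 4"
  by (rule tight[OF e4])
 obtain d1 where d1: "0 < d1" "\<forall>\<^sub>F n in sequentially. outer_prob M {x \<in> space M. \<bar>m1 n x (C4 * min d1 (tU - tL))\<bar> > 1}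
   + outer_prob M {x \<in> space M. \<bar>m2 n x (C4 * min d1 (tU - tL))\<bar> > 1} <= p / 4"
 proof (rule null_sequences_imp_uniform[where u="\<lambda>r n. outer_prob M {x \<in> space M. \<bar>m1 n x (C4 * min r (tU - tL))\<bar> > 1}
   + outer_prob M {x \<in> space M. \<bar>m2 n x (C4 * min r (tU - tL))\<bar> > 1}", OF _ e4])
  fix r :: "nat => real" assume r: "\<And>n. 0 <= r n" "r \<longlonglongrightarrow> 0"
  show "(\<lambda>n. outer_prob M {x \<in> space M. \<bar>m1 n x (C4 * min (r n) (tU - tL))\<bar> > 1}
   + outer_prob M {x \<in> space M. \<bar>m2 n x (C4 * min (r n) (tU - tL))\<bar> > 1}) \<longlonglongrightarrow> 0"
   using tendsto_add[OF null[OF r D zero_less_one]] by simp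
 qed
 (* Truncating inside the moduli makes them refer to exactly this radius. *)
 define c0 where "c0 = min d1 (tU - tL)"
 have c0: "0 < c0" "c0 <= tU - tL" using d1(1) D by (auto simp: c0_def)
 define B where "B = ?d * ((2 * Kw + 1) / c0 + 1 / (1 - tU))"
 have B0: "0 <= B" using K(1) c0 taus by (simp add: B_def)
 define d3 where "d3 = e * (1 - tU) / (2 * (B + 1))"
 have d3: "0 < d3" using e taus B0 by (simp add: d3_def)
 define c where "c = e / (2 * ?d)"
 have c: "0 < c" using e d0 by (simp add: c_def)
 obtain d2 where d2: "0 < d2" "\<forall>\<^sub>F n in sequentially. outer_prob M {x \<in> space M. \<bar>m1 n x (C4 * min d2 d3)\<bar> > c} <= p / 4"
 proof (rule null_sequences_imp_uniform[where u="\<lambda>r n. outer_prob M {x \<in> space M. \<bar>m1 n x (C4 * min r d3)\<bar> > c}", OF _ e4])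
  fix r :: "nat => real" assume r: "\<And>n. 0 <= r n" "r \<longlonglongrightarrow> 0"
  show "(\<lambda>n. outer_prob M {x \<in> space M. \<bar>m1 n x (C4 * min (r n) d3)\<bar> > c}) \<longlonglongrightarrow> 0"
   by (rule null(1)[OF r d3 c])
 qed
 define h where "h = min d2 d3"
 have h: "0 < h" using d2(1) d3 by (simp add: h_def)
 have de: "B * h / (1 - tU) <= e / 2"
 proof -
  have "B * h <= (B + 1) * d3" using B0 h d3 by (intro mult_mono) (auto simp: h_def)
  also have "... = e / 2 * (1 - tU)" using B0 by (simp add: d3_def field_simps)
  finally show ?thesis using taus by (simp add: pos_divide_le_eq)
 qed
 have m: "\<forall>\<^sub>F n in sequentially. outer_prob M {x \<in> space M. \<bar>m1 n x (C4 * c0)\<bar> > 1} <= p / 4"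
  "\<forall>\<^sub>F n in sequentially. outer_prob M {x \<in> space M. \<bar>m2 n x (C4 * c0)\<bar> > 1} <= p / 4"
  using d1(2) unfolding c0_def[symmetric]
  by (eventually_elim, use outer_prob_nonneg[of "{x \<in> space M. _ x}"] in "smt (verit) outer_prob_nonneg")+
 have "\<forall>\<^sub>F n in sequentially. outer_prob M {x \<in> space M. (\<not> (\<forall>s\<in>I. infnorm (wsc n x s) <= Kw)) \<or>
   \<bar>m1 n x (C4 * c0)\<bar> > 1 \<or> \<bar>m2 n x (C4 * c0)\<bar> > 1 \<or> \<bar>m1 n x (C4 * h)\<bar> > c} <= p / 4 + (p / 4 + (p / 4 + p / 4))"
  using K(2) m d2(2) unfolding h_def[symmetric] by (intro eventually_outer_prob_or)
 hence "\<forall>\<^sub>F n in sequentially. outer_prob M {x \<in> space M.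
   \<not> (\<forall>s\<in>I. \<forall>t\<in>I. \<bar>s - t\<bar> < h --> infnorm (wsc n x s - wsc n x t) <= e)} <= p / 4 + (p / 4 + (p / 4 + p / 4))"
 proof (rule eventually_outer_prob_mono[rotated], use eventually_gt_at_top[of "0::nat"] in eventually_elim)
  case (elim n)
  have osc: "infnorm (wsc n x s - wsc n x t) <= e"
   if x: "x \<in> space M" "ok x" and g: "\<forall>s\<in>I. infnorm (wsc n x s) <= Kw" "\<bar>m1 n x (C4 * c0)\<bar> <= 1" "\<bar>m2 n x (C4 * c0)\<bar> <= 1"
    "\<bar>m1 n x (C4 * h)\<bar> <= c" and st: "s \<in> I" "t \<in> I" "\<bar>s - t\<bar> < h" for x s t
  proof -
   have bound: "sqrt (real n) * norm (nut M Y Ys n x (\<beta> u)) <= B" if "u \<in> I" for u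
    unfolding B_def by (rule nut_bound[OF x(2) elim x(1) c0]) (use g that in auto)
   have "norm (wsc n x s - wsc n x t) <= ?d * m1 n x (C4 * h) + B * h / (1 - tU)"
    unfolding scaleR_diff_right[symmetric]
    by (rule w_oscillation[OF x(2) elim x(1) bound st(1,2)]) (use st in auto)
   also have "... <= ?d * c + e / 2" using g(4) d0 by (intro add_mono de mult_left_mono) auto
   also have "... = e" using d0 by (simp add: c_def)
   finally show ?thesis by (rule order_trans[OF infnorm_le_norm])
  qed
  show ?case using ok_AE AE_space
  proof eventually_elim
   case (elim x)
   thus ?case using osc[of x] by (metis not_le_imp_less)
  qed
 qed
 thus ?thesis using h by (intro exI[of _ h]) simp
qed

lemma limit_continuous: "AE w in N. continuous_on I (W w)"
 by (rule weak_limit_continuous[OF tL_le prob_space_axioms N_prob D3 w_equicontinuous])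

lemma estimator_weakly_converges:
 "weakly_converges tL tU M (\<lambda>n z s. sqrt (real n) *\<^sub>R (bhat n z s - \<beta> s)) N (\<lambda>w. path_map (W w))"
proof -
 obtain C' where C': "0 <= C'"
  "\<And>x y. x \<in> cadlag tL tU ==> y \<in> cadlag tL tU ==> sup_dist tL tU (path_map x) (path_map y) <= C' * sup_dist tL tU x y"
  by (rule path_map_lipschitz) blast
 have map: "weakly_converges tL tU M (\<lambda>n z. path_map (wsc n z)) N (\<lambda>w. path_map (W w))"
  by (rule weakly_converges_map[OF tL_le D3 path_map_cadlag path_map_measurable C'])
 have cont: "AE w in N. continuous_on I (path_map (W w))"
  using limit_continuous by eventually_elim (rule path_map_continuous)
 show ?thesis
 proof (rule weakly_converges_perturb[OF tL_le prob_space_axioms N_prob map cont])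
  show "AE z in M. (\<lambda>s. sqrt (real n) *\<^sub>R (bhat n z s - \<beta> s)) \<in> cadlag tL tU" for n
  proof (cases "n = 0")
   case True
   thus ?thesis by (simp add: zero_cadlag)
  next
   case False
   show ?thesis using ok_AE AE_space
   proof eventually_elim
    case (elim z)
    thus ?case using False
     by (intro cadlag_scaleR cadlag_diff estimator_cadlag continuous_imp_cadlag \<beta>_continuous) auto
   qed
  qed
  fix e :: real assume e: "0 < e"
  show "(\<lambda>n. outer_prob M {z \<in> space M. \<not> (\<forall>s\<in>I.
    infnorm (sqrt (real n) *\<^sub>R (bhat n z s - \<beta> s) - path_map (wsc n z) s) <= e)}) \<longlonglongrightarrow> 0"
  proof (rule tendsto_sandwich[OF _ _ tendsto_const remainder_negligible[OF e]])
   show "\<forall>\<^sub>F n in sequentially. 0 <= outer_prob M {z \<in> space M. \<not> (\<forall>s\<in>I.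
    infnorm (sqrt (real n) *\<^sub>R (bhat n z s - \<beta> s) - path_map (wsc n z) s) <= e)}"
    by (simp add: outer_prob_nonneg)
   show "\<forall>\<^sub>F n in sequentially. outer_prob M {z \<in> space M. \<not> (\<forall>s\<in>I.
    infnorm (sqrt (real n) *\<^sub>R (bhat n z s - \<beta> s) - path_map (wsc n z) s) <= e)}
    <= outer_prob M {z \<in> space M. \<not> (\<forall>s\<in>I. sqrt (real n) * infnorm (R n z s) <= e)}"
    using eventually_gt_at_top[of "0::nat"]
   proof eventually_elim
    case (elim n)
    have eq: "infnorm (sqrt (real n) *\<^sub>R (bhat n z s - \<beta> s) - path_map (wsc n z) s) = sqrt (real n) * infnorm (R n z s)"
     if "z \<in> space M" "ok z" "s \<in> I" for z s
    proof -
     have "path_map (wsc n z) s = sqrt (real n) *\<^sub>R path_map (wn M Y Ys tL \<beta> n z) s"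
      by (rule path_map_scaleR[OF wn_measurable[OF that(2) elim that(1)] that(3)])
     hence "sqrt (real n) *\<^sub>R (bhat n z s - \<beta> s) - path_map (wsc n z) s = sqrt (real n) *\<^sub>R R n z s"
      by (simp add: R_def path_map_def scaleR_diff_right)
     thus ?thesis by (simp add: infnorm_mul)
    qed
    show ?case
    proof (rule outer_prob_cover1, use ok_AE AE_space in eventually_elim)
     case (elim z)
     thus ?case using eq[of z] by simp
    qed
   qed
  qed
 qed
qed

end

theorem theorem3p4:
  fixes M :: "'a measure" and N :: "'w measure"
    and Y :: "'a \<Rightarrow> 'd::finite datum" and Ys :: "nat \<Rightarrow> 'a \<Rightarrow> 'd datum"
    and K :: "real ^ 'd \<Rightarrow> (real \<times> real) measure"
    and \<beta> :: "real \<Rightarrow> real ^ 'd" and W :: "'w \<Rightarrow> real \<Rightarrow> real ^ 'd"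
    and \<tau>L \<tau>U a \<epsilon> \<gamma> :: real and first :: 'd
    and Ngrid :: "nat \<Rightarrow> nat" and an bn :: "nat \<Rightarrow> real"
    and \<beta>hat :: "nat \<Rightarrow> 'a \<Rightarrow> real \<Rightarrow> real ^ 'd"
    and f ft :: "real \<Rightarrow> real ^ 'd \<Rightarrow> real"
    and \<nu> \<nu>t :: "nat \<Rightarrow> 'a \<Rightarrow> real ^ 'd \<Rightarrow> real ^ 'd"
    and w :: "nat \<Rightarrow> 'a \<Rightarrow> real \<Rightarrow> real ^ 'd"
    and Mu :: "real \<Rightarrow> real ^ 'd ^ 'd"
    and Z :: "'a \<Rightarrow> real ^ 'd" and supp :: "(real ^ 'd) set" and B Beps :: "(real ^ 'd) set"
  \<comment> \<open>notation\<close>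
  assumes Z_eq: "Z = (\<lambda>\<omega>. covar (Y \<omega>))"
    and supp_eq: "supp = support M Z"
    and f_eq: "f = f_cond K" and ft_eq: "ft = ft_cond K"
    and nu_eq: "\<nu> = nu M Y Ys" and nut_eq: "\<nu>t = nut M Y Ys"
    and w_eq: "w = wn M Y Ys \<tau>L \<beta>"
    and B_eq: "B = nbhd_closed \<beta> \<tau>L \<tau>U \<epsilon>" and Beps_eq: "Beps = nbhd_open \<beta> \<tau>L \<tau>U \<epsilon>"
    and Mu_eq: "Mu = (\<lambda>u. mut' M Y (\<beta> u) ** matrix_inv (mu' M Y (\<beta> u)))"
    and an_eq: "an = (\<lambda>n. (\<tau>U - \<tau>L) / real (Ngrid n))"
    and bn_eq: "bn = (\<lambda>n. an n / (1 - \<tau>U))"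
  \<comment> \<open>model\<close>
    and prob: "prob_space M" "prob_space N"
    and rv: "Y \<in> borel_measurable M" "\<And>i. Ys i \<in> borel_measurable M"
    and ident: "\<And>i. distr M borel (Ys i) = distr M borel Y"
    and taus: "0 < \<tau>L" "\<tau>L < \<tau>U" "\<tau>U < 1"
    and kernel: "regular_cond_dist M (\<lambda>\<omega>. (resp (Y \<omega>), cens (Y \<omega>))) Z K"
    and cond_indep: "AE \<omega> in M. prob_space.indep_var (K (Z \<omega>)) borel fst borel snd"
    and lin_quantile: "\<And>\<tau>. \<tau> \<in> {\<tau>L..\<tau>U} \<Longrightarrow> AE \<omega> in M. cond_quantile K \<tau> (Z \<omega>) = Z \<omega> \<bullet> \<beta> \<tau>"
    and densities: "\<And>z t. z \<in> supp \<Longrightarrow> (\<lambda>s. F_cond K s z) field_differentiable (at t)"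
      "\<And>z t. z \<in> supp \<Longrightarrow> (\<lambda>s. Ft_cond K s z) field_differentiable (at t)"
    and no_early_censoring: "0 < a" "\<tau>L + a \<le> \<tau>U" "AE \<omega> in M. cens (Y \<omega>) > Z \<omega> \<bullet> \<beta> (\<tau>L + a)"
  \<comment> \<open>estimator\<close>
    and mesh: "\<And>n. 0 < Ngrid n" "an \<in> o(\<lambda>n. real n powr (- 1 / 2))"
    and estimator: "\<And>n \<omega>. 0 < n \<Longrightarrow> \<omega> \<in> space M \<Longrightarrow>
        cqr_estimator \<tau>L \<tau>U (Ngrid n) (\<lambda>i. Ys i \<omega>) n (\<beta>hat n \<omega>)"
  \<comment> \<open>conditions (C1)-(C4), (D1)-(D3)\<close>
    and eps: "0 < \<epsilon>"
    and C1: "\<And>i. AE \<omega> in M. covar (Ys i \<omega>) $ first = 1"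
      "\<exists>CZ. AE \<omega> in M. infnorm (Z \<omega>) \<le> CZ"
    and C2: "\<exists>C4. \<forall>\<tau>\<in>{\<tau>L..\<tau>U}. \<forall>\<tau>'\<in>{\<tau>L..\<tau>U}. infnorm (\<beta> \<tau> - \<beta> \<tau>') \<le> C4 * \<bar>\<tau> - \<tau>'\<bar>"
    and C3_bounded: "bdd_above ((\<lambda>(b, z). f (z \<bullet> b) z) ` (Beps \<times> supp))"
      "bdd_above ((\<lambda>(b, z). ft (z \<bullet> b) z) ` (Beps \<times> supp))"
    and C3_continuous:
      "uniformly_continuous_on ({b \<bullet> z |b z. b \<in> Beps \<and> z \<in> supp} \<times> supp) (\<lambda>(t, z). f t z)"
      "uniformly_continuous_on ({b \<bullet> z |b z. b \<in> Beps \<and> z \<in> supp} \<times> supp) (\<lambda>(t, z). ft t z)"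
    and C3_hoelder: "0 < \<gamma>"
      "\<exists>Hf. \<forall>b1\<in>Beps. \<forall>b2\<in>Beps. \<forall>z\<in>supp.
         \<bar>f (z \<bullet> b1) z - f (z \<bullet> b2) z\<bar> \<le> Hf * infnorm (b1 - b2) powr \<gamma>"
      "\<exists>Hft. \<forall>b1\<in>Beps. \<forall>b2\<in>Beps. \<forall>z\<in>supp.
         \<bar>ft (z \<bullet> b1) z - ft (z \<bullet> b2) z\<bar> \<le> Hft * infnorm (b1 - b2) powr \<gamma>"
    and C4: "\<exists>l0>0. \<forall>b\<in>Beps.
        l0 \<le> lambda_min (LINT \<omega>|M. f (Z \<omega> \<bullet> b) (Z \<omega>) *\<^sub>R outer_prod (Z \<omega>))"
    and D1: "small_oP1 M (\<lambda>n \<omega>. (SUP b. infnorm (\<nu> n \<omega> b)) + (SUP b. infnorm (\<nu>t n \<omega> b)))"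
    and D2: "\<And>r. (\<And>n. 0 \<le> r n) \<Longrightarrow> r \<longlonglongrightarrow> 0 \<Longrightarrow>
        small_oP1 M (\<lambda>n \<omega>. modulus B (r n) (\<lambda>b. sqrt (real n) *\<^sub>R \<nu> n \<omega> b))"
      "\<And>r. (\<And>n. 0 \<le> r n) \<Longrightarrow> r \<longlonglongrightarrow> 0 \<Longrightarrow>
        small_oP1 M (\<lambda>n \<omega>. modulus B (r n) (\<lambda>b. sqrt (real n) *\<^sub>R \<nu>t n \<omega> b))"
    and D3: "centered_gaussian_process N {\<tau>L..\<tau>U} W"
      "weakly_converges \<tau>L \<tau>U M (\<lambda>n \<omega> s. sqrt (real n) *\<^sub>R w n \<omega> s) N W"
  shows "(\<exists>R :: nat \<Rightarrow> 'a \<Rightarrow> real \<Rightarrow> real ^ 'd.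
      (\<forall>n \<omega>. \<forall>s\<in>{\<tau>L..\<tau>U}.
         \<beta>hat n \<omega> s - \<beta> s = matrix_inv (mu' M Y (\<beta> s)) *v duhamel \<tau>L Mu (w n \<omega>) s + R n \<omega> s) \<and>
      (\<forall>c. filterlim c at_top sequentially \<longrightarrow>
         big_OP M (\<lambda>n \<omega>. SUP \<tau>\<in>{\<tau>L..\<tau>U}. sqrt (real n) * infnorm (R n \<omega> \<tau>))
           (\<lambda>n \<omega>. sqrt (real n) * bn n + real n powr (- \<gamma> / 2)
              + modulus B (c n * real n powr (- 1 / 2)) (\<lambda>b. sqrt (real n) *\<^sub>R \<nu> n \<omega> b)
              + modulus B (c n * real n powr (- 1 / 2)) (\<lambda>b. sqrt (real n) *\<^sub>R \<nu>t n \<omega> b)))) \<and>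
    centered_gaussian_process N {\<tau>L..\<tau>U} (\<lambda>\<omega>. duhamel \<tau>L Mu (W \<omega>)) \<and>
    weakly_converges \<tau>L \<tau>U M (\<lambda>n \<omega> s. sqrt (real n) *\<^sub>R (\<beta>hat n \<omega> s - \<beta> s))
           N (\<lambda>\<omega> s. matrix_inv (mu' M Y (\<beta> s)) *v duhamel \<tau>L Mu (W \<omega>) s)"
proof -
 let ?d = "sqrt (real CARD('d))"
 have norm_infnorm: "norm x <= ?d * infnorm x" for x :: "real^'d" using norm_le_infnorm[of x] by simp
 (* The hypotheses bound maximum norms; the Euclidean constants are larger by the square root of the dimension. *)
 obtain CZ where CZ: "AE \<omega> in M. infnorm (Z \<omega>) <= CZ" using C1(2) by blast
 obtain C4' where C4': "\<forall>\<tau>\<in>{\<tau>L..\<tau>U}. \<forall>\<tau>'\<in>{\<tau>L..\<tau>U}. infnorm (\<beta> \<tau> - \<beta> \<tau>') <= C4' * \<bar>\<tau> - \<tau>'\<bar>"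
  using C2 by blast
 obtain L1 where L1: "\<And>b z. b \<in> Beps ==> z \<in> supp ==> f (z \<bullet> b) z <= L1"
  using C3_bounded(1) unfolding bdd_above_def by force
 obtain L2 where L2: "\<And>b z. b \<in> Beps ==> z \<in> supp ==> ft (z \<bullet> b) z <= L2"
  using C3_bounded(2) unfolding bdd_above_def by force
 obtain H1 where H1: "\<And>b1 b2 z. b1 \<in> Beps ==> b2 \<in> Beps ==> z \<in> supp ==>
   \<bar>f (z \<bullet> b1) z - f (z \<bullet> b2) z\<bar> <= H1 * infnorm (b1 - b2) powr \<gamma>"
  using C3_hoelder(2) by blast
 obtain H2 where H2: "\<And>b1 b2 z. b1 \<in> Beps ==> b2 \<in> Beps ==> z \<in> supp ==>
   \<bar>ft (z \<bullet> b1) z - ft (z \<bullet> b2) z\<bar> <= H2 * infnorm (b1 - b2) powr \<gamma>"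
  using C3_hoelder(3) by blast
 obtain l0 where l0: "0 < l0" "\<And>b. b \<in> Beps ==> l0 <= lambda_min (LINT \<omega>|M. f (Z \<omega> \<bullet> b) (Z \<omega>) *\<^sub>R outer_prod (Z \<omega>))"
  using C4 by blast
 define L where "L = max 0 (max L1 L2)"
 define Hf where "Hf = max 0 (max H1 H2)"
 have L: "0 <= L" "L1 <= L" "L2 <= L" by (auto simp: L_def)
 have Hf: "0 <= Hf" "H1 * infnorm b powr \<gamma> <= Hf * infnorm b powr \<gamma>" "H2 * infnorm b powr \<gamma> <= Hf * infnorm b powr \<gamma>" for b :: "real^'d"
  by (auto simp: Hf_def intro!: mult_right_mono)
 have Z_le: "AE \<omega> in M. norm (Z \<omega>) <= ?d * CZ"
  using CZ
 proof eventually_elim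
  case (elim \<omega>)
  have "norm (Z \<omega>) <= ?d * infnorm (Z \<omega>)" by (rule norm_infnorm)
  also have "... <= ?d * CZ" using elim by (intro mult_left_mono) auto
  finally show ?case .
 qed
 have \<beta>_lipschitz: "norm (\<beta> \<tau> - \<beta> \<tau>') <= (?d * \<bar>C4'\<bar>) * \<bar>\<tau> - \<tau>'\<bar>" if "\<tau> \<in> {\<tau>L..\<tau>U}" "\<tau>' \<in> {\<tau>L..\<tau>U}" for \<tau> \<tau>'
 proof -
  have "infnorm (\<beta> \<tau> - \<beta> \<tau>') <= C4' * \<bar>\<tau> - \<tau>'\<bar>" using C4' that by blast
  also have "... <= \<bar>C4'\<bar> * \<bar>\<tau> - \<tau>'\<bar>" by (intro mult_right_mono) auto
  finally have "?d * infnorm (\<beta> \<tau> - \<beta> \<tau>') <= ?d * (\<bar>C4'\<bar> * \<bar>\<tau> - \<tau>'\<bar>)" by (rule mult_left_mono) simp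
  from order_trans[OF norm_infnorm this] show ?thesis by (simp add: mult.assoc)
 qed
 have f_le: "f (z \<bullet> b) z <= L" "ft (z \<bullet> b) z <= L" if "b \<in> Beps" "z \<in> supp" for b z
  using L1[OF that] L2[OF that] L by auto
 have f_hoelder: "\<bar>f (z \<bullet> b1) z - f (z \<bullet> b2) z\<bar> <= Hf * infnorm (b1 - b2) powr \<gamma>"
  "\<bar>ft (z \<bullet> b1) z - ft (z \<bullet> b2) z\<bar> <= Hf * infnorm (b1 - b2) powr \<gamma>"
  if "b1 \<in> Beps" "b2 \<in> Beps" "z \<in> supp" for b1 b2 z
  using H1[OF that] H2[OF that] Hf(2,3)[of "b1 - b2"] by linarith+
 have C4_nonneg: "0 <= ?d * \<bar>C4'\<bar>" by simp
 have population: "cqr_population M Y K \<beta> \<tau>L \<tau>U a \<epsilon> \<gamma> (?d * CZ) L Hf l0 (?d * \<bar>C4'\<bar>)"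
  using prob(1) rv(1) taus kernel cond_indep lin_quantile densities no_early_censoring eps Z_le C4_nonneg \<beta>_lipschitz L(1) f_le
   C3_hoelder(1) Hf(1) f_hoelder l0
  unfolding Z_eq supp_eq Beps_eq f_eq ft_eq
  by (intro cqr_population.intro cqr_population_axioms.intro)
 have asymptotic: "cqr_asymptotic M Y K \<beta> \<tau>L \<tau>U a \<epsilon> \<gamma> (?d * CZ) L Hf l0 (?d * \<bar>C4'\<bar>) Ys Ngrid \<beta>hat N W"
 proof (intro cqr_asymptotic.intro population cqr_asymptotic_axioms.intro)
  fix r :: "nat => real" assume r: "\<And>n. 0 <= r n" "r \<longlonglongrightarrow> 0"
  show "small_oP1 M (\<lambda>n \<omega>. modulus (nbhd_closed \<beta> \<tau>L \<tau>U \<epsilon>) (r n) (\<lambda>b. sqrt (real n) *\<^sub>R nu M Y Ys n \<omega> b))"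
   using D2(1)[OF r] unfolding B_eq nu_eq .
  show "small_oP1 M (\<lambda>n \<omega>. modulus (nbhd_closed \<beta> \<tau>L \<tau>U \<epsilon>) (r n) (\<lambda>b. sqrt (real n) *\<^sub>R nut M Y Ys n \<omega> b))"
   using D2(2)[OF r] unfolding B_eq nut_eq .
 qed (use rv(2) ident mesh estimator prob(2) D3(2) in "simp_all add: an_eq w_eq")
 interpret A: cqr_asymptotic M Y K \<beta> \<tau>L \<tau>U a \<epsilon> \<gamma> "?d * CZ" L Hf l0 "?d * \<bar>C4'\<bar>"
   "\<lambda>\<omega>. covar (Y \<omega>)" "nbhd_open \<beta> \<tau>L \<tau>U \<epsilon>" "support M (\<lambda>\<omega>. covar (Y \<omega>))" Ys Ngrid \<beta>hat N W
  by (rule asymptotic)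
 have Mu: "Mu = A.Mu" by (simp add: fun_eq_iff Mu_eq A.Mu_def A.Ainv_def)
 have gaussian: "centered_gaussian_process N {\<tau>L..\<tau>U} (\<lambda>w. duhamel \<tau>L Mu (W w))"
  unfolding Mu by (rule duhamel_gaussian[OF A.Mu_continuous taus(3) A.tL_le prob(2) D3(1) weakly_converges_cadlag[OF D3(2)]])
 have weak: "weakly_converges \<tau>L \<tau>U M (\<lambda>n \<omega> s. sqrt (real n) *\<^sub>R (\<beta>hat n \<omega> s - \<beta> s))
   N (\<lambda>w s. matrix_inv (mu' M Y (\<beta> s)) *v duhamel \<tau>L Mu (W w) s)"
  using A.estimator_weakly_converges unfolding A.path_map_def[abs_def] A.Ainv_def Mu .
 have rate: "A.rt c = (\<lambda>n \<omega>. sqrt (real n) * bn n + real n powr (- \<gamma> / 2)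
   + modulus B (c n * real n powr (- 1 / 2)) (\<lambda>b. sqrt (real n) *\<^sub>R \<nu> n \<omega> b)
   + modulus B (c n * real n powr (- 1 / 2)) (\<lambda>b. sqrt (real n) *\<^sub>R \<nu>t n \<omega> b))" for c
  by (simp add: fun_eq_iff A.rt_def A.m1_def A.m2_def A.an_def bn_eq an_eq B_eq nu_eq nut_eq)
 have representation: "\<beta>hat n \<omega> s - \<beta> s = matrix_inv (mu' M Y (\<beta> s)) *v duhamel \<tau>L Mu (w n \<omega>) s + A.R n \<omega> s" for n \<omega> s
  by (simp add: A.R_def A.Ainv_def Mu w_eq)
 show ?thesis
  using representation A.remainder_big_OP[unfolded rate] gaussian weak by blast
qed

end
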